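(* Let $k$ be a field of characteristic different from $2$, let $\varepsilon\in\{\pm1\}$, and let $\delta\in k$, with $\delta=0$ if $\varepsilon=-1$. As an associative $k$-algebra, the marked Brauer algebra $B_r(\delta,\varepsilon)$ is isomorphic to the algebra generated by $e_1,\dots,e_{r-1},s_1,\dots,s_{r-1}$ subject to the relations $$s_i^2=1,\quad e_i^2=\delta e_i,\quad e_is_i=\varepsilon e_i,\quad s_ie_i=e_i,$$ $$s_is_j=s_js_i,\quad e_ie_j=e_je_i,\quad s_ie_j=e_js_i,$$ $$s_is_{i+1}s_i=s_{i+1}s_is_{i+1},\quad e_ie_{i+1}e_i=\varepsilon e_i,\quad e_{i+1}e_ie_{i+1}=\varepsilon e_{i+1},$$ $$s_ie_{i+1}e_i=\varepsilon s_{i+1}e_i,\quad e_{i+1}e_is_{i+1}=\varepsilon e_{i+1}s_i,$$ where $i,j$ range over all values in $\{1,\dots,r-1\}$ for which the expressions make sense, subject to $j\ne i,i\pm1$.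
   Context: A Brauer diagram for $(r,s)$ is a partition of $\{1,\dots,r,1',\dots,s'\}$ into two-element subsets (edges), drawn with vertices $1,\dots,r$ in a top row and $1',\dots,s'$ in a bottom row. An edge joining two top vertices is a cup, an edge joining two bottom vertices is a cap, any other edge is a through string. A marked Brauer diagram is a Brauer diagram in which each cup carries one bead and each cap carries one arrow (pointing along the edge, toward its left or right endpoint), with no two markings (beads or arrows) at the same height. Up to equivalence it is the data of the Brauer diagram, the total order of all markings from top to bottom, and a direction for each arrow. Two markings are adjacent if no other marking has height strictly between them. $B_{r,s}(\delta,\varepsilon)$ is the $k$-vector space spanned by marked Brauer diagrams for $(r,s)$ modulo: (i) interchanging the heights of two adjacent markings multiplies the diagram by $\varepsilon$; (ii) reversing the direction of one arrow multiplies the diagram by $\varepsilon$. Composition $B_{r,s}\times B_{s,t}\to B_{r,t}$, $(D_1,D_2)\mapsto D_1\circ D_2$: stack $D_1$ above $D_2$, identifying the bottom vertices of $D_1$ with the top vertices of $D_2$ (markings of $D_1$ lie above those of $D_2$), then simplify: (1) if $m$ closed loops occur, delete them and multiply by $\delta^m$; (2) whenever a bead and an arrow are consecutive along the same edge and adjacent in height (which can be arranged using (i)), remove both and multiply by $1$ if the arrow is above the bead and points along the edge toward the bead, or the bead is above the arrow and the arrow points away from the bead, and by $\varepsilon$ otherwise; repeat until each cup carries one bead, each cap one arrow, and through strings carry no marking. The marked Brauer algebra is $B_r(\delta,\varepsilon)=B_{r,r}(\delta,\varepsilon)$ with product $\circ$. In $B_r(\delta,\varepsilon)$ the element $s_i$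 is the diagram with through strings $\{i,(i+1)'\}$, $\{i+1,i'\}$ and $\{l,l'\}$ for $l\neq i,i+1$; the element $e_i$ is the diagram with cup $\{i,i+1\}$, cap $\{i',(i+1)'\}$, through strings $\{l,l'\}$ for $l\ne i,i+1$, where the bead on the cup lies above the arrow on the cap and the arrow points to the right. *)

theory Defs
  imports
    Complex_Main
    "HOL-Library.Poly_Mapping"
    "HOL-Library.Disjoint_Sets"
    "HOL-Algebra.QuotRing"
    "HOL-Algebra.Module"
begin

section \<open>Marked Brauer diagrams\<close>

text \<open>
  The unprimed vertex \<open>i\<close> is \<open>Top i\<close> and the primed vertex \<open>i'\<close> is \<open>Bot i\<close>. The constructor \<open>Mid\<close> is
  only used for the middle row of two stacked diagrams.
\<close>

datatype vertex = Top nat | Mid nat | Bot nat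

text \<open>\<open>Arrow u v\<close> sits on the edge \<open>{u, v}\<close> and points from \<open>u\<close> to \<open>v\<close>.\<close>

datatype marking = Bead "vertex set" | Arrow vertex vertex

fun edge_of :: "marking \<Rightarrow> vertex set" where
  "edge_of (Bead e) = e"
| "edge_of (Arrow u v) = {u, v}"

definition brauer_diagram :: "nat \<Rightarrow> nat \<Rightarrow> vertex set set \<Rightarrow> bool" where
  "brauer_diagram r s E \<longleftrightarrow>
     partition_on (Top ` {1..r} \<union> Bot ` {1..s}) E \<and> (\<forall>e\<in>E. card e = 2)"

definition cups :: "vertex set set \<Rightarrow> vertex set set" where
  "cups E = {e \<in> E. e \<subseteq> range Top}"

definition caps :: "vertex set set \<Rightarrow> vertex set set" where
  "caps E = {e \<in> E. e \<subseteq> range Bot}"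

text \<open>A set of edges together with the list of all markings, ordered from top to bottom.\<close>

type_synonym mdiagram = "vertex set set \<times> marking list"

definition marked_brauer :: "nat \<Rightarrow> nat \<Rightarrow> mdiagram set" where
  "marked_brauer r s = {(E, ms). brauer_diagram r s E \<and> distinct (map edge_of ms) \<and>
     {e. Bead e \<in> set ms} = cups E \<and> {{u, v} |u v. Arrow u v \<in> set ms} = caps E}"


section \<open>The spaces \<open>B_{r,s}(\<delta>,\<epsilon>)\<close>\<close>

definition scale :: "'k \<Rightarrow> ('a \<Rightarrow>\<^sub>0 'k) \<Rightarrow> ('a \<Rightarrow>\<^sub>0 'k::field)" where
  "scale c x = Poly_Mapping.map (\<lambda>a. c * a) x"

definition diagram_space :: "nat \<Rightarrow> nat \<Rightarrow> (mdiagram \<Rightarrow>\<^sub>0 'k::field) set" where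
  "diagram_space r s = {x. Poly_Mapping.keys x \<subseteq> marked_brauer r s}"

definition marking_relations :: "'k::field \<Rightarrow> nat \<Rightarrow> nat \<Rightarrow> (mdiagram \<Rightarrow>\<^sub>0 'k) set" where
  "marking_relations \<epsilon> r s =
     {Poly_Mapping.single (E, xs @ b # a # ys) 1 - Poly_Mapping.single (E, xs @ a # b # ys) \<epsilon>
       |E xs a b ys. (E, xs @ a # b # ys) \<in> marked_brauer r s} \<union>
     {Poly_Mapping.single (E, xs @ Arrow v u # ys) 1 - Poly_Mapping.single (E, xs @ Arrow u v # ys) \<epsilon>
       |E xs u v ys. (E, xs @ Arrow u v # ys) \<in> marked_brauer r s}"

definition relation_space :: "'k::field \<Rightarrow> nat \<Rightarrow> nat \<Rightarrow> (mdiagram \<Rightarrow>\<^sub>0 'k) set" where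
  "relation_space \<epsilon> r s = Modules.module.span scale (marking_relations \<epsilon> r s)"

text \<open>The class of a vector in the quotient \<open>B_{r,s}\<close> of the diagram space by the relation space.\<close>

definition diagram_class :: "'k::field \<Rightarrow> nat \<Rightarrow> nat \<Rightarrow> (mdiagram \<Rightarrow>\<^sub>0 'k) \<Rightarrow> (mdiagram \<Rightarrow>\<^sub>0 'k) set" where
  "diagram_class \<epsilon> r s x = (\<lambda>n. x + n) ` relation_space \<epsilon> r s"


section \<open>Composition of marked Brauer diagrams\<close>

fun bot_to_mid :: "vertex \<Rightarrow> vertex" where
  "bot_to_mid (Bot i) = Mid i"
| "bot_to_mid v = v"

fun top_to_mid :: "vertex \<Rightarrow> vertex" where
  "top_to_mid (Top i) = Mid i"
| "top_to_mid v = v"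

fun relabel :: "(vertex \<Rightarrow> vertex) \<Rightarrow> marking \<Rightarrow> marking" where
  "relabel f (Bead e) = Bead (f ` e)"
| "relabel f (Arrow u v) = Arrow (f u) (f v)"

text \<open>
  An edge between two middle vertices that occurs in both diagrams occurs only once in the set below.
  Such an edge is part of a closed loop with two edges, so no strand with endpoints is affected, and
  the loop is still counted once as a connected component.
\<close>

fun stack_edges :: "mdiagram \<Rightarrow> mdiagram \<Rightarrow> vertex set set" where
  "stack_edges (E1, ms1) (E2, ms2) = (\<lambda>e. bot_to_mid ` e) ` E1 \<union> (\<lambda>e. top_to_mid ` e) ` E2"

fun stack_markings :: "mdiagram \<Rightarrow> mdiagram \<Rightarrow> marking list" where
  "stack_markings (E1, ms1) (E2, ms2) = map (relabel bot_to_mid) ms1 @ map (relabel top_to_mid) ms2"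

definition linked :: "vertex set set \<Rightarrow> (vertex \<times> vertex) set" where
  "linked G = {(u, v). {u, v} \<in> G}\<^sup>*"

definition closed_loops :: "vertex set set \<Rightarrow> vertex set set" where
  "closed_loops G = {C. \<exists>v\<in>\<Union>G. C = linked G `` {v} \<and> C \<subseteq> range Mid}"

definition delete_loop_markings :: "vertex set set \<Rightarrow> marking list \<Rightarrow> marking list" where
  "delete_loop_markings G ms = filter (\<lambda>m. \<not> edge_of m \<subseteq> \<Union>(closed_loops G)) ms"

definition strand_path :: "vertex set set \<Rightarrow> vertex list \<Rightarrow> bool" where
  "strand_path G p \<longleftrightarrow> distinct p \<and> successively (\<lambda>u v. {u, v} \<in> G) p"

text \<open>
  \<open>facing G ms u v e\<close>: traversing the edge \<open>{u, v}\<close> from \<open>u\<close> to \<open>v\<close> and continuing along the strand, one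
  reaches the edge \<open>e\<close>, and no marking of \<open>ms\<close> lies on the edges strictly in between.
\<close>

definition facing :: "vertex set set \<Rightarrow> marking list \<Rightarrow> vertex \<Rightarrow> vertex \<Rightarrow> vertex set \<Rightarrow> bool" where
  "facing G ms u v e \<longleftrightarrow> (\<exists>p. strand_path G p \<and> length p \<ge> 3 \<and> p ! 0 = u \<and> p ! 1 = v \<and>
     e = {p ! (length p - 2), p ! (length p - 1)} \<and>
     (\<forall>i m. 0 < i \<longrightarrow> i + 2 < length p \<longrightarrow> m \<in> set ms \<longrightarrow> edge_of m \<noteq> {p ! i, p ! (i + 1)}))"

text \<open>
  Simplification of a scalar multiple of a stack with underlying edges \<open>G\<close>: the interchange of two
  adjacent markings, and the removal of a bead and an arrow that are adjacent in height and consecutive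
  along a strand.
\<close>

inductive simp_step ::
  "'k::field \<Rightarrow> vertex set set \<Rightarrow> 'k \<times> marking list \<Rightarrow> 'k \<times> marking list \<Rightarrow> bool"
  for \<epsilon> :: 'k and G :: "vertex set set" where
  interchange:
    "simp_step \<epsilon> G (c, xs @ a # b # ys) (\<epsilon> * c, xs @ b # a # ys)"
| arrow_above_toward: "facing G (xs @ ys) u v e \<Longrightarrow>
    simp_step \<epsilon> G (c, xs @ Arrow u v # Bead e # ys) (c, xs @ ys)"
| arrow_above_away: "facing G (xs @ ys) u v e \<Longrightarrow>
    simp_step \<epsilon> G (c, xs @ Arrow v u # Bead e # ys) (\<epsilon> * c, xs @ ys)"
| bead_above_away: "facing G (xs @ ys) u v e \<Longrightarrow>
    simp_step \<epsilon> G (c, xs @ Bead e # Arrow v u # ys) (c, xs @ ys)"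
| bead_above_toward: "facing G (xs @ ys) u v e \<Longrightarrow>
    simp_step \<epsilon> G (c, xs @ Bead e # Arrow u v # ys) (\<epsilon> * c, xs @ ys)"

text \<open>
  After simplification every strand between two outer vertices is contracted to a single edge; the
  remaining markings slide along, arrows keeping their direction.
\<close>

definition contract_edges :: "vertex set set \<Rightarrow> vertex set set" where
  "contract_edges G =
     {{u, v} |u v. u \<noteq> v \<and> (u, v) \<in> linked G \<and> u \<notin> range Mid \<and> v \<notin> range Mid}"

inductive contract_marking :: "vertex set set \<Rightarrow> marking \<Rightarrow> marking \<Rightarrow> bool"
  for G :: "vertex set set" where
  bead: "\<lbrakk>strand_path G p; hd p \<notin> range Mid; last p \<notin> range Mid; i + 1 < length p\<rbrakk> \<Longrightarrow>
    contract_marking G (Bead {p ! i, p ! (i + 1)}) (Bead {hd p, last p})"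
| arrow: "\<lbrakk>strand_path G p; hd p \<notin> range Mid; last p \<notin> range Mid; i + 1 < length p\<rbrakk> \<Longrightarrow>
    contract_marking G (Arrow (p ! i) (p ! (i + 1))) (Arrow (hd p) (last p))"

text \<open>
  All scalar multiples of marked diagrams for \<open>(r, t)\<close> that can be obtained by completely simplifying
  the stack of \<open>D1\<close> above \<open>D2\<close>. They represent \<open>D1 \<circ> D2\<close>.
\<close>

definition composites ::
  "'k::field \<Rightarrow> 'k \<Rightarrow> nat \<Rightarrow> nat \<Rightarrow> mdiagram \<Rightarrow> mdiagram \<Rightarrow> (mdiagram \<Rightarrow>\<^sub>0 'k) set" where
  "composites \<delta> \<epsilon> r t D1 D2 =
     {Poly_Mapping.single (contract_edges (stack_edges D1 D2), ms') c |c ms ms'.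
        (simp_step \<epsilon> (stack_edges D1 D2))\<^sup>*\<^sup>*
          (\<delta> ^ card (closed_loops (stack_edges D1 D2)),
           delete_loop_markings (stack_edges D1 D2) (stack_markings D1 D2))
          (c, ms) \<and>
        list_all2 (contract_marking (stack_edges D1 D2)) ms ms' \<and>
        (contract_edges (stack_edges D1 D2), ms') \<in> marked_brauer r t}"

definition bilinear_extension ::
  "(mdiagram \<Rightarrow> mdiagram \<Rightarrow> (mdiagram \<Rightarrow>\<^sub>0 'k)) \<Rightarrow>
   (mdiagram \<Rightarrow>\<^sub>0 'k) \<Rightarrow> (mdiagram \<Rightarrow>\<^sub>0 'k) \<Rightarrow> (mdiagram \<Rightarrow>\<^sub>0 'k::field)" where
  "bilinear_extension f x y = (\<Sum>D1\<in>Poly_Mapping.keys x. \<Sum>D2\<in>Poly_Mapping.keys y.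
     scale (Poly_Mapping.lookup x D1 * Poly_Mapping.lookup y D2) (f D1 D2))"

text \<open>
  As for \<^const>\<open>rcoset_mult\<close>, the product of two classes is the union of the classes of all products of
  representatives, here also over all possible outcomes \<open>f\<close> of the simplification procedure. It is a
  single class exactly because the composition is well defined; no choice of outcomes enters.
\<close>

definition class_compose ::
  "'k::field \<Rightarrow> 'k \<Rightarrow> nat \<Rightarrow> nat \<Rightarrow> nat \<Rightarrow>
   (mdiagram \<Rightarrow>\<^sub>0 'k) set \<Rightarrow> (mdiagram \<Rightarrow>\<^sub>0 'k) set \<Rightarrow> (mdiagram \<Rightarrow>\<^sub>0 'k) set" where
  "class_compose \<delta> \<epsilon> r s t A B =
     (\<Union>x\<in>A. \<Union>y\<in>B.
        \<Union>f\<in>{f. \<forall>D1\<in>marked_brauer r s. \<forall>D2\<in>marked_brauer s t. f D1 D2 \<in> composites \<delta> \<epsilon> r t D1 D2}.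
          diagram_class \<epsilon> r t (bilinear_extension f x y))"


section \<open>The marked Brauer algebra\<close>

definition identity_diagram :: "nat \<Rightarrow> mdiagram" where
  "identity_diagram r = ((\<lambda>l. {Top l, Bot l}) ` {1..r}, [])"

definition s_diagram :: "nat \<Rightarrow> nat \<Rightarrow> mdiagram" where
  "s_diagram r i =
     ({{Top i, Bot (i + 1)}, {Top (i + 1), Bot i}} \<union> (\<lambda>l. {Top l, Bot l}) ` ({1..r} - {i, i + 1}),
      [])"

definition e_diagram :: "nat \<Rightarrow> nat \<Rightarrow> mdiagram" where
  "e_diagram r i =
     ({{Top i, Top (i + 1)}, {Bot i, Bot (i + 1)}} \<union> (\<lambda>l. {Top l, Bot l}) ` ({1..r} - {i, i + 1}),
      [Bead {Top i, Top (i + 1)}, Arrow (Bot i) (Bot (i + 1))])"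

definition marked_brauer_algebra ::
  "'k::field \<Rightarrow> 'k \<Rightarrow> nat \<Rightarrow> ('k, (mdiagram \<Rightarrow>\<^sub>0 'k) set) module" where
  "marked_brauer_algebra \<delta> \<epsilon> r =
     \<lparr>carrier = diagram_class \<epsilon> r r ` diagram_space r r,
      mult = class_compose \<delta> \<epsilon> r r r,
      one = diagram_class \<epsilon> r r (Poly_Mapping.single (identity_diagram r) 1),
      zero = diagram_class \<epsilon> r r 0,
      add = (\<lambda>A B. \<Union>x\<in>A. \<Union>y\<in>B. diagram_class \<epsilon> r r (x + y)),
      smult = (\<lambda>c A. \<Union>x\<in>A. diagram_class \<epsilon> r r (scale c x))\<rparr>"


section \<open>Algebras given by generators and relations\<close>

text \<open>
  With words as keys, the type of finitely supported functions carries the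
  multiplication of the free associative algebra.
\<close>

datatype 'a word = Word (letters: "'a list")

instantiation word :: (type) monoid_add
begin

definition zero_word :: "'a word" where "0 = Word []"

definition plus_word :: "'a word \<Rightarrow> 'a word \<Rightarrow> 'a word" where
  "v + w = Word (letters v @ letters w)"

instance
  by standard (simp_all add: zero_word_def plus_word_def)

end

definition free_algebra :: "'a set \<Rightarrow> ('k::field, 'a word \<Rightarrow>\<^sub>0 'k) module" where
  "free_algebra X =
     \<lparr>carrier = {x. \<forall>w\<in>Poly_Mapping.keys x. set (letters w) \<subseteq> X},
      mult = (*), one = 1, zero = 0, add = (+), smult = scale\<rparr>"

definition free_gen :: "'a \<Rightarrow> ('a word \<Rightarrow>\<^sub>0 'k::field)" where
  "free_gen a = Poly_Mapping.single (Word [a]) 1"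

definition relation_ideal :: "'a set \<Rightarrow> ('a word \<Rightarrow>\<^sub>0 'k::field) set \<Rightarrow> ('a word \<Rightarrow>\<^sub>0 'k) set" where
  "relation_ideal X R = genideal (free_algebra X) R"

text \<open>\<^const>\<open>FactRing\<close> yields a plain ring; the scalar multiplication is added to it.\<close>

definition presented_algebra ::
  "'a set \<Rightarrow> ('a word \<Rightarrow>\<^sub>0 'k::field) set \<Rightarrow> ('k, ('a word \<Rightarrow>\<^sub>0 'k) set) module" where
  "presented_algebra X R =
     ring.extend (free_algebra X Quot relation_ideal X R)
       (module.fields (\<lambda>c A. \<Union>x\<in>A. relation_ideal X R +>\<^bsub>free_algebra X\<^esub> scale c x))"

definition presented_gen :: "'a set \<Rightarrow> ('a word \<Rightarrow>\<^sub>0 'k::field) set \<Rightarrow> 'a \<Rightarrow> ('a word \<Rightarrow>\<^sub>0 'k) set" where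
  "presented_gen X R a = relation_ideal X R +>\<^bsub>free_algebra X\<^esub> free_gen a"

definition algebra_iso :: "('k, 'a) module \<Rightarrow> ('k, 'b) module \<Rightarrow> ('a \<Rightarrow> 'b) set" where
  "algebra_iso A B =
     {h \<in> ring_iso A B. \<forall>c. \<forall>x\<in>carrier A. h (c \<odot>\<^bsub>A\<^esub> x) = c \<odot>\<^bsub>B\<^esub> h x}"


section \<open>The generators and relations for the marked Brauer algebra\<close>

datatype letter = S nat | E nat

definition brauer_letters :: "nat \<Rightarrow> letter set" where
  "brauer_letters r = S ` {1..<r} \<union> E ` {1..<r}"

text \<open>An equation \<open>x = y\<close> is encoded as the element \<open>x - y\<close>.\<close>

definition brauer_relations :: "'k::field \<Rightarrow> 'k \<Rightarrow> nat \<Rightarrow> (letter word \<Rightarrow>\<^sub>0 'k) set" where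
  "brauer_relations \<delta> \<epsilon> r =
    (let s = (\<lambda>i. free_gen (S i)); e = (\<lambda>i. free_gen (E i));
         I = {1..<r};
         far = {(i, j). i \<in> I \<and> j \<in> I \<and> j \<noteq> i \<and> j \<noteq> i + 1 \<and> i \<noteq> j + 1};
         near = {i. i \<in> I \<and> i + 1 \<in> I}
     in {s i * s i - 1 |i. i \<in> I} \<union>
        {e i * e i - scale \<delta> (e i) |i. i \<in> I} \<union>
        {e i * s i - scale \<epsilon> (e i) |i. i \<in> I} \<union>
        {s i * e i - e i |i. i \<in> I} \<union>
        {s i * s j - s j * s i |i j. (i, j) \<in> far} \<union>
        {e i * e j - e j * e i |i j. (i, j) \<in> far} \<union>
        {s i * e j - e j * s i |i j. (i, j) \<in> far} \<union>
        {s i * s (i + 1) * s i - s (i + 1) * s i * s (i + 1) |i. i \<in> near} \<union>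
        {e i * e (i + 1) * e i - scale \<epsilon> (e i) |i. i \<in> near} \<union>
        {e (i + 1) * e i * e (i + 1) - scale \<epsilon> (e (i + 1)) |i. i \<in> near} \<union>
        {s i * e (i + 1) * e i - scale \<epsilon> (s (i + 1) * e i) |i. i \<in> near} \<union>
        {e (i + 1) * e i * s (i + 1) - scale \<epsilon> (e (i + 1) * s i) |i. i \<in> near})"

end

theory Submission
  imports Defs "HOL-Combinatorics.Permutations" "HOL-Library.Nat_Bijection"
begin

text \<open>
  Order the edges of a stack strand by strand and orient every strand. The sign of a list of markings
  that counts inversions and reversed arrows is then preserved by each simplification rule. So the
  quotient by the marking relations has one basis vector per Brauer diagram, and composition is well
  defined on it.

  Every Brauer diagram is obtained from a permutation diagram by repeatedly gluing in a cup and a cap.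
  Gluing changes the strands of a stack only by one surgery, which yields explicit formulas for the
  products with the generators, hence all relations and a homomorphism from the presented algebra.

  In the presented algebra every word is a multiple of a normal form: a permutation times a product of
  commuting conjugates \<open>e\<^sub>a\<^sub>b\<close> of \<open>e\<^sub>1\<close>. Two normal forms with the same Brauer diagram agree up to an
  invertible scalar, so the homomorphism maps a spanning set to a basis.
\<close>

text \<open>A product of classes must therefore be shown to be nonempty as well as unique. The sign
  gives uniqueness; existence comes from the gluing induction, where a simplification known for a
  smaller upper diagram is replayed after the surgery. Deleting a closed loop also deletes its
  markings and so loses the parity of their order; the assumption \<delta> = 0 for \<epsilon> = -1
  enters only where loops occur.

  Associativity is never checked on three diagrams. The relations are verified as identities between
  operators of left multiplication, and \<open>qmul_nf_diagram\<close> shows that a diagram acts as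
  the word of a normal form. That suffices to make the homomorphism multiplicative.

  Scalars in the presented algebra need not be computed. Words are compared up to a nonzero factor,
  and since a normal form is mapped to a basis vector with a coefficient of square 1, the factor can
  be read off in the image. The same device settles the scalars in the description of the relation
  space.\<close>

abbreviation "single \<equiv> Poly_Mapping.single"
abbreviation "keys \<equiv> Poly_Mapping.keys"
abbreviation "lookup \<equiv> Poly_Mapping.lookup"
abbreviation "trp \<equiv> Transposition.transpose"
type_synonym 'k coords = "vertex set set \<Rightarrow>\<^sub>0 'k"

section \<open>Linear extension\<close>

lemma lookup_scale [simp]: "lookup (scale c x) k = c * lookup x k"
  by (simp add: scale_def Poly_Mapping.map.rep_eq when_def)

interpretation scale: vector_space "scale :: 'k::field \<Rightarrow> ('a \<Rightarrow>\<^sub>0 'k) \<Rightarrow> ('a \<Rightarrow>\<^sub>0 'k)"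
  by unfold_locales (auto intro!: poly_mapping_eqI simp: lookup_add algebra_simps)

lemma scale_single [simp]: "scale c (single k a) = single k (c * a)"
  by (rule poly_mapping_eqI) (simp add: lookup_single when_def)

lemma keys_scale: "keys (scale c x) \<subseteq> keys x" by (auto simp: in_keys_iff)

definition lin :: "('a \<Rightarrow> ('b \<Rightarrow>\<^sub>0 'k::field)) \<Rightarrow> ('a \<Rightarrow>\<^sub>0 'k) \<Rightarrow> ('b \<Rightarrow>\<^sub>0 'k)" where
  "lin g x = (\<Sum>k\<in>keys x. scale (lookup x k) (g k))"

lemma lin_superset:
  assumes "finite A" "keys x \<subseteq> A" shows "lin g x = (\<Sum>k\<in>A. scale (lookup x k) (g k))"
  unfolding lin_def using assms by (intro sum.mono_neutral_left) (auto simp: in_keys_iff)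

lemma lin_add: "lin g (x + y) = lin g x + lin g y"
proof -
  define A where "A = keys x \<union> keys y"
  have fin: "finite A" by (simp add: A_def)
  have "lin g z = (\<Sum>k\<in>A. scale (lookup z k) (g k))" if "z \<in> {x, y, x + y}" for z
    using that Poly_Mapping.keys_add[of x y] by (intro lin_superset fin) (auto simp: A_def)
  then show ?thesis by (simp add: lookup_add scale.scale_left_distrib sum.distrib)
qed

lemma lin_scale: "lin g (scale c x) = scale c (lin g x)"
proof -
  have "lin g (scale c x) = (\<Sum>k\<in>keys x. scale (lookup (scale c x) k) (g k))"
    by (intro lin_superset keys_scale) simp
  then show ?thesis by (simp add: lin_def scale.scale_sum_right)
qed

lemma lin_zero [simp]: "lin g 0 = 0" by (simp add: lin_def)

lemma lin_uminus: "lin g (- x) = - lin g x"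
  using lin_add[of g x "- x"] by (simp add: eq_neg_iff_add_eq_0 add.commute)

lemma lin_diff: "lin g (x - y) = lin g x - lin g y" using lin_add[of g "x" "- y"] by (simp add: lin_uminus)

lemma lin_sum: "lin g (sum f A) = (\<Sum>a\<in>A. lin g (f a))"
  by (induction A rule: infinite_finite_induct) (auto simp: lin_add)

lemma lin_single [simp]: "lin g (single k c) = scale c (g k)" by (simp add: lin_def)

lemma lin_cong: "(\<And>k. k \<in> keys x \<Longrightarrow> g k = g' k) \<Longrightarrow> lin g x = lin g' x" by (simp add: lin_def)

lemma poly_mapping_expansion: "(x :: 'a \<Rightarrow>\<^sub>0 'k::field) = (\<Sum>k\<in>keys x. single k (lookup x k))"
  by (rule poly_mapping_eqI) (simp add: lookup_sum lookup_single when_def in_keys_iff)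

lemma lin_single_id [simp]: "lin (\<lambda>k. single k 1) x = x" by (simp add: lin_def flip: poly_mapping_expansion)

text \<open>Only the keys of the given vector are tested, so two linear maps can be compared on the
  span of some keys although they may differ elsewhere.\<close>

lemma linear_eq_on_keys:
  assumes f: "\<And>x y. f (x + y) = f x + f y" "\<And>c x. f (scale c x) = scale c (f x)"
    and g: "\<And>x y. g (x + y) = g x + g y" "\<And>c x. g (scale c x) = scale c (g x)" and eq: "\<And>k. k \<in> keys x \<Longrightarrow>
      f (single k 1) = g (single k (1::'k::field))"
  shows "f x = (g x :: 'b \<Rightarrow>\<^sub>0 'k)"
proof -
  have sums: "f (sum h A) = (\<Sum>a\<in>A. f (h a))" "g (sum h A) = (\<Sum>a\<in>A. g (h a))" for h :: "'c \<Rightarrow> _" and A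
    using f(2)[of 0 0] g(2)[of 0 0] by (induction A rule: infinite_finite_induct) (auto simp: f(1) g(1))
  have "f (single k c) = g (single k c)" if "k \<in> keys x" for k c
    using eq[OF that] f(2)[of c "single k 1"] g(2)[of c "single k 1"] by simp
  then show ?thesis by (subst (1 2) poly_mapping_expansion) (simp add: sums)
qed

lemma keys_sum_subset: "keys (sum f A) \<subseteq> (\<Union>a\<in>A. keys (f a))"
proof (induction A rule: infinite_finite_induct)
  case (insert a A)
  then show ?case using Poly_Mapping.keys_add[of "f a" "sum f A"] by auto
qed auto

lemma keys_lin:
  assumes "\<And>k. k \<in> keys x \<Longrightarrow> keys (g k) \<subseteq> A" shows "keys (lin g x) \<subseteq> A"
  unfolding lin_def using keys_sum_subset keys_scale assms by fastforce

section \<open>Signs of lists of markings\<close>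

fun dir_sign :: "'k::field \<Rightarrow> (vertex \<Rightarrow> vertex \<Rightarrow> bool) \<Rightarrow> marking \<Rightarrow> 'k" where
  "dir_sign \<epsilon> fw (Bead e) = 1"
| "dir_sign \<epsilon> fw (Arrow u v) = (if fw u v then 1 else \<epsilon>)"

definition inv_sign :: "'k::field \<Rightarrow> (vertex set \<Rightarrow> nat) \<Rightarrow> marking \<Rightarrow> marking \<Rightarrow> 'k" where
  "inv_sign \<epsilon> \<kappa> a b = (if \<kappa> (edge_of b) < \<kappa> (edge_of a) then \<epsilon> else 1)"

text \<open>For \<epsilon> = -1 this is the parity of sorting the list by \<open>\<kappa>\<close>,
  as if markings were odd symbols, with a further -1 for every arrow against \<open>fw\<close>.
  Order and orientation stay parameters because the sign is taken twice: along the strands of a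
  stack, and with \<open>key0\<close> and \<open>fw0\<close> on a simplified diagram.\<close>

fun msign :: "'k::field \<Rightarrow> (vertex set \<Rightarrow> nat) \<Rightarrow> (vertex \<Rightarrow> vertex \<Rightarrow> bool) \<Rightarrow> marking list \<Rightarrow> 'k" where
  "msign \<epsilon> \<kappa> fw [] = 1"
| "msign \<epsilon> \<kappa> fw (m # ms) = dir_sign \<epsilon> fw m * prod_list (map (inv_sign \<epsilon> \<kappa> m) ms) * msign \<epsilon> \<kappa> fw ms"

lemma msign_append: "msign \<epsilon> \<kappa> fw (xs @ ys) = msign \<epsilon> \<kappa> fw xs * msign \<epsilon> \<kappa> fw ys *
     prod_list (map (\<lambda>x. prod_list (map (inv_sign \<epsilon> \<kappa> x) ys)) xs)" by (induction xs) (auto simp: algebra_simps)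

text \<open>With \<epsilon> = 1 the sign carries no information. This makes the deletion of markings
  on closed loops harmless in that case.\<close>

lemma msign_one: "msign (1::'k::field) \<kappa> fw ms = 1"
proof (induction ms)
  case (Cons m ms)
  have "dir_sign 1 fw m = (1::'k)" by (cases m) auto
  moreover have "prod_list (map (inv_sign 1 \<kappa> m) ms) = (1::'k)" for ms
    by (induction ms) (auto simp: inv_sign_def)
  ultimately show ?case using Cons by simp
qed simp

context
  fixes \<epsilon> :: "'k::field" assumes eps: "\<epsilon> * \<epsilon> = 1"
begin

lemma eps_cancel [simp]: "\<epsilon> * (\<epsilon> * x) = x" using eps by (simp flip: mult.assoc)

lemma dir_sign_square: "dir_sign \<epsilon> fw m * dir_sign \<epsilon> fw m = 1" by (cases m) (auto simp: eps)

lemma inv_sign_square: "inv_sign \<epsilon> \<kappa> a b * inv_sign \<epsilon> \<kappa> a b = 1" by (auto simp: inv_sign_def eps)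

lemma prod_list_square:
  "(\<And>x. x \<in> set xs \<Longrightarrow> f x * f x = (1::'k)) \<Longrightarrow> prod_list (map f xs) * prod_list (map f xs) = 1"
  by (induction xs) (auto simp: algebra_simps)

lemma msign_square: "msign \<epsilon> \<kappa> fw ms * msign \<epsilon> \<kappa> fw ms = 1"
proof (induction ms)
  case (Cons m ms)
  have "msign \<epsilon> \<kappa> fw (m # ms) * msign \<epsilon> \<kappa> fw (m # ms) =
    (dir_sign \<epsilon> fw m * dir_sign \<epsilon> fw m) * (prod_list (map (inv_sign \<epsilon> \<kappa> m) ms) * prod_list (map (inv_sign \<epsilon> \<kappa> m) ms))
     * (msign \<epsilon> \<kappa> fw ms * msign \<epsilon> \<kappa> fw ms)" by (simp add: algebra_simps)
  then show ?case
    using Cons dir_sign_square prod_list_square[of ms "inv_sign \<epsilon> \<kappa> m"] by (simp add: inv_sign_square)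
qed simp

lemma msign_swap:
  assumes "\<kappa> (edge_of a) \<noteq> \<kappa> (edge_of b)"
  shows "msign \<epsilon> \<kappa> fw (xs @ b # a # ys) = \<epsilon> * msign \<epsilon> \<kappa> fw (xs @ a # b # ys)"
proof -
  have "inv_sign \<epsilon> \<kappa> b a = \<epsilon> * inv_sign \<epsilon> \<kappa> a b" using assms by (auto simp: inv_sign_def eps)
  then show ?thesis by (simp add: msign_append algebra_simps)
qed

lemma msign_reverse:
  assumes "fw u v \<longleftrightarrow> \<not> fw v u"
  shows "msign \<epsilon> \<kappa> fw (xs @ Arrow v u # ys) = \<epsilon> * msign \<epsilon> \<kappa> fw (xs @ Arrow u v # ys)"
proof -
  have "inv_sign \<epsilon> \<kappa> (Arrow v u) = inv_sign \<epsilon> \<kappa> (Arrow u v)"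
    "\<And>x. inv_sign \<epsilon> \<kappa> x (Arrow v u) = inv_sign \<epsilon> \<kappa> x (Arrow u v)" by (auto simp: inv_sign_def insert_commute)
  then show ?thesis using assms by (auto simp: msign_append algebra_simps eps)
qed

text \<open>No other key separates those of \<open>a\<close> and \<open>b\<close>. Every other
  marking therefore forms an inversion with both or with neither, and its two factors multiply to a
  square, which is 1.\<close>

lemma msign_remove:
  assumes "\<And>m. m \<in> set (xs @ ys) \<Longrightarrow> \<kappa> (edge_of m) \<noteq> \<kappa> (edge_of a) \<and> \<kappa> (edge_of m) \<noteq> \<kappa> (edge_of b) \<and>
    (\<kappa> (edge_of m) < \<kappa> (edge_of a) \<longleftrightarrow> \<kappa> (edge_of m) < \<kappa> (edge_of b))"
  shows "msign \<epsilon> \<kappa> fw (xs @ a # b # ys) =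
    dir_sign \<epsilon> fw a * dir_sign \<epsilon> fw b * inv_sign \<epsilon> \<kappa> a b * msign \<epsilon> \<kappa> fw (xs @ ys)"
proof -
  have 1: "inv_sign \<epsilon> \<kappa> x a = inv_sign \<epsilon> \<kappa> x b" if "x \<in> set xs" for x
    using assms[of x] that by (auto simp: inv_sign_def)
  have 2: "inv_sign \<epsilon> \<kappa> a y = inv_sign \<epsilon> \<kappa> b y" if "y \<in> set ys" for y
    using assms[of y] that by (auto simp: inv_sign_def)
  have sq: "prod_list (map (inv_sign \<epsilon> \<kappa> a) ys) * prod_list (map (inv_sign \<epsilon> \<kappa> b) ys) = 1"
  proof -
    have "map (inv_sign \<epsilon> \<kappa> a) ys = map (inv_sign \<epsilon> \<kappa> b) ys" using 2 by simp
    then show ?thesis using prod_list_square[of ys "inv_sign \<epsilon> \<kappa> b"] inv_sign_square by metis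
  qed
  have "prod_list (map (\<lambda>x. prod_list (map (inv_sign \<epsilon> \<kappa> x) (a # b # ys))) xs) =
      prod_list (map (\<lambda>x. prod_list (map (inv_sign \<epsilon> \<kappa> x) ys)) xs)"
  proof (rule arg_cong[of _ _ prod_list], rule map_cong[OF refl])
    fix x assume "x \<in> set xs"
    from 1[OF this] have "inv_sign \<epsilon> \<kappa> x a * (inv_sign \<epsilon> \<kappa> x b * z) = z" for z
      using inv_sign_square[of \<kappa> x b] by (simp flip: mult.assoc)
    then show "prod_list (map (inv_sign \<epsilon> \<kappa> x) (a # b # ys)) = prod_list (map (inv_sign \<epsilon> \<kappa> x) ys)" by simp
  qed
  then have "msign \<epsilon> \<kappa> fw (xs @ a # b # ys) = dir_sign \<epsilon> fw a * dir_sign \<epsilon> fw b * inv_sign \<epsilon> \<kappa> a b *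
     (prod_list (map (inv_sign \<epsilon> \<kappa> a) ys) * prod_list (map (inv_sign \<epsilon> \<kappa> b) ys)) * msign \<epsilon> \<kappa> fw (xs @ ys)"
    by (simp only: msign_append msign.simps map_append prod_list.append) (simp add: algebra_simps)
  then show ?thesis using sq by simp
qed

end

section \<open>Strands\<close>

fun vcode :: "vertex \<Rightarrow> nat" where
  "vcode (Top i) = 3 * i"
| "vcode (Mid i) = 3 * i + 1"
| "vcode (Bot i) = 3 * i + 2"

lemma inj_vcode: "inj vcode"
proof (rule injI)
  fix x y assume "vcode x = vcode y"
  then show "x = y" by (cases x; cases y; simp; presburger)
qed

definition outer :: "vertex set" where
  "outer = - range Mid"

lemma outer_simps [simp]: "Top i \<in> outer" "Bot i \<in> outer" "Mid i \<notin> outer" by (auto simp: outer_def)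

lemma outer_iff: "v \<in> outer \<longleftrightarrow> v \<notin> range Mid" by (simp add: outer_def)

definition strand :: "vertex set set \<Rightarrow> vertex list \<Rightarrow> bool" where
  "strand G p \<longleftrightarrow> strand_path G p \<and> 2 \<le> length p \<and> hd p \<in> outer \<and> last p \<in> outer"

lemma strand_path_nth: "strand_path G p \<longleftrightarrow> distinct p \<and> (\<forall>i. i + 1 < length p \<longrightarrow> {p ! i, p ! (i + 1)} \<in> G)"
  unfolding strand_path_def successively_conv_nth by (auto simp: less_diff_conv)

lemma strand_path_edge: "strand_path G p \<Longrightarrow> i + 1 < length p \<Longrightarrow> {p ! i, p ! (i + 1)} \<in> G"
  by (simp add: strand_path_nth)

lemma strand_path_mono: "strand_path G p \<Longrightarrow> G \<subseteq> H \<Longrightarrow> strand_path H p" by (auto simp: strand_path_nth)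

lemma strand_path_rev [simp]: "strand_path G (rev p) \<longleftrightarrow> strand_path G p"
  by (simp add: strand_path_def insert_commute)

lemma strand_rev: "strand G p \<Longrightarrow> strand G (rev p)" by (auto simp: strand_def hd_rev last_rev)

lemma strand_hd_neq_last: "strand G p \<Longrightarrow> hd p \<noteq> last p"
  unfolding strand_def strand_path_def by (cases p) (auto split: if_splits)

lemma linked_refl [simp]: "(v, v) \<in> linked G" by (simp add: linked_def)

lemma linked_edge: "{u, v} \<in> G \<Longrightarrow> (u, v) \<in> linked G" by (auto simp: linked_def)

lemma linked_trans: "(u, v) \<in> linked G \<Longrightarrow> (v, w) \<in> linked G \<Longrightarrow> (u, w) \<in> linked G" by (simp add: linked_def)

lemma linked_sym: "(u, v) \<in> linked G \<Longrightarrow> (v, u) \<in> linked G" unfolding linked_def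
proof (induction rule: rtrancl_induct)
  case (step y z)
  then have "(z, y) \<in> {(u, v). {u, v} \<in> G}" by (auto simp: insert_commute)
  then show ?case using step.IH by (rule converse_rtrancl_into_rtrancl)
qed simp

lemma linked_mono: "G \<subseteq> H \<Longrightarrow> linked G \<subseteq> linked H" unfolding linked_def by (intro rtrancl_mono) auto

lemma linked_closed:
  assumes "(u, v) \<in> linked G" "u \<in> C" "\<And>x y. {x, y} \<in> G \<Longrightarrow> x \<in> C \<Longrightarrow> y \<in> C" shows "v \<in> C"
  using assms(1) unfolding linked_def by (induction rule: rtrancl_induct) (use assms(2,3) in auto)

lemma strand_path_linked:
  assumes "strand_path G p" "u \<in> set p" "v \<in> set p" shows "(u, v) \<in> linked G"
proof -
  have *: "(p ! 0, p ! i) \<in> linked G" if "i < length p" for i using that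
  proof (induction i)
    case (Suc i)
    then show ?case
      using linked_trans linked_edge strand_path_edge[OF assms(1), of i] by (metis Suc_eq_plus1 Suc_lessD)
  qed simp
  then show ?thesis using assms(2,3) by (metis in_set_conv_nth linked_sym linked_trans)
qed

lemma linked_strand_path:
  assumes "(u, v) \<in> linked G"
  obtains p where "strand_path G p" "p \<noteq> []" "hd p = u" "last p = v"
proof -
  have "\<exists>p. strand_path G p \<and> p \<noteq> [] \<and> hd p = u \<and> last p = v" using assms unfolding linked_def
  proof (induction rule: rtrancl_induct)
    case base
    show ?case by (rule exI[of _ "[u]"]) (simp add: strand_path_def)
  next
    case (step v w)
    then obtain p where p: "strand_path G p" "p \<noteq> []" "hd p = u" "last p = v" by auto
    show ?case
    proof (cases "w \<in> set p")
      case True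
      \<comment> \<open>A return to a visited vertex is cut off, so that the path stays free of
        repetitions.\<close>
      then obtain p1 p2 where "p = p1 @ w # p2" by (auto dest: split_list)
      then have "strand_path G (p1 @ [w])" "hd (p1 @ [w]) = u"
        using p by (auto simp: strand_path_def successively_append_iff hd_append)
      then show ?thesis by (intro exI[of _ "p1 @ [w]"]) auto
    next
      case False
      then show ?thesis using p step.hyps(2)
        by (intro exI[of _ "p @ [w]"]) (auto simp: strand_path_def successively_append_iff)
    qed
  qed
  then show ?thesis using that by auto
qed

lemma contract_edges_strand: "contract_edges G = {{hd p, last p} |p. strand G p}"
proof (intro equalityI subsetI)
  fix e assume "e \<in> contract_edges G"
  then obtain u v where uv: "e = {u, v}" "u \<noteq> v" "(u, v) \<in> linked G" "u \<in> outer" "v \<in> outer"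
    by (auto simp: contract_edges_def outer_iff)
  from linked_strand_path[OF uv(3)] obtain p where
    p: "strand_path G p" "p \<noteq> []" "hd p = u" "last p = v" .
  have "2 \<le> length p" using p uv(2) by (cases p; cases "tl p") auto
  then have "strand G p" using p uv by (auto simp: strand_def)
  then show "e \<in> {{hd p, last p} |p. strand G p}" using p uv by blast
next
  fix e assume "e \<in> {{hd p, last p} |p. strand G p}"
  then obtain p where p: "e = {hd p, last p}" "strand G p" by auto
  then have "p \<noteq> []" by (auto simp: strand_def)
  then have "(hd p, last p) \<in> linked G" using p by (intro strand_path_linked[of G p]) (auto simp: strand_def)
  then show "e \<in> contract_edges G" using p strand_hd_neq_last[OF p(2)]
    by (auto simp: contract_edges_def strand_def outer_iff)
qed

text \<open>The graphs obtained by stacking are disjoint unions of paths between outer vertices and cycles.\<close>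

definition thin :: "vertex set set \<Rightarrow> bool" where
  "thin G \<longleftrightarrow>
     (\<forall>v a b c. {v, a} \<in> G \<longrightarrow> {v, b} \<in> G \<longrightarrow> {v, c} \<in> G \<longrightarrow> a = b \<or> b = c \<or> a = c) \<and>
     (\<forall>v a b. v \<in> outer \<longrightarrow> {v, a} \<in> G \<longrightarrow> {v, b} \<in> G \<longrightarrow> a = b)"

lemma thin_degree: "thin G \<Longrightarrow> {v, a} \<in> G \<Longrightarrow> {v, b} \<in> G \<Longrightarrow> {v, c} \<in> G \<Longrightarrow> a = b \<or> b = c \<or> a = c"
  unfolding thin_def by blast

lemma thin_outer: "thin G \<Longrightarrow> v \<in> outer \<Longrightarrow> {v, a} \<in> G \<Longrightarrow> {v, b} \<in> G \<Longrightarrow> a = b" unfolding thin_def by blast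

lemma strand_outer_index:
  assumes "thin G" "strand_path G p" "i < length p" "p ! i \<in> outer"
  shows "i = 0 \<or> i + 1 = length p"
proof (rule ccontr)
  assume "\<not> (i = 0 \<or> i + 1 = length p)"
  then have i: "i - 1 + 1 = i" "i - 1 + 1 < length p" "i + 1 < length p" using assms(3) by auto
  have "{p ! i, p ! (i - 1)} \<in> G" "{p ! i, p ! (i + 1)} \<in> G"
    using strand_path_edge[OF assms(2) i(2)] strand_path_edge[OF assms(2) i(3)] i(1)
    by (auto simp: insert_commute)
  then have "p ! (i - 1) = p ! (i + 1)" using thin_outer[OF assms(1,4)] by blast
  then show False using assms(2) i by (auto simp: strand_path_def nth_eq_iff_index_eq)
qed

text \<open>An end of a strand is outer and has only one neighbour; an inner vertex already has two
  distinct neighbours on the strand, and \<open>thin\<close> allows no third.\<close>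

lemma strand_neighbour:
  assumes G: "thin G" and p: "strand G p" and i: "i < length p" and w: "{p ! i, w} \<in> G"
  shows "0 < i \<and> w = p ! (i - 1) \<or> i + 1 < length p \<and> w = p ! (i + 1)"
proof -
  have path: "strand_path G p" and len: "2 \<le> length p" using p by (auto simp: strand_def)
  have left: "{p ! i, p ! (i - 1)} \<in> G" if "0 < i"
    using strand_path_edge[OF path, of "i - 1"] that i by (auto simp: insert_commute)
  have right: "{p ! i, p ! (i + 1)} \<in> G" if "i + 1 < length p" using strand_path_edge[OF path that] .
  consider "i = 0" | "i + 1 = length p" "0 < i" | "0 < i" "i + 1 < length p" using i by linarith
  then show ?thesis
  proof cases
    case 1
    then have "p ! i \<in> outer" using p len by (cases p) (auto simp: strand_def)
    then show ?thesis using thin_outer[OF G _ w right] 1 len by auto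
  next
    case 2
    then have "p ! i = last p"
      using len by (metis add_diff_cancel_right' last_conv_nth list.size(3) not_numeral_le_zero)
    then have "p ! i \<in> outer" using p by (auto simp: strand_def)
    then show ?thesis using thin_outer[OF G _ w left] 2 by auto
  next
    case 3
    have "p ! (i - 1) \<noteq> p ! (i + 1)" using path 3 by (auto simp: strand_path_def nth_eq_iff_index_eq)
    then show ?thesis using thin_degree[OF G w left right] 3 by auto
  qed
qed

lemma strand_component:
  assumes "thin G" "strand G p" "u \<in> set p" "(u, v) \<in> linked G" shows "v \<in> set p"
proof (rule linked_closed[OF assms(4,3)])
  fix x y assume "{x, y} \<in> G" "x \<in> set p"
  then obtain i where "i < length p" "x = p ! i" "{p ! i, y} \<in> G" by (auto simp: in_set_conv_nth)
  from strand_neighbour[OF assms(1,2) this(1,3)] show "y \<in> set p" using \<open>i < length p\<close> by auto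
qed

text \<open>Once a path has entered a strand in its direction it has no choice: the next vertex is a
  neighbour on the strand, and going back would repeat a vertex. Hence the induction looks back two
  steps.\<close>

lemma strand_subpath:
  assumes G: "thin G" and p: "strand G p" and q: "strand_path G q"
    and 0: "2 \<le> length q" "i + 1 < length p" "q ! 0 = p ! i" "q ! 1 = p ! (i + 1)" and j: "j < length q"
  shows "i + j < length p \<and> q ! j = p ! (i + j)" using j
proof (induction j rule: less_induct)
  case (less j)
  consider "j = 0" | "j = 1" | j' where "j = j' + 2" by (metis One_nat_def add_2_eq_Suc' not0_implies_Suc)
  then show ?case
  proof cases
    case 3
    then have IH: "i + j' < length p" "q ! j' = p ! (i + j')" "i + j' + 1 < length p" "q ! (j' + 1) = p ! (i + j' + 1)"
      using less.IH[of j'] less.IH[of "j' + 1"] less.prems by (auto simp: add.assoc)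
    have "{p ! (i + j' + 1), q ! j} \<in> G" using strand_path_edge[OF q, of "j' + 1"] less.prems 3 IH by simp
    from strand_neighbour[OF G p IH(3) this] show ?thesis
    proof
      assume "0 < i + j' + 1 \<and> q ! j = p ! (i + j' + 1 - 1)"
      then have "q ! j = q ! j'" using IH by simp
      then show ?thesis using q less.prems 3 by (auto simp: strand_path_def nth_eq_iff_index_eq)
    qed (use 3 in \<open>auto simp: algebra_simps\<close>)
  qed (use 0 in auto)
qed

lemma strand_hd_nth:
  assumes "strand G p" shows "hd p = p ! 0" "last p = p ! (length p - 1)"
proof -
  have "p \<noteq> []" using assms by (auto simp: strand_def)
  then show "hd p = p ! 0" "last p = p ! (length p - 1)" by (simp_all add: hd_conv_nth last_conv_nth)
qed

lemma strand_unique: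
  assumes G: "thin G" and p: "strand G p" and q: "strand G q" and hd: "hd p = hd q"
  shows "p = q"
proof -
  have len: "2 \<le> length p" "2 \<le> length q" using p q by (auto simp: strand_def)
  have 0: "p ! 0 = q ! 0" "p ! 0 \<in> outer"
    using hd strand_hd_nth(1)[OF p] strand_hd_nth(1)[OF q] p unfolding strand_def by metis+
  have "{p ! 0, p ! 1} \<in> G" "{p ! 0, q ! 1} \<in> G"
    using strand_path_edge[of G p 0] strand_path_edge[of G q 0] p q len 0 by (auto simp: strand_def)
  then have 1: "p ! 1 = q ! 1" using thin_outer[OF G 0(2)] by blast
  have *: "j < length q \<and> p ! j = q ! j" if "j < length p" for j
    using strand_subpath[OF G q, of p 0 j] p len 0 1 that by (simp add: strand_def)
  have "j < length p" if "j < length q" for j using strand_subpath[OF G p, of q 0 j] q len 0 1 that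
    by (simp add: strand_def)
  then have "length p = length q" using * by (meson linorder_neqE_nat less_irrefl)
  then show ?thesis using * by (intro nth_equalityI) auto
qed

lemma strand_outer:
  assumes "thin G" "strand G p" "v \<in> set p" "v \<in> outer" shows "v = hd p \<or> v = last p"
proof -
  obtain i where i: "i < length p" "v = p ! i" using assms(3) by (auto simp: in_set_conv_nth)
  then have "i = 0 \<or> i = length p - 1"
    using strand_outer_index[OF assms(1), of p i] assms by (auto simp: strand_def)
  then show ?thesis using i strand_hd_nth[OF assms(2)] by auto
qed

text \<open>The end \<open>hd q\<close> is linked to the common vertex and so lies on
  \<open>p\<close>; being outer, it is an end of \<open>p\<close>. A strand is determined by its
  first vertex.\<close>

lemma strands_meet:
  assumes G: "thin G" and p: "strand G p" and q: "strand G q" and "v \<in> set p" "v \<in> set q"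
  shows "q = p \<or> q = rev p"
proof -
  have ne: "p \<noteq> []" "q \<noteq> []" using p q by (auto simp: strand_def)
  have "(v, hd q) \<in> linked G" using q ne assms by (intro strand_path_linked[of G q]) (auto simp: strand_def)
  then have "hd q \<in> set p" using strand_component[OF G p] assms by blast
  then have "hd q = hd p \<or> hd q = last p" using strand_outer[OF G p] q by (auto simp: strand_def)
  then show ?thesis
    using strand_unique[OF G q p] strand_unique[OF G q strand_rev[OF p]] ne by (auto simp: hd_rev)
qed

lemma strand_edge_index:
  assumes G: "thin G" and p: "strand G p" and e: "{u, v} \<in> G" and u: "u \<in> set p"
  shows "\<exists>i. i + 1 < length p \<and> (u = p ! i \<and> v = p ! (i + 1) \<or> v = p ! i \<and> u = p ! (i + 1))"
proof -
  obtain i where i: "i < length p" "u = p ! i" using u by (auto simp: in_set_conv_nth)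
  then have "0 < i \<and> v = p ! (i - 1) \<or> i + 1 < length p \<and> v = p ! (i + 1)"
    using strand_neighbour[OF G p i(1), of v] e by simp
  then show ?thesis
  proof (elim disjE)
    assume "0 < i \<and> v = p ! (i - 1)"
    then show ?thesis using i by (intro exI[of _ "i - 1"]) auto
  qed (use i in auto)
qed

section \<open>Invariance of the sign under simplification\<close>

text \<open>Turns sets of vertices into numbers, so that strands can be ordered by their pairs of
  ends. \<open>set_encode\<close> is injective on finite sets only, which explains the finiteness
  premises below.\<close>

definition key0 :: "vertex set \<Rightarrow> nat" where
  "key0 e = set_encode (vcode ` e)"

definition fw0 :: "vertex \<Rightarrow> vertex \<Rightarrow> bool" where
  "fw0 u v \<longleftrightarrow> vcode u < vcode v"

lemma key0_inject: "finite e \<Longrightarrow> finite f \<Longrightarrow> key0 e = key0 f \<longleftrightarrow> e = f"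
  using inj_on_eq_iff[OF inj_on_set_encode, of "vcode ` e" "vcode ` f"] inj_image_eq_iff[OF inj_vcode, of e f]
  by (simp add: key0_def)

lemma fw0_not_sym: "u \<noteq> v \<Longrightarrow> fw0 u v \<longleftrightarrow> \<not> fw0 v u" using inj_eq[OF inj_vcode, of u v] by (auto simp: fw0_def)

text \<open>A strand and its reversal are the same geometric object; \<open>fw0\<close> on the ends
  selects one of the two lists.\<close>

definition canon :: "vertex set set \<Rightarrow> vertex list \<Rightarrow> bool" where
  "canon G p \<longleftrightarrow> strand G p \<and> fw0 (hd p) (last p)"

text \<open>
  Edges are ordered strand by strand and, within a strand, along its canonical orientation. With
  respect to this order and orientation removing a bead and an arrow contributes no sign exactly if
  the rules say so.
\<close>

definition edge_key :: "vertex set set \<Rightarrow> vertex set \<Rightarrow> nat" where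
  "edge_key G e = (SOME n. \<exists>p i. canon G p \<and> i + 1 < length p \<and> e = {p ! i, p ! (i + 1)} \<and>
     n = key0 {hd p, last p} * Suc (card (\<Union>G)) + i)"

definition along :: "vertex set set \<Rightarrow> vertex \<Rightarrow> vertex \<Rightarrow> bool" where
  "along G u v \<longleftrightarrow> (\<exists>p i. canon G p \<and> i + 1 < length p \<and> u = p ! i \<and> v = p ! (i + 1))"

definition on_strand :: "vertex set set \<Rightarrow> vertex set \<Rightarrow> bool" where
  "on_strand G e \<longleftrightarrow> (\<exists>p i. canon G p \<and> i + 1 < length p \<and> e = {p ! i, p ! (i + 1)})"

lemma canon_or_rev:
  assumes "strand G p" shows "canon G p \<or> canon G (rev p)"
proof -
  have "p \<noteq> []" using assms by (auto simp: strand_def)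
  then show ?thesis
    using assms strand_hd_neq_last[OF assms] strand_rev[OF assms] fw0_not_sym[of "hd p" "last p"]
    by (auto simp: canon_def hd_rev last_rev)
qed

lemma on_strandI:
  assumes "strand G p" "i + 1 < length p" shows "on_strand G {p ! i, p ! (i + 1)}"
  using canon_or_rev[OF assms(1)]
proof
  assume "canon G (rev p)"
  \<comment> \<open>Reversal turns the edge with index \<open>i\<close> into the edge with index
    \<open>length p - 2 - i\<close>.\<close>
  moreover have "rev p ! (length p - 2 - i) = p ! (i + 1)" "rev p ! (length p - 2 - i + 1) = p ! i"
    "length p - 2 - i + 1 < length (rev p)" using assms(2) by (auto simp: rev_nth Suc_diff_Suc)
  ultimately show ?thesis unfolding on_strand_def by (metis insert_commute)
qed (use assms in \<open>auto simp: on_strand_def\<close>)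

text \<open>Comparison of two-digit numbers in base \<open>K\<close> with different leading
  digits.\<close>

lemma lex_block: "i < K \<Longrightarrow> j < K \<Longrightarrow> a \<noteq> b \<Longrightarrow> a * K + i < b * K + j \<longleftrightarrow> a < (b::nat)"
proof -
  have *: "a * K + i < b * K + j" if "i < K" "a < b" for a b i j :: nat
  proof -
    have "a * K + i < Suc a * K" using that by simp
    also have "\<dots> \<le> b * K" using that by (intro mult_right_mono) auto
    finally show ?thesis by simp
  qed
  assume "i < K" "j < K" "a \<noteq> b"
  then show ?thesis using *[of i a b j] *[of j b a i] by linarith
qed

section \<open>The order of edges in a thin graph and its behaviour under simplification\<close>

context
  fixes G :: "vertex set set" assumes thin: "thin G" and fin: "finite (\<Union>G)"
begin

text \<open>Keeps the index of an edge below the base \<open>Suc (card (\<Union>G))\<close> of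
  \<open>edge_key\<close>, so that the blocks of different strands do not overlap.\<close>

lemma strand_length:
  assumes "strand G p" shows "length p \<le> card (\<Union>G)"
proof -
  have "set p \<subseteq> \<Union>G"
  proof
    fix v assume "v \<in> set p"
    then obtain i where i: "i < length p" "v = p ! i" by (auto simp: in_set_conv_nth)
    show "v \<in> \<Union>G"
    proof (cases "i + 1 < length p")
      case True
      then show ?thesis using strand_path_edge[of G p i] assms i by (auto simp: strand_def)
    next
      case False
      then have "i - 1 + 1 = i" using assms i by (auto simp: strand_def)
      then show ?thesis using strand_path_edge[of G p "i - 1"] assms i by (auto simp: strand_def)
    qed
  qed
  moreover have "card (set p) = length p" using assms by (simp add: distinct_card strand_def strand_path_def)
  ultimately show ?thesis using fin card_mono by metis
qed

text \<open>A common edge makes the two strands equal up to reversal, and the canonical orientation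
  rules reversal out.\<close>

lemma canon_edge_unique:
  assumes "canon G p" "canon G q" "i + 1 < length p" "j + 1 < length q"
    and eq: "{p ! i, p ! (i + 1)} = {q ! j, q ! (j + 1)}" shows "p = q \<and> i = j"
proof -
  have "p ! i \<in> set p" "p ! i \<in> set q" using assms by (auto simp: doubleton_eq_iff)
  then have "q = p \<or> q = rev p" using strands_meet[OF thin, of p q "p ! i"] assms(1,2) by (simp add: canon_def)
  moreover have "q \<noteq> rev p"
  proof
    assume "q = rev p"
    then have "hd q = last p" "last q = hd p" using assms(3) by (auto simp: hd_rev last_rev)
    then show False using assms by (auto simp: canon_def fw0_def)
  qed
  ultimately have "p = q" by blast
  then show ?thesis
    using assms by (auto simp: canon_def strand_def strand_path_def doubleton_eq_iff nth_eq_iff_index_eq)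
qed

lemma edge_key_eq:
  assumes "canon G p" "i + 1 < length p"
  shows "edge_key G {p ! i, p ! (i + 1)} = key0 {hd p, last p} * Suc (card (\<Union>G)) + i" unfolding edge_key_def
proof (rule someI2)
  show "\<exists>p' i'. canon G p' \<and> i' + 1 < length p' \<and> {p ! i, p ! (i + 1)} = {p' ! i', p' ! (i' + 1)} \<and>
      key0 {hd p, last p} * Suc (card (\<Union>G)) + i = key0 {hd p', last p'} * Suc (card (\<Union>G)) + i'"
    using assms by blast
qed (use assms canon_edge_unique in blast)

lemma along_iff:
  assumes "canon G p" "i + 1 < length p"
  shows "along G (p ! i) (p ! (i + 1))" "\<not> along G (p ! (i + 1)) (p ! i)"
proof -
  show "along G (p ! i) (p ! (i + 1))" using assms by (auto simp: along_def)
  show "\<not> along G (p ! (i + 1)) (p ! i)"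
  proof
    assume "along G (p ! (i + 1)) (p ! i)"
    then obtain q j where q: "canon G q" "j + 1 < length q" "p ! (i + 1) = q ! j" "p ! i = q ! (j + 1)"
      by (auto simp: along_def)
    then have "p = q \<and> i = j" using assms by (intro canon_edge_unique) auto
    then show False using q assms by (auto simp: canon_def strand_def strand_path_def nth_eq_iff_index_eq)
  qed
qed

lemma along_not_sym: "on_strand G {u, v} \<Longrightarrow> along G u v \<longleftrightarrow> \<not> along G v u"
proof -
  assume "on_strand G {u, v}"
  then obtain p i where p: "canon G p" "i + 1 < length p" "{u, v} = {p ! i, p ! (i + 1)}"
    by (auto simp: on_strand_def)
  then consider "u = p ! i" "v = p ! (i + 1)" | "u = p ! (i + 1)" "v = p ! i" by (auto simp: doubleton_eq_iff)
  then show ?thesis using along_iff[OF p(1,2)] by cases simp_all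
qed

lemma canon_key0_neq:
  assumes "canon G p" "canon G q" "p \<noteq> q" shows "key0 {hd p, last p} \<noteq> key0 {hd q, last q}"
proof
  assume "key0 {hd p, last p} = key0 {hd q, last q}"
  then have "{hd p, last p} = {hd q, last q}" by (subst (asm) key0_inject) auto
  then have "hd p = hd q" using assms by (auto simp: canon_def fw0_def doubleton_eq_iff)
  then show False using strand_unique[OF thin] assms by (auto simp: canon_def)
qed

lemma edge_key_less_other:
  assumes "canon G p" "canon G q" "p \<noteq> q" "i + 1 < length p" "j + 1 < length q"
  shows "edge_key G {p ! i, p ! (i + 1)} < edge_key G {q ! j, q ! (j + 1)} \<longleftrightarrow>
    key0 {hd p, last p} < key0 {hd q, last q}"
proof -
  have "i < Suc (card (\<Union>G))" "j < Suc (card (\<Union>G))"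
    using assms strand_length[of p] strand_length[of q] by (auto simp: canon_def)
  then show ?thesis unfolding edge_key_eq[OF assms(1,4)] edge_key_eq[OF assms(2,5)]
    by (rule lex_block) (rule canon_key0_neq[OF assms(1-3)])
qed

lemma edge_key_inject:
  assumes "on_strand G e" "on_strand G f" shows "edge_key G e = edge_key G f \<longleftrightarrow> e = f"
proof -
  obtain p i where p: "canon G p" "i + 1 < length p" "e = {p ! i, p ! (i + 1)}"
    using assms by (auto simp: on_strand_def)
  obtain q j where q: "canon G q" "j + 1 < length q" "f = {q ! j, q ! (j + 1)}"
    using assms by (auto simp: on_strand_def)
  show ?thesis
  proof (cases "p = q")
    case True
    then have "edge_key G e = edge_key G f \<longleftrightarrow> i = j"
      using edge_key_eq[OF p(1,2)] edge_key_eq[OF q(1,2)] p(3) q(3) by simp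
    then show ?thesis using canon_edge_unique[OF p(1) q(1) p(2) q(2)] p(3) q(3) True by metis
  next
    case False
    have "key0 {hd p, last p} \<noteq> key0 {hd q, last q}" by (rule canon_key0_neq[OF p(1) q(1) False])
    then have "edge_key G e \<noteq> edge_key G f" using edge_key_less_other[OF p(1) q(1) False p(2) q(2)]
        edge_key_less_other[OF q(1) p(1) _ q(2) p(2)] False p(3) q(3) by (metis linorder_neqE_nat nat_neq_iff)
    then show ?thesis by auto
  qed
qed

text \<open>An edge on another strand lies in a block wholly before or wholly after that of
  \<open>p\<close>; an edge on \<open>p\<close> itself lies outside the gap by assumption. In this
  form the condition in \<open>facing\<close> feeds \<open>msign_remove\<close>.\<close>

lemma between_same_strand:
  assumes p: "canon G p" "i + 1 < length p" "i' + 1 < length p" "i < i'"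
    and m: "on_strand G f" "f \<noteq> {p ! i, p ! (i + 1)}" "f \<noteq> {p ! i', p ! (i' + 1)}"
    and nb: "\<And>k. i < k \<Longrightarrow> k < i' \<Longrightarrow> f \<noteq> {p ! k, p ! (k + 1)}"
  shows "edge_key G f < edge_key G {p ! i, p ! (i + 1)} \<longleftrightarrow> edge_key G f < edge_key G {p ! i', p ! (i' + 1)}"
proof -
  obtain q j where q: "canon G q" "j + 1 < length q" "f = {q ! j, q ! (j + 1)}"
    using m(1) by (auto simp: on_strand_def)
  show ?thesis
  proof (cases "q = p")
    case True
    then have "j < i \<or> i' < j" using m(2,3) nb[of j] q by (metis linorder_neqE_nat)
    then show ?thesis
      using p q True edge_key_eq[OF p(1,2)] edge_key_eq[OF p(1,3)] edge_key_eq[OF q(1,2)] by auto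
  next
    case False
    then show ?thesis
      using edge_key_less_other[OF q(1) p(1) False q(2) p(2)] edge_key_less_other[OF q(1) p(1) False q(2) p(3)] q(3)
      by simp
  qed
qed

text \<open>The path that witnesses \<open>facing\<close> follows a canonical strand forwards or
  backwards. Forwards, the arrow edge precedes \<open>e\<close> in the order of keys and the step
  from \<open>u\<close> to \<open>v\<close> is along the strand; backwards, both statements fail.
  Direction and order thus always agree.\<close>

lemma facing_edge_key:
  assumes fac: "facing G ms u v e" and uv: "on_strand G {u, v}"
    and ms: "\<And>m. m \<in> set ms \<Longrightarrow> on_strand G (edge_of m) \<and> edge_of m \<noteq> {u, v} \<and> edge_of m \<noteq> e"
  shows "on_strand G e" "along G u v \<longleftrightarrow> edge_key G {u, v} < edge_key G e" "edge_key G e \<noteq> edge_key G {u, v}"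
    and "\<And>m. m \<in> set ms \<Longrightarrow>
      edge_key G (edge_of m) < edge_key G {u, v} \<longleftrightarrow> edge_key G (edge_of m) < edge_key G e"
proof -
  from fac obtain q where q: "strand_path G q" "length q \<ge> 3" "q ! 0 = u" "q ! 1 = v"
      "e = {q ! (length q - 2), q ! (length q - 1)}"
    and un: "\<And>i m. 0 < i \<Longrightarrow> i + 2 < length q \<Longrightarrow> m \<in> set ms \<Longrightarrow> edge_of m \<noteq> {q ! i, q ! (i + 1)}"
    unfolding facing_def by blast
  define n where "n = length q - 2"
  have n: "length q = n + 2" "0 < n" using q(2) by (auto simp: n_def)
  obtain p i where p: "canon G p" "i + 1 < length p" "{u, v} = {p ! i, p ! (i + 1)}"
    using uv by (auto simp: on_strand_def)
  have sp: "strand G p" using p by (simp add: canon_def)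
  consider "u = p ! i" "v = p ! (i + 1)" | "u = p ! (i + 1)" "v = p ! i"
    using p(3) by (auto simp: doubleton_eq_iff)
  then have "on_strand G e \<and> (along G u v \<longleftrightarrow> edge_key G {u, v} < edge_key G e) \<and> edge_key G e \<noteq> edge_key G {u, v} \<and>
    (\<forall>m\<in>set ms. edge_key G (edge_of m) < edge_key G {u, v} \<longleftrightarrow> edge_key G (edge_of m) < edge_key G e)"
  proof cases
    case 1
    have sub: "i + j < length p \<and> q ! j = p ! (i + j)" if "j < length q" for j
      using strand_subpath[OF thin sp q(1) _ p(2) _ _ that] q 1 by simp
    have len: "i + n + 1 < length p" using sub[of "n + 1"] n by simp
    have e: "e = {p ! (i + n), p ! (i + n + 1)}" using q(5) sub[of n] sub[of "n + 1"] n by simp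
    have "edge_key G (edge_of m) < edge_key G {u, v} \<longleftrightarrow> edge_key G (edge_of m) < edge_key G e" if "m \<in> set ms" for m
      unfolding e p(3)
    proof (rule between_same_strand[OF p(1,2) len])
      fix k assume k: "i < k" "k < i + n"
      then show "edge_of m \<noteq> {p ! k, p ! (k + 1)}"
        using un[of "k - i" m] sub[of "k - i"] sub[of "k - i + 1"] that n by simp
    qed (use ms[OF that] e p(3) n in auto)
    moreover have "on_strand G e" using e len p(1) unfolding on_strand_def by blast
    ultimately show ?thesis
      using along_iff[OF p(1,2)] 1 edge_key_eq[OF p(1,2)] edge_key_eq[OF p(1) len] n e p(3) by auto
  next
    case 2
    \<comment> \<open>Travelling against the canonical orientation: the subpath lemma is applied to
      the reversed strand and its indices are mirrored back.\<close>
    have r: "strand G (rev p)" "length p - 2 - i + 1 < length (rev p)"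
      "rev p ! (length p - 2 - i) = u" "rev p ! (length p - 2 - i + 1) = v"
      using strand_rev[OF sp] p(2) 2 by (auto simp: rev_nth Suc_diff_Suc)
    have sub: "j \<le> i + 1 \<and> q ! j = p ! (i + 1 - j)" if "j < length q" for j
    proof -
      have "length p - 2 - i + j < length p \<and> q ! j = rev p ! (length p - 2 - i + j)"
        using strand_subpath[OF thin r(1) q(1) _ r(2) _ _ that] q r by simp
      moreover from this have "rev p ! (length p - 2 - i + j) = p ! (i + 1 - j)"
        using p(2) by (simp add: rev_nth)
      ultimately show ?thesis using p(2) by auto
    qed
    have le: "n \<le> i" using sub[of "n + 1"] n by simp
    then have len: "i - n + 1 < length p" using p(2) by simp
    have e: "e = {p ! (i - n), p ! (i - n + 1)}"
      using q(5) sub[of n] sub[of "n + 1"] n le by (auto simp: Suc_diff_le)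
    have "edge_key G (edge_of m) < edge_key G e \<longleftrightarrow> edge_key G (edge_of m) < edge_key G {u, v}" if "m \<in> set ms" for m
      unfolding e p(3)
    proof (rule between_same_strand[OF p(1) len p(2)])
      fix k assume k: "i - n < k" "k < i"
      then have "i + 1 - (i - k) = k + 1" "i + 1 - (i - k + 1) = k" "0 < i - k" "i - k + 2 < length q"
        using n le by auto
      then show "edge_of m \<noteq> {p ! k, p ! (k + 1)}"
        using un[of "i - k" m] sub[of "i - k"] sub[of "i - k + 1"] that n by (auto simp: insert_commute)
    qed (use ms[OF that] e p(3) n le in auto)
    moreover have "on_strand G e" using e len p(1) unfolding on_strand_def by blast
    ultimately show ?thesis
      using along_iff[OF p(1,2)] 2 edge_key_eq[OF p(1,2)] edge_key_eq[OF p(1) len] n le e p(3) by auto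
  qed
  then show "on_strand G e" "along G u v \<longleftrightarrow> edge_key G {u, v} < edge_key G e" "edge_key G e \<noteq> edge_key G {u, v}"
    "\<And>m. m \<in> set ms \<Longrightarrow>
      edge_key G (edge_of m) < edge_key G {u, v} \<longleftrightarrow> edge_key G (edge_of m) < edge_key G e" by blast+
qed

text \<open>The invariant of simplification. Without it \<open>edge_key\<close> need not separate
  two markings of the list.\<close>

definition markings_ok :: "marking list \<Rightarrow> bool" where
  "markings_ok ms \<longleftrightarrow> distinct (map edge_of ms) \<and> (\<forall>m\<in>set ms. on_strand G (edge_of m))"

text \<open>For an arrow directly above the bead it points to, the direction sign and the inversion
  sign are both 1 or both \<epsilon>, by \<open>facing_edge_key\<close>, and cancel. Reversing the
  arrow or exchanging the heights flips exactly one of the two, which reproduces the scalars of all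
  four removal rules.\<close>

lemma simp_step_sign:
  fixes \<epsilon> :: "'k::field" assumes eps: "\<epsilon> * \<epsilon> = 1" and step: "simp_step \<epsilon> G s t" and ok: "markings_ok (snd s)"
  shows "markings_ok (snd t) \<and>
    fst t * msign \<epsilon> (edge_key G) (along G) (snd t) = fst s * msign \<epsilon> (edge_key G) (along G) (snd s)"
proof -
  have removal: "on_strand G e \<and> msign \<epsilon> (edge_key G) (along G) (xs @ a # b # ys) =
      dir_sign \<epsilon> (along G) a * dir_sign \<epsilon> (along G) b * inv_sign \<epsilon> (edge_key G) a b *
      msign \<epsilon> (edge_key G) (along G) (xs @ ys) \<and>
      (along G u v \<longleftrightarrow> edge_key G {u, v} < edge_key G e) \<and> edge_key G e \<noteq> edge_key G {u, v} \<and>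
      (along G u v \<longleftrightarrow> \<not> along G v u)"
    if fac: "facing G (xs @ ys) u v e" and ok': "markings_ok (xs @ a # b # ys)"
      and ab: "edge_of a = {u, v} \<and> edge_of b = e \<or> edge_of b = {u, v} \<and> edge_of a = e"
    for xs ys a b u v e
  proof -
    have uv: "on_strand G {u, v}" using ok' ab by (auto simp: markings_ok_def)
    have ms: "on_strand G (edge_of m) \<and> edge_of m \<noteq> {u, v} \<and> edge_of m \<noteq> e" if "m \<in> set (xs @ ys)" for m
    proof -
      have "on_strand G (edge_of m)" using ok' that by (auto simp: markings_ok_def)
      moreover have "edge_of a \<notin> set (map edge_of (xs @ ys))" "edge_of b \<notin> set (map edge_of (xs @ ys))"
        using ok' by (auto simp: markings_ok_def)
      then have "edge_of m \<noteq> edge_of a" "edge_of m \<noteq> edge_of b" using that by (metis image_eqI image_set)+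
      ultimately show ?thesis using ab by metis
    qed
    note * = facing_edge_key[OF fac uv ms]
    have keys: "edge_key G (edge_of m) \<noteq> edge_key G (edge_of a)" "edge_key G (edge_of m) \<noteq> edge_key G (edge_of b)"
      if "m \<in> set (xs @ ys)" for m
    proof -
      have "edge_key G (edge_of m) \<noteq> edge_key G {u, v}" "edge_key G (edge_of m) \<noteq> edge_key G e"
        using ms[OF that] uv *(1) edge_key_inject[of "edge_of m"] by simp_all
      then show "edge_key G (edge_of m) \<noteq> edge_key G (edge_of a)" "edge_key G (edge_of m) \<noteq> edge_key G (edge_of b)"
        using ab by metis+
    qed
    have "msign \<epsilon> (edge_key G) (along G) (xs @ a # b # ys) =
      dir_sign \<epsilon> (along G) a * dir_sign \<epsilon> (along G) b * inv_sign \<epsilon> (edge_key G) a b *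
      msign \<epsilon> (edge_key G) (along G) (xs @ ys)"
    proof (rule msign_remove[OF eps])
      fix m assume m: "m \<in> set (xs @ ys)"
      show "edge_key G (edge_of m) \<noteq> edge_key G (edge_of a) \<and> edge_key G (edge_of m) \<noteq> edge_key G (edge_of b) \<and>
        (edge_key G (edge_of m) < edge_key G (edge_of a) \<longleftrightarrow> edge_key G (edge_of m) < edge_key G (edge_of b))"
        using keys[OF m] *(4)[OF _ m] ab by metis
    qed
    then show ?thesis using *(1-3) along_not_sym[OF uv] by blast
  qed
  show ?thesis using step
  proof cases
    case (interchange c xs a b ys)
    have "edge_key G (edge_of a) \<noteq> edge_key G (edge_of b)"
      using ok interchange edge_key_inject[of "edge_of a" "edge_of b"] by (auto simp: markings_ok_def)
    then show ?thesis using interchange ok msign_swap[OF eps, of "edge_key G" a b "along G" xs ys]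
      by (auto simp: markings_ok_def algebra_simps eps_cancel[OF eps])
  next
    case (arrow_above_toward xs ys u v e c)
    note r = removal[OF arrow_above_toward(3), of "Arrow u v" "Bead e"]
    show ?thesis using r ok arrow_above_toward(1,2) eps by (auto simp: markings_ok_def inv_sign_def)
  next
    case (arrow_above_away xs ys u v e c)
    note r = removal[OF arrow_above_away(3), of "Arrow v u" "Bead e"]
    show ?thesis
      using r ok arrow_above_away(1,2) eps by (auto simp: markings_ok_def inv_sign_def insert_commute)
  next
    case (bead_above_away xs ys u v e c)
    note r = removal[OF bead_above_away(3), of "Bead e" "Arrow v u"]
    show ?thesis using r ok bead_above_away(1,2) eps by (auto simp: markings_ok_def inv_sign_def insert_commute)
  next
    case (bead_above_toward xs ys u v e c)
    note r = removal[OF bead_above_toward(3), of "Bead e" "Arrow u v"]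
    show ?thesis using r ok bead_above_toward(1,2) eps by (auto simp: markings_ok_def inv_sign_def)
  qed
qed

lemma simp_steps_sign:
  fixes \<epsilon> :: "'k::field"
  assumes eps: "\<epsilon> * \<epsilon> = 1" and steps: "(simp_step \<epsilon> G)\<^sup>*\<^sup>* s t" and ok: "markings_ok (snd s)"
  shows "markings_ok (snd t) \<and>
    fst t * msign \<epsilon> (edge_key G) (along G) (snd t) = fst s * msign \<epsilon> (edge_key G) (along G) (snd s)"
  using steps by (induction rule: rtranclp_induct) (use simp_step_sign[OF eps] ok in auto)

text \<open>A canonical strand is oriented by \<open>fw0\<close> on its ends, so an arrow keeps its
  direction sign when its strand shrinks to a single edge.\<close>

lemma contract_marking_canon:
  assumes "contract_marking G m m'"
  obtains p i where "canon G p" "i + 1 < length p" "edge_of m = {p ! i, p ! (i + 1)}" "edge_of m' = {hd p, last p}"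
    "dir_sign \<epsilon> (along G) m = dir_sign \<epsilon> fw0 m'" using assms
proof cases
  case (bead p i)
  then have p: "strand G p" by (auto simp: strand_def outer_iff)
  have "on_strand G {p ! i, p ! (i + 1)}" using on_strandI[OF p] bead by simp
  then obtain q j where q: "canon G q" "j + 1 < length q" "{p ! i, p ! (i + 1)} = {q ! j, q ! (j + 1)}"
    by (auto simp: on_strand_def)
  then have "p ! i \<in> set q" "p ! i \<in> set p" using bead by (auto simp: doubleton_eq_iff)
  then have "p = q \<or> p = rev q" using strands_meet[OF thin _ p] q by (auto simp: canon_def)
  then have "{hd p, last p} = {hd q, last q}" using q(2) by (cases q) (auto simp: hd_rev last_rev)
  then show ?thesis using that[OF q(1,2)] q(3) bead by simp
next
  case (arrow p i)
  then have p: "strand G p" by (auto simp: strand_def outer_iff)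
  then have ne: "p \<noteq> []" by (auto simp: strand_def)
  show ?thesis using canon_or_rev[OF p]
  proof
    assume c: "canon G p"
    then show ?thesis using that[OF c arrow(6)] arrow along_iff[OF c arrow(6)] by (auto simp: canon_def)
  next
    assume c: "canon G (rev p)"
    define j where "j = length p - 2 - i"
    have j: "j + 1 < length (rev p)" "rev p ! j = p ! (i + 1)" "rev p ! (j + 1) = p ! i"
      using arrow(6) by (auto simp: j_def rev_nth Suc_diff_Suc)
    have "\<not> fw0 (hd p) (last p)" using c ne by (auto simp: canon_def fw0_def hd_rev last_rev)
    then show ?thesis using that[OF c j(1)] arrow j along_iff[OF c j(1)] ne
      by (auto simp: hd_rev last_rev insert_commute)
  qed
qed

text \<open>The blocks of \<open>edge_key\<close> are ordered by \<open>key0\<close> of the pair of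
  ends, which is the key of the contracted edge. Distinct contracted edges mean that a strand
  carries at most one marking, so only comparisons between different blocks occur.\<close>

lemma contract_sign:
  fixes \<epsilon> :: "'k::field" assumes "list_all2 (contract_marking G) ms ms'" "distinct (map edge_of ms')"
  shows "msign \<epsilon> (edge_key G) (along G) ms = msign \<epsilon> key0 fw0 ms'" using assms
proof (induction rule: list_all2_induct)
  case (Cons m ms m' ms')
  obtain p i where p: "canon G p" "i + 1 < length p" "edge_of m = {p ! i, p ! (i + 1)}" "edge_of m' = {hd p, last p}"
    "dir_sign \<epsilon> (along G) m = dir_sign \<epsilon> fw0 m'" using contract_marking_canon[OF Cons.hyps(1), of \<epsilon>] .
  have inv: "inv_sign \<epsilon> (edge_key G) m x = inv_sign \<epsilon> key0 m' x'"
    if x: "contract_marking G x x'" and ne: "edge_of x' \<noteq> edge_of m'" for x x'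
  proof -
    obtain q j where q: "canon G q" "j + 1 < length q" "edge_of x = {q ! j, q ! (j + 1)}" "edge_of x' = {hd q, last q}"
      using contract_marking_canon[OF x, of \<epsilon>] by metis
    then have "q \<noteq> p" using ne p by auto
    then show ?thesis using edge_key_less_other[OF q(1) p(1) _ q(2) p(2)] p q by (simp add: inv_sign_def)
  qed
  have "map (inv_sign \<epsilon> (edge_key G) m) ms = map (inv_sign \<epsilon> key0 m') ms'"
  proof (rule nth_equalityI)
    show "length (map (inv_sign \<epsilon> (edge_key G) m) ms) = length (map (inv_sign \<epsilon> key0 m') ms')"
      using Cons.hyps(2) by (simp add: list_all2_lengthD)
    fix k assume "k < length (map (inv_sign \<epsilon> (edge_key G) m) ms)"
    then have k: "k < length ms" "k < length ms'" using Cons.hyps(2) by (auto simp: list_all2_lengthD)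
    have "edge_of (ms' ! k) \<noteq> edge_of m'"
      using Cons.prems k(2) by (metis distinct.simps(2) image_eqI list.set_map list.simps(9) nth_mem)
    then show "map (inv_sign \<epsilon> (edge_key G) m) ms ! k = map (inv_sign \<epsilon> key0 m') ms' ! k"
      using k inv[of "ms ! k" "ms' ! k"] Cons.hyps(2) by (simp add: list_all2_nthD)
  qed
  then show ?case using p(5) Cons by simp
qed simp

end

section \<open>The quotient by the marking relations\<close>

lemma brauer_diagram_iff: "brauer_diagram r s X \<longleftrightarrow> \<Union>X = Top ` {1..r} \<union> Bot ` {1..s} \<and> (\<forall>e\<in>X. card e = 2) \<and>
     (\<forall>e\<in>X. \<forall>f\<in>X. \<forall>v. v \<in> e \<longrightarrow> v \<in> f \<longrightarrow> e = f)"
proof -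
  have "disjoint X \<longleftrightarrow> (\<forall>e\<in>X. \<forall>f\<in>X. \<forall>v. v \<in> e \<longrightarrow> v \<in> f \<longrightarrow> e = f)" unfolding disjoint_def by blast
  moreover have "{} \<notin> X" if "\<forall>e\<in>X. card e = 2" using that by force
  ultimately show ?thesis unfolding brauer_diagram_def partition_on_def by metis
qed

lemma brauer_edge:
  assumes "brauer_diagram r s X" "e \<in> X" obtains u v where "e = {u, v}" "u \<noteq> v"
proof -
  have "card e = 2" using assms by (simp add: brauer_diagram_iff)
  then show ?thesis using that unfolding card_2_iff by blast
qed

lemma brauer_unique:
  assumes "brauer_diagram r s X" "{v, a} \<in> X" "{v, b} \<in> X" shows "a = b"
proof -
  have "\<forall>e\<in>X. \<forall>f\<in>X. \<forall>v. v \<in> e \<longrightarrow> v \<in> f \<longrightarrow> e = f" using assms(1) unfolding brauer_diagram_iff by (elim conjE)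
  then have "{v, a} = {v, b}" using assms(2,3) by (meson insertI1)
  then show ?thesis by (auto simp: doubleton_eq_iff)
qed

lemma brauer_neq:
  assumes "brauer_diagram r s X" "{v, w} \<in> X" shows "v \<noteq> w"
proof
  assume "v = w"
  then have "card {v, w} = 1" by simp
  then show False using assms by (auto simp: brauer_diagram_iff)
qed

lemma brauer_vertex:
  assumes "brauer_diagram r s X" "{v, w} \<in> X"
  shows "v \<in> Top ` {1..r} \<union> Bot ` {1..s}" "v \<in> outer"
proof -
  have "v \<in> \<Union>X" using assms(2) by blast
  then show "v \<in> Top ` {1..r} \<union> Bot ` {1..s}" using assms(1) unfolding brauer_diagram_iff by blast
  then show "v \<in> outer" by auto
qed

lemma brauer_partner:
  assumes "brauer_diagram r s X" "v \<in> Top ` {1..r} \<union> Bot ` {1..s}"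
  obtains w where "{v, w} \<in> X" "w \<noteq> v"
proof -
  have "v \<in> \<Union>X" using assms unfolding brauer_diagram_iff by blast
  then obtain e where e: "e \<in> X" "v \<in> e" by blast
  then show ?thesis using brauer_edge[OF assms(1) e(1)] that by (metis doubleton_eq_iff insert_iff singletonD)
qed

lemma brauer_finite:
  assumes "brauer_diagram r s X" shows "finite X"
proof -
  have "finite (\<Union>X)" using assms by (simp add: brauer_diagram_iff)
  then show ?thesis by (rule finite_UnionD)
qed

lemma marked_edge:
  assumes "(X, ms) \<in> marked_brauer r s" "m \<in> set ms"
  shows "edge_of m \<in> X" "edge_of m \<in> cups X \<or> edge_of m \<in> caps X" "finite (edge_of m)"
proof -
  show *: "edge_of m \<in> cups X \<or> edge_of m \<in> caps X" using assms by (cases m) (auto simp: marked_brauer_def)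
  then show "edge_of m \<in> X" by (auto simp: cups_def caps_def)
  show "finite (edge_of m)"
  proof (cases m)
    case (Bead e)
    then have "card e = 2" using \<open>edge_of m \<in> X\<close> assms(1) by (auto simp: marked_brauer_def brauer_diagram_iff)
    then show ?thesis using Bead card.infinite by fastforce
  qed auto
qed

lemma marked_bead_iff: "(X, ms) \<in> marked_brauer r s \<Longrightarrow> Bead e \<in> set ms \<longleftrightarrow> e \<in> cups X"
  unfolding marked_brauer_def by blast

lemma marked_arrow:
  assumes "(X, ms) \<in> marked_brauer r s" "Arrow u v \<in> set ms"
  shows "{u, v} \<in> caps X" "u \<noteq> v" "u \<in> range Bot" "v \<in> range Bot"
proof -
  show *: "{u, v} \<in> caps X" using assms by (auto simp: marked_brauer_def)
  then show "u \<in> range Bot" "v \<in> range Bot" by (auto simp: caps_def)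
  show "u \<noteq> v" using * assms brauer_neq[of r s X u v] by (auto simp: marked_brauer_def caps_def)
qed

lemma marked_cap:
  assumes "(X, ms) \<in> marked_brauer r s" "{u, v} \<in> caps X"
  shows "Arrow u v \<in> set ms \<or> Arrow v u \<in> set ms"
proof -
  have "{u, v} \<in> {{u, v} |u v. Arrow u v \<in> set ms}" using assms by (simp add: marked_brauer_def)
  then show ?thesis by (auto simp: doubleton_eq_iff)
qed

text \<open>Interchange and arrow reversal both cost a single factor \<epsilon>, so one step
  relation covers both families of marking relations.\<close>

inductive mstep :: "marking list \<Rightarrow> marking list \<Rightarrow> bool" where
  swap: "mstep (xs @ a # b # ys) (xs @ b # a # ys)"
| reverse: "mstep (xs @ Arrow u v # ys) (xs @ Arrow v u # ys)"

lemma mstep_append: "mstep ms ms' \<Longrightarrow> mstep (xs @ ms @ ys) (xs @ ms' @ ys)"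
proof (induction rule: mstep.induct)
  case (swap xs' a b ys')
  then show ?case using mstep.swap[of "xs @ xs'" a b "ys' @ ys"] by simp
next
  case (reverse xs' u v ys')
  then show ?case using mstep.reverse[of "xs @ xs'" u v "ys' @ ys"] by simp
qed

lemma mstep_Cons: "mstep ms ms' \<Longrightarrow> mstep (m # ms) (m # ms')" using mstep_append[of ms ms' "[m]" "[]"] by simp

lemma mstep_relabel: "mstep ms ms' \<Longrightarrow> mstep (map (relabel f) ms) (map (relabel f) ms')"
proof (induction rule: mstep.induct)
  case (swap xs a b ys)
  then show ?case using mstep.swap[of "map (relabel f) xs" "relabel f a" "relabel f b"] by simp
next
  case (reverse xs u v ys)
  then show ?case using mstep.reverse[of "map (relabel f) xs" "f u" "f v"] by simp
qed

lemma msteps_Cons: "mstep\<^sup>*\<^sup>* ms ms' \<Longrightarrow> mstep\<^sup>*\<^sup>* (m # ms) (m # ms')"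
  by (induction rule: rtranclp_induct) (auto intro: mstep_Cons rtranclp.rtrancl_into_rtrancl)

lemma msteps_move_front: "mstep\<^sup>*\<^sup>* (xs @ m # ys) (m # xs @ ys)"
proof (induction xs)
  case (Cons x xs)
  then have "mstep\<^sup>*\<^sup>* ((x # xs) @ m # ys) (x # m # xs @ ys)" using msteps_Cons by simp
  also have "mstep (x # m # xs @ ys) (m # x # xs @ ys)" using mstep.swap[of "[]"] by simp
  finally (rtranclp.rtrancl_into_rtrancl) show ?case by simp
qed simp

fun kind :: "marking \<Rightarrow> bool \<times> vertex set" where
  "kind (Bead e) = (True, e)"
| "kind (Arrow u v) = (False, {u, v})"

lemma snd_kind [simp]: "snd (kind m) = edge_of m" by (cases m) auto

text \<open>Up to the direction of arrows a marking is its \<open>kind\<close>. The wanted marking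
  is moved to the front and reversed if necessary, and the rest follows by induction.\<close>

lemma mset_kind_msteps: "mset (map kind ms) = mset (map kind ms') \<Longrightarrow> mstep\<^sup>*\<^sup>* ms ms'"
proof (induction ms' arbitrary: ms)
  case (Cons m' ms')
  then have "kind m' \<in> set (map kind ms)" by (metis list.set_intros(1) list.simps(9) set_mset_mset)
  then obtain m xs ys where m: "ms = xs @ m # ys" "kind m = kind m'" by (auto simp: in_set_conv_decomp)
  have "mstep\<^sup>*\<^sup>* (m # xs @ ys) (m' # xs @ ys)"
  proof (cases "m = m'")
    case False
    then obtain u v where "m = Arrow u v" "m' = Arrow v u"
      using m(2) by (cases m; cases m') (auto simp: doubleton_eq_iff)
    then show ?thesis using mstep.reverse[of "[]"] by auto
  qed simp
  moreover have "mstep\<^sup>*\<^sup>* (xs @ ys) ms'" using Cons m by simp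
  ultimately show ?case using msteps_move_front[of xs m ys] msteps_Cons[of "xs @ ys" ms' m'] m(1)
    by (metis rtranclp_trans)
qed simp

lemma mset_kind_mstep: "mstep ms ms' \<Longrightarrow> mset (map kind ms) = mset (map kind ms')"
  by (induction rule: mstep.induct) (auto simp: insert_commute)

lemma marked_brauer_iff_kind: "(X, ms) \<in> marked_brauer r s \<longleftrightarrow> brauer_diagram r s X \<and> distinct (map edge_of ms) \<and>
     kind ` set ms = {True} \<times> cups X \<union> {False} \<times> caps X"
proof -
  have "kind ` set ms = {True} \<times> {e. Bead e \<in> set ms} \<union> {False} \<times> {{u, v} |u v. Arrow u v \<in> set ms}"
  proof (intro equalityI subsetI)
    fix x assume "x \<in> kind ` set ms"
    then obtain m where m: "m \<in> set ms" "x = kind m" by auto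
    show "x \<in> {True} \<times> {e. Bead e \<in> set ms} \<union> {False} \<times> {{u, v} |u v. Arrow u v \<in> set ms}"
    proof (cases m)
      case (Arrow u v)
      then have "{u, v} \<in> {{u, v} |u v. Arrow u v \<in> set ms}" using m by blast
      then show ?thesis using m Arrow by simp
    qed (use m in simp)
  qed force
  moreover have "{True} \<times> A \<union> {False} \<times> B = {True} \<times> A' \<union> {False} \<times> B' \<longleftrightarrow> A = A' \<and> B = B'"
    for A A' B B' :: "vertex set set" by auto
  ultimately show ?thesis unfolding marked_brauer_def by simp
qed

lemma marked_mset_kind:
  assumes "(X, ms) \<in> marked_brauer r s" "(X, ms') \<in> marked_brauer r s"
  shows "mset (map kind ms) = mset (map kind ms')"
proof -
  have "distinct (map kind ms)" if "(X, ms) \<in> marked_brauer r s" for ms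
  proof -
    have "distinct (map snd (map kind ms))" using that by (simp add: marked_brauer_iff_kind comp_def)
    then show ?thesis by (simp only: distinct_map[of snd])
  qed
  then show ?thesis
    using assms by (subst set_eq_iff_mset_eq_distinct[symmetric]) (auto simp: marked_brauer_iff_kind)
qed

text \<open>The Brauer diagram fixes which edges carry beads and which carry arrows. All its
  markings are therefore connected by steps, and it contributes at most one dimension to the
  quotient.\<close>

lemma marked_msteps: "(X, ms) \<in> marked_brauer r s \<Longrightarrow> (X, ms') \<in> marked_brauer r s \<Longrightarrow> mstep\<^sup>*\<^sup>* ms ms'"
  by (intro mset_kind_msteps marked_mset_kind)

lemma marked_mset_kindI:
  assumes "(X, ms) \<in> marked_brauer r s" "mset (map kind ms) = mset (map kind ms')"
  shows "(X, ms') \<in> marked_brauer r s"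
proof -
  have eq: "mset (map edge_of ms) = mset (map edge_of ms')"
    using arg_cong[OF assms(2), of "image_mset snd"] by (simp add: multiset.map_comp comp_def flip: mset_map)
  then have "distinct (map edge_of ms')"
    using assms(1) mset_eq_imp_distinct_iff[OF eq] by (simp add: marked_brauer_def)
  moreover have "kind ` set ms = kind ` set ms'" using arg_cong[OF assms(2), of set_mset] by simp
  ultimately show ?thesis using assms(1) by (simp add: marked_brauer_iff_kind)
qed

lemma marked_mstep: "(X, ms) \<in> marked_brauer r s \<Longrightarrow> mstep ms ms' \<Longrightarrow> (X, ms') \<in> marked_brauer r s"
  by (rule marked_mset_kindI[OF _ mset_kind_mstep])

lemma finite_marked_brauer_list: "brauer_diagram r s X \<Longrightarrow> \<exists>ms. (X, ms) \<in> marked_brauer r s"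
proof -
  assume X: "brauer_diagram r s X"
  have "finite (cups X)" "finite (caps X)" using brauer_finite[OF X] by (auto simp: cups_def caps_def)
  then obtain cs ds where cs: "set cs = cups X" "distinct cs" and ds: "set ds = caps X" "distinct ds"
    by (meson finite_distinct_list)
  have "\<exists>m. kind m = (False, e)" if "e \<in> caps X" for e
    using that brauer_edge[OF X, of e] by (metis caps_def kind.simps(2) mem_Collect_eq)
  then obtain g where g: "\<And>e. e \<in> caps X \<Longrightarrow> kind (g e) = (False, e)" by metis
  have ge: "edge_of (g e) = e" if "e \<in> caps X" for e using g[OF that] snd_kind[of "g e"] by simp
  have "map edge_of (map Bead cs @ map g ds) = cs @ ds" using ge ds by (simp add: comp_def) (rule map_idI, simp)
  moreover have "cups X \<inter> caps X = {}"
  proof -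
    have "e \<notin> caps X" if "e \<in> cups X" for e
    proof -
      obtain u v where "e = {u, v}" "u \<noteq> v" using brauer_edge[OF X, of e] \<open>e \<in> cups X\<close> by (auto simp: cups_def)
      then show ?thesis using that by (auto simp: cups_def caps_def)
    qed
    then show ?thesis by blast
  qed
  ultimately have "distinct (map edge_of (map Bead cs @ map g ds))" using cs ds by simp
  moreover have "kind ` set (map Bead cs @ map g ds) = {True} \<times> cups X \<union> {False} \<times> caps X"
    using cs ds g by (auto simp: image_Un image_image)
  ultimately have "(X, map Bead cs @ map g ds) \<in> marked_brauer r s"
    using X unfolding marked_brauer_iff_kind by blast
  then show ?thesis ..
qed

section \<open>Coordinates of marked diagrams and the relation space as their kernel\<close>

definition dvec :: "'k::field \<Rightarrow> mdiagram \<Rightarrow> 'k coords" where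
  "dvec \<epsilon> D = single (fst D) (msign \<epsilon> key0 fw0 (snd D))"

definition nf :: "'k::field \<Rightarrow> (mdiagram \<Rightarrow>\<^sub>0 'k) \<Rightarrow> 'k coords" where
  "nf \<epsilon> = lin (dvec \<epsilon>)"

lemma nf_single [simp]: "nf \<epsilon> (single D c) = scale c (dvec \<epsilon> D)" by (simp add: nf_def)

lemma lin_lin: "lin f (lin g x) = lin (\<lambda>k. lin f (g k)) x"
  unfolding lin_def[of g] lin_sum lin_scale lin_def[of "\<lambda>k. lin f (g k)"] ..

lemma msign_mstep:
  fixes \<epsilon> :: "'k::field" assumes "\<epsilon> * \<epsilon> = 1" "mstep ms ms'"
    and key: "\<And>a b. a \<in> set ms \<Longrightarrow> b \<in> set ms \<Longrightarrow> edge_of a \<noteq> edge_of b \<Longrightarrow> \<kappa> (edge_of a) \<noteq> \<kappa> (edge_of b)"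
    and dist: "distinct (map edge_of ms)" and dir: "\<And>u v. Arrow u v \<in> set ms \<Longrightarrow> fw u v \<longleftrightarrow> \<not> fw v u"
  shows "msign \<epsilon> \<kappa> fw ms' = \<epsilon> * msign \<epsilon> \<kappa> fw ms" using assms(2)
proof cases
  case (swap xs a b ys)
  then have "\<kappa> (edge_of a) \<noteq> \<kappa> (edge_of b)" using dist by (intro key) auto
  then show ?thesis unfolding swap by (rule msign_swap[OF assms(1)])
next
  case (reverse xs u v ys)
  then have "fw u v \<longleftrightarrow> \<not> fw v u" by (intro dir) auto
  then show ?thesis unfolding reverse by (rule msign_reverse[OF assms(1)])
qed

lemma dvec_mstep:
  fixes \<epsilon> :: "'k::field" assumes "\<epsilon> * \<epsilon> = 1" "(X, ms) \<in> marked_brauer r s" "mstep ms ms'"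
  shows "dvec \<epsilon> (X, ms') = scale \<epsilon> (dvec \<epsilon> (X, ms))"
proof -
  have "msign \<epsilon> key0 fw0 ms' = \<epsilon> * msign \<epsilon> key0 fw0 ms"
  proof (rule msign_mstep[OF assms(1,3)])
    show "key0 (edge_of a) \<noteq> key0 (edge_of b)" if "a \<in> set ms" "b \<in> set ms" "edge_of a \<noteq> edge_of b" for a b
      using that key0_inject marked_edge(3)[OF assms(2)] by auto
    show "distinct (map edge_of ms)" using assms(2) by (simp add: marked_brauer_def)
    show "fw0 u v \<longleftrightarrow> \<not> fw0 v u" if "Arrow u v \<in> set ms" for u v
      by (rule fw0_not_sym[OF marked_arrow(2)[OF assms(2) that]])
  qed
  then show ?thesis by (simp add: dvec_def)
qed

text \<open>Whatever picks up \<epsilon> under each step varies with the marking exactly as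
  \<open>msign\<close> does. Applied to \<open>cval\<close> in either argument, this shows that the
  product does not depend on the chosen markings.\<close>

lemma msteps_proportional:
  fixes \<epsilon> :: "'k::field" and g :: "marking list \<Rightarrow> ('b \<Rightarrow>\<^sub>0 'k)"
  assumes eps: "\<epsilon> * \<epsilon> = 1" and ms: "(X, ms) \<in> marked_brauer r s" "(X, ms') \<in> marked_brauer r s"
    and g: "\<And>a b. (X, a) \<in> marked_brauer r s \<Longrightarrow> mstep a b \<Longrightarrow> g b = scale \<epsilon> (g a)"
  shows "scale (msign \<epsilon> key0 fw0 ms) (g ms) = scale (msign \<epsilon> key0 fw0 ms') (g ms')"
proof -
  have *: "(X, b) \<in> marked_brauer r s \<and> scale (msign \<epsilon> key0 fw0 b) (g b) = scale (msign \<epsilon> key0 fw0 ms) (g ms)"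
    if "mstep\<^sup>*\<^sup>* ms b" for b using that
  proof (induction rule: rtranclp_induct)
    case (step a b)
    have "dvec \<epsilon> (X, b) = scale \<epsilon> (dvec \<epsilon> (X, a))" using step by (intro dvec_mstep[OF eps]) auto
    then have "msign \<epsilon> key0 fw0 b = \<epsilon> * msign \<epsilon> key0 fw0 a" by (simp add: dvec_def) (metis lookup_single_eq)
    then show ?case using step g[of a b] marked_mstep[of X a r s b] eps
      by (auto simp: mult.commute mult.left_commute)
  qed (use ms in auto)
  show ?thesis using *[OF marked_msteps[OF ms]] by metis
qed

definition mark :: "nat \<Rightarrow> nat \<Rightarrow> vertex set set \<Rightarrow> mdiagram" where
  "mark r s X = (X, SOME ms. (X, ms) \<in> marked_brauer r s)"

lemma mark_marked: "brauer_diagram r s X \<Longrightarrow> mark r s X \<in> marked_brauer r s"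
  unfolding mark_def by (rule someI_ex[OF finite_marked_brauer_list])

lemma fst_mark [simp]: "fst (mark r s X) = X" by (simp add: mark_def)

lemma marking_relations_mstep:
  "x \<in> marking_relations \<epsilon> r s \<longleftrightarrow> (\<exists>X ms ms'. (X, ms) \<in> marked_brauer r s \<and> mstep ms ms' \<and>
     x = single (X, ms') 1 - single (X, ms) \<epsilon>)" (is "_ \<longleftrightarrow> ?rhs")
proof
  assume "x \<in> marking_relations \<epsilon> r s"
  then consider
    X xs a b ys where "x = single (X, xs @ b # a # ys) 1 - single (X, xs @ a # b # ys) \<epsilon>"
      "(X, xs @ a # b # ys) \<in> marked_brauer r s"
  | X xs u v ys where "x = single (X, xs @ Arrow v u # ys) 1 - single (X, xs @ Arrow u v # ys) \<epsilon>"
      "(X, xs @ Arrow u v # ys) \<in> marked_brauer r s"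
    unfolding marking_relations_def by (elim UnE CollectE exE conjE) metis+
  then show ?rhs by cases (metis mstep.intros)+
next
  assume ?rhs
  then obtain X ms ms' where X: "(X, ms) \<in> marked_brauer r s" "mstep ms ms'"
    "x = single (X, ms') 1 - single (X, ms) \<epsilon>" by metis
  from X(2) show "x \<in> marking_relations \<epsilon> r s"
  proof cases
    case (swap xs a b ys)
    then show ?thesis
      using X unfolding marking_relations_def by (intro UnI1 CollectI exI[of _ X] exI[of _ xs] exI[of _ a] exI[of _ b] exI[of _ ys]) simp
  next
    case (reverse xs u v ys)
    then show ?thesis
      using X unfolding marking_relations_def by (intro UnI2 CollectI exI[of _ X] exI[of _ xs] exI[of _ u] exI[of _ v] exI[of _ ys]) simp
  qed
qed

lemma relation_space_subset:
  fixes \<epsilon> :: "'k::field" assumes "\<epsilon> * \<epsilon> = 1" shows "relation_space \<epsilon> r s \<subseteq> {x \<in> diagram_space r s. nf \<epsilon> x = 0}"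
  unfolding relation_space_def
proof (rule scale.span_minimal)
  show "scale.subspace {x \<in> diagram_space r s. nf \<epsilon> x = 0}"
  proof (rule scale.subspaceI)
    show "x + y \<in> {x \<in> diagram_space r s. nf \<epsilon> x = 0}"
      if "x \<in> {x \<in> diagram_space r s. nf \<epsilon> x = 0}" "y \<in> {x \<in> diagram_space r s. nf \<epsilon> x = 0}" for x y
      using that Poly_Mapping.keys_add[of x y] by (auto simp: diagram_space_def nf_def lin_add)
    show "scale c x \<in> {x \<in> diagram_space r s. nf \<epsilon> x = 0}"
      if "x \<in> {x \<in> diagram_space r s. nf \<epsilon> x = 0}" for c x
      using that keys_scale[of c x] by (auto simp: diagram_space_def nf_def lin_scale)
  qed (auto simp: diagram_space_def nf_def)
  have *: "single (X, ms') 1 - single (X, ms) \<epsilon> \<in> {x \<in> diagram_space r s. nf \<epsilon> x = 0}"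
    if "(X, ms) \<in> marked_brauer r s" "mstep ms ms'" for X ms ms'
  proof -
    have "nf \<epsilon> (single (X, ms') 1 - single (X, ms) \<epsilon>) = 0"
      using dvec_mstep[OF assms that] by (simp add: nf_def lin_diff)
    moreover have "keys (single (X, ms') 1 - single (X, ms) \<epsilon>)
        \<subseteq> {(X, ms'), (X, ms)}" by (auto simp: in_keys_iff lookup_minus lookup_single when_def split: if_splits)
    ultimately show ?thesis using that marked_mstep[OF that] by (auto simp: diagram_space_def)
  qed
  then show "marking_relations \<epsilon> r s \<subseteq> {x \<in> diagram_space r s. nf \<epsilon> x = 0}"
    by (auto simp only: marking_relations_mstep subset_iff)
qed

lemma relation_space_mark:
  fixes \<epsilon> :: "'k::field" assumes eps: "\<epsilon> * \<epsilon> = 1" and X: "(X, ms) \<in> marked_brauer r s"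
  shows "\<exists>c. single (X, ms) 1 - single (mark r s X) c \<in> relation_space \<epsilon> r s"
proof -
  obtain ms0 where ms0: "mark r s X = (X, ms0)" "(X, ms0) \<in> marked_brauer r s"
    using X mark_marked[of r s X] by (auto simp: mark_def marked_brauer_def)
  have rel: "single (X, b) 1 - single (X, a) \<epsilon> \<in> relation_space \<epsilon> r s"
    if "(X, a) \<in> marked_brauer r s" "mstep a b" for a b unfolding relation_space_def using that
    by (intro scale.span_base) (auto simp only: marking_relations_mstep)
  have "(X, b) \<in> marked_brauer r s \<and>
      (\<exists>c. single (X, b) 1 - single (X, ms0) c \<in> relation_space \<epsilon> r s)"
    if "mstep\<^sup>*\<^sup>* ms0 b" for b using that
  proof (induction rule: rtranclp_induct)
    case base
    have "single (X, ms0) 1 - single (X, ms0) 1 \<in> relation_space \<epsilon> r s"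
      by (simp add: relation_space_def scale.span_zero)
    then show ?case using ms0(2) by blast
  next
    case (step a b)
    then obtain c where c: "single (X, a) 1 - single (X, ms0) c \<in> relation_space \<epsilon> r s" by blast
    have "(single (X, b) 1 - single (X, a) \<epsilon>) +
        scale \<epsilon> (single (X, a) 1 - single (X, ms0) c) \<in> relation_space \<epsilon> r s"
      using rel[of a b] step.IH step.hyps c
      unfolding relation_space_def by (intro scale.span_add scale.span_scale) simp_all
    also have "(single (X, b) 1 - single (X, a) \<epsilon>) +
        scale \<epsilon> (single (X, a) 1 - single (X, ms0) c) =
        single (X, b) 1 - single (X, ms0) (\<epsilon> * c)" by (simp add: scale.scale_right_diff_distrib)
    finally show ?case using marked_mstep step by blast
  qed
  then show ?thesis using marked_msteps[OF ms0(2) X] ms0(1) by simp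
qed

text \<open>Modulo the relations every marked diagram is a multiple of the chosen marking of its
  edges, with an unknown scalar. Applying \<open>nf\<close> determines that scalar, so
  \<open>lin h\<close> after \<open>nf\<close> is the identity modulo relations and the kernel of
  \<open>nf\<close> is no larger than the relation space.\<close>

lemma relation_space_eq:
  fixes \<epsilon> :: "'k::field" assumes eps: "\<epsilon> * \<epsilon> = 1"
  shows "relation_space \<epsilon> r s = {x \<in> diagram_space r s. nf \<epsilon> x = 0}"
proof
  show "{x \<in> diagram_space r s. nf \<epsilon> x = 0} \<subseteq> relation_space \<epsilon> r s"
  proof safe
    fix x :: "mdiagram \<Rightarrow>\<^sub>0 'k" assume x: "x \<in> diagram_space r s" "nf \<epsilon> x = 0"
    define h :: "vertex set set \<Rightarrow> mdiagram \<Rightarrow>\<^sub>0 'k" where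
      "h X = single (mark r s X) (msign \<epsilon> key0 fw0 (snd (mark r s X)))" for X
    have rel: "single D 1 - lin h (dvec \<epsilon> D) \<in> relation_space \<epsilon> r s"
      if D: "D \<in> marked_brauer r s" for D
    proof -
      obtain X ms where X: "D = (X, ms)" by (cases D)
      obtain c where c: "single D 1 - single (mark r s X) c \<in> relation_space \<epsilon> r s"
        using relation_space_mark[OF eps] D X by blast
      then have "nf \<epsilon> (single D 1 - single (mark r s X) c) = 0" using relation_space_subset[OF eps] by blast
      then have "dvec \<epsilon> D = scale c (dvec \<epsilon> (mark r s X))" by (simp add: nf_def lin_diff)
      then have "lin h (dvec \<epsilon> D) = scale c (lin h (dvec \<epsilon> (mark r s X)))" by (simp add: lin_scale)
      also have "lin h (dvec \<epsilon> (mark r s X)) = single (mark r s X) 1"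
        by (simp add: dvec_def h_def msign_square[OF eps])
      finally show ?thesis using c by simp
    qed
    have "(\<Sum>D\<in>keys x. scale (lookup x D)
        (single D 1 - lin h (dvec \<epsilon> D))) \<in> relation_space \<epsilon> r s"
      using rel x(1) unfolding relation_space_def diagram_space_def
      by (intro scale.span_sum scale.span_scale) auto
    also have "(\<Sum>D\<in>keys x. scale (lookup x D)
        (single D 1 - lin h (dvec \<epsilon> D))) = x - lin h (nf \<epsilon> x)"
    proof -
      have "(\<Sum>D\<in>keys x. scale (lookup x D) (single D 1)) = x" by (simp flip: poly_mapping_expansion)
      moreover have "(\<Sum>D\<in>keys x. scale (lookup x D) (lin h (dvec \<epsilon> D))) = lin h (nf \<epsilon> x)"
        by (simp add: nf_def lin_lin lin_def[of "\<lambda>k. lin h (dvec \<epsilon> k)"])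
      ultimately show ?thesis by (simp only: scale.scale_right_diff_distrib sum_subtractf)
    qed
    finally show "x \<in> relation_space \<epsilon> r s" using x(2) by simp
  qed
qed (rule relation_space_subset[OF eps])

text \<open>Classes become fibres of \<open>nf\<close>, so that the arithmetic of classes can be
  done on coordinates.\<close>

lemma diagram_class_eq:
  fixes \<epsilon> :: "'k::field" assumes eps: "\<epsilon> * \<epsilon> = 1" and x: "x \<in> diagram_space r s"
  shows "diagram_class \<epsilon> r s x = {y \<in> diagram_space r s. nf \<epsilon> y = nf \<epsilon> x}"
proof (intro equalityI subsetI)
  fix y assume "y \<in> diagram_class \<epsilon> r s x"
  then obtain n where n: "y = x + n" "n \<in> diagram_space r s" "nf \<epsilon> n = 0"
    by (auto simp: diagram_class_def relation_space_eq[OF eps])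
  then show "y \<in> {y \<in> diagram_space r s. nf \<epsilon> y = nf \<epsilon> x}"
    using x Poly_Mapping.keys_add[of x n] by (auto simp: diagram_space_def nf_def lin_add)
next
  fix y assume y: "y \<in> {y \<in> diagram_space r s. nf \<epsilon> y = nf \<epsilon> x}"
  have "keys (y - x) \<subseteq> keys y \<union> keys x" by (auto simp: in_keys_iff lookup_minus)
  then have "y - x \<in> relation_space \<epsilon> r s"
    using x y by (auto simp: relation_space_eq[OF eps] diagram_space_def nf_def lin_diff)
  then show "y \<in> diagram_class \<epsilon> r s x" by (auto simp: diagram_class_def intro!: image_eqI[of _ _ "y - x"])
qed

section \<open>Stacked diagrams\<close>

abbreviation simplifies :: "'k::field \<Rightarrow> 'k \<Rightarrow> vertex set set \<Rightarrow> marking list \<Rightarrow> 'k \<Rightarrow> marking list \<Rightarrow> bool" where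
  "simplifies \<delta> \<epsilon> G ms c ms' \<equiv>
     (simp_step \<epsilon> G)\<^sup>*\<^sup>* (\<delta> ^ card (closed_loops G), delete_loop_markings G ms) (c, ms')"

definition stk :: "vertex set set \<Rightarrow> vertex set set \<Rightarrow> vertex set set" where
  "stk X Y = (\<lambda>e. bot_to_mid ` e) ` X \<union> (\<lambda>e. top_to_mid ` e) ` Y"

lemma stack_edges_stk: "stack_edges D1 D2 = stk (fst D1) (fst D2)" by (cases D1; cases D2) (simp add: stk_def)

lemma stack_markings_conv:
  "stack_markings D1 D2 = map (relabel bot_to_mid) (snd D1) @ map (relabel top_to_mid) (snd D2)"
  by (cases D1; cases D2) simp

lemma outer_cases:
  assumes "v \<in> outer" obtains i where "v = Top i" | i where "v = Bot i"
  using assms by (cases v) auto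

lemma bot_to_mid_inject: "u \<in> outer \<Longrightarrow> v \<in> outer \<Longrightarrow> bot_to_mid u = bot_to_mid v \<longleftrightarrow> u = v"
  by (cases u; cases v) auto

lemma top_to_mid_inject: "u \<in> outer \<Longrightarrow> v \<in> outer \<Longrightarrow> top_to_mid u = top_to_mid v \<longleftrightarrow> u = v"
  by (cases u; cases v) auto

lemma edge_of_relabel [simp]: "edge_of (relabel f m) = f ` edge_of m" by (cases m) auto

lemma brauer_outer:
  assumes "brauer_diagram r s X" "e \<in> X" shows "e \<subseteq> outer"
proof -
  have "e \<subseteq> \<Union>X" using assms(2) by blast
  also have "\<Union>X = Top ` {1..r} \<union> Bot ` {1..s}" using assms(1) unfolding brauer_diagram_iff by (elim conjE)
  finally show ?thesis by auto
qed

locale stacked =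
  fixes r s t :: nat and X Y :: "vertex set set" assumes X: "brauer_diagram r s X" and Y: "brauer_diagram s t Y"
begin

abbreviation "G \<equiv> stk X Y"

lemma stk_edge: "{v, w} \<in> G \<longleftrightarrow> (\<exists>a b. {a, b} \<in> X \<and> v = bot_to_mid a \<and> w = bot_to_mid b) \<or>
     (\<exists>a b. {a, b} \<in> Y \<and> v = top_to_mid a \<and> w = top_to_mid b)"
proof -
  have *: "(\<exists>e\<in>Z. {v, w} = f ` e) \<longleftrightarrow> (\<exists>a b. {a, b} \<in> Z \<and> v = f a \<and> w = f b)"
    if Z: "brauer_diagram m n Z" for Z m n and f :: "vertex \<Rightarrow> vertex"
  proof
    assume "\<exists>e\<in>Z. {v, w} = f ` e"
    then obtain e where e: "e \<in> Z" "{v, w} = f ` e" by blast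
    obtain a b where ab: "e = {a, b}" "a \<noteq> b" using brauer_edge[OF Z e(1)] .
    then have "v = f a \<and> w = f b \<or> v = f b \<and> w = f a" using e(2) by (auto simp: doubleton_eq_iff)
    then show "\<exists>a b. {a, b} \<in> Z \<and> v = f a \<and> w = f b" using ab e(1) by (metis insert_commute)
  next
    assume "\<exists>a b. {a, b} \<in> Z \<and> v = f a \<and> w = f b"
    then obtain a b where "{a, b} \<in> Z" "v = f a" "w = f b" by blast
    then show "\<exists>e\<in>Z. {v, w} = f ` e" by (intro bexI[of _ "{a, b}"]) auto
  qed
  show ?thesis unfolding stk_def Un_iff image_iff *[OF X] *[OF Y] ..
qed

lemma stk_edgeE:
  assumes "e \<in> G" obtains u v where "e = {u, v}" "u \<noteq> v"
proof -
  from assms consider f where "f \<in> X" "e = bot_to_mid ` f" | f where "f \<in> Y" "e = top_to_mid ` f"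
    by (auto simp: stk_def)
  then show ?thesis
  proof cases
    case 1
    obtain a b where ab: "f = {a, b}" "a \<noteq> b" using brauer_edge[OF X 1(1)] .
    then have "bot_to_mid a \<noteq> bot_to_mid b"
      using 1 brauer_vertex(2)[OF X, of a b] brauer_vertex(2)[OF X, of b a]
      by (simp add: bot_to_mid_inject insert_commute)
    then show ?thesis using that 1 ab by auto
  next
    case 2
    obtain a b where ab: "f = {a, b}" "a \<noteq> b" using brauer_edge[OF Y 2(1)] .
    then have "top_to_mid a \<noteq> top_to_mid b"
      using 2 brauer_vertex(2)[OF Y, of a b] brauer_vertex(2)[OF Y, of b a]
      by (simp add: top_to_mid_inject insert_commute)
    then show ?thesis using that 2 ab by auto
  qed
qed

lemma upper_unique:
  assumes "{a, b} \<in> X" "{a', b'} \<in> X" "bot_to_mid a = bot_to_mid a'"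
  shows "bot_to_mid b = bot_to_mid b'"
proof -
  have "a = a'" using assms brauer_vertex(2)[OF X] bot_to_mid_inject by metis
  then show ?thesis using assms brauer_unique[OF X] by metis
qed

lemma lower_unique:
  assumes "{a, b} \<in> Y" "{a', b'} \<in> Y" "top_to_mid a = top_to_mid a'"
  shows "top_to_mid b = top_to_mid b'"
proof -
  have "a = a'" using assms brauer_vertex(2)[OF Y] top_to_mid_inject by metis
  then show ?thesis using assms brauer_unique[OF Y] by metis
qed

lemma bot_to_mid_not_Bot: "bot_to_mid v \<noteq> Bot i" by (cases v) auto

lemma top_to_mid_not_Top: "top_to_mid v \<noteq> Top i" by (cases v) auto

lemma stk_edge_Top:
  assumes "{Top i, w} \<in> G" obtains b where "{Top i, b} \<in> X" "w = bot_to_mid b"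
proof -
  from assms obtain a b where ab: "{a, b} \<in> X" "Top i = bot_to_mid a" "w = bot_to_mid b"
    unfolding stk_edge using top_to_mid_not_Top by metis
  then have "a = Top i" using brauer_vertex(2)[OF X ab(1)] by (cases a) auto
  then show ?thesis using ab that by blast
qed

lemma stk_edge_Bot:
  assumes "{Bot i, w} \<in> G" obtains b where "{Bot i, b} \<in> Y" "w = top_to_mid b"
proof -
  from assms obtain a b where ab: "{a, b} \<in> Y" "Bot i = top_to_mid a" "w = top_to_mid b"
    unfolding stk_edge using bot_to_mid_not_Bot by metis
  then have "a = Bot i" using brauer_vertex(2)[OF Y ab(1)] by (cases a) auto
  then show ?thesis using ab that by blast
qed

text \<open>Each of the two diagrams contributes at most one edge at a vertex, so among three edges
  two come from the same diagram. An outer vertex meets only one of the diagrams.\<close>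

lemma thin_stk: "thin G" unfolding thin_def
proof (intro conjI allI impI)
  fix v a b c assume "{v, a} \<in> G" "{v, b} \<in> G" "{v, c} \<in> G"
  then show "a = b \<or> b = c \<or> a = c" unfolding stk_edge using upper_unique lower_unique by metis
next
  fix v a b assume v: "v \<in> outer" and e: "{v, a} \<in> G" "{v, b} \<in> G"
  from v show "a = b"
  proof (cases rule: outer_cases)
    case (1 i)
    then show ?thesis using e brauer_unique[OF X] by (metis stk_edge_Top)
  next
    case (2 i)
    then show ?thesis using e brauer_unique[OF Y] by (metis stk_edge_Bot)
  qed
qed

lemma stk_outer_vertex:
  assumes "v \<in> \<Union>G" "v \<in> outer" shows "v \<in> Top ` {1..r} \<union> Bot ` {1..t}"
proof -
  obtain e where "e \<in> G" "v \<in> e" using assms(1) by blast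
  then obtain w where w: "{v, w} \<in> G" by (metis stk_edgeE insertE insert_commute singletonD)
  from assms(2) show ?thesis
  proof (cases rule: outer_cases)
    case (1 i)
    then obtain b where "{Top i, b} \<in> X" using w stk_edge_Top by metis
    then show ?thesis using 1 brauer_vertex(1)[OF X] by blast
  next
    case (2 i)
    then obtain b where "{Bot i, b} \<in> Y" using w stk_edge_Bot by metis
    then show ?thesis using 2 brauer_vertex(1)[OF Y] by blast
  qed
qed

lemma finite_stk: "finite (\<Union>G)"
proof (rule finite_Union)
  show "finite G" using brauer_finite[OF X] brauer_finite[OF Y] by (simp add: stk_def)
  show "finite e" if "e \<in> G" for e using stk_edgeE[OF that] by (metis finite.emptyI finite.insertI)
qed

lemma finite_closed_loops: "finite (closed_loops G)"
proof -
  have "closed_loops G \<subseteq> (\<lambda>v. linked G `` {v}) ` \<Union>G" by (auto simp: closed_loops_def)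
  then show ?thesis using finite_stk finite_surj by blast
qed

text \<open>The component of such an edge contains an outer vertex, and the contracted graph, being
  a Brauer diagram, has an edge there, hence a strand. That the contraction is a Brauer diagram is a
  premise at this stage; it comes with every element of \<open>composites\<close>.\<close>

lemma edge_not_in_loop_on_strand:
  assumes cont: "brauer_diagram r t (contract_edges G)"
    and e: "e \<in> G" "\<not> e \<subseteq> \<Union>(closed_loops G)" shows "on_strand G e"
proof -
  obtain a b where ab: "e = {a, b}" "a \<noteq> b" using stk_edgeE[OF e(1)] .
  have "\<not> linked G `` {a} \<subseteq> range Mid"
  proof
    assume "linked G `` {a} \<subseteq> range Mid"
    moreover have "a \<in> \<Union>G" using e(1) ab by blast
    ultimately have "linked G `` {a} \<in> closed_loops G" unfolding closed_loops_def by blast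
    moreover have "{a, b} \<subseteq> linked G `` {a}" using linked_edge[of a b G] e(1) ab by auto
    ultimately show False using e(2) ab by blast
  qed
  then obtain u where u: "(a, u) \<in> linked G" "u \<in> outer" by (auto simp: outer_iff)
  have "u \<in> \<Union>G"
  proof (rule linked_closed[OF u(1)])
    show "a \<in> \<Union>G" using e(1) ab by blast
  qed blast
  then have "u \<in> Top ` {1..r} \<union> Bot ` {1..t}" using stk_outer_vertex u(2) by blast
  then obtain w where "{u, w} \<in> contract_edges G" using brauer_partner[OF cont] by metis
  then obtain p where p: "strand G p" "{u, w} = {hd p, last p}" by (auto simp: contract_edges_strand)
  have "p \<noteq> []" using p(1) by (auto simp: strand_def)
  then have "u \<in> set p" using p(2) by (metis doubleton_eq_iff hd_in_set last_in_set)
  then have "a \<in> set p" using strand_component[OF thin_stk p(1)] linked_sym[OF u(1)] by blast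
  then obtain i where i: "i + 1 < length p" "a = p ! i \<and> b = p ! (i + 1) \<or> b = p ! i \<and> a = p ! (i + 1)"
    using strand_edge_index[OF thin_stk p(1), of a b] e(1) ab by auto
  then have "e = {p ! i, p ! (i + 1)}" using ab by auto
  then show ?thesis using on_strandI[OF p(1) i(1)] by simp
qed

text \<open>Markings of both factors can share an edge of \<open>G\<close> only if an edge of
  \<open>X\<close> and an edge of \<open>Y\<close> coincide in the middle row. Such an edge is a
  whole loop with two vertices, and its markings are deleted before simplification starts.\<close>

lemma double_edge_in_loop:
  assumes "e \<in> X" "f \<in> Y" "bot_to_mid ` e = top_to_mid ` f"
  shows "bot_to_mid ` e \<subseteq> \<Union>(closed_loops G)"
proof -
  obtain a b where ab: "e = {a, b}" "a \<noteq> b" using brauer_edge[OF X assms(1)] .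
  obtain c d where cd: "f = {c, d}" "c \<noteq> d" using brauer_edge[OF Y assms(2)] .
  have out: "a \<in> outer" "b \<in> outer" "c \<in> outer" "d \<in> outer"
    using brauer_vertex(2)[OF X] brauer_vertex(2)[OF Y] assms ab cd by (metis insert_commute)+
  have "bot_to_mid x \<in> range Mid" if x: "x \<in> e" for x
  proof -
    obtain y where y: "y \<in> f" "bot_to_mid x = top_to_mid y" using x assms(3) by blast
    have "x \<in> outer" "y \<in> outer" using y x ab cd out by auto
    then show ?thesis using y(2) by (cases x; cases y) auto
  qed
  then have mid: "bot_to_mid a \<in> range Mid" "bot_to_mid b \<in> range Mid" using ab by auto
  have "top_to_mid c = bot_to_mid a \<and> top_to_mid d = bot_to_mid b \<or> top_to_mid c = bot_to_mid b \<and> top_to_mid d = bot_to_mid a"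
    using assms(3) ab cd by (auto simp: doubleton_eq_iff)
  then have Y: "\<exists>c d. {c, d} \<in> Y \<and> top_to_mid c = bot_to_mid a \<and> top_to_mid d = bot_to_mid b"
    using assms(2) cd by (metis insert_commute)
  then have Y': "\<exists>c d. {c, d} \<in> Y \<and> top_to_mid c = bot_to_mid b \<and> top_to_mid d = bot_to_mid a"
    by (metis insert_commute)
  have closed: "y \<in> {bot_to_mid a, bot_to_mid b}" if "{x, y} \<in> G" "x \<in> {bot_to_mid a, bot_to_mid b}" for x y
  proof -
    have "y = bot_to_mid b" if "{bot_to_mid a, y} \<in> G"
      using that Y upper_unique[of a b] lower_unique assms(1) ab unfolding stk_edge by metis
    moreover have "y = bot_to_mid a" if "{bot_to_mid b, y} \<in> G"
      using that Y' upper_unique[of b a] lower_unique assms(1) ab unfolding stk_edge by (metis insert_commute)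
    ultimately show ?thesis using that by blast
  qed
  have edge: "{bot_to_mid a, bot_to_mid b} \<in> G" using assms(1) ab unfolding stk_edge by blast
  have "linked G `` {bot_to_mid a} = {bot_to_mid a, bot_to_mid b}"
    using linked_closed[of "bot_to_mid a" _ G "{bot_to_mid a, bot_to_mid b}"] closed linked_edge[OF edge] by auto
  moreover have "bot_to_mid a \<in> \<Union>G" using edge by blast
  ultimately have "{bot_to_mid a, bot_to_mid b} \<in> closed_loops G" using mid unfolding closed_loops_def by blast
  then show ?thesis using ab by auto
qed

text \<open>Relabelling is injective on each diagram, and a clash between the two diagrams is
  excluded by \<open>double_edge_in_loop\<close>, since markings on loops are gone.\<close>

lemma start_ok:
  assumes ms: "(X, ms1) \<in> marked_brauer r s" "(Y, ms2) \<in> marked_brauer s t"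
    and cont: "brauer_diagram r t (contract_edges G)"
  shows "markings_ok G (delete_loop_markings G (stack_markings (X, ms1) (Y, ms2)))"
proof -
  define L where "L = \<Union>(closed_loops G)"
  define f where "f = (\<lambda>m. \<not> edge_of m \<subseteq> L)"
  have inG: "edge_of m \<in> G" if "m \<in> set (stack_markings (X, ms1) (Y, ms2))" for m
    using that marked_edge(1)[OF ms(1)] marked_edge(1)[OF ms(2)] by (auto simp: stk_def)
  have inj1: "inj_on (\<lambda>e. bot_to_mid ` e) X"
  proof (rule inj_onI)
    fix e f assume ef: "e \<in> X" "f \<in> X" "bot_to_mid ` e = bot_to_mid ` f"
    have "inj_on bot_to_mid outer" using bot_to_mid_inject by (auto intro: inj_onI)
    moreover have "e \<subseteq> outer" "f \<subseteq> outer" using ef brauer_outer[OF X] by auto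
    ultimately show "e = f" using ef(3) inj_on_image_eq_iff by metis
  qed
  have inj2: "inj_on (\<lambda>e. top_to_mid ` e) Y"
  proof (rule inj_onI)
    fix e f assume ef: "e \<in> Y" "f \<in> Y" "top_to_mid ` e = top_to_mid ` f"
    have "inj_on top_to_mid outer" using top_to_mid_inject by (auto intro: inj_onI)
    moreover have "e \<subseteq> outer" "f \<subseteq> outer" using ef brauer_outer[OF Y] by auto
    ultimately show "e = f" using ef(3) inj_on_image_eq_iff by metis
  qed
  have d1: "distinct (map edge_of (map (relabel bot_to_mid) ms1))"
  proof -
    have "map edge_of (map (relabel bot_to_mid) ms1) = map (\<lambda>e. bot_to_mid ` e) (map edge_of ms1)" by simp
    moreover have "inj_on (\<lambda>e. bot_to_mid ` e) (set (map edge_of ms1))"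
      using marked_edge(1)[OF ms(1)] by (intro inj_on_subset[OF inj1]) auto
    ultimately show ?thesis
      using ms(1) distinct_map[of "\<lambda>e. bot_to_mid ` e" "map edge_of ms1"] by (simp add: marked_brauer_def comp_def)
  qed
  have d2: "distinct (map edge_of (map (relabel top_to_mid) ms2))"
  proof -
    have "map edge_of (map (relabel top_to_mid) ms2) = map (\<lambda>e. top_to_mid ` e) (map edge_of ms2)" by simp
    moreover have "inj_on (\<lambda>e. top_to_mid ` e) (set (map edge_of ms2))"
      using marked_edge(1)[OF ms(2)] by (intro inj_on_subset[OF inj2]) auto
    ultimately show ?thesis
      using ms(2) distinct_map[of "\<lambda>e. top_to_mid ` e" "map edge_of ms2"] by (simp add: marked_brauer_def comp_def)
  qed
  have dist_filter: "distinct (map edge_of (filter f l))" if "distinct (map edge_of l)" for l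
    using that by (rule distinct_map_filter)
  have disj: "edge_of m \<noteq> edge_of m'" if m: "m \<in> set (filter f (map (relabel bot_to_mid) ms1))"
      "m' \<in> set (filter f (map (relabel top_to_mid) ms2))" for m m'
  proof
    assume eq: "edge_of m = edge_of m'"
    have "m \<in> relabel bot_to_mid ` set ms1" "m' \<in> relabel top_to_mid ` set ms2" "\<not> edge_of m \<subseteq> L"
      using m by (simp_all add: f_def)
    then obtain k k' where k: "k \<in> set ms1" "m = relabel bot_to_mid k" "k' \<in> set ms2" "m' = relabel top_to_mid k'" "\<not> edge_of m \<subseteq> L"
      by blast
    have "bot_to_mid ` edge_of k \<subseteq> L"
      unfolding L_def using marked_edge(1)[OF ms(1) k(1)] marked_edge(1)[OF ms(2) k(3)] eq k
      by (intro double_edge_in_loop) auto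
    then show False using k by simp
  qed
  have eq: "delete_loop_markings G (stack_markings (X, ms1) (Y, ms2)) =
      filter f (map (relabel bot_to_mid) ms1) @ filter f (map (relabel top_to_mid) ms2)"
    unfolding delete_loop_markings_def f_def L_def by simp
  have "distinct (map edge_of (delete_loop_markings G (stack_markings (X, ms1) (Y, ms2))))"
  proof -
    have "edge_of ` set (filter f (map (relabel bot_to_mid) ms1)) \<inter> edge_of ` set (filter f (map (relabel top_to_mid) ms2)) = {}"
      using disj by blast
    then show ?thesis
      unfolding eq map_append distinct_append set_map using dist_filter[OF d1] dist_filter[OF d2] by (simp only: simp_thms)
  qed
  moreover have "on_strand G (edge_of m)" if "m \<in> set (delete_loop_markings G (stack_markings (X, ms1) (Y, ms2)))" for m
  proof -
    have "m \<in> set (stack_markings (X, ms1) (Y, ms2))" "\<not> edge_of m \<subseteq> \<Union>(closed_loops G)"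
      using that by (simp_all add: delete_loop_markings_def del: stack_markings.simps)
    then show ?thesis using edge_not_in_loop_on_strand[OF cont inG] by blast
  qed
  ultimately show ?thesis by (simp add: markings_ok_def[OF thin_stk finite_stk])
qed

end

text \<open>The coordinates that the composite must have by invariance of the sign. The formula
  makes sense for every pair, before any complete simplification is known to exist.\<close>

definition cval :: "'k::field \<Rightarrow> 'k \<Rightarrow> mdiagram \<Rightarrow> mdiagram \<Rightarrow> 'k coords" where
  "cval \<delta> \<epsilon> D1 D2 = (let G = stack_edges D1 D2 in single (contract_edges G)
     (\<delta> ^ card (closed_loops G) * msign \<epsilon> (edge_key G) (along G) (delete_loop_markings G (stack_markings D1 D2))))"

lemma composites_brauer:
  assumes "z \<in> composites \<delta> \<epsilon> r t D1 D2"
  shows "brauer_diagram r t (contract_edges (stk (fst D1) (fst D2)))"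
  using assms by (auto simp: composites_def marked_brauer_def stack_edges_stk)

text \<open>All complete simplifications of a stack agree in the quotient: by invariance only the
  sign of the starting list matters.\<close>

lemma composites_nf:
  fixes \<epsilon> :: "'k::field" assumes eps: "\<epsilon> * \<epsilon> = 1" and D: "D1 \<in> marked_brauer r s" "D2 \<in> marked_brauer s t"
    and z: "z \<in> composites \<delta> \<epsilon> r t D1 D2" shows "nf \<epsilon> z = cval \<delta> \<epsilon> D1 D2"
proof -
  obtain X ms1 Y ms2 where D12: "D1 = (X, ms1)" "D2 = (Y, ms2)" by (cases D1; cases D2)
  interpret stacked r s t X Y using D by unfold_locales (auto simp: D12 marked_brauer_def)
  obtain c ms ms' where z': "z = single (contract_edges G, ms') c"
    "simplifies \<delta> \<epsilon> G (stack_markings D1 D2) c ms"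
    "list_all2 (contract_marking G) ms ms'" "(contract_edges G, ms') \<in> marked_brauer r t"
    using z unfolding composites_def by (auto simp: D12 stk_def)
  have ok: "markings_ok G (delete_loop_markings G (stack_markings D1 D2))"
    using start_ok[of ms1 ms2] D composites_brauer[OF z] by (simp add: D12 del: stack_markings.simps)
  have "c * msign \<epsilon> (edge_key G) (along G) ms = \<delta> ^ card (closed_loops G) *
      msign \<epsilon> (edge_key G) (along G) (delete_loop_markings G (stack_markings D1 D2))"
    using simp_steps_sign[OF thin_stk finite_stk eps z'(2)] ok by simp
  moreover have "msign \<epsilon> (edge_key G) (along G) ms = msign \<epsilon> key0 fw0 ms'"
    using contract_sign[OF thin_stk finite_stk z'(3)] z'(4) by (simp add: marked_brauer_def)
  ultimately show ?thesis
    unfolding z'(1) cval_def Let_def by (simp add: dvec_def stack_edges_stk D12 del: stack_edges.simps stack_markings.simps)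
qed

text \<open>Without closed loops no marking is deleted, and the step changes the sign of the whole
  list. With loops the step may disappear together with deleted markings; then the statement
  survives because \<epsilon> = 1 or the power of \<delta> vanishes.\<close>

lemma cval_mstep:
  fixes \<delta> \<epsilon> :: "'k::field" assumes param: "\<epsilon> = 1 \<or> \<delta> = 0 \<and> \<epsilon> * \<epsilon> = 1"
    and ms: "(X, ms1) \<in> marked_brauer r s" "(Y, ms2) \<in> marked_brauer s t"
    and cont: "brauer_diagram r t (contract_edges (stk X Y))"
    and step: "mstep (stack_markings (X, ms1) (Y, ms2)) (stack_markings (X, ms1') (Y, ms2'))"
  shows "cval \<delta> \<epsilon> (X, ms1') (Y, ms2') = scale \<epsilon> (cval \<delta> \<epsilon> (X, ms1) (Y, ms2))"
proof -
  interpret stacked r s t X Y using ms by unfold_locales (auto simp: marked_brauer_def)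
  let ?L = "stack_markings (X, ms1) (Y, ms2)" and ?L' = "stack_markings (X, ms1') (Y, ms2')"
  let ?del = "delete_loop_markings G"
  have eps: "\<epsilon> * \<epsilon> = 1" using param by auto
  have "\<delta> ^ card (closed_loops G) * msign \<epsilon> (edge_key G) (along G) (?del ?L') =
    \<epsilon> * (\<delta> ^ card (closed_loops G) * msign \<epsilon> (edge_key G) (along G) (?del ?L))"
  proof (cases "closed_loops G = {}")
    case True
    have ok: "markings_ok G (?del ?L)" by (rule start_ok[OF ms cont])
    have "?del ?L = ?L" "?del ?L' = ?L'"
    proof -
      have "filter (\<lambda>m. \<not> edge_of m \<subseteq> \<Union>{}) l = l" if "\<And>m. m \<in> set l \<Longrightarrow> edge_of m \<noteq> {}" for l
        using that by (simp add: filter_id_conv)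
      moreover have "edge_of m \<noteq> {}" if "m \<in> set ?L" for m
      proof -
        have "edge_of m \<in> G"
          using that marked_edge(1)[OF ms(1)] marked_edge(1)[OF ms(2)] by (auto simp: stk_def)
        then show ?thesis by (metis insert_not_empty stk_edgeE)
      qed
      moreover have "set (map edge_of ?L') = set (map edge_of ?L)"
      proof -
        have "snd ` set (map kind ?L) = snd ` set (map kind ?L')"
          using mset_kind_mstep[OF step] by (metis set_mset_mset)
        then show ?thesis by (simp only: set_map image_image snd_kind)
      qed
      then have "edge_of m \<noteq> {}" if "m \<in> set ?L'" for m
        using that \<open>\<And>m. m \<in> set ?L \<Longrightarrow> edge_of m \<noteq> {}\<close> unfolding set_map by (metis imageE imageI)
      ultimately show "?del ?L = ?L" "?del ?L' = ?L'" unfolding delete_loop_markings_def True by blast+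
    qed
    moreover have "msign \<epsilon> (edge_key G) (along G) ?L' = \<epsilon> * msign \<epsilon> (edge_key G) (along G) ?L"
    proof (rule msign_mstep[OF eps step])
      have ok': "distinct (map edge_of ?L)" "\<And>m. m \<in> set ?L \<Longrightarrow> on_strand G (edge_of m)"
        using ok \<open>?del ?L = ?L\<close> by (simp_all only: markings_ok_def[OF thin_stk finite_stk])
      show "distinct (map edge_of ?L)" by (rule ok'(1))
      show "edge_key G (edge_of a) \<noteq> edge_key G (edge_of b)" if "a \<in> set ?L" "b \<in> set ?L" "edge_of a \<noteq> edge_of b" for a b
        using that edge_key_inject[OF thin_stk finite_stk ok'(2)[OF that(1)] ok'(2)[OF that(2)]] by simp
      show "along G u v \<longleftrightarrow> \<not> along G v u" if "Arrow u v \<in> set ?L" for u v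
        using along_not_sym[OF thin_stk finite_stk] ok'(2)[OF that] by simp
    qed
    ultimately show ?thesis by (simp del: stack_markings.simps)
  next
    case False
    then have "0 < card (closed_loops G)" using finite_closed_loops by (simp add: card_gt_0_iff)
    then show ?thesis using param by (auto simp: msign_one simp del: stack_markings.simps)
  qed
  then show ?thesis unfolding cval_def Let_def stack_edges_stk fst_conv scale_single by (rule arg_cong)
qed

section \<open>Surgery on strands\<close>

text \<open>Each outer vertex is an end of a single strand up to reversal, so contracted edges that
  already meet every outer vertex leave no room for others.\<close>

lemma contract_edges_eqI:
  assumes thin: "thin G" and Z: "Z \<subseteq> contract_edges G"
    and cover: "\<And>v. v \<in> \<Union>G \<Longrightarrow> v \<in> outer \<Longrightarrow> \<exists>w. {v, w} \<in> Z" shows "contract_edges G = Z"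
proof (intro equalityI subsetI)
  fix e assume "e \<in> contract_edges G"
  then obtain p where p: "strand G p" "e = {hd p, last p}" by (auto simp: contract_edges_strand)
  have "hd p \<in> \<Union>G" using p(1) strand_path_edge[of G p 0] strand_hd_nth(1)[OF p(1)] by (auto simp: strand_def)
  then obtain w where w: "{hd p, w} \<in> Z" using cover p(1) by (auto simp: strand_def)
  then obtain q where q: "strand G q" "{hd p, w} = {hd q, last q}" using Z by (auto simp: contract_edges_strand)
  have ne: "q \<noteq> []" using q(1) by (auto simp: strand_def)
  from q(2) have "hd p = hd q \<and> w = last q \<or> hd p = last q \<and> w = hd q" by (auto simp: doubleton_eq_iff)
  then have "last p = w"
  proof
    assume "hd p = hd q \<and> w = last q"
    then show ?thesis using strand_unique[OF thin p(1) q(1)] by simp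
  next
    assume *: "hd p = last q \<and> w = hd q"
    then have "p = rev q" using ne by (intro strand_unique[OF thin p(1) strand_rev[OF q(1)]]) (simp add: hd_rev)
    then show ?thesis using * ne by (simp add: last_rev)
  qed
  then show "e \<in> Z" using w p(2) by simp
qed (use Z in blast)

lemma linked_class:
  assumes "(u, v) \<in> linked G" shows "linked G `` {u} = linked G `` {v}"
proof (intro equalityI subsetI)
  fix w assume "w \<in> linked G `` {u}"
  then show "w \<in> linked G `` {v}" using linked_trans[OF linked_sym[OF assms], of w] by simp
next
  fix w assume "w \<in> linked G `` {v}"
  then show "w \<in> linked G `` {u}" using linked_trans[OF assms, of w] by simp
qed

text \<open>Think of \<open>G\<close> as a stack whose upper diagram has through strings from the
  top vertices \<open>\<alpha>\<close> and \<open>\<beta>\<close> to the middle vertices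
  \<open>\<gamma>\<close> and \<open>\<eta>\<close>. In \<open>H\<close> they are replaced by the
  cup \<open>{\<alpha>, \<beta>}\<close> and by the cap \<open>{\<gamma>, \<eta>}\<close> in the
  middle row; all other edges form \<open>R\<close>.\<close>

locale surgery =
  fixes R :: "vertex set set" and \<alpha> \<beta> \<gamma> \<eta> :: vertex
  assumes out: "\<alpha> \<in> outer" "\<beta> \<in> outer" and mid: "\<gamma> \<notin> outer" "\<eta> \<notin> outer"
    and neq: "\<alpha> \<noteq> \<beta>" "\<gamma> \<noteq> \<eta>" and fresh: "\<alpha> \<notin> \<Union>R" "\<beta> \<notin> \<Union>R" and thinG: "thin (insert {\<alpha>, \<gamma>} (insert {\<beta>, \<eta>} R))"
begin

definition "G = insert {\<alpha>, \<gamma>} (insert {\<beta>, \<eta>} R)"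
definition "H = insert {\<alpha>, \<beta>} (insert {\<gamma>, \<eta>} R)"

lemma thin_G: "thin G" using thinG by (simp add: G_def)

lemma R_sub: "R \<subseteq> G" "R \<subseteq> H" by (auto simp: G_def H_def)

lemma neqs: "\<alpha> \<noteq> \<gamma>" "\<alpha> \<noteq> \<eta>" "\<beta> \<noteq> \<gamma>" "\<beta> \<noteq> \<eta>" using out mid by auto

lemma edges_G: "{\<alpha>, \<gamma>} \<in> G" "{\<beta>, \<eta>} \<in> G" and edges_H: "{\<alpha>, \<beta>} \<in> H" "{\<gamma>, \<eta>} \<in> H" by (auto simp: G_def H_def)

lemma not_R: "{\<alpha>, w} \<notin> R" "{w, \<alpha>} \<notin> R" "{\<beta>, w} \<notin> R" "{w, \<beta>} \<notin> R" using fresh by blast+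

lemma G_edge: "{v, w} \<in> G \<Longrightarrow> v \<noteq> \<alpha> \<Longrightarrow> v \<noteq> \<beta> \<Longrightarrow> w \<noteq> \<alpha> \<Longrightarrow> w \<noteq> \<beta> \<Longrightarrow> {v, w} \<in> R"
  unfolding G_def by (auto simp: doubleton_eq_iff)

lemma G_alpha: "{\<alpha>, w} \<in> G \<Longrightarrow> w = \<gamma>" and G_beta: "{\<beta>, w} \<in> G \<Longrightarrow> w = \<eta>"
  unfolding G_def using not_R neq neqs by (auto simp: doubleton_eq_iff)

lemma H_edge: "{v, w} \<in> H \<Longrightarrow> {v, w} \<in> R \<or> v = \<alpha> \<and> w = \<beta> \<or> v = \<beta> \<and> w = \<alpha> \<or> v = \<gamma> \<and> w = \<eta> \<or> v = \<eta> \<and> w = \<gamma>"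
  unfolding H_def by (auto simp: doubleton_eq_iff)

lemma R_gamma: "{\<gamma>, x} \<in> R \<Longrightarrow> {\<gamma>, y} \<in> R \<Longrightarrow> x = y"
  using thin_degree[OF thin_G, of \<gamma> \<alpha> x y] edges_G R_sub not_R by (metis insert_commute subsetD)

lemma R_eta: "{\<eta>, x} \<in> R \<Longrightarrow> {\<eta>, y} \<in> R \<Longrightarrow> x = y"
  using thin_degree[OF thin_G, of \<eta> \<beta> x y] edges_G R_sub not_R by (metis insert_commute subsetD)

lemma thin_H: "thin H" unfolding thin_def
proof (intro conjI allI impI)
  fix v a b c assume e: "{v, a} \<in> H" "{v, b} \<in> H" "{v, c} \<in> H"
  consider "v = \<alpha>" | "v = \<beta>" | "v = \<gamma>" | "v = \<eta>" | "v \<noteq> \<alpha>" "v \<noteq> \<beta>" "v \<noteq> \<gamma>" "v \<noteq> \<eta>" by blast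
  then show "a = b \<or> b = c \<or> a = c"
  proof cases
    case 1
    then show ?thesis using e[THEN H_edge] not_R neq neqs by blast
  next
    case 2
    then show ?thesis using e[THEN H_edge] not_R neq neqs by blast
  next
    case 3
    then show ?thesis using e[THEN H_edge] neq neqs R_gamma by metis
  next
    case 4
    then show ?thesis using e[THEN H_edge] neq neqs R_eta by metis
  next
    case 5
    then have "{v, a} \<in> G" "{v, b} \<in> G" "{v, c} \<in> G" using e[THEN H_edge] R_sub by blast+
    then show ?thesis by (rule thin_degree[OF thin_G])
  qed
next
  fix v a b assume v: "v \<in> outer" and e: "{v, a} \<in> H" "{v, b} \<in> H"
  have "v \<noteq> \<gamma>" "v \<noteq> \<eta>" using v mid by auto
  then consider "v = \<alpha>" | "v = \<beta>" | "{v, a} \<in> R" "{v, b} \<in> R" using e[THEN H_edge] by blast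
  then show "a = b"
  proof cases
    case 1
    then show ?thesis using e[THEN H_edge] not_R neq neqs by blast
  next
    case 2
    then show ?thesis using e[THEN H_edge] not_R neq neqs by blast
  next
    case 3
    then show ?thesis using thin_outer[OF thin_G v] R_sub by blast
  qed
qed

lemma path_R:
  assumes "strand_path G p" "\<alpha> \<notin> set p" "\<beta> \<notin> set p" shows "strand_path R p"
  unfolding strand_path_nth
proof (intro conjI allI impI)
  show "distinct p" using assms by (simp add: strand_path_def)
  fix i assume i: "i + 1 < length p"
  then have "p ! i \<in> set p" "p ! (i + 1) \<in> set p" by auto
  then show "{p ! i, p ! (i + 1)} \<in> R" using strand_path_edge[OF assms(1) i] G_edge assms by metis
qed

lemma path_H: "strand_path R p \<Longrightarrow> strand_path H p" using strand_path_mono R_sub by blast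

text \<open>The vertices \<open>\<alpha>\<close> and \<open>\<beta>\<close> are outer, so they could
  only be ends of the path, but both end edges lie in \<open>R\<close>.\<close>

lemma facing_path:
  assumes "facing G ms u v e" "{u, v} \<in> R" "e \<in> R"
  obtains p where "strand_path R p" "length p \<ge> 3" "p ! 0 = u" "p ! 1 = v"
    "e = {p ! (length p - 2), p ! (length p - 1)}"
    "\<And>i m. 0 < i \<Longrightarrow> i + 2 < length p \<Longrightarrow> m \<in> set ms \<Longrightarrow> edge_of m \<noteq> {p ! i, p ! (i + 1)}"
proof -
  from assms(1) obtain p where p: "strand_path G p" "length p \<ge> 3" "p ! 0 = u" "p ! 1 = v"
    "e = {p ! (length p - 2), p ! (length p - 1)}"
    "\<And>i m. 0 < i \<Longrightarrow> i + 2 < length p \<Longrightarrow> m \<in> set ms \<Longrightarrow> edge_of m \<noteq> {p ! i, p ! (i + 1)}"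
    unfolding facing_def by blast
  have *: "w \<notin> set p" if w: "w \<in> outer" "w \<notin> \<Union>R" for w
  proof
    assume "w \<in> set p"
    then obtain i where i: "i < length p" "w = p ! i" by (auto simp: in_set_conv_nth)
    then have "i = 0 \<or> i = length p - 1" using strand_outer_index[OF thin_G p(1) i(1)] w by auto
    then have "w \<in> {u, v} \<or> w \<in> e" using i p by auto
    then show False using assms(2,3) w by blast
  qed
  then have "strand_path R p" using path_R[OF p(1)] out fresh by blast
  then show ?thesis using that p by blast
qed

lemma facing_H:
  assumes "facing G ms u v e" "{u, v} \<in> R" "e \<in> R"
    and ms': "\<And>m. m \<in> set ms' \<Longrightarrow> m \<in> set ms \<or> edge_of m \<notin> R" shows "facing H ms' u v e"
proof -
  from facing_path[OF assms(1-3)] obtain p where p: "strand_path R p" "length p \<ge> 3" "p ! 0 = u" "p ! 1 = v"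
    "e = {p ! (length p - 2), p ! (length p - 1)}"
    "\<And>i m. 0 < i \<Longrightarrow> i + 2 < length p \<Longrightarrow> m \<in> set ms \<Longrightarrow> edge_of m \<noteq> {p ! i, p ! (i + 1)}" by metis
  have "edge_of m \<noteq> {p ! i, p ! (i + 1)}" if "0 < i" "i + 2 < length p" "m \<in> set ms'" for i m
    using ms'[OF that(3)] p(6)[OF that(1,2)] strand_path_edge[OF p(1), of i] that by auto
  then show ?thesis unfolding facing_def using p path_H[OF p(1)] by blast
qed

text \<open>As long as all markings sit on edges of \<open>R\<close>, the paths used by the rules
  run inside \<open>R\<close>. A step in \<open>G\<close> can therefore be replayed in
  \<open>H\<close>, below markings \<open>pre\<close> on edges outside \<open>R\<close>, which do
  not block such a path.\<close>

lemma simp_step_H: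
  assumes "simp_step \<epsilon> G s s'" and inR: "\<And>m. m \<in> set (snd s) \<Longrightarrow> edge_of m \<in> R"
    and pre: "\<And>m. m \<in> set pre \<Longrightarrow> edge_of m \<notin> R"
  shows "simp_step \<epsilon> H (fst s, pre @ snd s) (fst s', pre @ snd s') \<and> (\<forall>m\<in>set (snd s'). edge_of m \<in> R)"
  using assms(1)
proof cases
  case (interchange c xs a b ys)
  then show ?thesis using simp_step.interchange[of \<epsilon> H c "pre @ xs" a b ys] inR by auto
next
  case (arrow_above_toward xs ys u v e c)
  have *: "{u, v} \<in> R" "e \<in> R"
    using inR[of "Arrow u v"] inR[of "Bead e"] arrow_above_toward(1) by (simp_all add: insert_commute)
  have "facing H ((pre @ xs) @ ys) u v e" by (rule facing_H[OF arrow_above_toward(3) *]) (use pre in auto)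
  then show ?thesis
    using simp_step.arrow_above_toward[of H "pre @ xs" ys u v e \<epsilon> c] inR arrow_above_toward by auto
next
  case (arrow_above_away xs ys u v e c)
  have *: "{u, v} \<in> R" "e \<in> R"
    using inR[of "Arrow v u"] inR[of "Bead e"] arrow_above_away(1) by (simp_all add: insert_commute)
  have "facing H ((pre @ xs) @ ys) u v e" by (rule facing_H[OF arrow_above_away(3) *]) (use pre in auto)
  then show ?thesis using simp_step.arrow_above_away[of H "pre @ xs" ys u v e \<epsilon> c] inR arrow_above_away by auto
next
  case (bead_above_away xs ys u v e c)
  have *: "{u, v} \<in> R" "e \<in> R"
    using inR[of "Arrow v u"] inR[of "Bead e"] bead_above_away(1) by (simp_all add: insert_commute)
  have "facing H ((pre @ xs) @ ys) u v e" by (rule facing_H[OF bead_above_away(3) *]) (use pre in auto)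
  then show ?thesis using simp_step.bead_above_away[of H "pre @ xs" ys u v e \<epsilon> c] inR bead_above_away by auto
next
  case (bead_above_toward xs ys u v e c)
  have *: "{u, v} \<in> R" "e \<in> R"
    using inR[of "Arrow u v"] inR[of "Bead e"] bead_above_toward(1) by (simp_all add: insert_commute)
  have "facing H ((pre @ xs) @ ys) u v e" by (rule facing_H[OF bead_above_toward(3) *]) (use pre in auto)
  then show ?thesis
    using simp_step.bead_above_toward[of H "pre @ xs" ys u v e \<epsilon> c] inR bead_above_toward by auto
qed

lemma simp_steps_H:
  assumes "(simp_step \<epsilon> G)\<^sup>*\<^sup>* s s'" and inR: "\<And>m. m \<in> set (snd s) \<Longrightarrow> edge_of m \<in> R"
    and pre: "\<And>m. m \<in> set pre \<Longrightarrow> edge_of m \<notin> R"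
  shows "(simp_step \<epsilon> H)\<^sup>*\<^sup>* (fst s, pre @ snd s) (fst s', pre @ snd s') \<and> (\<forall>m\<in>set (snd s'). edge_of m \<in> R)"
  using assms(1)
proof (induction rule: rtranclp_induct)
  case (step s' s'')
  then have IH: "(simp_step \<epsilon> H)\<^sup>*\<^sup>* (fst s, pre @ snd s) (fst s', pre @ snd s')" "\<And>m. m \<in> set (snd s') \<Longrightarrow> edge_of m \<in> R"
    by auto
  have "simp_step \<epsilon> H (fst s', pre @ snd s') (fst s'', pre @ snd s'') \<and> (\<forall>m\<in>set (snd s''). edge_of m \<in> R)"
    by (rule simp_step_H[OF step.hyps(2) IH(2) pre])
  then show ?case using IH(1) rtranclp.rtrancl_into_rtrancl by metis
qed (use inR in simp)

text \<open>The replay when the markings in \<open>W\<close>, the future closed loop, are deleted.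
  Facing edges are joined by a path in \<open>R\<close>, so a bead and its arrow lie both inside or
  both outside \<open>W\<close>. An interchange with a deleted marking leaves no trace; the
  condition on \<open>d\<close> allows its sign to be dropped.\<close>

lemma simp_step_H_filter:
  assumes "simp_step \<epsilon> G s s'" and inR: "\<And>m. m \<in> set (snd s) \<Longrightarrow> edge_of m \<in> R"
    and pre: "\<And>m. m \<in> set pre \<Longrightarrow> edge_of m \<notin> R" and W: "\<And>x y. {x, y} \<in> R \<Longrightarrow> x \<in> W \<Longrightarrow> y \<in> W" and d: "\<epsilon> * d = d"
  shows "(simp_step \<epsilon> H)\<^sup>*\<^sup>* (d, pre @ filter (\<lambda>m. \<not> edge_of m \<subseteq> W) (snd s))
     (d, pre @ filter (\<lambda>m. \<not> edge_of m \<subseteq> W) (snd s')) \<and> (\<forall>m\<in>set (snd s'). edge_of m \<in> R)"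
proof -
  let ?f = "filter (\<lambda>m. \<not> edge_of m \<subseteq> W)"
  have both: "({u, v} \<subseteq> W \<longleftrightarrow> e \<subseteq> W) \<and> facing H ((pre @ ?f xs) @ ?f ys) u v e"
    if fac: "facing G (xs @ ys) u v e" and R: "{u, v} \<in> R" "e \<in> R" for xs ys u v e
  proof -
    obtain p where p: "strand_path R p" "length p \<ge> 3" "p ! 0 = u" "p ! 1 = v"
      "e = {p ! (length p - 2), p ! (length p - 1)}" using facing_path[OF fac R] by metis
    have iff: "x \<in> W \<longleftrightarrow> y \<in> W" if "x \<in> set p" "y \<in> set p" for x y
      using linked_closed[of x y R W] linked_closed[of y x R W] strand_path_linked[OF p(1)] that W by blast
    have mem: "u \<in> set p" "v \<in> set p" "p ! (length p - 2) \<in> set p" "p ! (length p - 1) \<in> set p"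
    proof -
      have "0 < length p" "1 < length p" "length p - 2 < length p" "length p - 1 < length p"
        using p(2) by linarith+
      then show "u \<in> set p" "v \<in> set p" "p ! (length p - 2) \<in> set p" "p ! (length p - 1) \<in> set p"
        using p(3,4) nth_mem by metis+
    qed
    have "{u, v} \<subseteq> W \<longleftrightarrow> u \<in> W" using iff[OF mem(1,2)] by simp
    moreover have "e \<subseteq> W \<longleftrightarrow> p ! (length p - 2) \<in> W" unfolding p(5) using iff[OF mem(3,4)] by simp
    ultimately have "{u, v} \<subseteq> W \<longleftrightarrow> e \<subseteq> W" using iff[OF mem(1,3)] by simp
    moreover have "facing H ((pre @ ?f xs) @ ?f ys) u v e" using pre by (intro facing_H[OF fac R]) auto
    ultimately show ?thesis ..
  qed
  show ?thesis using assms(1)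
  proof cases
    case (interchange c xs a b ys)
    have "(simp_step \<epsilon> H)\<^sup>*\<^sup>* (d, pre @ ?f (xs @ a # b # ys)) (d, pre @ ?f (xs @ b # a # ys))"
      using simp_step.interchange[of \<epsilon> H d "pre @ ?f xs" a b "?f ys"] d by auto
    then show ?thesis using interchange inR by auto
  next
    case (arrow_above_toward xs ys u v e c)
    have "{u, v} \<in> R" "e \<in> R"
      using inR[of "Arrow u v"] inR[of "Bead e"] arrow_above_toward(1) by (simp_all add: insert_commute)
    note * = both[OF arrow_above_toward(3) this]
    show ?thesis
      using simp_step.arrow_above_toward[of H "pre @ ?f xs" "?f ys" u v e \<epsilon> d] inR arrow_above_toward * by auto
  next
    case (arrow_above_away xs ys u v e c)
    have "{u, v} \<in> R" "e \<in> R"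
      using inR[of "Arrow v u"] inR[of "Bead e"] arrow_above_away(1) by (simp_all add: insert_commute)
    note * = both[OF arrow_above_away(3) this]
    show ?thesis
      using simp_step.arrow_above_away[of H "pre @ ?f xs" "?f ys" u v e \<epsilon> d] inR arrow_above_away * d by auto
  next
    case (bead_above_away xs ys u v e c)
    have "{u, v} \<in> R" "e \<in> R"
      using inR[of "Arrow v u"] inR[of "Bead e"] bead_above_away(1) by (simp_all add: insert_commute)
    note * = both[OF bead_above_away(3) this]
    show ?thesis
      using simp_step.bead_above_away[of H "pre @ ?f xs" "?f ys" u v e \<epsilon> d] inR bead_above_away * by auto
  next
    case (bead_above_toward xs ys u v e c)
    have "{u, v} \<in> R" "e \<in> R"
      using inR[of "Arrow u v"] inR[of "Bead e"] bead_above_toward(1) by (simp_all add: insert_commute)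
    note * = both[OF bead_above_toward(3) this]
    show ?thesis
      using simp_step.bead_above_toward[of H "pre @ ?f xs" "?f ys" u v e \<epsilon> d] inR bead_above_toward * d by auto
  qed
qed

lemma simp_steps_H_filter:
  assumes "(simp_step \<epsilon> G)\<^sup>*\<^sup>* s s'" and inR: "\<And>m. m \<in> set (snd s) \<Longrightarrow> edge_of m \<in> R"
    and pre: "\<And>m. m \<in> set pre \<Longrightarrow> edge_of m \<notin> R" and W: "\<And>x y. {x, y} \<in> R \<Longrightarrow> x \<in> W \<Longrightarrow> y \<in> W" and d: "\<epsilon> * d = d"
  shows "(simp_step \<epsilon> H)\<^sup>*\<^sup>* (d, pre @ filter (\<lambda>m. \<not> edge_of m \<subseteq> W) (snd s))
     (d, pre @ filter (\<lambda>m. \<not> edge_of m \<subseteq> W) (snd s')) \<and> (\<forall>m\<in>set (snd s'). edge_of m \<in> R)" using assms(1)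
proof (induction rule: rtranclp_induct)
  case (step s' s'')
  then have IH: "(simp_step \<epsilon> H)\<^sup>*\<^sup>* (d, pre @ filter (\<lambda>m. \<not> edge_of m \<subseteq> W) (snd s))
      (d, pre @ filter (\<lambda>m. \<not> edge_of m \<subseteq> W) (snd s'))" "\<And>m. m \<in> set (snd s') \<Longrightarrow> edge_of m \<in> R" by auto
  have "(simp_step \<epsilon> H)\<^sup>*\<^sup>* (d, pre @ filter (\<lambda>m. \<not> edge_of m \<subseteq> W) (snd s'))
      (d, pre @ filter (\<lambda>m. \<not> edge_of m \<subseteq> W) (snd s'')) \<and> (\<forall>m\<in>set (snd s''). edge_of m \<in> R)"
    by (rule simp_step_H_filter[OF step.hyps(2) IH(2) pre W d])
  then show ?case by (elim conjE, intro conjI rtranclp_trans[OF IH(1)])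
qed (use inR in simp)

text \<open>The loops away from the surgery, described in \<open>R\<close> alone. They are all the
  loops of \<open>G\<close>, since there \<open>\<gamma>\<close> and \<open>\<eta>\<close> hang on
  outer vertices, and all the loops of \<open>H\<close> except possibly one through
  \<open>{\<gamma>, \<eta>}\<close>.\<close>

definition "loopsR = {C. \<exists>v\<in>\<Union>R. C = linked R `` {v} \<and> C \<subseteq> range Mid \<and> \<gamma> \<notin> C \<and> \<eta> \<notin> C}"

lemma linked_R_eq:
  assumes "\<alpha> \<notin> linked R `` {v}" "\<beta> \<notin> linked R `` {v}" "\<gamma> \<notin> linked R `` {v}" "\<eta> \<notin> linked R `` {v}"
  shows "linked G `` {v} = linked R `` {v}" "linked H `` {v} = linked R `` {v}"
proof -
  have step: "y \<in> linked R `` {v}" if "{x, y} \<in> R" "x \<in> linked R `` {v}" for x y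
    using that linked_trans linked_edge by (meson Image_singleton_iff)
  have "y \<in> linked R `` {v}" if "{x, y} \<in> G" "x \<in> linked R `` {v}" for x y
  proof -
    have "{x, y} \<in> R" using that assms unfolding G_def by (auto simp: doubleton_eq_iff)
    then show ?thesis using step that by blast
  qed
  then have "linked G `` {v} \<subseteq> linked R `` {v}" using linked_closed[of v _ G "linked R `` {v}"] by auto
  then show "linked G `` {v} = linked R `` {v}" using linked_mono[OF R_sub(1)] by blast
  have "y \<in> linked R `` {v}" if "{x, y} \<in> H" "x \<in> linked R `` {v}" for x y
  proof -
    have "{x, y} \<in> R" using that assms unfolding H_def by (auto simp: doubleton_eq_iff)
    then show ?thesis using step that by blast
  qed
  then have "linked H `` {v} \<subseteq> linked R `` {v}" using linked_closed[of v _ H "linked R `` {v}"] by auto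
  then show "linked H `` {v} = linked R `` {v}" using linked_mono[OF R_sub(2)] by blast
qed

lemma mid_outer: "C \<subseteq> range Mid \<Longrightarrow> \<alpha> \<notin> C \<and> \<beta> \<notin> C" using out by (auto simp: outer_iff)

lemma loopsR_sub: "loopsR \<subseteq> closed_loops G" "loopsR \<subseteq> closed_loops H"
proof -
  have "C \<in> closed_loops G \<and> C \<in> closed_loops H" if C: "C \<in> loopsR" for C
  proof -
    obtain v where v: "v \<in> \<Union>R" "C = linked R `` {v}" "C \<subseteq> range Mid" "\<gamma> \<notin> C" "\<eta> \<notin> C"
      using C unfolding loopsR_def by blast
    then have "linked G `` {v} = C" "linked H `` {v} = C" using linked_R_eq[of v] mid_outer[OF v(3)] by auto
    moreover have "v \<in> \<Union>G" "v \<in> \<Union>H" using v(1) R_sub by blast+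
    ultimately show ?thesis using v(3) unfolding closed_loops_def by blast
  qed
  then show "loopsR \<subseteq> closed_loops G" "loopsR \<subseteq> closed_loops H" by blast+
qed

lemma closed_loops_G: "closed_loops G = loopsR"
proof (intro equalityI subsetI)
  fix C assume "C \<in> closed_loops G"
  then obtain v where v: "v \<in> \<Union>G" "C = linked G `` {v}" "C \<subseteq> range Mid" by (auto simp: closed_loops_def)
  note ab = mid_outer[OF v(3)]
  have g: "\<gamma> \<notin> C" "\<eta> \<notin> C"
    using v(2) ab linked_edge[OF edges_G(1)] linked_edge[OF edges_G(2)] linked_sym linked_trans
    by (meson Image_singleton_iff)+
  have "v \<in> C" using v(2) by simp
  then have "v \<in> \<Union>R" using v(1) ab g by (auto simp: G_def)
  moreover have sub: "linked R `` {v} \<subseteq> C" using v(2) linked_mono[OF R_sub(1)] by blast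
  then have "C = linked R `` {v}" using linked_R_eq(1)[of v] ab g v(2) by blast
  ultimately show "C \<in> loopsR" using v(3) g unfolding loopsR_def by blast
qed (use loopsR_sub in blast)

lemma closed_loops_H: "closed_loops H = loopsR \<union> (if linked H `` {\<gamma>} \<subseteq> range Mid then {linked H `` {\<gamma>}} else {})"
proof (intro equalityI subsetI)
  fix C assume "C \<in> closed_loops H"
  then obtain v where v: "v \<in> \<Union>H" "C = linked H `` {v}" "C \<subseteq> range Mid" by (auto simp: closed_loops_def)
  note ab = mid_outer[OF v(3)]
  show "C \<in> loopsR \<union> (if linked H `` {\<gamma>} \<subseteq> range Mid then {linked H `` {\<gamma>}} else {})"
  proof (cases "\<gamma> \<in> C \<or> \<eta> \<in> C")
    case True
    then have "(v, \<gamma>) \<in> linked H"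
      using v(2) linked_edge[OF edges_H(2)] linked_sym linked_trans by (meson Image_singleton_iff)
    then have "C = linked H `` {\<gamma>}" using v(2) linked_class by metis
    then show ?thesis using v(3) by simp
  next
    case False
    have "v \<in> C" using v(2) by simp
    then have "v \<in> \<Union>R" using v(1) ab False by (auto simp: H_def)
    moreover have sub: "linked R `` {v} \<subseteq> C" using v(2) linked_mono[OF R_sub(2)] by blast
    then have "C = linked R `` {v}" using linked_R_eq(2)[of v] ab False v(2) by blast
    ultimately show ?thesis using v(3) False unfolding loopsR_def by blast
  qed
next
  fix C assume "C \<in> loopsR \<union> (if linked H `` {\<gamma>} \<subseteq> range Mid then {linked H `` {\<gamma>}} else {})"
  moreover have "\<gamma> \<in> \<Union>H" using edges_H by blast
  ultimately show "C \<in> closed_loops H" using loopsR_sub(2) by (auto simp: closed_loops_def split: if_splits)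
qed

lemma strand_alpha_beta: "strand H [\<alpha>, \<beta>]" using out neq edges_H by (auto simp: strand_def strand_path_def)

lemma other_strand:
  assumes p: "strand G p" "{hd p, last p} \<inter> {\<alpha>, \<beta>} = {}" shows "strand_path R p" "strand H p"
proof -
  have "\<alpha> \<notin> set p" "\<beta> \<notin> set p" using strand_outer[OF thin_G p(1)] p(2) out by blast+
  then show "strand_path R p" using path_R p(1) by (simp add: strand_def)
  then show "strand H p" using p(1) path_H by (simp add: strand_def)
qed

lemma other_contract:
  assumes "contract_marking G m m'" "edge_of m' \<inter> {\<alpha>, \<beta>} = {}"
  shows "contract_marking H m m'" using assms(1)
proof cases
  case (bead p i)
  then have "strand H p" using assms(2) by (intro other_strand) (auto simp: strand_def outer_iff)
  then show ?thesis using bead contract_marking.bead[of H p i] by (simp add: strand_def)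
next
  case (arrow p i)
  then have "strand H p" using assms(2) by (intro other_strand) (auto simp: strand_def outer_iff)
  then show ?thesis using arrow contract_marking.arrow[of H p i] by (simp add: strand_def)
qed

end

section \<open>Surgery on two different strands\<close>

locale surgery_open = surgery +
  fixes P Q :: "vertex list" assumes P: "strand G (\<alpha> # P)" and Q: "strand G (\<beta> # Q)" and lastP: "last P \<noteq> \<beta>"
begin

lemma ne: "P \<noteq> []" "Q \<noteq> []" using P Q by (auto simp: strand_def)

lemma hd_P: "hd P = \<gamma>"
  using strand_path_edge[of G "\<alpha> # P" 0] P ne G_alpha by (auto simp: strand_def hd_conv_nth)

lemma hd_Q: "hd Q = \<eta>" using strand_path_edge[of G "\<beta> # Q" 0] Q ne G_beta by (auto simp: strand_def hd_conv_nth)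

lemma PQ_disjoint: "set (\<alpha> # P) \<inter> set (\<beta> # Q) = {}"
proof (rule ccontr)
  assume "set (\<alpha> # P) \<inter> set (\<beta> # Q) \<noteq> {}"
  then obtain v where "v \<in> set (\<alpha> # P)" "v \<in> set (\<beta> # Q)" by blast
  then have "\<beta> # Q = \<alpha> # P \<or> \<beta> # Q = rev (\<alpha> # P)" by (rule strands_meet[OF thin_G P Q])
  then have "\<beta> # Q = rev P @ [\<alpha>]" using neq by auto
  then have "hd (\<beta> # Q) = hd (rev P @ [\<alpha>])" by simp
  then show False using lastP ne by (simp add: hd_append hd_rev)
qed

lemma path_P: "strand_path R P" and path_Q: "strand_path R Q"
proof -
  have "strand_path G P" "\<alpha> \<notin> set P" "strand_path G Q" "\<beta> \<notin> set Q"
    using P Q by (auto simp: strand_def strand_path_def successively_Cons)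
  then show "strand_path R P" "strand_path R Q" using PQ_disjoint by (auto intro!: path_R)
qed

text \<open>The remainders of the two strands are joined across the new edge: back along
  \<open>P\<close> to \<open>\<gamma>\<close>, over to \<open>\<eta>\<close>, and out along
  \<open>Q\<close>.\<close>

lemma strand_joined: "strand H (rev P @ Q)"
proof -
  have "strand_path H (rev P @ Q)" using path_H[OF path_P] path_H[OF path_Q] PQ_disjoint ne hd_P hd_Q edges_H
    by (auto simp: strand_path_def successively_append_iff insert_commute last_rev)
  moreover have "2 \<le> length (rev P @ Q)" using ne by (cases P; cases Q) auto
  ultimately show ?thesis using P Q ne by (simp add: strand_def hd_rev)
qed

text \<open>Such an edge would connect the two strands. Hence the new arrow sits on an edge outside
  \<open>R\<close> and does not disturb the replay.\<close>

lemma gamma_eta_not_R: "{\<gamma>, \<eta>} \<notin> R"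
proof
  assume "{\<gamma>, \<eta>} \<in> R"
  then have "(\<gamma>, \<eta>) \<in> linked G" using R_sub linked_edge by blast
  moreover have "\<gamma> \<in> set (\<alpha> # P)" "\<eta> \<in> set (\<beta> # Q)" using hd_P hd_Q ne by (metis hd_in_set list.set_intros(2))+
  ultimately show False using strand_component[OF thin_G P] PQ_disjoint by blast
qed

lemma closed_loops_open: "closed_loops H = closed_loops G"
proof -
  have "\<gamma> \<in> set (rev P @ Q)" "last P \<in> set (rev P @ Q)" using hd_P ne hd_in_set[of P] by auto
  then have "(\<gamma>, last P) \<in> linked H"
    using strand_joined by (intro strand_path_linked[of H "rev P @ Q"]) (auto simp: strand_def)
  moreover have "last P \<in> outer" using P ne by (simp add: strand_def)
  ultimately have "\<not> linked H `` {\<gamma>} \<subseteq> range Mid" by (auto simp: outer_iff)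
  then show ?thesis using closed_loops_G closed_loops_H by simp
qed

lemma end_alpha: "strand G p \<Longrightarrow> hd p = \<alpha> \<Longrightarrow> last p = last P" using strand_unique[OF thin_G _ P, of p] ne by simp

lemma end_beta: "strand G p \<Longrightarrow> hd p = \<beta> \<Longrightarrow> last p = last Q" using strand_unique[OF thin_G _ Q, of p] ne by simp

lemma contract_edges_open:
  assumes cover: "\<And>v. v \<in> \<Union>G \<Longrightarrow> v \<in> outer \<Longrightarrow> \<exists>w. {v, w} \<in> contract_edges G"
  shows "contract_edges H = contract_edges G - {{\<alpha>, last P}, {\<beta>, last Q}} \<union> {{\<alpha>, \<beta>}, {last P, last Q}}"
    (is "_ = ?Z")
proof (rule contract_edges_eqI[OF thin_H])
  show "?Z \<subseteq> contract_edges H"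
  proof
    fix e assume "e \<in> ?Z"
    then consider "e = {\<alpha>, \<beta>}" | "e = {last P, last Q}"
      | "e \<in> contract_edges G" "e \<noteq> {\<alpha>, last P}" "e \<noteq> {\<beta>, last Q}" by blast
    then show "e \<in> contract_edges H"
    proof cases
      case 1
      then have "e = {hd [\<alpha>, \<beta>], last [\<alpha>, \<beta>]}" by simp
      then show ?thesis using strand_alpha_beta unfolding contract_edges_strand by blast
    next
      case 2
      then have "e = {hd (rev P @ Q), last (rev P @ Q)}" using ne by (simp add: hd_rev)
      then show ?thesis using strand_joined unfolding contract_edges_strand by blast
    next
      case 3
      then obtain p where p: "strand G p" "e = {hd p, last p}" by (auto simp: contract_edges_strand)
      then have pne: "p \<noteq> []" by (auto simp: strand_def)
      have "hd p \<noteq> \<alpha> \<and> hd p \<noteq> \<beta>" using end_alpha[OF p(1)] end_beta[OF p(1)] 3 p(2) by metis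
      moreover have "last p \<noteq> \<alpha> \<and> last p \<noteq> \<beta>"
      proof -
        have r: "strand G (rev p)" "hd (rev p) = last p" "last (rev p) = hd p"
          using strand_rev[OF p(1)] pne by (auto simp: hd_rev last_rev)
        then show ?thesis using end_alpha[OF r(1)] end_beta[OF r(1)] 3 p(2) by (metis insert_commute)
      qed
      ultimately have "strand H p" by (intro other_strand p) auto
      then show ?thesis using p(2) unfolding contract_edges_strand by blast
    qed
  qed
  fix v assume v: "v \<in> \<Union>H" "v \<in> outer"
  have vG: "v \<in> \<Union>G" using v(1) edges_G R_sub(1) unfolding H_def by blast
  then obtain w where w: "{v, w} \<in> contract_edges G" using cover v(2) by blast
  show "\<exists>w. {v, w} \<in> ?Z"
  proof (cases "{v, w} = {\<alpha>, last P} \<or> {v, w} = {\<beta>, last Q}")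
    case True
    then have "v = \<alpha> \<or> v = \<beta> \<or> v = last P \<or> v = last Q" by (auto simp: doubleton_eq_iff)
    moreover have "{\<alpha>, \<beta>} \<in> ?Z" "{\<beta>, \<alpha>} \<in> ?Z" "{last P, last Q} \<in> ?Z" "{last Q, last P} \<in> ?Z"
      by (simp_all add: insert_commute)
    ultimately show ?thesis by metis
  qed (use w in blast)
qed

text \<open>Needed when the bead of the first strand cancels against the new arrow: the bead of the
  second strand then marks the joined strand.\<close>

lemma joined_contract:
  assumes "contract_marking G m (Bead {\<beta>, last Q})" "edge_of m \<in> R"
  shows "contract_marking H m (Bead {last P, last Q})"
proof -
  from assms(1) obtain p i where p: "strand_path G p" "hd p \<in> outer" "last p \<in> outer" "i + 1 < length p"
      "m = Bead {p ! i, p ! (i + 1)}" "{hd p, last p} = {\<beta>, last Q}"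
    by (cases rule: contract_marking.cases) (auto simp: outer_iff)
  then have "strand G p" "p \<noteq> []" by (auto simp: strand_def)
  moreover have "\<beta> \<in> set p" using p(6) \<open>p \<noteq> []\<close> by (metis doubleton_eq_iff hd_in_set last_in_set)
  ultimately have "p = \<beta> # Q \<or> p = rev (\<beta> # Q)" using strands_meet[OF thin_G Q, of p \<beta>] by simp
  then have "set p = set (\<beta> # Q)" by (metis set_rev)
  then have "p ! i \<in> set (\<beta> # Q)" "p ! i \<noteq> \<beta>" "p ! (i + 1) \<noteq> \<beta>"
    using p(4,5) assms(2) not_R by (metis Suc_eq_plus1 Suc_lessD nth_mem, auto)
  then have "p ! i \<in> set (rev P @ Q)" by simp
  moreover have "{p ! i, p ! (i + 1)} \<in> H" using assms(2) p(5) R_sub by auto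
  ultimately obtain j where j: "j + 1 < length (rev P @ Q)"
    "p ! i = (rev P @ Q) ! j \<and> p ! (i + 1) = (rev P @ Q) ! (j + 1) \<or> p ! (i + 1) = (rev P @ Q) ! j \<and> p ! i = (rev P @ Q) ! (j + 1)"
    using strand_edge_index[OF thin_H strand_joined] by metis
  then have "m = Bead {(rev P @ Q) ! j, (rev P @ Q) ! (j + 1)}" using p(5) by (metis insert_commute)
  moreover have "hd (rev P @ Q) = last P" "last (rev P @ Q) = last Q" using ne by (auto simp: hd_rev)
  ultimately show ?thesis
    using contract_marking.bead[of H "rev P @ Q" j] strand_joined j(1) by (simp add: strand_def outer_iff)
qed

lemma joined_contract_arrow: "contract_marking H (Arrow \<gamma> \<eta>) (Arrow (last P) (last Q))"
proof -
  define i where "i = length P - 1"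
  have "(rev P @ Q) ! i = \<gamma>" "(rev P @ Q) ! (i + 1) = \<eta>" "i + 1 < length (rev P @ Q)"
    using ne hd_P hd_Q by (auto simp: i_def nth_append rev_nth hd_conv_nth)
  then show ?thesis
    using contract_marking.arrow[of H "rev P @ Q" i] strand_joined ne by (simp add: strand_def outer_iff hd_rev)
qed

text \<open>
  The edge \<open>{\<gamma>, \<eta>}\<close> carries the new arrow. Going backwards from it one runs along \<open>P\<close> into the marked
  edge of that strand.
\<close>

lemma facing_joined:
  assumes "contract_marking G (Bead e) (Bead {\<alpha>, last P})" "e \<in> R"
    and ms: "\<And>m i. m \<in> set ms \<Longrightarrow> i + 1 < length P \<Longrightarrow> edge_of m \<noteq> {P ! i, P ! (i + 1)}" shows "facing H ms \<eta> \<gamma> e"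
proof -
  from assms(1) obtain p i where p: "strand_path G p" "hd p \<in> outer" "last p \<in> outer" "i + 1 < length p"
      "e = {p ! i, p ! (i + 1)}" "{hd p, last p} = {\<alpha>, last P}"
    by (cases rule: contract_marking.cases) (auto simp: outer_iff)
  then have "strand G p" "p \<noteq> []" by (auto simp: strand_def)
  moreover have "\<alpha> \<in> set p" using p(6) \<open>p \<noteq> []\<close> by (metis doubleton_eq_iff hd_in_set last_in_set)
  ultimately have "p = \<alpha> # P \<or> p = rev (\<alpha> # P)" using strands_meet[OF thin_G P, of p \<alpha>] by simp
  then have "set p = set (\<alpha> # P)" by (metis set_rev)
  then have "p ! i \<in> set (\<alpha> # P)" "{p ! i, p ! (i + 1)} \<in> G" "p ! i \<noteq> \<alpha>" "p ! (i + 1) \<noteq> \<alpha>"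
    using p(4,5) strand_path_edge[OF p(1,4)] assms(2) not_R by (metis Suc_eq_plus1 Suc_lessD nth_mem, auto)
  then obtain j where j: "j + 1 < length (\<alpha> # P)" "p ! i = (\<alpha> # P) ! j \<and> p ! (i + 1) = (\<alpha> # P) ! (j + 1) \<or>
      p ! (i + 1) = (\<alpha> # P) ! j \<and> p ! i = (\<alpha> # P) ! (j + 1)" using strand_edge_index[OF thin_G P] by metis
  \<comment> \<open>Index 0 is the leg \<open>{\<alpha>, \<gamma>}\<close>, and \<open>e\<close>
    avoids \<open>\<alpha>\<close>.\<close>
  then have "j \<noteq> 0" using \<open>p ! i \<noteq> \<alpha>\<close> \<open>p ! (i + 1) \<noteq> \<alpha>\<close> by (cases j) auto
  then obtain k where k: "j = k + 1" "k + 1 < length P" "e = {P ! k, P ! (k + 1)}"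
    using j p(5) by (cases j) (auto simp: insert_commute)
  \<comment> \<open>\<open>P\<close> starts in \<open>\<gamma>\<close>, so \<open>\<eta>\<close> in
    front makes the first edge of \<open>q\<close> the new one; \<open>k + 2\<close> vertices of
    \<open>P\<close> reach exactly to the end of the marked edge.\<close>
  define q where "q = \<eta> # take (k + 2) P"
  have len: "length q = k + 3" using k by (simp add: q_def)
  have "\<eta> \<notin> set P" using hd_Q ne PQ_disjoint hd_in_set[of Q] by auto
  then have "\<eta> \<notin> set (take (k + 2) P)" using set_take_subset[of "k + 2" P] by blast
  moreover have "strand_path R (take (k + 2) P)" using path_P by (auto simp: strand_path_nth)
  moreover have "hd (take (k + 2) P) = \<gamma>" using hd_P ne by (cases P) auto
  ultimately have "strand_path H q" using edges_H(2) path_H[of "take (k + 2) P"] unfolding q_def strand_path_def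
    by (auto simp: successively_Cons insert_commute)
  moreover have "q ! 0 = \<eta>" "q ! 1 = \<gamma>" "e = {q ! (length q - 2), q ! (length q - 1)}"
    using k len hd_P ne by (auto simp: q_def hd_conv_nth)
  moreover have "edge_of m \<noteq> {q ! i, q ! (i + 1)}" if "0 < i" "i + 2 < length q" "m \<in> set ms" for i m
    using ms[OF that(3), of "i - 1"] that(1,2) k len by (cases i) (auto simp: q_def)
  ultimately show ?thesis unfolding facing_def using len by (intro exI[of _ q]) auto
qed

end

section \<open>Surgery on a single strand, which splits off a closed loop\<close>

locale surgery_loop = surgery +
  fixes P :: "vertex list" assumes P: "strand G (\<alpha> # P)" and lastP: "last P = \<beta>"
begin

lemma ne: "P \<noteq> []" using P by (auto simp: strand_def)

lemma hd_P: "hd P = \<gamma>"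
  using strand_path_edge[of G "\<alpha> # P" 0] P ne G_alpha by (auto simp: strand_def hd_conv_nth)

definition "W = linked H `` {\<gamma>}"

lemma P_conv: "P = butlast P @ [\<beta>]" using ne lastP by (metis append_butlast_last_id)

lemma strand_distinct: "\<alpha> \<notin> set (butlast P)" "\<beta> \<notin> set (butlast P)"
proof -
  have "distinct (\<alpha> # butlast P @ [\<beta>])" using P P_conv by (simp add: strand_def strand_path_def)
  then show "\<alpha> \<notin> set (butlast P)" "\<beta> \<notin> set (butlast P)" by auto
qed

lemma in_strand: "v \<in> set (\<alpha> # P) \<longleftrightarrow> v = \<alpha> \<or> v = \<beta> \<or> v \<in> set (butlast P)" by (subst P_conv) auto

lemma butlast_ne: "butlast P \<noteq> []"
proof
  assume "butlast P = []"
  then have "P = [\<beta>]" using P_conv by simp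
  then show False using hd_P neqs by simp
qed

lemma gamma_in: "\<gamma> \<in> set (butlast P)"
proof -
  have "hd (butlast P) = \<gamma>" using hd_P P_conv butlast_ne by (metis hd_append2)
  then show ?thesis using butlast_ne hd_in_set by metis
qed

lemma eta_in: "\<eta> \<in> set (butlast P)"
proof -
  have "\<eta> \<in> set (\<alpha> # P)"
    using strand_component[OF thin_G P, of \<beta> \<eta>] in_strand linked_edge[OF edges_G(2)] by blast
  then show ?thesis using in_strand[of \<eta>] neqs by metis
qed

lemma path_butlast: "strand_path R (butlast P)"
proof (rule path_R)
  have "strand_path G (\<alpha> # (butlast P @ [\<beta>]))" using P P_conv by (simp add: strand_def)
  then show "strand_path G (butlast P)"
    using butlast_ne by (auto simp: strand_path_def successively_Cons successively_append_iff)
qed (use strand_distinct in auto)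

text \<open>The strand from \<open>\<alpha>\<close> to \<open>\<beta>\<close> loses both ends; the
  edge \<open>{\<gamma>, \<eta>}\<close> closes what is left, and no edge of \<open>H\<close> leads
  out of it.\<close>

lemma W_eq: "W = set (butlast P)"
proof (intro equalityI subsetI)
  fix v assume "v \<in> W"
  then have "(\<gamma>, v) \<in> linked H" by (simp add: W_def)
  then show "v \<in> set (butlast P)"
  proof (rule linked_closed)
    fix x y assume xy: "{x, y} \<in> H" "x \<in> set (butlast P)"
    then have "x \<noteq> \<alpha>" "x \<noteq> \<beta>" using strand_distinct by auto
    then consider "{x, y} \<in> R" | "y = \<gamma>" | "y = \<eta>" using H_edge[OF xy(1)] by blast
    then show "y \<in> set (butlast P)"
    proof cases
      case 1
      then have "(x, y) \<in> linked G" using R_sub linked_edge by blast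
      then have "y \<in> set (\<alpha> # P)" using strand_component[OF thin_G P] xy(2) in_strand by blast
      then show ?thesis using in_strand[of y] 1 not_R(2)[of x] not_R(4)[of x] by metis
    qed (use gamma_in eta_in in auto)
  qed (rule gamma_in)
next
  fix v assume "v \<in> set (butlast P)"
  then have "(\<gamma>, v) \<in> linked R" using strand_path_linked[OF path_butlast gamma_in] by blast
  then show "v \<in> W" using linked_mono[OF R_sub(2)] by (auto simp: W_def)
qed

lemma W_mid: "W \<subseteq> range Mid"
proof
  fix v assume "v \<in> W"
  then have "v \<in> set (\<alpha> # P)" "v \<noteq> \<alpha>" "v \<noteq> \<beta>" using in_strand strand_distinct by (auto simp: W_eq)
  then have "v \<notin> outer" using strand_outer[OF thin_G P, of v] lastP ne by auto
  then show "v \<in> range Mid" by (simp add: outer_iff)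
qed

lemma closed_loops_loop: "closed_loops H = insert W (closed_loops G)" "W \<notin> closed_loops G"
proof -
  show "closed_loops H = insert W (closed_loops G)"
    using closed_loops_G closed_loops_H W_mid by (simp add: W_def)
  show "W \<notin> closed_loops G" unfolding closed_loops_G loopsR_def using gamma_in W_eq by auto
qed

lemma W_closed: "{x, y} \<in> R \<Longrightarrow> x \<in> W \<Longrightarrow> y \<in> W"
  unfolding W_def using linked_trans[of \<gamma> x H y] linked_edge[of x y H] R_sub by blast

text \<open>Identifies the markings that vanish with the loop by their position in the simplified
  diagram for \<open>G\<close>.\<close>

lemma contract_alpha_beta:
  assumes "contract_marking G m m'" "edge_of m \<in> R"
  shows "edge_of m \<subseteq> W \<longleftrightarrow> edge_of m' = {\<alpha>, \<beta>}"
proof -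
  obtain p i where p: "strand_path G p" "hd p \<in> outer" "last p \<in> outer" "i + 1 < length p"
    "edge_of m = {p ! i, p ! (i + 1)}" "edge_of m' = {hd p, last p}"
    using assms(1) by (cases rule: contract_marking.cases) (auto simp: outer_iff)
  then have sp: "strand G p" and pne: "p \<noteq> []" by (auto simp: strand_def)
  show ?thesis
  proof
    assume "edge_of m \<subseteq> W"
    then have "p ! i \<in> set (\<alpha> # P)" "p ! i \<in> set p" using p W_eq in_strand by auto
    then have "p = \<alpha> # P \<or> p = rev (\<alpha> # P)" using strands_meet[OF thin_G P sp] by blast
    then show "edge_of m' = {\<alpha>, \<beta>}"
    proof
      assume "p = \<alpha> # P"
      then show ?thesis using p(6) lastP ne by simp
    next
      assume "p = rev (\<alpha> # P)"
      then have "hd p = \<beta>" "last p = \<alpha>" using lastP ne by (auto simp: hd_append hd_rev)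
      then show ?thesis using p(6) by (simp add: insert_commute)
    qed
  next
    assume "edge_of m' = {\<alpha>, \<beta>}"
    then have "\<alpha> \<in> set p" using p(6) pne by (metis doubleton_eq_iff hd_in_set last_in_set)
    then have "p = \<alpha> # P \<or> p = rev (\<alpha> # P)" using strands_meet[OF thin_G P sp, of \<alpha>] by simp
    then have "set p = set (\<alpha> # P)" by (metis set_rev)
    then have "p ! i \<in> set (\<alpha> # P)" "p ! (i + 1) \<in> set (\<alpha> # P)"
      using p(4) nth_mem[of i p] nth_mem[of "i + 1" p] by auto
    moreover have "\<alpha> \<notin> edge_of m" "\<beta> \<notin> edge_of m" using assms(2) fresh by blast+
    ultimately show "edge_of m \<subseteq> W" using p(5) W_eq in_strand by auto
  qed
qed

lemma contract_edges_loop: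
  assumes cover: "\<And>v. v \<in> \<Union>G \<Longrightarrow> v \<in> outer \<Longrightarrow> \<exists>w. {v, w} \<in> contract_edges G"
  shows "contract_edges H = contract_edges G"
proof (rule contract_edges_eqI[OF thin_H])
  show "contract_edges G \<subseteq> contract_edges H"
  proof
    fix e assume "e \<in> contract_edges G"
    then obtain p where p: "strand G p" "e = {hd p, last p}" by (auto simp: contract_edges_strand)
    then have pne: "p \<noteq> []" by (auto simp: strand_def)
    show "e \<in> contract_edges H"
    proof (cases "{hd p, last p} \<inter> {\<alpha>, \<beta>} = {}")
      case True
      then show ?thesis using other_strand(2)[OF p(1)] p(2) unfolding contract_edges_strand by blast
    next
      case False
      then have "\<alpha> \<in> set p \<or> \<beta> \<in> set p" using pne hd_in_set last_in_set by auto
      then have "p = \<alpha> # P \<or> p = rev (\<alpha> # P)" using strands_meet[OF thin_G P p(1)] in_strand by blast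
      then have "e = {hd [\<alpha>, \<beta>], last [\<alpha>, \<beta>]}" using p(2) lastP ne by (auto simp: hd_append hd_rev)
      then show ?thesis using strand_alpha_beta unfolding contract_edges_strand by blast
    qed
  qed
  fix v assume v: "v \<in> \<Union>H" "v \<in> outer"
  have vG: "v \<in> \<Union>G" using v(1) edges_G R_sub(1) unfolding H_def by blast
  then show "\<exists>w. {v, w} \<in> contract_edges G" using cover v(2) by blast
qed

end

section \<open>Composition and relabelling\<close>

text \<open>Membership in \<open>composites\<close> with the scalar and the final list of markings
  exposed, since the surgeries change both in an explicit way.\<close>

definition composes ::
  "'k::field \<Rightarrow> 'k \<Rightarrow> nat \<Rightarrow> nat \<Rightarrow> mdiagram \<Rightarrow> mdiagram \<Rightarrow> 'k \<Rightarrow> marking list \<Rightarrow> bool" where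
  "composes \<delta> \<epsilon> r t D1 D2 k mz \<longleftrightarrow> (\<exists>ms.
     simplifies \<delta> \<epsilon> (stk (fst D1) (fst D2)) (stack_markings D1 D2) k ms \<and>
     list_all2 (contract_marking (stk (fst D1) (fst D2))) ms mz \<and>
     (contract_edges (stk (fst D1) (fst D2)), mz) \<in> marked_brauer r t)"

lemma composites_composes: "composites \<delta> \<epsilon> r t D1 D2 =
     {single (contract_edges (stk (fst D1) (fst D2)), mz) k |k mz. composes \<delta> \<epsilon> r t D1 D2 k mz}"
  unfolding composites_def composes_def stack_edges_stk by blast

lemma composes_swap:
  assumes "composes \<delta> \<epsilon> r t D1 D2 k (xs @ a # b # ys)"
  shows "composes \<delta> \<epsilon> r t D1 D2 (\<epsilon> * k) (xs @ b # a # ys)"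
proof -
  let ?G = "stk (fst D1) (fst D2)"
  obtain ms where ms: "simplifies \<delta> \<epsilon> ?G (stack_markings D1 D2) k ms"
     "list_all2 (contract_marking ?G) ms (xs @ a # b # ys)"
     "(contract_edges ?G, xs @ a # b # ys) \<in> marked_brauer r t" using assms unfolding composes_def by blast
  from ms(2) obtain xs' a' b' ys' where ms': "ms = xs' @ a' # b' # ys'" "list_all2 (contract_marking ?G) xs' xs"
    "contract_marking ?G a' a" "contract_marking ?G b' b" "list_all2 (contract_marking ?G) ys' ys"
    by (auto simp: list_all2_append2 list_all2_Cons2)
  have "simplifies \<delta> \<epsilon> ?G (stack_markings D1 D2) (\<epsilon> * k) (xs' @ b' # a' # ys')"
    using ms(1) unfolding ms'(1) by (rule rtranclp.rtrancl_into_rtrancl) (rule simp_step.interchange)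
  moreover have "list_all2 (contract_marking ?G) (xs' @ b' # a' # ys') (xs @ b # a # ys)"
    using ms' by (simp add: list_all2_appendI)
  moreover have "(contract_edges ?G, xs @ b # a # ys) \<in> marked_brauer r t"
    using marked_mstep[OF ms(3)] mstep.swap by blast
  ultimately show ?thesis unfolding composes_def by blast
qed

text \<open>The new scalar is left open: the product formulas are relative to whatever outcome is at
  hand, so only the position of the marking matters.\<close>

lemma composes_front:
  assumes "composes \<delta> \<epsilon> r t D1 D2 k (xs @ m # ys)"
  shows "\<exists>k'. composes \<delta> \<epsilon> r t D1 D2 k' (m # xs @ ys)" using assms
proof (induction xs arbitrary: k ys rule: rev_induct)
  case (snoc x xs)
  then have "composes \<delta> \<epsilon> r t D1 D2 (\<epsilon> * k) (xs @ m # x # ys)"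
    using composes_swap[of \<delta> \<epsilon> r t D1 D2 k xs x m ys] by simp
  from snoc.IH[OF this] show ?case by simp
qed auto

definition vmap :: "(vertex \<Rightarrow> vertex) \<Rightarrow> vertex set set \<Rightarrow> vertex set set" where
  "vmap f X = (\<lambda>e. f ` e) ` X"

definition dmap :: "(vertex \<Rightarrow> vertex) \<Rightarrow> mdiagram \<Rightarrow> mdiagram" where
  "dmap f D = (vmap f (fst D), map (relabel f) (snd D))"

lemma fst_dmap [simp]: "fst (dmap f D) = vmap f (fst D)" and snd_dmap [simp]: "snd (dmap f D) = map (relabel f) (snd D)"
  by (simp_all add: dmap_def)

lemma vmap_vmap: "vmap f (vmap g X) = vmap (f \<circ> g) X" by (simp add: vmap_def image_image image_comp)

lemma relabel_relabel: "relabel f (relabel g m) = relabel (f \<circ> g) m" by (cases m) (auto simp: image_comp)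

lemma dmap_dmap: "dmap f (dmap g D) = dmap (f \<circ> g) D" by (simp add: dmap_def vmap_vmap relabel_relabel comp_def)

lemma relabel_cong: "(\<And>v. v \<in> edge_of m \<Longrightarrow> f v = g v) \<Longrightarrow> relabel f m = relabel g m"
  by (cases m) (auto intro!: image_cong)

lemma contract_edges_outer:
  "contract_edges G = {{u, v} |u v. u \<noteq> v \<and> (u, v) \<in> linked G \<and> u \<in> outer \<and> v \<in> outer}"
  by (simp only: contract_edges_def outer_iff)

lemma closed_loops_outer: "closed_loops G = {C. \<exists>v\<in>\<Union>G. C = linked G `` {v} \<and> C \<inter> outer = {}}"
proof -
  have "C \<subseteq> range Mid \<longleftrightarrow> C \<inter> outer = {}" for C unfolding outer_def by blast
  then show ?thesis by (simp only: closed_loops_def)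
qed

context
  fixes f :: "vertex \<Rightarrow> vertex" assumes bij: "bij f" and f_outer: "\<And>v. f v \<in> outer \<longleftrightarrow> v \<in> outer"
begin

lemma f_eq [simp]: "f u = f v \<longleftrightarrow> u = v" using bij by (simp add: bij_def inj_eq)

lemma vmap_edge: "{f u, f v} \<in> vmap f G \<longleftrightarrow> {u, v} \<in> G"
proof
  assume "{f u, f v} \<in> vmap f G"
  then obtain e where e: "e \<in> G" "f ` {u, v} = f ` e" by (auto simp: vmap_def)
  then have "{u, v} = e" using inj_image_eq_iff[of f] bij by (metis bij_def)
  then show "{u, v} \<in> G" using e by simp
next
  assume "{u, v} \<in> G"
  then have "f ` {u, v} \<in> vmap f G" unfolding vmap_def by (rule imageI)
  then show "{f u, f v} \<in> vmap f G" by simp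
qed

lemma f_surj: obtains u where "v = f u" using bij by (metis bij_def surjD)

lemma linked_vmap: "(f u, f v) \<in> linked (vmap f G) \<longleftrightarrow> (u, v) \<in> linked G"
proof
  assume "(f u, f v) \<in> linked (vmap f G)"
  then have "f v \<in> f ` (linked G `` {u})"
  proof (rule linked_closed)
    fix x y assume xy: "{x, y} \<in> vmap f G" "x \<in> f ` (linked G `` {u})"
    then obtain x' where x': "x = f x'" "(u, x') \<in> linked G" by blast
    obtain y' where y': "y = f y'" by (rule f_surj)
    have "{x', y'} \<in> G" using xy(1) x'(1) y' vmap_edge by simp
    then have "(u, y') \<in> linked G" using linked_trans[OF x'(2) linked_edge] by blast
    then show "y \<in> f ` (linked G `` {u})" using y' by blast
  qed simp
  then show "(u, v) \<in> linked G" by auto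
next
  assume "(u, v) \<in> linked G"
  then show "(f u, f v) \<in> linked (vmap f G)" unfolding linked_def[of G]
  proof (induction rule: rtrancl_induct)
    case (step y z)
    then have "{y, z} \<in> G" by simp
    then have "(f y, f z) \<in> linked (vmap f G)" by (intro linked_edge) (simp only: vmap_edge)
    then show ?case by (rule linked_trans[OF step.IH])
  qed simp
qed

lemma linked_vmap_Image: "linked (vmap f G) `` {f v} = f ` (linked G `` {v})"
proof (intro equalityI subsetI)
  fix w assume "w \<in> linked (vmap f G) `` {f v}"
  moreover obtain w' where "w = f w'" by (rule f_surj)
  ultimately show "w \<in> f ` (linked G `` {v})" using linked_vmap by auto
qed (use linked_vmap in auto)

lemma contract_edges_vmap: "contract_edges (vmap f G) = vmap f (contract_edges G)"
proof (intro equalityI subsetI)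
  fix e assume "e \<in> contract_edges (vmap f G)"
  then obtain u v where uv: "e = {u, v}" "u \<noteq> v" "(u, v) \<in> linked (vmap f G)" "u \<in> outer" "v \<in> outer"
    unfolding contract_edges_outer by blast
  obtain u' where u': "u = f u'" by (rule f_surj)
  obtain v' where v': "v = f v'" by (rule f_surj)
  have "u' \<noteq> v'" "(u', v') \<in> linked G" "u' \<in> outer" "v' \<in> outer"
    using uv linked_vmap f_outer unfolding u' v' by auto
  then have "{u', v'} \<in> contract_edges G" unfolding contract_edges_outer by blast
  then have "f ` {u', v'} \<in> vmap f (contract_edges G)" unfolding vmap_def by (rule imageI)
  then show "e \<in> vmap f (contract_edges G)" using uv(1) u' v' by simp
next
  fix e assume "e \<in> vmap f (contract_edges G)"
  then obtain u v where uv: "e = f ` {u, v}" "u \<noteq> v" "(u, v) \<in> linked G" "u \<in> outer" "v \<in> outer"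
    unfolding contract_edges_outer vmap_def by blast
  then have "(f u, f v) \<in> linked (vmap f G)" "f u \<noteq> f v" "f u \<in> outer" "f v \<in> outer" "e = {f u, f v}"
    using linked_vmap f_outer by auto
  then show "e \<in> contract_edges (vmap f G)" unfolding contract_edges_outer by blast
qed

lemma closed_loops_vmap: "closed_loops (vmap f G) = (\<lambda>C. f ` C) ` closed_loops G"
proof -
  have iff: "f ` C \<inter> outer = {} \<longleftrightarrow> C \<inter> outer = {}" for C using f_outer by auto
  have "\<Union>(vmap f G) = f ` \<Union>G" unfolding vmap_def by blast
  then have "closed_loops (vmap f G) = {C. \<exists>v\<in>\<Union>G. C = f ` (linked G `` {v}) \<and> C \<inter> outer = {}}"
    unfolding closed_loops_outer by (simp add: linked_vmap_Image)
  also have "\<dots> = {f ` (linked G `` {v}) |v. v \<in> \<Union>G \<and> f ` (linked G `` {v}) \<inter> outer = {}}" by blast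
  also have "\<dots> = {f ` (linked G `` {v}) |v. v \<in> \<Union>G \<and> linked G `` {v} \<inter> outer = {}}" by (simp only: iff)
  also have "\<dots> = (\<lambda>C. f ` C) ` {C. \<exists>v\<in>\<Union>G. C = linked G `` {v} \<and> C \<inter> outer = {}}" by blast
  finally show ?thesis unfolding closed_loops_outer .
qed

lemma card_closed_loops_vmap: "card (closed_loops (vmap f G)) = card (closed_loops G)"
  unfolding closed_loops_vmap by (intro card_image inj_onI) (simp only: inj_image_eq_iff[OF bij_is_inj[OF bij]])

lemma delete_loop_markings_vmap:
  "delete_loop_markings (vmap f G) (map (relabel f) ms) = map (relabel f) (delete_loop_markings G ms)"
proof -
  have "f ` e \<subseteq> \<Union>(closed_loops (vmap f G)) \<longleftrightarrow> e \<subseteq> \<Union>(closed_loops G)" for e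
  proof -
    have "\<Union>(closed_loops (vmap f G)) = f ` \<Union>(closed_loops G)" unfolding closed_loops_vmap by blast
    then show ?thesis using bij inj_image_subset_iff[of f] by (simp add: bij_def)
  qed
  then show ?thesis by (simp add: delete_loop_markings_def filter_map comp_def)
qed

lemma strand_path_vmap:
  assumes "strand_path G p" shows "strand_path (vmap f G) (map f p)"
  unfolding strand_path_nth
proof (intro conjI allI impI)
  show "distinct (map f p)"
    using assms inj_on_subset[OF bij_is_inj[OF bij] subset_UNIV] by (simp add: distinct_map strand_path_def)
  show "{map f p ! i, map f p ! (i + 1)} \<in> vmap f G" if "i + 1 < length (map f p)" for i
    using strand_path_edge[OF assms, of i] that by (simp add: vmap_edge)
qed

lemma facing_vmap:
  assumes "facing G ms u v e"
  shows "facing (vmap f G) (map (relabel f) ms) (f u) (f v) (f ` e)"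
proof -
  from assms obtain p where p: "strand_path G p" "length p \<ge> 3" "p ! 0 = u" "p ! 1 = v"
      "e = {p ! (length p - 2), p ! (length p - 1)}"
      "\<And>i m. 0 < i \<Longrightarrow> i + 2 < length p \<Longrightarrow> m \<in> set ms \<Longrightarrow> edge_of m \<noteq> {p ! i, p ! (i + 1)}"
    unfolding facing_def by blast
  have "edge_of m \<noteq> {map f p ! i, map f p ! (i + 1)}"
    if i: "0 < i" "i + 2 < length (map f p)" and m: "m \<in> set (map (relabel f) ms)" for i m
  proof -
    obtain m' where m': "m' \<in> set ms" "m = relabel f m'" using m by auto
    have "edge_of m' \<noteq> {p ! i, p ! (i + 1)}" using p(6)[of i m'] i m' by simp
    then have "f ` edge_of m' \<noteq> f ` {p ! i, p ! (i + 1)}"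
      using inj_image_eq_iff[of f] bij unfolding bij_def by metis
    then show ?thesis using m'(2) i by simp
  qed
  moreover have "f ` e = {map f p ! (length (map f p) - 2), map f p ! (length (map f p) - 1)}"
    using p(2) unfolding p(5) by simp
  moreover have "map f p ! 0 = f u" "map f p ! 1 = f v" "length (map f p) \<ge> 3"
  proof -
    have "0 < length p" "1 < length p" using p(2) by linarith+
    then show "map f p ! 0 = f u" "map f p ! 1 = f v" "length (map f p) \<ge> 3"
      using p(2) unfolding p(3,4)[symmetric] by (simp_all only: nth_map length_map)
  qed
  ultimately show ?thesis unfolding facing_def using strand_path_vmap[OF p(1)] by blast
qed

lemma simp_step_vmap:
  assumes "simp_step \<epsilon> G s s'"
  shows "simp_step \<epsilon> (vmap f G) (fst s, map (relabel f) (snd s)) (fst s', map (relabel f) (snd s'))" using assms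
proof cases
  case (interchange c xs a b ys)
  then show ?thesis using simp_step.interchange[of \<epsilon> "vmap f G" c "map (relabel f) xs"] by simp
next
  case (arrow_above_toward xs ys u v e c)
  then show ?thesis
    using simp_step.arrow_above_toward[of "vmap f G" "map (relabel f) xs" "map (relabel f) ys"] facing_vmap[of G "xs @ ys" u v e] by simp
next
  case (arrow_above_away xs ys u v e c)
  then show ?thesis
    using simp_step.arrow_above_away[of "vmap f G" "map (relabel f) xs" "map (relabel f) ys"] facing_vmap[of G "xs @ ys" u v e] by simp
next
  case (bead_above_away xs ys u v e c)
  then show ?thesis
    using simp_step.bead_above_away[of "vmap f G" "map (relabel f) xs" "map (relabel f) ys"] facing_vmap[of G "xs @ ys" u v e] by simp
next
  case (bead_above_toward xs ys u v e c)
  then show ?thesis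
    using simp_step.bead_above_toward[of "vmap f G" "map (relabel f) xs" "map (relabel f) ys"] facing_vmap[of G "xs @ ys" u v e] by simp
qed

lemma simp_steps_vmap:
  assumes "(simp_step \<epsilon> G)\<^sup>*\<^sup>* s s'"
  shows "(simp_step \<epsilon> (vmap f G))\<^sup>*\<^sup>* (fst s, map (relabel f) (snd s)) (fst s', map (relabel f) (snd s'))"
  using assms
proof (induction rule: rtranclp_induct)
  case (step s' s'')
  show ?case by (rule rtranclp.rtrancl_into_rtrancl[OF step.IH simp_step_vmap[OF step.hyps(2)]])
qed simp

lemma contract_marking_vmap:
  assumes "contract_marking G m m'"
  shows "contract_marking (vmap f G) (relabel f m) (relabel f m')" using assms
proof cases
  case (bead p i)
  then have "p \<noteq> []" by auto
  then show ?thesis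
    using bead contract_marking.bead[of "vmap f G" "map f p" i] strand_path_vmap[OF bead(3)] f_outer
    by (simp add: outer_iff[symmetric] hd_map last_map)
next
  case (arrow p i)
  then have "p \<noteq> []" by auto
  then show ?thesis
    using arrow contract_marking.arrow[of "vmap f G" "map f p" i] strand_path_vmap[OF arrow(3)] f_outer
    by (simp add: outer_iff[symmetric] hd_map last_map)
qed

text \<open>Strands, loops and steps are defined from the graph and its outer vertices alone, so a
  bijection that respects outer vertices carries a complete simplification over with the same
  scalar.\<close>

lemma composes_relabel:
  assumes c: "composes \<delta> \<epsilon> r t D1 D2 k mz"
    and edges: "stk (fst D1') (fst D2') = vmap f (stk (fst D1) (fst D2))"
    and markings: "stack_markings D1' D2' = map (relabel f) (stack_markings D1 D2)"
    and result: "(vmap f (contract_edges (stk (fst D1) (fst D2))), map (relabel f) mz) \<in> marked_brauer r t"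
  shows "composes \<delta> \<epsilon> r t D1' D2' k (map (relabel f) mz)"
proof -
  let ?G = "stk (fst D1) (fst D2)"
  obtain ms where ms: "simplifies \<delta> \<epsilon> ?G (stack_markings D1 D2) k ms" "list_all2 (contract_marking ?G) ms mz"
    using c unfolding composes_def by blast
  have "simplifies \<delta> \<epsilon> (vmap f ?G) (map (relabel f) (stack_markings D1 D2)) k (map (relabel f) ms)"
    using simp_steps_vmap[OF ms(1)] by (simp add: delete_loop_markings_vmap card_closed_loops_vmap)
  moreover have "list_all2 (contract_marking (vmap f ?G)) (map (relabel f) ms) (map (relabel f) mz)"
    using ms(2) contract_marking_vmap by (auto simp: list_all2_conv_all_nth)
  ultimately show ?thesis using result unfolding composes_def edges markings contract_edges_vmap by blast
qed

end

section \<open>Permutations of the rows of a stack\<close>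

abbreviation pinv :: "('a \<Rightarrow> 'b) \<Rightarrow> 'b \<Rightarrow> 'a" where
  "pinv \<equiv> inv_into UNIV"

fun tp :: "(nat \<Rightarrow> nat) \<Rightarrow> vertex \<Rightarrow> vertex" where
  "tp \<pi> (Top i) = Top (\<pi> i)"
| "tp \<pi> v = v"

fun bp :: "(nat \<Rightarrow> nat) \<Rightarrow> vertex \<Rightarrow> vertex" where
  "bp \<pi> (Bot i) = Bot (\<pi> i)"
| "bp \<pi> v = v"

fun mp :: "(nat \<Rightarrow> nat) \<Rightarrow> vertex \<Rightarrow> vertex" where
  "mp \<pi> (Mid i) = Mid (\<pi> i)"
| "mp \<pi> v = v"

lemma perm_outer [simp]: "tp \<pi> v \<in> outer \<longleftrightarrow> v \<in> outer" "bp \<pi> v \<in> outer \<longleftrightarrow> v \<in> outer" "mp \<pi> v \<in> outer \<longleftrightarrow> v \<in> outer"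
  by (cases v; simp)+

lemma perm_comp: "tp \<pi> \<circ> tp \<rho> = tp (\<pi> \<circ> \<rho>)" "bp \<pi> \<circ> bp \<rho> = bp (\<pi> \<circ> \<rho>)" "mp \<pi> \<circ> mp \<rho> = mp (\<pi> \<circ> \<rho>)"
  "tp \<pi> \<circ> bp \<rho> = bp \<rho> \<circ> tp \<pi>"
proof -
  have "tp \<pi> (tp \<rho> v) = tp (\<pi> \<circ> \<rho>) v" "bp \<pi> (bp \<rho> v) = bp (\<pi> \<circ> \<rho>) v" "mp \<pi> (mp \<rho> v) = mp (\<pi> \<circ> \<rho>) v"
    "tp \<pi> (bp \<rho> v) = bp \<rho> (tp \<pi> v)" for v by (cases v; simp)+
  then show "tp \<pi> \<circ> tp \<rho> = tp (\<pi> \<circ> \<rho>)" "bp \<pi> \<circ> bp \<rho> = bp (\<pi> \<circ> \<rho>)" "mp \<pi> \<circ> mp \<rho> = mp (\<pi> \<circ> \<rho>)"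
    "tp \<pi> \<circ> bp \<rho> = bp \<rho> \<circ> tp \<pi>" by (simp_all add: fun_eq_iff)
qed

lemma perm_id [simp]: "tp id = id" "bp id = id" "mp id = id"
proof -
  have "tp id v = v" "bp id v = v" "mp id v = v" for v by (cases v; simp)+
  then show "tp id = id" "bp id = id" "mp id = id" by (simp_all add: fun_eq_iff)
qed

lemma bij_perm:
  assumes "bij \<pi>" shows bij_tp: "bij (tp \<pi>)" and bij_bp: "bij (bp \<pi>)" and bij_mp: "bij (mp \<pi>)"
proof -
  have inv: "pinv \<pi> \<circ> \<pi> = id" "\<pi> \<circ> pinv \<pi> = id"
    using inv_o_cancel[OF bij_is_inj[OF assms]] surj_iff[THEN iffD1, OF bij_is_surj[OF assms]] by simp_all
  show "bij (tp \<pi>)" by (rule o_bij[of "tp (pinv \<pi>)"]) (simp_all only: perm_comp inv perm_id)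
  show "bij (bp \<pi>)" by (rule o_bij[of "bp (pinv \<pi>)"]) (simp_all only: perm_comp inv perm_id)
  show "bij (mp \<pi>)" by (rule o_bij[of "mp (pinv \<pi>)"]) (simp_all only: perm_comp inv perm_id)
qed

lemma dmap_id [simp]: "dmap id D = D"
proof -
  have "relabel id m = m" for m by (cases m) auto
  then show ?thesis by (cases D) (simp add: dmap_def vmap_def map_idI)
qed

lemma marked_dmap:
  assumes D: "D \<in> marked_brauer r s" and bij: "bij f"
    and top: "\<And>i. i \<in> {1..r} \<Longrightarrow> f (Top i) \<in> Top ` {1..r}" and bot: "\<And>i. i \<in> {1..s} \<Longrightarrow> f (Bot i) \<in> Bot ` {1..s}"
    and range: "\<And>v. f v \<in> range Top \<longleftrightarrow> v \<in> range Top" "\<And>v. f v \<in> range Bot \<longleftrightarrow> v \<in> range Bot"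
  shows "dmap f D \<in> marked_brauer r s"
proof -
  obtain X ms where D': "D = (X, ms)" "(X, ms) \<in> marked_brauer r s" using D by (cases D) auto
  then have X: "brauer_diagram r s X" by (simp add: marked_brauer_def)
  have inj: "inj f" using bij by (simp add: bij_def)
  have U: "\<Union>X = Top ` {1..r} \<union> Bot ` {1..s}" using X unfolding brauer_diagram_iff by (elim conjE)
  have "f ` (Top ` {1..r}) = Top ` {1..r}"
    by (rule endo_inj_surj) (use top in \<open>auto intro!: inj_on_subset[OF inj]\<close>)
  moreover have "f ` (Bot ` {1..s}) = Bot ` {1..s}"
    by (rule endo_inj_surj) (use bot in \<open>auto intro!: inj_on_subset[OF inj]\<close>)
  moreover have "\<Union>(vmap f X) = f ` \<Union>X" unfolding vmap_def by blast
  ultimately have "\<Union>(vmap f X) = Top ` {1..r} \<union> Bot ` {1..s}" unfolding U image_Un by simp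
  moreover have "card e = 2" if e: "e \<in> vmap f X" for e
  proof -
    obtain d where "d \<in> X" "e = f ` d" using e unfolding vmap_def by blast
    moreover from this have "card d = 2" using X unfolding brauer_diagram_iff by blast
    ultimately show ?thesis using card_image[OF inj_on_subset[OF inj subset_UNIV]] by simp
  qed
  moreover have "e = e'" if e: "e \<in> vmap f X" "e' \<in> vmap f X" "v \<in> e" "v \<in> e'" for e e' v
  proof -
    obtain d d' where d: "d \<in> X" "e = f ` d" "d' \<in> X" "e' = f ` d'" using e(1,2) unfolding vmap_def by blast
    then obtain u u' where u: "u \<in> d" "v = f u" "u' \<in> d'" "v = f u'" using e(3,4) by blast
    then have "u \<in> d'" using inj by (metis injD)
    moreover have "\<forall>e\<in>X. \<forall>f\<in>X. \<forall>v. v \<in> e \<longrightarrow> v \<in> f \<longrightarrow> e = f" using X unfolding brauer_diagram_iff by (elim conjE)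
    ultimately have "d = d'" using d(1,3) u(1) by blast
    then show ?thesis using d by simp
  qed
  ultimately have vX: "brauer_diagram r s (vmap f X)" unfolding brauer_diagram_iff by blast
  have iff: "f ` d \<subseteq> range Top \<longleftrightarrow> d \<subseteq> range Top" "f ` d \<subseteq> range Bot \<longleftrightarrow> d \<subseteq> range Bot" for d
    unfolding image_subset_iff range by blast+
  have "{e \<in> vmap f X. e \<subseteq> T} = vmap f {e \<in> X. f ` e \<subseteq> T}" for T unfolding vmap_def by auto
  then have cups: "cups (vmap f X) = vmap f (cups X)" and caps: "caps (vmap f X) = vmap f (caps X)"
    unfolding cups_def caps_def by (simp_all only: iff)
  have "distinct (map edge_of (map (relabel f) ms))"
  proof -
    have "map edge_of (map (relabel f) ms) = map (\<lambda>e. f ` e) (map edge_of ms)" by simp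
    moreover have "distinct (map edge_of ms)" using D'(2) by (simp add: marked_brauer_def)
    moreover have "inj_on (\<lambda>e. f ` e) A" for A using inj by (auto intro!: inj_onI simp: inj_image_eq_iff)
    ultimately show ?thesis by (metis distinct_map)
  qed
  moreover have "kind ` set (map (relabel f) ms) = {True} \<times> cups (vmap f X) \<union> {False} \<times> caps (vmap f X)"
  proof -
    have "kind (relabel f m) = map_prod id (\<lambda>e. f ` e) (kind m)" for m by (cases m) auto
    then have "kind ` set (map (relabel f) ms) = map_prod id (\<lambda>e. f ` e) ` kind ` set ms"
      by (auto simp: image_image)
    moreover have "kind ` set ms = {True} \<times> cups X \<union> {False} \<times> caps X"
      using D'(2) by (simp add: marked_brauer_iff_kind)
    moreover have "map_prod id (\<lambda>e. f ` e) ` ({b} \<times> A) = {b} \<times> (\<lambda>e. f ` e) ` A" for b :: bool and A by force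
    ultimately show ?thesis by (simp add: cups caps image_Un) (simp add: vmap_def)
  qed
  ultimately show ?thesis using vX unfolding D'(1) dmap_def marked_brauer_iff_kind by simp
qed

lemma marked_tp: "D \<in> marked_brauer r s \<Longrightarrow> \<pi> permutes {1..r} \<Longrightarrow> dmap (tp \<pi>) D \<in> marked_brauer r s"
proof (rule marked_dmap)
  fix v :: vertex
  show "tp \<pi> v \<in> range Top \<longleftrightarrow> v \<in> range Top" "tp \<pi> v \<in> range Bot \<longleftrightarrow> v \<in> range Bot" by (cases v; auto)+
next
  assume "\<pi> permutes {1..r}"
  then show "bij (tp \<pi>)" by (intro bij_tp permutes_bij)
  show "tp \<pi> (Top i) \<in> Top ` {1..r}" if "i \<in> {1..r}" for i
    using permutes_in_image[OF \<open>\<pi> permutes {1..r}\<close>, of i] that by auto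
qed auto

lemma marked_bp: "D \<in> marked_brauer r s \<Longrightarrow> \<pi> permutes {1..s} \<Longrightarrow> dmap (bp \<pi>) D \<in> marked_brauer r s"
proof (rule marked_dmap)
  fix v :: vertex
  show "bp \<pi> v \<in> range Top \<longleftrightarrow> v \<in> range Top" "bp \<pi> v \<in> range Bot \<longleftrightarrow> v \<in> range Bot" by (cases v; auto)+
next
  assume "\<pi> permutes {1..s}"
  then show "bij (bp \<pi>)" by (intro bij_bp permutes_bij)
  show "bp \<pi> (Bot i) \<in> Bot ` {1..s}" if "i \<in> {1..s}" for i
    using permutes_in_image[OF \<open>\<pi> permutes {1..s}\<close>, of i] that by auto
qed auto

lemma composes_tp:
  assumes D: "D1 \<in> marked_brauer r s" "D2 \<in> marked_brauer s t" and \<pi>: "\<pi> permutes {1..r}"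
    and c: "composes \<delta> \<epsilon> r t D1 D2 k mz"
  shows "composes \<delta> \<epsilon> r t (dmap (tp \<pi>) D1) D2 k (map (relabel (tp \<pi>)) mz)"
    and "contract_edges (stk (fst (dmap (tp \<pi>) D1)) (fst D2)) = vmap (tp \<pi>) (contract_edges (stk (fst D1) (fst D2)))"
proof -
  have bij: "bij (tp \<pi>)" using \<pi> by (intro bij_tp permutes_bij)
  have comm: "bot_to_mid (tp \<pi> v) = tp \<pi> (bot_to_mid v)" "tp \<pi> (top_to_mid v) = top_to_mid v" for v
    by (cases v; simp)+
  then have comm': "bot_to_mid \<circ> tp \<pi> = tp \<pi> \<circ> bot_to_mid" "tp \<pi> \<circ> top_to_mid = top_to_mid"
    by (auto simp: fun_eq_iff)
  have st: "stk (fst (dmap (tp \<pi>) D1)) (fst D2) = vmap (tp \<pi>) (stk (fst D1) (fst D2))"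
    by (simp add: stk_def vmap_def image_Un image_image image_comp comm comp_def)
  show "contract_edges (stk (fst (dmap (tp \<pi>) D1)) (fst D2)) = vmap (tp \<pi>) (contract_edges (stk (fst D1) (fst D2)))"
    unfolding st by (rule contract_edges_vmap[OF bij]) simp
  show "composes \<delta> \<epsilon> r t (dmap (tp \<pi>) D1) D2 k (map (relabel (tp \<pi>)) mz)"
  proof (rule composes_relabel[OF bij _ c st])
    show "stack_markings (dmap (tp \<pi>) D1) D2 = map (relabel (tp \<pi>)) (stack_markings D1 D2)"
      by (simp add: stack_markings_conv relabel_relabel comm')
    have "(contract_edges (stk (fst D1) (fst D2)), mz) \<in> marked_brauer r t"
      using c unfolding composes_def by blast
    from marked_tp[OF this \<pi>]
    show "(vmap (tp \<pi>) (contract_edges (stk (fst D1) (fst D2))), map (relabel (tp \<pi>)) mz) \<in> marked_brauer r t"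
      by (simp add: dmap_def)
  qed simp
qed

text \<open>Permuting the bottom of \<open>D1\<close> by \<open>\<pi>\<close>, or the top of
  \<open>D2\<close> by its inverse, gives stacks that differ only by the renaming
  \<open>mp \<pi>\<close> of middle vertices, and these are forgotten in the result.\<close>

lemma composes_bp:
  assumes D: "D1 \<in> marked_brauer r s" "D2 \<in> marked_brauer s t" and \<pi>: "\<pi> permutes {1..s}"
    and c: "composes \<delta> \<epsilon> r t D1 (dmap (tp (pinv \<pi>)) D2) k mz" shows "composes \<delta> \<epsilon> r t (dmap (bp \<pi>) D1) D2 k mz"
    and "contract_edges (stk (fst (dmap (bp \<pi>) D1)) (fst D2)) = contract_edges (stk (fst D1) (fst (dmap (tp (pinv \<pi>)) D2)))"
proof -
  have bij: "bij (mp \<pi>)" using \<pi> by (intro bij_mp permutes_bij)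
  have inv: "\<pi> (pinv \<pi> i) = i" for i by (rule permutes_inverses(1)[OF \<pi>])
  have comm: "bot_to_mid (bp \<pi> v) = mp \<pi> (bot_to_mid v)" "top_to_mid v = mp \<pi> (top_to_mid (tp (pinv \<pi>) v))"
    "mp \<pi> v = v" if "v \<in> outer" for v using that by (cases v; simp add: inv)+
  obtain X ms1 Y ms2 where D12: "D1 = (X, ms1)" "D2 = (Y, ms2)" by (cases D1; cases D2)
  have ms: "(X, ms1) \<in> marked_brauer r s" "(Y, ms2) \<in> marked_brauer s t" using D D12 by auto
  have XY: "brauer_diagram r s X" "brauer_diagram s t Y" using ms by (auto simp: marked_brauer_def)
  let ?G = "stk (fst D1) (fst (dmap (tp (pinv \<pi>)) D2))"
  let ?Z = "contract_edges ?G"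
  have Z: "(?Z, mz) \<in> marked_brauer r t" using c unfolding composes_def by blast
  then have BZ: "brauer_diagram r t ?Z" by (simp add: marked_brauer_def)
  have st: "stk (fst (dmap (bp \<pi>) D1)) (fst D2) = vmap (mp \<pi>) ?G"
  proof -
    have 1: "bot_to_mid ` bp \<pi> ` e = mp \<pi> ` bot_to_mid ` e" if "e \<in> X" for e
      using brauer_outer[OF XY(1) that] comm(1) unfolding image_image by (intro image_cong) auto
    have 2: "top_to_mid ` e = mp \<pi> ` top_to_mid ` tp (pinv \<pi>) ` e" if "e \<in> Y" for e
      using brauer_outer[OF XY(2) that] comm(2) unfolding image_image by (intro image_cong) auto
    have "(\<lambda>e. bot_to_mid ` bp \<pi> ` e) ` X = (\<lambda>e. mp \<pi> ` bot_to_mid ` e) ` X" by (intro image_cong refl 1)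
    moreover have "(\<lambda>e. top_to_mid ` e) ` Y = (\<lambda>e. mp \<pi> ` top_to_mid ` tp (pinv \<pi>) ` e) ` Y"
      by (intro image_cong refl 2)
    ultimately show ?thesis
      unfolding D12 stk_def vmap_def fst_dmap fst_conv image_Un image_image[of "\<lambda>e. _ ` e"] by simp
  qed
  have Zfix: "vmap (mp \<pi>) ?Z = ?Z"
  proof -
    have "mp \<pi> ` e = e" if "e \<in> ?Z" for e
      using brauer_outer[OF BZ that] comm(3) by (metis image_cong image_ident subsetD)
    then have "vmap (mp \<pi>) ?Z = (\<lambda>e. e) ` ?Z" unfolding vmap_def by (intro image_cong refl)
    then show ?thesis by simp
  qed
  show "contract_edges (stk (fst (dmap (bp \<pi>) D1)) (fst D2)) = ?Z"
    unfolding st using contract_edges_vmap[OF bij] Zfix by simp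
  have "map (relabel (mp \<pi>)) mz = map (relabel id) mz"
  proof (rule map_cong[OF refl], rule relabel_cong)
    fix m v assume "m \<in> set mz" "v \<in> edge_of m"
    then have "v \<in> outer" using marked_edge(1)[OF Z] brauer_outer[OF BZ] by blast
    then show "mp \<pi> v = id v" using comm(3) by simp
  qed
  moreover have "relabel id m = m" for m by (cases m) auto
  ultimately have mz: "map (relabel (mp \<pi>)) mz = mz" by (simp add: map_idI)
  have "composes \<delta> \<epsilon> r t (dmap (bp \<pi>) D1) D2 k (map (relabel (mp \<pi>)) mz)"
  proof (rule composes_relabel[OF bij _ c st])
    have "map (relabel bot_to_mid) (map (relabel (bp \<pi>)) ms1) = map (relabel (mp \<pi>)) (map (relabel bot_to_mid) ms1)"
      unfolding map_map
    proof (rule map_cong[OF refl], unfold comp_def relabel_relabel, rule relabel_cong)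
      fix m v assume "m \<in> set ms1" "v \<in> edge_of m"
      then have "v \<in> outer" using marked_edge(1)[OF ms(1)] brauer_outer[OF XY(1)] by blast
      then show "bot_to_mid (bp \<pi> v) = mp \<pi> (bot_to_mid v)" by (rule comm(1))
    qed
    moreover have "map (relabel top_to_mid) ms2 =
        map (relabel (mp \<pi>)) (map (relabel top_to_mid) (map (relabel (tp (pinv \<pi>))) ms2))" unfolding map_map
    proof (rule map_cong[OF refl], unfold comp_def relabel_relabel, rule relabel_cong)
      fix m v assume "m \<in> set ms2" "v \<in> edge_of m"
      then have "v \<in> outer" using marked_edge(1)[OF ms(2)] brauer_outer[OF XY(2)] by blast
      then show "top_to_mid v = mp \<pi> (top_to_mid (tp (pinv \<pi>) v))" by (rule comm(2))
    qed
    ultimately show "stack_markings (dmap (bp \<pi>) D1) D2 = map (relabel (mp \<pi>)) (stack_markings D1 (dmap (tp (pinv \<pi>)) D2))"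
      unfolding stack_markings_conv D12 snd_dmap snd_conv map_append by simp
    show "(vmap (mp \<pi>) ?Z, map (relabel (mp \<pi>)) mz) \<in> marked_brauer r t" using Z Zfix mz by simp
  qed simp
  then show "composes \<delta> \<epsilon> r t (dmap (bp \<pi>) D1) D2 k mz" by (simp only: mz)
qed

section \<open>Composition with the identity\<close>

lemma brauer_disjoint:
  assumes "brauer_diagram r s X" "e \<in> X" "f \<in> X" "v \<in> e" "v \<in> f" shows "e = f"
proof -
  have "\<forall>e\<in>X. \<forall>f\<in>X. \<forall>v. v \<in> e \<longrightarrow> v \<in> f \<longrightarrow> e = f" using assms(1) unfolding brauer_diagram_iff by (elim conjE)
  then show ?thesis using assms(2-5) by meson
qed

lemma identity_marked: "identity_diagram s \<in> marked_brauer s s"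
proof -
  have "brauer_diagram s s ((\<lambda>l. {Top l, Bot l}) ` {1..s})"
    unfolding brauer_diagram_iff by (auto simp: card_2_iff)
  moreover have "cups ((\<lambda>l. {Top l, Bot l}) ` {1..s}) = {}" "caps ((\<lambda>l. {Top l, Bot l}) ` {1..s}) = {}"
    by (auto simp: cups_def caps_def)
  ultimately show ?thesis by (simp add: identity_diagram_def marked_brauer_iff_kind)
qed

lemma composes_identity:
  assumes "(Y, ms2) \<in> marked_brauer s t"
  shows "composes \<delta> \<epsilon> s t (identity_diagram s) (Y, ms2) 1 ms2"
    and "contract_edges (stk (fst (identity_diagram s)) Y) = Y"
proof -
  define X where "X = (\<lambda>l. {Top l, Bot l}) ` {1..s}"
  have id: "identity_diagram s = (X, [])" by (simp add: identity_diagram_def X_def)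
  interpret stacked s s t X Y
    using assms identity_marked[of s] by unfold_locales (auto simp: marked_brauer_def id)
  have leg: "{Top i, Mid i} \<in> G" if "i \<in> {1..s}" for i
    using that by (auto simp: stk_def X_def intro!: image_eqI[of _ _ "{Top i, Bot i}"])
  define pre where "pre v = (case v of Top i \<Rightarrow> [Top i, Mid i] | _ \<Rightarrow> [v])" for v
  have path: "\<exists>p i. strand_path G p \<and> hd p = u \<and> last p = v \<and> i + 1 < length p \<and>
      p ! i = top_to_mid u \<and> p ! (i + 1) = top_to_mid v" if uv: "{u, v} \<in> Y" for u v
  proof -
    have e: "{top_to_mid u, top_to_mid v} \<in> G" using uv unfolding stk_edge by blast
    have ne: "u \<noteq> v" by (rule brauer_neq[OF Y uv])
    have vu: "{v, u} \<in> Y" using uv by (simp add: insert_commute)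
    have uv': "u \<in> Top ` {1..s} \<union> Bot ` {1..t}" "v \<in> Top ` {1..s} \<union> Bot ` {1..t}"
      using brauer_vertex(1)[OF Y uv] brauer_vertex(1)[OF Y vu] by auto
    consider i j where "u = Top i" "v = Top j" | i j where "u = Top i" "v = Bot j"
      | i j where "u = Bot i" "v = Top j" | i j where "u = Bot i" "v = Bot j" using uv' by blast
    then show ?thesis
    proof cases
      case (1 i j)
      then show ?thesis using e ne leg[of i] leg[of j] uv'
        by (intro exI[of _ "[Top i, Mid i, Mid j, Top j]"] exI[of _ 1]) (auto simp: strand_path_def insert_commute)
    next
      case (2 i j)
      then show ?thesis using e ne leg[of i] uv'
        by (intro exI[of _ "[Top i, Mid i, Bot j]"] exI[of _ 1]) (auto simp: strand_path_def insert_commute)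
    next
      case (3 i j)
      then show ?thesis using e ne leg[of j] uv'
        by (intro exI[of _ "[Bot i, Mid j, Top j]"] exI[of _ 0]) (auto simp: strand_path_def insert_commute)
    next
      case (4 i j)
      then show ?thesis using e ne
        by (intro exI[of _ "[Bot i, Bot j]"] exI[of _ 0]) (auto simp: strand_path_def insert_commute)
    qed
  qed
  have cont: "contract_edges G = Y"
  proof (rule contract_edges_eqI[OF thin_stk])
    show "Y \<subseteq> contract_edges G"
    proof
      fix e assume e: "e \<in> Y"
      obtain u v where uv: "e = {u, v}" "u \<noteq> v" using brauer_edge[OF Y e] .
      then obtain p i where p: "strand_path G p" "hd p = u" "last p = v" "i + 1 < length p"
        using path[of u v] e by blast
      have "u \<in> outer" "v \<in> outer" using brauer_outer[OF Y e] uv by auto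
      then have "strand G p" using p by (simp add: strand_def)
      then show "e \<in> contract_edges G" unfolding contract_edges_strand using p uv by blast
    qed
    show "\<exists>w. {v, w} \<in> Y" if "v \<in> \<Union>G" "v \<in> outer" for v
      using brauer_partner[OF Y stk_outer_vertex[OF that]] by metis
  qed
  then show "contract_edges (stk (fst (identity_diagram s)) Y) = Y" by (simp add: id)
  have loops: "closed_loops G = {}"
  proof (rule equals0I)
    fix C assume "C \<in> closed_loops G"
    then obtain v where v: "v \<in> \<Union>G" "C = linked G `` {v}" "C \<inter> outer = {}" unfolding closed_loops_outer by blast
    then have "v \<notin> outer" by auto
    then obtain i where i: "v = Mid i" by (cases v) auto
    obtain e where e: "e \<in> G" "Mid i \<in> e" using v(1) i by blast
    then obtain w where "{Mid i, w} \<in> G" by (metis insert_commute insert_iff singletonD stk_edgeE)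
    then have "i \<in> {1..s}" unfolding stk_edge
    proof (elim disjE exE conjE)
      fix a b assume ab: "{a, b} \<in> X" "Mid i = bot_to_mid a"
      then have "a = Bot i" using brauer_vertex(2)[OF X ab(1)] by (cases a) auto
      then show ?thesis using brauer_vertex(1)[OF X ab(1)] by auto
    next
      fix a b assume ab: "{a, b} \<in> Y" "Mid i = top_to_mid a"
      then have "a = Top i" using brauer_vertex(2)[OF Y ab(1)] by (cases a) auto
      then show ?thesis using brauer_vertex(1)[OF Y ab(1)] by auto
    qed
    then have "{Mid i, Top i} \<in> G" using leg by (simp add: insert_commute)
    then have "Top i \<in> C" using linked_edge v(2) i by auto
    then show False using v(3) by auto
  qed
  have start: "delete_loop_markings G (stack_markings (identity_diagram s) (Y, ms2)) = map (relabel top_to_mid) ms2"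
  proof -
    have "edge_of m \<noteq> {}" if "m \<in> set ms2" for m
      using marked_edge(1)[OF assms that] brauer_edge[OF Y] by (metis insert_not_empty)
    then show ?thesis
      unfolding stack_markings_conv delete_loop_markings_def loops by (simp add: id filter_id_conv)
  qed
  have contract: "contract_marking G (relabel top_to_mid m) m" if m: "m \<in> set ms2" for m
  proof (cases m)
    case (Bead e)
    have eY: "e \<in> Y" using marked_edge(1)[OF assms m] Bead by simp
    obtain u v where uv: "e = {u, v}" "u \<noteq> v" using brauer_edge[OF Y eY] .
    then obtain p i where p: "strand_path G p" "hd p = u" "last p = v" "i + 1 < length p"
      "p ! i = top_to_mid u" "p ! (i + 1) = top_to_mid v" using path[of u v] eY by blast
    have "u \<notin> range Mid" "v \<notin> range Mid" using brauer_outer[OF Y eY] uv by (auto simp: outer_iff)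
    then show ?thesis using contract_marking.bead[OF p(1) _ _ p(4)] p uv Bead by simp
  next
    case (Arrow u v)
    have eY: "{u, v} \<in> Y" using marked_edge(1)[OF assms m] Arrow by simp
    then obtain p i where p: "strand_path G p" "hd p = u" "last p = v" "i + 1 < length p"
      "p ! i = top_to_mid u" "p ! (i + 1) = top_to_mid v" using path[of u v] by blast
    have "u \<notin> range Mid" "v \<notin> range Mid" using brauer_outer[OF Y eY] by (auto simp: outer_iff)
    then show ?thesis using contract_marking.arrow[OF p(1) _ _ p(4)] p Arrow by simp
  qed
  show "composes \<delta> \<epsilon> s t (identity_diagram s) (Y, ms2) 1 ms2" unfolding composes_def
  proof (intro exI conjI)
    show "simplifies \<delta> \<epsilon> (stk (fst (identity_diagram s)) (fst (Y, ms2))) (stack_markings (identity_diagram s) (Y, ms2)) 1 (map (relabel top_to_mid) ms2)"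
      using start loops by (simp add: id del: stack_markings.simps)
    show "list_all2 (contract_marking (stk (fst (identity_diagram s)) (fst (Y, ms2)))) (map (relabel top_to_mid) ms2) ms2"
      using contract by (simp add: id list_all2_map1 list.rel_refl_strong)
    show "(contract_edges (stk (fst (identity_diagram s)) (fst (Y, ms2))), ms2) \<in> marked_brauer s t"
      using assms cont by (simp add: id)
  qed
qed

section \<open>Adding a cup and a cap\<close>

text \<open>Two edges of a matching are recombined. Applied to two through strings this creates a
  cup and a cap; applied to a cup and a cap it restores two through strings.\<close>

definition exch :: "vertex \<Rightarrow> vertex \<Rightarrow> vertex \<Rightarrow> vertex \<Rightarrow> vertex set set \<Rightarrow> vertex set set" where
  "exch u1 w1 u2 w2 X = X - {{u1, w1}, {u2, w2}} \<union> {{u1, u2}, {w1, w2}}"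

lemma exch_distinct:
  assumes X: "brauer_diagram r s X" and e: "{u1, w1} \<in> X" "{u2, w2} \<in> X" and ne: "u1 \<noteq> u2" "u1 \<noteq> w2"
  shows "u1 \<noteq> w1" "u2 \<noteq> w2" "w1 \<noteq> w2" "w1 \<noteq> u2"
proof -
  show "u1 \<noteq> w1" "u2 \<noteq> w2" using brauer_neq[OF X] e by blast+
  have e': "{w1, u1} \<in> X" "{w2, u2} \<in> X" using e by (simp_all add: insert_commute)
  show "w1 \<noteq> w2" using brauer_unique[OF X e'(1), of u2] e'(2) ne by blast
  show "w1 \<noteq> u2" using brauer_unique[OF X e'(1), of w2] e(2) ne by blast
qed

lemma brauer_exch:
  assumes X: "brauer_diagram r s X" and e: "{u1, w1} \<in> X" "{u2, w2} \<in> X" and ne: "u1 \<noteq> u2" "u1 \<noteq> w2"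
  shows "brauer_diagram r s (exch u1 w1 u2 w2 X)"
proof -
  note d = exch_distinct[OF assms]
  have U: "\<Union>X = Top ` {1..r} \<union> Bot ` {1..s}" and two: "\<And>e. e \<in> X \<Longrightarrow> card e = 2"
    using X unfolding brauer_diagram_iff by simp_all
  note un = brauer_disjoint[OF X]
  have union: "\<Union>(exch u1 w1 u2 w2 X) = \<Union>X" using e unfolding exch_def by blast
  have two': "card e = 2" if "e \<in> exch u1 w1 u2 w2 X" for e using that two d ne unfolding exch_def by auto
  have un': "e = f" if ef: "e \<in> exch u1 w1 u2 w2 X" "f \<in> exch u1 w1 u2 w2 X" "v \<in> e" "v \<in> f" for e f v
  proof -
    have old: "v \<notin> {u1, w1, u2, w2}" if "g \<in> X" "g \<noteq> {u1, w1}" "g \<noteq> {u2, w2}" "v \<in> g" for g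
      using un[OF that(1) e(1) that(4)] un[OF that(1) e(2) that(4)] that by blast
    have e': "e \<in> X \<and> e \<noteq> {u1, w1} \<and> e \<noteq> {u2, w2} \<or> e \<in> {{u1, u2}, {w1, w2}}"
      using ef(1) unfolding exch_def by (elim UnE DiffE) simp_all
    have f': "f \<in> X \<and> f \<noteq> {u1, w1} \<and> f \<noteq> {u2, w2} \<or> f \<in> {{u1, u2}, {w1, w2}}"
      using ef(2) unfolding exch_def by (elim UnE DiffE) simp_all
    consider "e \<in> X" "f \<in> X" | "e \<in> X" "e \<noteq> {u1, w1}" "e \<noteq> {u2, w2}" "f \<in> {{u1, u2}, {w1, w2}}"
      | "f \<in> X" "f \<noteq> {u1, w1}" "f \<noteq> {u2, w2}" "e \<in> {{u1, u2}, {w1, w2}}"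
      | "e \<in> {{u1, u2}, {w1, w2}}" "f \<in> {{u1, u2}, {w1, w2}}" using e' f' by argo
    then show ?thesis
    proof cases
      case 1
      then show ?thesis using un ef by blast
    next
      case 2
      then show ?thesis using old[of e] ef by auto
    next
      case 3
      then show ?thesis using old[of f] ef by auto
    next
      case 4
      then show ?thesis using ef(3,4) d ne by auto
    qed
  qed
  show ?thesis unfolding brauer_diagram_iff
  proof (intro conjI ballI allI impI)
    show "\<Union>(exch u1 w1 u2 w2 X) = Top ` {1..r} \<union> Bot ` {1..s}" using union U by simp
  qed (fact two', fact un')
qed

lemma exch_sym: "exch u1 w1 u2 w2 X = exch u2 w2 u1 w1 X"
  unfolding exch_def insert_commute[of "{u1, w1}"] insert_commute[of u1 u2] insert_commute[of w1 w2] ..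

text \<open>Joining \<open>u\<close> to \<open>b\<close> instead of its partner \<open>p\<close>
  amounts to renaming \<open>p\<close> and \<open>b\<close> into each other. This is why gluing at a
  vertex that already lies on a cup acts by a permutation only.\<close>

lemma exch_transpose:
  assumes X: "brauer_diagram r s X" and e: "{u, p} \<in> X" "{b, w} \<in> X" and ne: "u \<noteq> b" "u \<noteq> w"
  shows "vmap (trp p b) X = exch u p b w X"
proof -
  note d = exch_distinct[OF assms]
  have un: "e = f" if "e \<in> X" "f \<in> X" "v \<in> e" "v \<in> f" for e f v using that by (rule brauer_disjoint[OF X])
  let ?\<tau> = "trp p b"
  have t: "?\<tau> ` {u, p} = {u, b}" "?\<tau> ` {b, w} = {p, w}" using d ne by (auto simp: transpose_def)
  have fixed: "?\<tau> ` e = e" if "e \<in> X" "e \<noteq> {u, p}" "e \<noteq> {b, w}" for e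
  proof -
    have "p \<notin> e" "b \<notin> e" using un[OF that(1) e(1), of p] un[OF that(1) e(2), of b] that by auto
    then have "?\<tau> ` e = (\<lambda>v. v) ` e" by (intro image_cong refl) (auto simp: transpose_def)
    then show ?thesis by simp
  qed
  have "X = (X - {{u, p}, {b, w}}) \<union> {{u, p}, {b, w}}" using e by blast
  then have "vmap ?\<tau> X = (\<lambda>e. ?\<tau> ` e) ` (X - {{u, p}, {b, w}}) \<union> {?\<tau> ` {u, p}, ?\<tau> ` {b, w}}"
    unfolding vmap_def by (metis image_Un image_empty image_insert)
  also have "(\<lambda>e. ?\<tau> ` e) ` (X - {{u, p}, {b, w}}) = (\<lambda>e. e) ` (X - {{u, p}, {b, w}})"
    by (intro image_cong refl) (use fixed in blast)
  finally show ?thesis unfolding exch_def t by simp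
qed

lemma marked_exch:
  assumes D: "(X, ms) \<in> marked_brauer r s" and e: "{Top a, Bot c} \<in> X" "{Top b, Bot d} \<in> X" and ab: "a \<noteq> b"
    and A: "A = Arrow (Bot c) (Bot d) \<or> A = Arrow (Bot d) (Bot c)"
  shows "(exch (Top a) (Bot c) (Top b) (Bot d) X, Bead {Top a, Top b} # A # ms) \<in> marked_brauer r s"
proof -
  have X: "brauer_diagram r s X" using D by (simp add: marked_brauer_def)
  have kA: "kind A = (False, {Bot c, Bot d})" "edge_of A = {Bot c, Bot d}"
    using A by (auto simp: insert_commute)
  have d1: "{Top a, Top b} \<notin> X" using brauer_unique[OF X e(1), of "Top b"] by blast
  have d2: "{Bot c, Bot d} \<notin> X"
    using brauer_unique[OF X, of "Bot c" "Top a" "Bot d"] e(1) by (auto simp: insert_commute)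
  have X': "brauer_diagram r s (exch (Top a) (Bot c) (Top b) (Bot d) X)" using brauer_exch[OF X e] ab by simp
  have cups: "cups (exch (Top a) (Bot c) (Top b) (Bot d) X) = insert {Top a, Top b} (cups X)"
    and caps: "caps (exch (Top a) (Bot c) (Top b) (Bot d) X) = insert {Bot c, Bot d} (caps X)"
    by (auto simp: cups_def caps_def exch_def)
  have "distinct (map edge_of (Bead {Top a, Top b} # A # ms))"
    using D d1 d2 marked_edge(1)[OF D] kA by (auto simp: marked_brauer_def doubleton_eq_iff)
  moreover have "kind ` set (Bead {Top a, Top b} # A # ms) = {True} \<times> insert {Top a, Top b} (cups X) \<union> {False} \<times> insert {Bot c, Bot d} (caps X)"
    using D kA by (auto simp: marked_brauer_iff_kind)
  ultimately show ?thesis using X' cups caps by (simp add: marked_brauer_iff_kind)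
qed

locale lift = stacked r s t X Y for r s t X Y +
  fixes a b c d :: nat and ms1 ms2 :: "marking list" and A :: marking
  assumes ms1: "(X, ms1) \<in> marked_brauer r s" and ms2: "(Y, ms2) \<in> marked_brauer s t"
    and edges: "{Top a, Bot c} \<in> X" "{Top b, Bot d} \<in> X" and ab: "a \<noteq> b"
    and A: "A = Arrow (Bot c) (Bot d) \<or> A = Arrow (Bot d) (Bot c)"
begin

definition "R = stk (X - {{Top a, Bot c}, {Top b, Bot d}}) Y"

lemma X_unique: "e \<in> X \<Longrightarrow> f \<in> X \<Longrightarrow> v \<in> e \<Longrightarrow> v \<in> f \<Longrightarrow> e = f" by (rule brauer_disjoint[OF X])

lemma G_eq: "G = insert {Top a, Mid c} (insert {Top b, Mid d} R)"
proof -
  have "X = insert {Top a, Bot c} (insert {Top b, Bot d} (X - {{Top a, Bot c}, {Top b, Bot d}}))"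
    using edges by blast
  then have "(\<lambda>e. bot_to_mid ` e) ` X = insert {Top a, Mid c} (insert {Top b, Mid d}
      ((\<lambda>e. bot_to_mid ` e) ` (X - {{Top a, Bot c}, {Top b, Bot d}})))"
    by (metis (no_types, lifting) bot_to_mid.simps(1,2) image_empty image_insert)
  then show ?thesis unfolding R_def stk_def by (simp only: Un_insert_left)
qed

lemma H_eq: "stk (exch (Top a) (Bot c) (Top b) (Bot d) X) Y = insert {Top a, Top b} (insert {Mid c, Mid d} R)"
  by (simp add: R_def stk_def exch_def image_Un)

lemma cd: "c \<noteq> d" using exch_distinct(3)[OF X edges] ab by simp

lemma Top_fresh: "Top a \<notin> \<Union>R" "Top b \<notin> \<Union>R"
proof -
  have *: "Top i \<notin> \<Union>R" if i: "{Top i, w} \<in> {{Top a, Bot c}, {Top b, Bot d}}" for i w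
  proof
    assume "Top i \<in> \<Union>R"
    then consider e where "e \<in> X" "e \<notin> {{Top a, Bot c}, {Top b, Bot d}}" "Top i \<in> bot_to_mid ` e"
      | e where "Top i \<in> top_to_mid ` e" unfolding R_def stk_def by blast
    then show False
    proof cases
      case 1
      then obtain v where v: "v \<in> e" "Top i = bot_to_mid v" by blast
      then have "v = Top i" by (cases v) auto
      moreover have "{Top i, w} \<in> X" using i edges by (metis insertE singletonD)
      ultimately have "e = {Top i, w}" using X_unique[OF 1(1), of "{Top i, w}" "Top i"] v(1) by simp
      then show ?thesis using 1(2) i by metis
    next
      case 2
      then show ?thesis using top_to_mid_not_Top by (metis imageE)
    qed
  qed
  show "Top a \<notin> \<Union>R" "Top b \<notin> \<Union>R" using *[of a "Bot c"] *[of b "Bot d"] by simp_all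
qed

sublocale sg: surgery R "Top a" "Top b" "Mid c" "Mid d"
  using Top_fresh ab cd thin_stk unfolding G_eq by unfold_locales auto

lemma sg_G: "sg.G = G" and sg_H: "sg.H = stk (exch (Top a) (Bot c) (Top b) (Bot d) X) Y"
  unfolding sg.G_def sg.H_def G_eq H_eq by simp_all

abbreviation "X' \<equiv> exch (Top a) (Bot c) (Top b) (Bot d) X"
abbreviation "B \<equiv> Bead {Top a, Top b}"
abbreviation "start_ms \<equiv> stack_markings (X, ms1) (Y, ms2)"
abbreviation "A' \<equiv> relabel bot_to_mid A"

lemma start: "stack_markings (X', B # A # ms1) (Y, ms2) = B # A' # start_ms" by simp

lemma edge_A: "edge_of A' = {Mid c, Mid d}" using A by (auto simp: insert_commute)

lemma markings_in_R: "m \<in> set start_ms \<Longrightarrow> edge_of m \<in> R"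
proof -
  assume "m \<in> set start_ms"
  then consider k where "k \<in> set ms1" "m = relabel bot_to_mid k" | k where "k \<in> set ms2" "m = relabel top_to_mid k"
    by auto
  then show ?thesis
  proof cases
    case 1
    have "edge_of k \<in> X" "edge_of k \<subseteq> range Top \<or> edge_of k \<subseteq> range Bot"
      using marked_edge[OF ms1 1(1)] by (auto simp: cups_def caps_def)
    then have "edge_of k \<in> X - {{Top a, Bot c}, {Top b, Bot d}}" by auto
    then show ?thesis unfolding R_def stk_def using 1(2) by auto
  next
    case 2
    then show ?thesis unfolding R_def stk_def using marked_edge(1)[OF ms2 2(1)] by auto
  qed
qed

lemma start_in_R: "m \<in> set (delete_loop_markings G start_ms) \<Longrightarrow> edge_of m \<in> R"
  using markings_in_R by (simp add: delete_loop_markings_def del: stack_markings.simps)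

lemma B_not_R: "edge_of B \<notin> R" using Top_fresh by auto

end

lemma contract_edges_strandE:
  assumes "{u, w} \<in> contract_edges G"
  obtains p where "strand G (u # p)" "last p = w" "p \<noteq> []"
proof -
  obtain q where q: "strand G q" "{u, w} = {hd q, last q}" using assms unfolding contract_edges_strand by blast
  have ne: "q \<noteq> []" using q(1) by (auto simp: strand_def)
  have "\<exists>q. strand G q \<and> hd q = u \<and> last q = w"
  proof (cases "hd q = u \<and> last q = w")
    case False
    then have "hd (rev q) = u" "last (rev q) = w" using q(2) ne by (auto simp: hd_rev last_rev doubleton_eq_iff)
    then show ?thesis using strand_rev[OF q(1)] by blast
  qed (use q in blast)
  then obtain q where q: "strand G q" "hd q = u" "last q = w" by blast
  then obtain p where p: "q = u # p" "p \<noteq> []" by (cases q; cases "tl q") (auto simp: strand_def)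
  then show ?thesis using that q by simp
qed

lemma list_all2_partner: "list_all2 Q xs ys \<Longrightarrow> x \<in> set xs \<Longrightarrow> \<exists>y\<in>set ys. Q x y"
  by (metis in_set_conv_nth list_all2_conv_all_nth)

lemma tp_transpose: "tp (trp i j) = trp (Top i) (Top j)"
proof
  show "tp (trp i j) v = trp (Top i) (Top j) v" for v by (cases v) (auto simp: transpose_def)
qed

lemma simp_steps_scalar:
  assumes "(simp_step \<epsilon> K)\<^sup>*\<^sup>* x y" and "\<epsilon> * fst x = fst x" shows "fst y = fst x"
  using assms(1)
proof (induction rule: rtranclp_induct)
  case (step y z)
  from step.hyps(2) show ?case using assms(2) step.IH by cases auto
qed simp

context surgery
begin

lemma contract_new_cup: "contract_marking H (Bead {\<alpha>, \<beta>}) (Bead {\<alpha>, \<beta>})"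
  using contract_marking.bead[of H "[\<alpha>, \<beta>]" 0] strand_alpha_beta by (simp add: strand_def outer_iff)

end

context surgery_open
begin

lemma contract_on_P:
  assumes "contract_marking G m m'" "edge_of m = {P ! i, P ! (i + 1)}" "i + 1 < length P"
  shows "edge_of m' = {\<alpha>, last P}"
proof -
  obtain p j where p: "strand_path G p" "hd p \<in> outer" "last p \<in> outer" "j + 1 < length p"
    "edge_of m = {p ! j, p ! (j + 1)}" "edge_of m' = {hd p, last p}"
    using assms(1) by (cases rule: contract_marking.cases) (auto simp: outer_iff)
  then have sp: "strand G p" by (auto simp: strand_def)
  have "P ! i \<in> {p ! j, p ! (j + 1)}" using p(5) assms(2) by auto
  then have "P ! i \<in> set p" using p(4) nth_mem[of j p] nth_mem[of "j + 1" p] by auto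
  moreover have "P ! i \<in> set (\<alpha> # P)" using assms(3) by simp
  ultimately have "p = \<alpha> # P \<or> p = rev (\<alpha> # P)" using strands_meet[OF thin_G P sp] by blast
  then show ?thesis
  proof
    assume "p = rev (\<alpha> # P)"
    then have "hd p = last P" "last p = \<alpha>" using ne by (auto simp: hd_append hd_rev)
    then show ?thesis using p(6) by (simp add: insert_commute)
  qed (use p(6) ne in simp)
qed

end

context lift
begin

lemma loops_mid: "C \<in> closed_loops K \<Longrightarrow> C \<subseteq> range Mid" by (auto simp: closed_loops_def)

lemma open_setup:
  assumes "{Top a, p} \<in> contract_edges G" "{Top b, q} \<in> contract_edges G" "p \<noteq> Top b"
  obtains P Q where "surgery_open R (Top a) (Top b) (Mid c) (Mid d) P Q" "last P = p" "last Q = q"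
proof -
  obtain P where P: "strand G (Top a # P)" "last P = p" "P \<noteq> []" using contract_edges_strandE[OF assms(1)] .
  obtain Q where Q: "strand G (Top b # Q)" "last Q = q" "Q \<noteq> []" using contract_edges_strandE[OF assms(2)] .
  have "surgery_open R (Top a) (Top b) (Mid c) (Mid d) P Q"
    using P Q assms(3) sg.surgery_axioms by (simp add: surgery_open_def surgery_open_axioms_def sg_G)
  then show ?thesis using that P Q by blast
qed

lemma cover:
  assumes "brauer_diagram r t (contract_edges G)" "v \<in> \<Union>sg.G" "v \<in> outer"
  shows "\<exists>w. {v, w} \<in> contract_edges sg.G"
proof -
  have "v \<in> Top ` {1..r} \<union> Bot ` {1..t}" using stk_outer_vertex assms(2,3) unfolding sg_G by blast
  then show ?thesis using brauer_partner[OF assms(1)] unfolding sg_G by metis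
qed

lemma delete_open:
  assumes "surgery_open R (Top a) (Top b) (Mid c) (Mid d) P Q"
  shows "delete_loop_markings sg.H (B # A' # ms) = B # A' # delete_loop_markings sg.G ms"
    and "closed_loops sg.H = closed_loops sg.G"
proof -
  interpret so: surgery_open R "Top a" "Top b" "Mid c" "Mid d" P Q by (fact assms)
  show eq: "closed_loops sg.H = closed_loops sg.G" by (rule so.closed_loops_open)
  have 1: "\<not> edge_of B \<subseteq> \<Union>(closed_loops sg.G)" using loops_mid by fastforce
  have 2: "\<not> edge_of A' \<subseteq> \<Union>(closed_loops sg.G)" unfolding edge_A sg.closed_loops_G sg.loopsR_def by blast
  show "delete_loop_markings sg.H (B # A' # ms) = B # A' # delete_loop_markings sg.G ms"
    using 1 2 by (simp add: delete_loop_markings_def eq)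
qed

lemma composesE:
  assumes "composes \<delta> \<epsilon> r t (X, ms1) (Y, ms2) k mz"
  obtains ms where "simplifies \<delta> \<epsilon> sg.G start_ms k ms"
    "list_all2 (contract_marking sg.G) ms mz" "(contract_edges G, mz) \<in> marked_brauer r t"
    "brauer_diagram r t (contract_edges G)"
proof -
  obtain ms where ms: "simplifies \<delta> \<epsilon> sg.G start_ms k ms"
    "list_all2 (contract_marking sg.G) ms mz" "(contract_edges G, mz) \<in> marked_brauer r t"
    using assms unfolding composes_def sg_G fst_conv by (elim exE conjE)
  from ms(3) have "brauer_diagram r t (contract_edges G)" by (simp add: marked_brauer_def)
  then show ?thesis by (rule that[OF ms])
qed

lemma open_steps:
  assumes so: "surgery_open R (Top a) (Top b) (Mid c) (Mid d) P Q"
    and steps: "simplifies \<delta> \<epsilon> sg.G start_ms k ms"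
  shows "simplifies \<delta> \<epsilon> sg.H (stack_markings (X', B # A # ms1) (Y, ms2)) k (B # A' # ms)"
    and "\<And>m. m \<in> set ms \<Longrightarrow> edge_of m \<in> R"
proof -
  interpret so: surgery_open R "Top a" "Top b" "Mid c" "Mid d" P Q by (fact so)
  have pre: "edge_of m \<notin> R" if "m \<in> set [B, A']" for m using that B_not_R edge_A so.gamma_eta_not_R by auto
  have "(simp_step \<epsilon> sg.H)\<^sup>*\<^sup>* (\<delta> ^ card (closed_loops sg.G),
      [B, A'] @ delete_loop_markings sg.G start_ms) (k, [B, A'] @ ms) \<and> (\<forall>m\<in>set ms. edge_of m \<in> R)"
    using sg.simp_steps_H[OF steps _ pre] start_in_R unfolding sg_G snd_conv fst_conv by blast
  then show "simplifies \<delta> \<epsilon> sg.H (stack_markings (X', B # A # ms1) (Y, ms2)) k (B # A' # ms)"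
    "\<And>m. m \<in> set ms \<Longrightarrow> edge_of m \<in> R" unfolding start delete_open[OF so] by auto
qed

lemma composesI:
  assumes "simplifies \<delta> \<epsilon> sg.H (stack_markings (X', B # A # ms1) (Y, ms2)) k ms"
    "list_all2 (contract_marking sg.H) ms mz" "(contract_edges sg.H, mz) \<in> marked_brauer r t"
  shows "composes \<delta> \<epsilon> r t (X', B # A # ms1) (Y, ms2) k mz"
  unfolding composes_def fst_conv sg_H[symmetric] by (intro exI conjI) (fact assms)+

text \<open>Both strands run to the bottom and carry no marking in the old result. So nothing
  cancels against the new bead and arrow; they survive on a new cup and a new cap.\<close>

lemma lift_bot:
  assumes comp: "composes \<delta> \<epsilon> r t (X, ms1) (Y, ms2) k mz"
    and pq: "{Top a, Bot p} \<in> contract_edges G" "{Top b, Bot q} \<in> contract_edges G"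
    and fwd: "A = Arrow (Bot c) (Bot d)"
  shows "contract_edges (stk X' Y) = exch (Top a) (Bot p) (Top b) (Bot q) (contract_edges G)"
    and "composes \<delta> \<epsilon> r t (X', B # A # ms1) (Y, ms2) k (B # Arrow (Bot p) (Bot q) # mz)"
proof -
  obtain ms where ms: "simplifies \<delta> \<epsilon> sg.G start_ms k ms"
    "list_all2 (contract_marking sg.G) ms mz" "(contract_edges G, mz) \<in> marked_brauer r t"
    "brauer_diagram r t (contract_edges G)" using composesE[OF comp] .
  obtain P Q where so: "surgery_open R (Top a) (Top b) (Mid c) (Mid d) P Q" and PQ: "last P = Bot p" "last Q = Bot q"
    by (rule open_setup[OF pq]) auto
  interpret so: surgery_open R "Top a" "Top b" "Mid c" "Mid d" P Q by (fact so)
  show eq: "contract_edges (stk X' Y) = exch (Top a) (Bot p) (Top b) (Bot q) (contract_edges G)"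
    using so.contract_edges_open[OF cover[OF ms(4)]] unfolding sg_G sg_H PQ exch_def .
  have other: "contract_marking sg.H m m'" if "contract_marking sg.G m m'" "m' \<in> set mz" for m m'
  proof (rule sg.other_contract[OF that(1)])
    have e: "edge_of m' \<in> contract_edges G" "edge_of m' \<subseteq> range Top \<or> edge_of m' \<subseteq> range Bot"
      using marked_edge[OF ms(3) that(2)] by (auto simp: cups_def caps_def)
    have "Top a \<notin> edge_of m'"
    proof
      assume "Top a \<in> edge_of m'"
      then have "edge_of m' = {Top a, Bot p}" by (intro brauer_disjoint[OF ms(4) e(1) pq(1)]) auto
      then show False using e(2) by auto
    qed
    moreover have "Top b \<notin> edge_of m'"
    proof
      assume "Top b \<in> edge_of m'"
      then have "edge_of m' = {Top b, Bot q}" by (intro brauer_disjoint[OF ms(4) e(1) pq(2)]) auto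
      then show False using e(2) by auto
    qed
    ultimately show "edge_of m' \<inter> {Top a, Top b} = {}" by blast
  qed
  show "composes \<delta> \<epsilon> r t (X', B # A # ms1) (Y, ms2) k (B # Arrow (Bot p) (Bot q) # mz)"
  proof (rule composesI[OF open_steps(1)[OF so ms(1)]])
    have "list_all2 (contract_marking sg.H) ms mz" using ms(2) other by (auto simp: list_all2_conv_all_nth)
    moreover have "contract_marking sg.H A' (Arrow (Bot p) (Bot q))"
      using so.joined_contract_arrow PQ fwd by simp
    ultimately show "list_all2 (contract_marking sg.H) (B # A' # ms) (B # Arrow (Bot p) (Bot q) # mz)"
      using sg.contract_new_cup by simp
    show "(contract_edges sg.H, B # Arrow (Bot p) (Bot q) # mz) \<in> marked_brauer r t"
      unfolding sg_H eq by (rule marked_exch[OF ms(3) pq ab]) simp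
  qed
qed

text \<open>The strand from \<open>a\<close> returns to the top and carries a bead, required to come
  first so that it is adjacent to the new arrow. The two cancel, with \<epsilon> when the arrow
  points away from that bead, and the new bead takes its place. By \<open>exch_transpose\<close>
  only the names \<open>p\<close> and \<open>b\<close> are exchanged.\<close>

lemma lift_cup:
  assumes comp: "composes \<delta> \<epsilon> r t (X, ms1) (Y, ms2) k mz"
    and mz: "mz = Bead {Top a, Top p} # vs" and pb: "p \<noteq> b"
  shows "contract_edges (stk X' Y) = vmap (tp (trp p b)) (contract_edges G)"
    and "composes \<delta> \<epsilon> r t (X', B # A # ms1) (Y, ms2) ((if A = Arrow (Bot c) (Bot d) then \<epsilon> else 1) * k)
      (map (relabel (tp (trp p b))) mz)"
proof -
  obtain ms where ms: "simplifies \<delta> \<epsilon> sg.G start_ms k ms"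
    "list_all2 (contract_marking sg.G) ms mz" "(contract_edges G, mz) \<in> marked_brauer r t"
    "brauer_diagram r t (contract_edges G)" using composesE[OF comp] .
  let ?Z = "contract_edges G"
  let ?\<tau> = "tp (trp p b)"
  have ap: "{Top a, Top p} \<in> ?Z" using marked_edge(1)[OF ms(3), of "Bead {Top a, Top p}"] mz by simp
  have bX: "Top b \<in> Top ` {1..r} \<union> Bot ` {1..t}" using brauer_vertex(1)[OF X edges(2)] by auto
  obtain w where bw: "{Top b, w} \<in> ?Z" using brauer_partner[OF ms(4) bX] by metis
  obtain P Q where so: "surgery_open R (Top a) (Top b) (Mid c) (Mid d) P Q" and PQ: "last P = Top p" "last Q = w"
    by (rule open_setup[OF ap bw]) (use pb in auto)
  interpret so: surgery_open R "Top a" "Top b" "Mid c" "Mid d" P Q by (fact so)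
  have aw: "Top a \<noteq> w"
    using brauer_unique[OF ms(4), of "Top a" "Top p" "Top b"] ap bw pb by (auto simp: insert_commute)
  note dist = exch_distinct[OF ms(4) ap bw _ aw]
  have ex: "exch (Top a) (Top p) (Top b) w ?Z = vmap ?\<tau> ?Z"
    using exch_transpose[OF ms(4) ap bw _ aw] ab by (simp add: tp_transpose)
  show eq: "contract_edges (stk X' Y) = vmap ?\<tau> ?Z"
    using so.contract_edges_open[OF cover[OF ms(4)]] ex unfolding sg_G sg_H PQ exch_def by simp
  obtain m0 rest where rest: "ms = m0 # rest" "contract_marking sg.G m0 (Bead {Top a, Top p})"
    "list_all2 (contract_marking sg.G) rest vs" using ms(2) unfolding mz by (auto simp: list_all2_Cons2)
  then obtain e0 where e0: "m0 = Bead e0" by (auto elim: contract_marking.cases)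
  note inR = open_steps(2)[OF so ms(1)]
  have distinct: "edge_of m' \<noteq> {Top a, Top p}" if "m' \<in> set vs" for m'
  proof -
    have "distinct (map edge_of mz)" using ms(3) by (simp add: marked_brauer_def)
    then have "{Top a, Top p} \<notin> edge_of ` set vs" unfolding mz by simp
    then show ?thesis using that by (metis imageI)
  qed
  have fac: "facing sg.H ([B] @ rest) (Mid d) (Mid c) e0"
  proof (rule so.facing_joined)
    show "contract_marking sg.G (Bead e0) (Bead {Top a, last P})" using rest(2) e0 PQ by simp
    show "e0 \<in> R" using inR[of m0] rest(1) e0 by simp
    fix m i assume m: "m \<in> set ([B] @ rest)" and i: "i + 1 < length P"
    show "edge_of m \<noteq> {P ! i, P ! (i + 1)}"
    proof
      assume eqm: "edge_of m = {P ! i, P ! (i + 1)}"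
      show False
      proof (cases "m = B")
        case True
        then have "edge_of B \<in> R" using eqm strand_path_edge[OF so.path_P i] by simp
        then show ?thesis using B_not_R by blast
      next
        case False
        then obtain m' where "m' \<in> set vs" "contract_marking sg.G m m'"
          using m list_all2_partner[OF rest(3), of m] by auto
        then show ?thesis using so.contract_on_P[OF _ eqm i] distinct PQ(1) by metis
      qed
    qed
  qed
  have step: "simp_step \<epsilon> sg.H (k, B # A' # ms) ((if A = Arrow (Bot c) (Bot d) then \<epsilon> else 1) * k, B # rest)"
  proof (cases "A = Arrow (Bot c) (Bot d)")
    case True
    then show ?thesis using simp_step.arrow_above_away[OF fac, of \<epsilon> k] rest(1) e0 by simp
  next
    case False
    then have "A' = Arrow (Mid d) (Mid c)" using A by auto
    then show ?thesis using simp_step.arrow_above_toward[OF fac, of \<epsilon> k] rest(1) e0 False by simp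
  qed
  have contract: "contract_marking sg.H m (relabel ?\<tau> m')"
    if cm: "contract_marking sg.G m m'" and m: "m \<in> set rest" and m': "m' \<in> set vs" for m m'
  proof -
    have m'Z: "edge_of m' \<in> ?Z" and kinds: "edge_of m' \<in> cups ?Z \<or> edge_of m' \<in> caps ?Z"
      using marked_edge[OF ms(3), of m'] m' mz by auto
    have a: "Top a \<notin> edge_of m'" "Top p \<notin> edge_of m'"
      using brauer_disjoint[OF ms(4) m'Z ap, of "Top a"] brauer_disjoint[OF ms(4) m'Z ap, of "Top p"] distinct[OF m'] by auto
    show ?thesis
    proof (cases "Top b \<in> edge_of m'")
      case True
      then have e: "edge_of m' = {Top b, w}" by (intro brauer_disjoint[OF ms(4) m'Z bw]) auto
      have "m' = Bead {Top b, w}"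
      proof (cases m')
        case (Arrow u v)
        then have "{u, v} \<subseteq> range Bot" using marked_arrow(3,4)[OF ms(3), of u v] m' mz by auto
        then show ?thesis using True Arrow by auto
      qed (use e in simp)
      moreover have "contract_marking sg.H m (Bead {last P, last Q})"
        using so.joined_contract[of m] cm calculation PQ inR[of m] m rest(1) by simp
      moreover have "?\<tau> ` {Top b, w} = {Top p, w}"
        using dist ab a(2) e by (auto simp: tp_transpose transpose_def)
      ultimately show ?thesis using PQ by simp
    next
      case False
      have "relabel ?\<tau> m' = relabel id m'"
        by (rule relabel_cong) (use a False in \<open>auto simp: tp_transpose transpose_def\<close>)
      moreover have "relabel id m' = m'" by (cases m') auto
      moreover have "contract_marking sg.H m m'" using sg.other_contract[OF cm] a False by auto
      ultimately show ?thesis by simp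
    qed
  qed
  show "composes \<delta> \<epsilon> r t (X', B # A # ms1) (Y, ms2) ((if A = Arrow (Bot c) (Bot d) then \<epsilon> else 1) * k) (map (relabel ?\<tau>) mz)"
  proof (rule composesI)
    show "simplifies \<delta> \<epsilon> sg.H (stack_markings (X', B # A # ms1) (Y, ms2)) ((if A = Arrow (Bot c) (Bot d) then \<epsilon> else 1) * k) (B # rest)"
      using open_steps(1)[OF so ms(1)] step by (rule rtranclp.rtrancl_into_rtrancl)
    have "list_all2 (contract_marking sg.H) rest (map (relabel ?\<tau>) vs)"
      using rest(3) contract by (auto simp: list_all2_conv_all_nth)
    moreover have "relabel ?\<tau> (Bead {Top a, Top p}) = B"
      using dist ab by (auto simp: tp_transpose transpose_def)
    ultimately show "list_all2 (contract_marking sg.H) (B # rest) (map (relabel ?\<tau>) mz)"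
      using sg.contract_new_cup unfolding mz by simp
    have "Top p \<in> Top ` {1..r} \<union> Bot ` {1..t}"
      using brauer_vertex(1)[OF ms(4), of "Top p" "Top a"] ap by (simp add: insert_commute)
    then have "trp p b permutes {1..r}" using bX by (intro permutes_swap_id) auto
    from marked_tp[OF ms(3) this]
    show "(contract_edges sg.H, map (relabel ?\<tau>) mz) \<in> marked_brauer r t"
      unfolding sg_H eq by (simp add: dmap_def)
  qed
qed

text \<open>The cap closes the strand between \<open>a\<close> and \<open>b\<close> into a loop,
  which takes the new arrow and the old bead with it; the new bead replaces the old one, and the
  loop costs \<delta>.\<close>

lemma lift_loop:
  fixes \<delta> \<epsilon> :: "'k::field" assumes param: "\<epsilon> = 1 \<or> \<delta> = 0" and comp: "composes \<delta> \<epsilon> r t (X, ms1) (Y, ms2) k mz"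
    and mz: "mz = Bead {Top a, Top b} # vs" shows "contract_edges (stk X' Y) = contract_edges G"
    and "composes \<delta> \<epsilon> r t (X', B # A # ms1) (Y, ms2) (\<delta> * k) mz"
proof -
  obtain ms where ms: "simplifies \<delta> \<epsilon> sg.G start_ms k ms"
    "list_all2 (contract_marking sg.G) ms mz" "(contract_edges G, mz) \<in> marked_brauer r t"
    "brauer_diagram r t (contract_edges G)" using composesE[OF comp] .
  let ?Z = "contract_edges G"
  have abZ: "{Top a, Top b} \<in> ?Z" using marked_edge(1)[OF ms(3), of "Bead {Top a, Top b}"] mz by simp
  then obtain P where P: "strand G (Top a # P)" "last P = Top b" "P \<noteq> []" by (rule contract_edges_strandE)
  interpret sl: surgery_loop R "Top a" "Top b" "Mid c" "Mid d" P
    using P sg.surgery_axioms by (simp add: surgery_loop_def surgery_loop_axioms_def sg_G)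
  show eq: "contract_edges (stk X' Y) = ?Z"
    using sl.contract_edges_loop[OF cover[OF ms(4)]] unfolding sg_G sg_H .
  let ?L = "card (closed_loops sg.G)"
  have card: "card (closed_loops sg.H) = Suc ?L"
    using sl.closed_loops_loop finite_closed_loops unfolding sg_G by simp
  have d: "\<epsilon> * (\<delta> * \<delta> ^ ?L) = \<delta> * \<delta> ^ ?L" using param by auto
  \<comment> \<open>For \<epsilon> = 1 no step changes the scalar; otherwise \<delta> = 0 and both
    sides vanish.\<close>
  have k: "\<delta> * k = \<delta> * \<delta> ^ ?L" using param simp_steps_scalar[OF ms(1)] by auto
  let ?f = "filter (\<lambda>m. \<not> edge_of m \<subseteq> sl.W)"
  have start': "delete_loop_markings sg.H (stack_markings (X', B # A # ms1) (Y, ms2)) =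
      [B] @ ?f (delete_loop_markings sg.G start_ms)"
  proof -
    have "\<not> edge_of B \<subseteq> \<Union>(closed_loops sg.H)" using loops_mid by fastforce
    moreover have "edge_of A' \<subseteq> \<Union>(closed_loops sg.H)"
      using sl.gamma_in sl.eta_in sl.closed_loops_loop(1) sl.W_eq edge_A by auto
    moreover have "edge_of m \<subseteq> \<Union>(closed_loops sg.H) \<longleftrightarrow> edge_of m \<subseteq> \<Union>(closed_loops sg.G) \<or> edge_of m \<subseteq> sl.W"
      if m: "m \<in> set start_ms" for m
    proof -
      have "edge_of m \<in> R" by (rule markings_in_R[OF m])
      then have "edge_of m \<in> G" using sg.R_sub(1) sg_G by blast
      then obtain x y where xy: "edge_of m = {x, y}" using stk_edgeE by metis
      have *: "u' \<in> \<Union>(closed_loops sg.G)" if "u \<in> \<Union>(closed_loops sg.G)" "{u, u'} \<in> sg.G" for u u'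
      proof -
        obtain C v where C: "C \<in> closed_loops sg.G" "u \<in> C" "C = linked sg.G `` {v}"
          using \<open>u \<in> \<Union>(closed_loops sg.G)\<close> unfolding closed_loops_def by blast
        then have "u' \<in> C" using linked_trans[of v u sg.G u'] linked_edge[OF that(2)] by simp
        then show ?thesis using C(1) by blast
      qed
      have "{x, y} \<in> sg.G" "{y, x} \<in> sg.G" "{x, y} \<in> R" "{y, x} \<in> R"
        using \<open>edge_of m \<in> G\<close> \<open>edge_of m \<in> R\<close> xy sg_G by (simp_all add: insert_commute)
      then have "x \<in> \<Union>(closed_loops sg.G) \<longleftrightarrow> y \<in> \<Union>(closed_loops sg.G)" "x \<in> sl.W \<longleftrightarrow> y \<in> sl.W"
        using *[of x y] *[of y x] sl.W_closed[of x y] sl.W_closed[of y x] by blast+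
      then show ?thesis unfolding xy sl.closed_loops_loop(1) by simp blast
    qed
    ultimately show ?thesis
      unfolding start delete_loop_markings_def by (simp add: filter_filter del: stack_markings.simps cong: filter_cong)
  qed
  have steps: "simplifies \<delta> \<epsilon> sg.H (stack_markings (X', B # A # ms1) (Y, ms2)) (\<delta> * k) ([B] @ ?f ms)"
    and inR: "\<And>m. m \<in> set ms \<Longrightarrow> edge_of m \<in> R"
  proof -
    have pre: "edge_of m \<notin> R" if "m \<in> set [B]" for m using that B_not_R by auto
    have inR0: "edge_of m \<in> R" if "m \<in> set (snd (\<delta> ^ ?L, delete_loop_markings sg.G start_ms))" for m
      using that start_in_R unfolding sg_G snd_conv by blast
    have *: "(simp_step \<epsilon> sg.H)\<^sup>*\<^sup>* (\<delta> * \<delta> ^ ?L, [B] @ ?f (snd (\<delta> ^ ?L, delete_loop_markings sg.G start_ms)))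
       (\<delta> * \<delta> ^ ?L, [B] @ ?f (snd (k, ms))) \<and> (\<forall>m\<in>set (snd (k, ms)). edge_of m \<in> R)"
      by (rule sg.simp_steps_H_filter[OF ms(1)]) (fact inR0, fact pre, fact sl.W_closed, fact d)
    show "simplifies \<delta> \<epsilon> sg.H (stack_markings (X', B # A # ms1) (Y, ms2)) (\<delta> * k) ([B] @ ?f ms)"
      using * unfolding start' card k snd_conv power_Suc by (rule conjunct1)
    show "\<And>m. m \<in> set ms \<Longrightarrow> edge_of m \<in> R" using * by simp
  qed
  obtain m0 rest where rest: "ms = m0 # rest" "contract_marking sg.G m0 (Bead {Top a, Top b})"
    "list_all2 (contract_marking sg.G) rest vs" using ms(2) unfolding mz by (auto simp: list_all2_Cons2)
  have distinct: "edge_of m' \<noteq> {Top a, Top b}" if "m' \<in> set vs" for m'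
  proof -
    have "distinct (map edge_of mz)" using ms(3) by (simp add: marked_brauer_def)
    then have "{Top a, Top b} \<notin> edge_of ` set vs" unfolding mz by simp
    then show ?thesis using that by (metis imageI)
  qed
  have "edge_of m0 \<subseteq> sl.W" using sl.contract_alpha_beta[OF rest(2)] inR rest(1) by simp
  moreover have "\<not> edge_of m \<subseteq> sl.W" if m: "m \<in> set rest" for m
  proof -
    obtain m' where "m' \<in> set vs" "contract_marking sg.G m m'" using list_all2_partner[OF rest(3) m] by blast
    then show ?thesis using sl.contract_alpha_beta[of m m'] inR[of m] rest(1) m distinct by auto
  qed
  ultimately have f: "?f ms = rest" unfolding rest(1) by (simp add: filter_id_conv)
  have contract: "contract_marking sg.H m m'"
    if cm: "contract_marking sg.G m m'" and m': "m' \<in> set vs" for m m'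
  proof (rule sg.other_contract[OF cm])
    have m'Z: "edge_of m' \<in> ?Z" using marked_edge(1)[OF ms(3), of m'] m' mz by auto
    show "edge_of m' \<inter> {Top a, Top b} = {}"
      using brauer_disjoint[OF ms(4) m'Z abZ, of "Top a"] brauer_disjoint[OF ms(4) m'Z abZ, of "Top b"] distinct[OF m']
      by auto
  qed
  show "composes \<delta> \<epsilon> r t (X', B # A # ms1) (Y, ms2) (\<delta> * k) mz"
  proof (rule composesI[OF steps])
    have "list_all2 (contract_marking sg.H) rest vs"
      using rest(3) contract by (auto simp: list_all2_conv_all_nth)
    then show "list_all2 (contract_marking sg.H) ([B] @ ?f ms) mz"
      unfolding f mz using sg.contract_new_cup by simp
    show "(contract_edges sg.H, mz) \<in> marked_brauer r t" unfolding sg_H eq by (rule ms(3))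
  qed
qed

end

section \<open>Existence of simplifications\<close>

lemma simp_steps_scale:
  assumes "(simp_step \<epsilon> K)\<^sup>*\<^sup>* x y"
  shows "(simp_step \<epsilon> K)\<^sup>*\<^sup>* (e * fst x, snd x) (e * fst y, snd y)" using assms
proof (induction rule: rtranclp_induct)
  case (step y z)
  from step.hyps(2) have "simp_step \<epsilon> K (e * fst y, snd y) (e * fst z, snd z)"
  proof cases
    case (interchange c xs a b ys)
    then show ?thesis using simp_step.interchange[of \<epsilon> K "e * c" xs a b ys] by (simp add: mult.left_commute)
  next
    case (arrow_above_toward xs ys u v e' c)
    then show ?thesis using simp_step.arrow_above_toward[OF arrow_above_toward(3), of \<epsilon> "e * c"] by simp
  next
    case (arrow_above_away xs ys u v e' c)
    then show ?thesis
      using simp_step.arrow_above_away[OF arrow_above_away(3), of \<epsilon> "e * c"] by (simp add: mult.left_commute)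
  next
    case (bead_above_away xs ys u v e' c)
    then show ?thesis using simp_step.bead_above_away[OF bead_above_away(3), of \<epsilon> "e * c"] by simp
  next
    case (bead_above_toward xs ys u v e' c)
    then show ?thesis
      using simp_step.bead_above_toward[OF bead_above_toward(3), of \<epsilon> "e * c"] by (simp add: mult.left_commute)
  qed
  then show ?case by (rule rtranclp.rtrancl_into_rtrancl[OF step.IH])
qed simp

lemma simp_step_front: "simp_step \<epsilon> K (c, xs @ a # b # ys) (\<epsilon> * c, xs @ b # a # ys)"
  by (rule simp_step.interchange)

lemma simp_steps_move: "\<exists>e. \<forall>c. (simp_step \<epsilon> K)\<^sup>*\<^sup>* (c, zs @ m # xs @ ys) (e * c, zs @ xs @ m # ys)"
proof (induction xs arbitrary: zs)
  case Nil
  show ?case by (rule exI[of _ 1]) simp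
next
  case (Cons x xs)
  obtain e where e: "\<And>c. (simp_step \<epsilon> K)\<^sup>*\<^sup>* (c, (zs @ [x]) @ m # xs @ ys) (e * c, (zs @ [x]) @ xs @ m # ys)"
    using Cons.IH[of "zs @ [x]"] by blast
  have "(simp_step \<epsilon> K)\<^sup>*\<^sup>* (c, zs @ m # (x # xs) @ ys) (e * (\<epsilon> * c), zs @ (x # xs) @ m # ys)" for c
  proof -
    have "simp_step \<epsilon> K (c, zs @ m # x # xs @ ys) (\<epsilon> * c, zs @ x # m # xs @ ys)" by (rule simp_step_front)
    moreover have "(simp_step \<epsilon> K)\<^sup>*\<^sup>* (\<epsilon> * c, zs @ x # m # xs @ ys) (e * (\<epsilon> * c), zs @ x # xs @ m # ys)"
      using e[of "\<epsilon> * c"] by simp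
    ultimately show ?thesis by (simp add: converse_rtranclp_into_rtranclp)
  qed
  then show ?case by (intro exI[of _ "e * \<epsilon>"]) (simp add: mult.assoc)
qed

text \<open>The factor \<open>e\<close> depends on the two lists but not on the scalar in front, so
  the reordering can be inserted before a known simplification.\<close>

lemma simp_steps_mset: "mset xs = mset ys \<Longrightarrow> \<exists>e. \<forall>c. (simp_step \<epsilon> K)\<^sup>*\<^sup>* (c, zs @ xs) (e * c, zs @ ys)"
proof (induction xs arbitrary: ys zs)
  case Nil
  then show ?case by (intro exI[of _ 1]) simp
next
  case (Cons x xs)
  then have "x \<in> set ys" by (metis list.set_intros(1) set_mset_mset)
  then obtain us vs where ys: "ys = us @ x # vs" by (auto dest: split_list)
  then have "mset xs = mset (us @ vs)" using Cons.prems by simp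
  from Cons.IH[OF this, of "zs @ [x]"] obtain e where
    e: "\<And>c. (simp_step \<epsilon> K)\<^sup>*\<^sup>* (c, zs @ x # xs) (e * c, zs @ x # us @ vs)" by auto
  obtain e' where e': "\<And>c. (simp_step \<epsilon> K)\<^sup>*\<^sup>* (c, zs @ x # us @ vs) (e' * c, zs @ us @ x # vs)"
    using simp_steps_move by blast
  have "(simp_step \<epsilon> K)\<^sup>*\<^sup>* (c, zs @ x # xs) (e' * (e * c), zs @ us @ x # vs)" for c
    using rtranclp_trans[OF e[of c] e'[of "e * c"]] .
  then show ?case unfolding ys by (intro exI[of _ "e' * e"]) (simp add: mult.assoc)
qed

lemma composes_mset:
  assumes c: "composes \<delta> \<epsilon> r t (X, ms) D k mz" and eq: "mset ms' = mset ms"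
  shows "\<exists>k'. composes \<delta> \<epsilon> r t (X, ms') D k' mz"
proof -
  let ?G = "stk X (fst D)"
  let ?del = "delete_loop_markings ?G"
  obtain ns where ns: "(simp_step \<epsilon> ?G)\<^sup>*\<^sup>* (\<delta> ^ card (closed_loops ?G), ?del (stack_markings (X, ms) D)) (k, ns)"
     "list_all2 (contract_marking ?G) ns mz" "(contract_edges ?G, mz) \<in> marked_brauer r t"
    using c unfolding composes_def fst_conv by blast
  have "mset (?del (stack_markings (X, ms') D)) = mset (?del (stack_markings (X, ms) D))"
    unfolding stack_markings_conv delete_loop_markings_def using eq by (simp add: mset_filter)
  then obtain e where e: "\<And>c. (simp_step \<epsilon> ?G)\<^sup>*\<^sup>* (c, ?del (stack_markings (X, ms') D)) (e * c, ?del (stack_markings (X, ms) D))"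
    using simp_steps_mset[of _ _ \<epsilon> ?G "[]"] by (metis append_Nil)
  have "(simp_step \<epsilon> ?G)\<^sup>*\<^sup>* (e * \<delta> ^ card (closed_loops ?G), ?del (stack_markings (X, ms) D)) (e * k, ns)"
    using simp_steps_scale[OF ns(1), of e] by simp
  then have "(simp_step \<epsilon> ?G)\<^sup>*\<^sup>* (\<delta> ^ card (closed_loops ?G), ?del (stack_markings (X, ms') D)) (e * k, ns)"
    by (rule rtranclp_trans[OF e])
  then show ?thesis unfolding composes_def fst_conv using ns(2,3) by blast
qed

text \<open>Without caps every bottom vertex is joined to a top vertex; as both rows have
  \<open>r\<close> vertices, this is a bijection and leaves no cup. It is the base of the inductions
  on the number of caps.\<close>

lemma no_caps_permutation:
  assumes X: "(X, ms) \<in> marked_brauer r r" and caps: "caps X = {}"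
  shows "\<exists>\<pi>. \<pi> permutes {1..r} \<and> (X, ms) = dmap (tp \<pi>) (identity_diagram r)"
proof -
  have B: "brauer_diagram r r X" using X by (simp add: marked_brauer_def)
  have "\<exists>i. {Top i, Bot l} \<in> X" if l: "l \<in> {1..r}" for l
  proof -
    obtain w where w: "{Bot l, w} \<in> X" using brauer_partner[OF B, of "Bot l"] l by blast
    have "w \<in> Top ` {1..r} \<union> Bot ` {1..r}"
      using brauer_vertex(1)[OF B, of w "Bot l"] w by (simp add: insert_commute)
    moreover have "w \<notin> range Bot"
    proof
      assume "w \<in> range Bot"
      then have "{Bot l, w} \<in> caps X" using w by (auto simp: caps_def)
      then show False using caps by simp
    qed
    ultimately obtain i where "w = Top i" by blast
    then show ?thesis using w by (auto simp: insert_commute)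
  qed
  then obtain f where f: "\<And>l. l \<in> {1..r} \<Longrightarrow> {Top (f l), Bot l} \<in> X" by metis
  define \<pi> where "\<pi> l = (if l \<in> {1..r} then f l else l)" for l
  have \<pi>: "{Top (\<pi> l), Bot l} \<in> X" if "l \<in> {1..r}" for l using f that by (simp add: \<pi>_def)
  have "inj_on \<pi> {1..r}"
  proof (rule inj_onI)
    fix l l' assume l: "l \<in> {1..r}" "l' \<in> {1..r}" "\<pi> l = \<pi> l'"
    then have "Bot l = Bot l'" using brauer_unique[OF B \<pi>[OF l(1)]] \<pi>[OF l(2)] by simp
    then show "l = l'" by simp
  qed
  moreover have "\<pi> ` {1..r} \<subseteq> {1..r}" using brauer_vertex(1)[OF B \<pi>] by blast
  ultimately have surj: "\<pi> ` {1..r} = {1..r}" by (intro endo_inj_surj) auto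
  then have perm: "\<pi> permutes {1..r}"
    using \<open>inj_on \<pi> {1..r}\<close> by (intro bij_imp_permutes) (auto simp: bij_betw_def \<pi>_def)
  have Xeq: "X = (\<lambda>l. {Top (\<pi> l), Bot l}) ` {1..r}"
  proof (intro equalityI subsetI)
    fix e assume e: "e \<in> X"
    obtain u v where uv: "e = {u, v}" "u \<noteq> v" using brauer_edge[OF B e] .
    have "u \<in> Top ` {1..r} \<union> Bot ` {1..r}" using brauer_vertex(1)[OF B] e uv by metis
    then consider i where "u = Top i" "i \<in> {1..r}" | l where "u = Bot l" "l \<in> {1..r}" by blast
    then show "e \<in> (\<lambda>l. {Top (\<pi> l), Bot l}) ` {1..r}"
    proof cases
      case 1
      then obtain l where l: "l \<in> {1..r}" "i = \<pi> l" using surj by blast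
      then have "e = {Top (\<pi> l), Bot l}" using brauer_disjoint[OF B e \<pi>[OF l(1)], of u] 1 uv by simp
      then show ?thesis using l(1) by blast
    next
      case 2
      then have "e = {Top (\<pi> l), Bot l}" using brauer_disjoint[OF B e \<pi>[OF 2(2)], of u] uv by simp
      then show ?thesis using 2(2) by blast
    qed
  qed (use \<pi> in blast)
  have "cups X = {}" unfolding Xeq cups_def by auto
  then have "kind ` set ms = {}" using X caps by (simp add: marked_brauer_iff_kind)
  then have "ms = []" by simp
  then have "(X, ms) = dmap (tp \<pi>) (identity_diagram r)"
    unfolding Xeq by (simp add: dmap_def vmap_def identity_diagram_def image_image)
  then show ?thesis using perm by blast
qed

text \<open>Without cups the through strings would use up all bottom vertices, by counting.\<close>

lemma cap_imp_cup:
  assumes B: "brauer_diagram r r X" and caps: "caps X \<noteq> {}" shows "cups X \<noteq> {}"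
proof
  assume cups: "cups X = {}"
  have "\<exists>l. {Top i, Bot l} \<in> X" if i: "i \<in> {1..r}" for i
  proof -
    obtain w where w: "{Top i, w} \<in> X" using brauer_partner[OF B, of "Top i"] i by blast
    have "w \<in> Top ` {1..r} \<union> Bot ` {1..r}"
      using brauer_vertex(1)[OF B, of w "Top i"] w by (simp add: insert_commute)
    moreover have "w \<notin> range Top"
    proof
      assume "w \<in> range Top"
      then have "{Top i, w} \<in> cups X" using w by (auto simp: cups_def)
      then show False using cups by simp
    qed
    ultimately show ?thesis using w by blast
  qed
  then obtain f where f: "\<And>i. i \<in> {1..r} \<Longrightarrow> {Top i, Bot (f i)} \<in> X" by metis
  have "inj_on f {1..r}"
  proof (rule inj_onI)
    fix i i' assume i: "i \<in> {1..r}" "i' \<in> {1..r}" "f i = f i'"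
    have "{Bot (f i), Top i} \<in> X" "{Bot (f i), Top i'} \<in> X"
      using f[OF i(1)] f[OF i(2)] i(3) by (simp_all add: insert_commute)
    then show "i = i'" using brauer_unique[OF B] by blast
  qed
  moreover have "f ` {1..r} \<subseteq> {1..r}"
  proof
    fix l assume "l \<in> f ` {1..r}"
    then obtain i where i: "i \<in> {1..r}" "l = f i" by blast
    then show "l \<in> {1..r}"
      using brauer_vertex(1)[OF B, of "Bot (f i)" "Top i"] f[OF i(1)] by (auto simp: insert_commute)
  qed
  ultimately have surj: "f ` {1..r} = {1..r}" by (intro endo_inj_surj) auto
  obtain e where e: "e \<in> X" "e \<subseteq> range Bot" using caps by (auto simp: caps_def)
  obtain u v where uv: "e = {u, v}" "u \<noteq> v" using brauer_edge[OF B e(1)] .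
  then obtain l where l: "u = Bot l" using e(2) by auto
  have "l \<in> {1..r}" using brauer_vertex(1)[OF B, of u v] e(1) uv l by auto
  then obtain i where i: "i \<in> {1..r}" "l = f i" using surj by blast
  then have "e = {Top i, Bot l}" using brauer_disjoint[OF B e(1) f[OF i(1)], of u] uv l by simp
  then show False using e(2) by auto
qed

lemma exch_exch:
  assumes X: "brauer_diagram r s X" and e: "{u1, u2} \<in> X" "{w1, w2} \<in> X" and ne: "u1 \<noteq> w1" "u1 \<noteq> w2"
  shows "exch u1 w1 u2 w2 (exch u1 u2 w1 w2 X) = X"
proof -
  note d = exch_distinct[OF X e ne]
  have "{u1, w1} \<notin> X" using brauer_unique[OF X e(1), of w1] d by blast
  moreover have "{u2, w2} \<notin> X" using brauer_unique[OF X, of u2 u1 w2] e(1) ne by (auto simp: insert_commute)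
  ultimately show ?thesis using e unfolding exch_def by auto
qed

text \<open>The inverse of gluing: some cup and some cap are recombined into two through strings,
  and their markings are dropped. The names \<open>c\<close> and \<open>d\<close> follow the
  direction of the arrow.\<close>

lemma cap_decomposition:
  assumes mX: "(X, ms) \<in> marked_brauer r r" and caps: "caps X \<noteq> {}"
  obtains a b c d X0 ms0 where "(X0, ms0) \<in> marked_brauer r r" "{Top a, Bot c} \<in> X0" "{Top b, Bot d} \<in> X0"
    "a \<noteq> b" "c \<noteq> d" "exch (Top a) (Bot c) (Top b) (Bot d) X0 = X" "card (caps X) = Suc (card (caps X0))"
    "mset ms = mset (Bead {Top a, Top b} # Arrow (Bot c) (Bot d) # ms0)"
proof -
  have B: "brauer_diagram r r X" using mX by (simp add: marked_brauer_def)
  have fin: "finite (caps X)" using brauer_finite[OF B] by (simp add: caps_def)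
  obtain e f where ef: "e \<in> cups X" "f \<in> caps X" using caps cap_imp_cup[OF B caps] by blast
  obtain u v where uv: "e = {u, v}" "u \<noteq> v" using brauer_edge[OF B, of e] ef by (auto simp: cups_def)
  then obtain a b where ab: "e = {Top a, Top b}" "a \<noteq> b" using ef(1) by (auto simp: cups_def)
  obtain w x where wx: "f = {w, x}" "w \<noteq> x" using brauer_edge[OF B, of f] ef by (auto simp: caps_def)
  then have "Arrow w x \<in> set ms \<or> Arrow x w \<in> set ms" using marked_cap[OF mX] ef(2) by blast
  then obtain c d where cd: "Arrow (Bot c) (Bot d) \<in> set ms" "f = {Bot c, Bot d}" "c \<noteq> d"
    using marked_arrow[OF mX] wx by (metis (no_types, opaque_lifting) imageE insert_commute)
  have bead: "Bead {Top a, Top b} \<in> set ms" using marked_bead_iff[OF mX] ef(1) ab by blast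
  have eX: "{Top a, Top b} \<in> X" "{Bot c, Bot d} \<in> X" using ef ab cd by (auto simp: cups_def caps_def)
  define Aw where "Aw = Arrow (Bot c) (Bot d)"
  define Bd where "Bd = Bead {Top a, Top b}"
  define ms0 where "ms0 = remove1 Aw (remove1 Bd ms)"
  have rem: "mset l = add_mset m (mset (remove1 m l))" if "m \<in> set l" for m and l :: "marking list"
    using that by simp
  have "Aw \<in> set (remove1 Bd ms)" using cd(1) by (simp add: Aw_def Bd_def)
  then have mset: "mset ms = mset (Bd # Aw # ms0)"
    using rem[of Bd ms] rem[of Aw "remove1 Bd ms"] bead unfolding ms0_def Bd_def mset.simps by metis
  define X0 where "X0 = exch (Top a) (Top b) (Bot c) (Bot d) X"
  have BX0: "brauer_diagram r r X0" unfolding X0_def by (rule brauer_exch[OF B eX]) auto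
  have e0: "{Top a, Bot c} \<in> X0" "{Top b, Bot d} \<in> X0" by (auto simp: X0_def exch_def)
  have X_eq: "exch (Top a) (Bot c) (Top b) (Bot d) X0 = X" unfolding X0_def by (rule exch_exch[OF B eX]) auto
  have marked': "(X, Bd # Aw # ms0) \<in> marked_brauer r r"
    by (rule marked_mset_kindI[OF mX]) (metis mset mset_map)
  have cups0: "cups X0 = cups X - {{Top a, Top b}}" and caps0: "caps X0 = caps X - {{Bot c, Bot d}}"
    by (auto simp: X0_def exch_def cups_def caps_def)
  have m0: "(X0, ms0) \<in> marked_brauer r r" unfolding marked_brauer_iff_kind
  proof (intro conjI)
    have dist: "distinct (map edge_of (Bd # Aw # ms0))" using marked' by (simp add: marked_brauer_def)
    then show "distinct (map edge_of ms0)" by simp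
    have k: "kind ` set (Bd # Aw # ms0) = {True} \<times> cups X \<union> {False} \<times> caps X"
      using marked' by (simp add: marked_brauer_iff_kind)
    have kind_edge: "e \<in> edge_of ` set ms0" if h: "(x, e) \<in> kind ` set ms0" for x e
    proof -
      obtain m where m: "m \<in> set ms0" "kind m = (x, e)" using h by auto
      then have "edge_of m = e" using snd_kind[of m] by simp
      then show ?thesis using m(1) by blast
    qed
    have "(True, {Top a, Top b}) \<notin> kind ` set ms0" "(False, {Bot c, Bot d}) \<notin> kind ` set ms0"
    proof -
      have "{Top a, Top b} \<notin> edge_of ` set ms0" "{Bot c, Bot d} \<notin> edge_of ` set ms0"
        using dist by (auto simp: Bd_def Aw_def)
      then show "(True, {Top a, Top b}) \<notin> kind ` set ms0" "(False, {Bot c, Bot d}) \<notin> kind ` set ms0"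
        using kind_edge by blast+
    qed
    moreover have "insert (True, {Top a, Top b}) (insert (False, {Bot c, Bot d}) (kind ` set ms0)) = {True} \<times> cups X \<union> {False} \<times> caps X"
      using k by (simp add: Bd_def Aw_def)
    moreover have "K = T - {x, y}" if "x \<notin> K" "y \<notin> K" "insert x (insert y K) = T" for K T :: "(bool \<times> vertex set) set" and x y
      using that by blast
    ultimately have "kind ` set ms0 = ({True} \<times> cups X \<union> {False} \<times> caps X) - {(True, {Top a, Top b}), (False, {Bot c, Bot d})}"
      by simp
    moreover have "({True} \<times> K \<union> {False} \<times> L) - {(True, x), (False, y)} = {True} \<times> (K - {x}) \<union> {False} \<times> (L - {y})"
      for K L :: "vertex set set" and x y by auto
    ultimately show "kind ` set ms0 = {True} \<times> cups X0 \<union> {False} \<times> caps X0" unfolding cups0 caps0 by simp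
  qed (rule BX0)
  have "card (caps X) = Suc (card (caps X0))"
    using ef(2) fin cd(2) card_Suc_Diff1[of "caps X" f] unfolding caps0 by simp
  with m0 e0 ab(2) cd(3) X_eq show ?thesis using that mset unfolding Bd_def Aw_def by blast
qed

text \<open>One case for each effect of a surgery; \<open>left\<close> and \<open>right\<close> may
  overlap.\<close>

lemma top_partner_cases:
  assumes Z: "brauer_diagram r t Z" and ab: "a \<in> {1..r}" "b \<in> {1..r}" "a \<noteq> b"
  obtains (loop) "{Top a, Top b} \<in> cups Z" | (left) p where "{Top a, Top p} \<in> cups Z" "p \<noteq> b"
    | (right) q where "{Top b, Top q} \<in> cups Z" "q \<noteq> a" | (bot) p q where "{Top a, Bot p} \<in> Z" "{Top b, Bot q} \<in> Z"
proof -
  obtain u where u: "{Top a, u} \<in> Z" using brauer_partner[OF Z, of "Top a"] ab by blast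
  obtain w where w: "{Top b, w} \<in> Z" using brauer_partner[OF Z, of "Top b"] ab by blast
  have "u \<in> outer" "w \<in> outer" using brauer_outer[OF Z u] brauer_outer[OF Z w] by auto
  then consider i where "u = Top i" | j i where "u = Bot i" "w = Top j" | i j where "u = Bot i" "w = Bot j"
    by (metis outer_cases)
  then show ?thesis
  proof cases
    case (1 i)
    then have "{Top a, Top i} \<in> cups Z" using u by (auto simp: cups_def)
    then show ?thesis using loop left by (cases "i = b") auto
  next
    case (2 j i)
    then have "{Top b, Top j} \<in> cups Z" using w by (auto simp: cups_def)
    moreover have "j \<noteq> a" using brauer_unique[OF Z u, of "Top b"] w 2 by (auto simp: insert_commute)
    ultimately show ?thesis by (rule right)
  next
    case (3 i j)
    then show ?thesis using bot u w by blast
  qed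
qed

lemma composes_brauer:
  "composes \<delta> \<epsilon> r t D1 D2 k mz \<Longrightarrow> (contract_edges (stk (fst D1) (fst D2)), mz) \<in> marked_brauer r t"
  unfolding composes_def by blast

lemma composes_cup_front:
  assumes "composes \<delta> \<epsilon> r t D D' k mz" "e \<in> cups (contract_edges (stk (fst D) (fst D')))"
  shows "\<exists>k' vs. composes \<delta> \<epsilon> r t D D' k' (Bead e # vs)"
proof -
  have "Bead e \<in> set mz" using marked_bead_iff[OF composes_brauer[OF assms(1)]] assms(2) by blast
  then obtain us vs where "mz = us @ Bead e # vs" by (auto dest: split_list)
  then show ?thesis using composes_front assms(1) by blast
qed

text \<open>Each product is assembled from one with fewer caps above by a single surgery, so no
  strategy for simplifying arbitrary stacks has to be designed. Existence is indispensable: a single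
  pair without outcome would make every product of classes empty.\<close>

theorem exists_composes:
  fixes \<delta> \<epsilon> :: "'k::field" assumes param: "\<epsilon> = 1 \<or> \<delta> = 0 \<and> \<epsilon> * \<epsilon> = 1"
    and D: "D1 \<in> marked_brauer r r" "D2 \<in> marked_brauer r t" shows "\<exists>k mz. composes \<delta> \<epsilon> r t D1 D2 k mz"
  using D(1)
proof (induction "card (caps (fst D1))" arbitrary: D1)
  case 0
  obtain X ms where D1: "D1 = (X, ms)" by (cases D1)
  have B: "brauer_diagram r r X" using 0 D1 by (simp add: marked_brauer_def)
  have "finite (caps X)" using brauer_finite[OF B] by (simp add: caps_def)
  then have "caps X = {}" using 0 D1 by simp
  then obtain \<pi> where \<pi>: "\<pi> permutes {1..r}" "D1 = dmap (tp \<pi>) (identity_diagram r)"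
    using no_caps_permutation 0 D1 by blast
  obtain Y ms2 where D2: "D2 = (Y, ms2)" by (cases D2)
  show ?case using composes_tp(1)[OF identity_marked D(2) \<pi>(1)] composes_identity(1)[of Y ms2 r t] D(2)
    unfolding \<pi>(2) D2 by blast
next
  case (Suc n)
  obtain X ms where D1: "D1 = (X, ms)" by (cases D1)
  obtain Y ms2 where D2: "D2 = (Y, ms2)" by (cases D2)
  have mX: "(X, ms) \<in> marked_brauer r r" using Suc.prems D1 by simp
  have "caps X \<noteq> {}" using Suc.hyps(2) D1 by auto
  from cap_decomposition[OF mX this] obtain a b c d X0 ms0 where
    m0: "(X0, ms0) \<in> marked_brauer r r" and e0: "{Top a, Bot c} \<in> X0" "{Top b, Bot d} \<in> X0" and ab: "a \<noteq> b"
    and X_eq: "exch (Top a) (Bot c) (Top b) (Bot d) X0 = X" and card: "card (caps X) = Suc (card (caps X0))"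
    and mset: "mset ms = mset (Bead {Top a, Top b} # Arrow (Bot c) (Bot d) # ms0)" by metis
  have "n = card (caps X0)" using Suc.hyps(2) D1 card by simp
  then obtain k mz where comp: "composes \<delta> \<epsilon> r t (X0, ms0) (Y, ms2) k mz"
    using Suc.hyps(1)[of "(X0, ms0)"] D2 m0 by auto
  let ?Aw = "Arrow (Bot c) (Bot d)"
  have BY: "brauer_diagram r t Y" and BX0: "brauer_diagram r r X0"
    using D(2) D2 m0 by (simp_all add: marked_brauer_def)
  interpret lf: lift r r t X0 Y a b c d ms0 ms2 ?Aw using BX0 BY m0 D(2) D2 e0 ab by unfold_locales auto
  have sw: "lift r r t X0 Y b a d c ms0 ms2 ?Aw" using BX0 BY m0 D(2) D2 e0 ab by unfold_locales auto
  let ?Z = "contract_edges (stk X0 Y)"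
  have BZ: "brauer_diagram r t ?Z" using composes_brauer[OF comp] by (simp add: marked_brauer_def)
  have abr: "a \<in> {1..r}" "b \<in> {1..r}"
    using brauer_vertex(1)[OF BX0 e0(1)] brauer_vertex(1)[OF BX0 e0(2)] by auto
  have front: "\<exists>k' vs. composes \<delta> \<epsilon> r t (X0, ms0) (Y, ms2) k' (Bead e' # vs)" if "e' \<in> cups ?Z" for e'
    using composes_cup_front[OF comp] that by simp
  have "\<exists>k mz. composes \<delta> \<epsilon> r t (X, Bead {Top a, Top b} # ?Aw # ms0) (Y, ms2) k mz" using BZ abr ab
  proof (cases rule: top_partner_cases)
    case loop
    then show ?thesis using front lf.lift_loop(2)[of \<epsilon> \<delta>] param unfolding X_eq by blast
  next
    case (left p)
    then show ?thesis using front lf.lift_cup(2)[OF _ refl left(2)] unfolding X_eq by blast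
  next
    case (right q)
    then obtain k' vs where c: "composes \<delta> \<epsilon> r t (X0, ms0) (Y, ms2) k' (Bead {Top b, Top q} # vs)"
      using front by blast
    \<comment> \<open>The same gluing read with \<open>a\<close> and \<open>b\<close> exchanged; the
      arrow then runs from the second bottom vertex to the first.\<close>
    have "exch (Top b) (Bot d) (Top a) (Bot c) X0 = X" using X_eq exch_sym by metis
    then show ?thesis using lift.lift_cup(2)[OF sw c refl right(2)] by (metis insert_commute)
  next
    case (bot p q)
    then show ?thesis using lf.lift_bot(2)[OF comp bot] unfolding X_eq by blast
  qed
  then show ?case using composes_mset[OF _ mset] unfolding D1 D2 by blast
qed

section \<open>The product in coordinates\<close>

lemma lin_fun_add: "lin (\<lambda>k. f k + g k) x = lin f x + lin g x"
  by (simp add: lin_def scale.scale_right_distrib sum.distrib)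

lemma lin_fun_scale: "lin (\<lambda>k. scale c (f k)) x = scale c (lin f x)"
  by (simp add: lin_def scale.scale_sum_right mult.commute)

definition perm_diagram :: "nat \<Rightarrow> (nat \<Rightarrow> nat) \<Rightarrow> mdiagram" where
  "perm_diagram r \<pi> = dmap (tp \<pi>) (identity_diagram r)"

definition glue :: "nat \<Rightarrow> nat \<Rightarrow> nat \<Rightarrow> nat \<Rightarrow> mdiagram \<Rightarrow> mdiagram" where
  "glue a b c d D = (exch (Top a) (Bot c) (Top b) (Bot d) (fst D),
     Bead {Top a, Top b} # Arrow (Bot c) (Bot d) # snd D)"

text \<open>Generalises \<open>e_diagram\<close> to an arbitrary pair of positions, as needed for
  conjugation by permutations.\<close>

definition cupcap :: "nat \<Rightarrow> nat \<Rightarrow> nat \<Rightarrow> mdiagram" where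
  "cupcap r a b = glue a b a b (identity_diagram r)"

locale marked_algebra =
  fixes \<delta> \<epsilon> :: "'k::field" and r :: nat assumes param: "\<epsilon> = 1 \<or> \<delta> = 0 \<and> \<epsilon> * \<epsilon> = 1"
begin

lemma eps: "\<epsilon> * \<epsilon> = 1" using param by auto

abbreviation "MB \<equiv> marked_brauer r r"
abbreviation "dv \<equiv> dvec \<epsilon>"
abbreviation "cp \<equiv> composes \<delta> \<epsilon> r r"

definition mark_sign :: "vertex set set \<Rightarrow> 'k" where
  "mark_sign X = msign \<epsilon> key0 fw0 (snd (mark r r X))"

text \<open>Evaluated on the chosen marking of each Brauer diagram and corrected by its sign; by
  \<open>cval_change\<close> any other marking would do.\<close>

definition qmul :: "'k coords \<Rightarrow> 'k coords \<Rightarrow> 'k coords" where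
  "qmul p q = lin (\<lambda>X. lin (\<lambda>Y. scale (mark_sign X * mark_sign Y) (cval \<delta> \<epsilon> (mark r r X) (mark r r Y))) q) p"

lemma qmul_add_left: "qmul (p + p') q = qmul p q + qmul p' q"
  and qmul_scale_left: "qmul (scale c p) q = scale c (qmul p q)"
  and qmul_add_right: "qmul p (q + q') = qmul p q + qmul p q'"
  and qmul_scale_right: "qmul p (scale c q) = scale c (qmul p q)"
  by (simp_all add: qmul_def lin_add lin_scale lin_fun_add lin_fun_scale)

lemma qmul_zero [simp]: "qmul 0 q = 0" "qmul p 0 = 0"
  using qmul_scale_left[of 0 0 q] qmul_scale_right[of p 0 0] by simp_all

lemma cval_change:
  assumes D: "(X, ms1) \<in> MB" "(X, ms1') \<in> MB" "(Y, ms2) \<in> MB" "(Y, ms2') \<in> MB"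
  shows "scale (msign \<epsilon> key0 fw0 ms1 * msign \<epsilon> key0 fw0 ms2) (cval \<delta> \<epsilon> (X, ms1) (Y, ms2)) =
    scale (msign \<epsilon> key0 fw0 ms1' * msign \<epsilon> key0 fw0 ms2') (cval \<delta> \<epsilon> (X, ms1') (Y, ms2'))"
proof -
  have "\<exists>k mz. cp (X, ms1) (Y, ms2) k mz" using exists_composes[OF param] D by blast
  then have cont: "brauer_diagram r r (contract_edges (stk X Y))"
    using composes_brauer by (fastforce simp: marked_brauer_def)
  have 1: "scale (msign \<epsilon> key0 fw0 ms1) (cval \<delta> \<epsilon> (X, ms1) (Y, ms2)) =
      scale (msign \<epsilon> key0 fw0 ms1') (cval \<delta> \<epsilon> (X, ms1') (Y, ms2))"
  proof (rule msteps_proportional[OF eps D(1,2), of "\<lambda>ms. cval \<delta> \<epsilon> (X, ms) (Y, ms2)"])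
    fix a b assume ab: "(X, a) \<in> MB" "mstep a b"
    have "mstep (stack_markings (X, a) (Y, ms2)) (stack_markings (X, b) (Y, ms2))"
      using mstep_append[OF mstep_relabel[OF ab(2)], of "[]"] by (simp add: stack_markings_conv)
    then show "cval \<delta> \<epsilon> (X, b) (Y, ms2) = scale \<epsilon> (cval \<delta> \<epsilon> (X, a) (Y, ms2))"
      by (rule cval_mstep[OF param ab(1) D(3) cont])
  qed
  have 2: "scale (msign \<epsilon> key0 fw0 ms2) (cval \<delta> \<epsilon> (X, ms1') (Y, ms2)) =
      scale (msign \<epsilon> key0 fw0 ms2') (cval \<delta> \<epsilon> (X, ms1') (Y, ms2'))"
  proof (rule msteps_proportional[OF eps D(3,4), of "\<lambda>ms. cval \<delta> \<epsilon> (X, ms1') (Y, ms)"])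
    fix a b assume ab: "(Y, a) \<in> MB" "mstep a b"
    have "mstep (stack_markings (X, ms1') (Y, a)) (stack_markings (X, ms1') (Y, b))"
      using mstep_append[OF mstep_relabel[OF ab(2)], of _ _ "[]"] by (simp add: stack_markings_conv)
    then show "cval \<delta> \<epsilon> (X, ms1') (Y, b) = scale \<epsilon> (cval \<delta> \<epsilon> (X, ms1') (Y, a))"
      by (rule cval_mstep[OF param D(2) ab(1) cont])
  qed
  have "scale (msign \<epsilon> key0 fw0 ms1 * msign \<epsilon> key0 fw0 ms2) (cval \<delta> \<epsilon> (X, ms1) (Y, ms2)) =
      scale (msign \<epsilon> key0 fw0 ms2) (scale (msign \<epsilon> key0 fw0 ms1) (cval \<delta> \<epsilon> (X, ms1) (Y, ms2)))"
    by (simp add: mult.commute)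
  also have "\<dots> = scale (msign \<epsilon> key0 fw0 ms1') (scale (msign \<epsilon> key0 fw0 ms2) (cval \<delta> \<epsilon> (X, ms1') (Y, ms2)))"
    unfolding 1 by (simp add: mult.commute)
  finally show ?thesis unfolding 2 by simp
qed

lemma qmul_dv:
  assumes "D1 \<in> MB" "D2 \<in> MB" shows "qmul (dv D1) (dv D2) = cval \<delta> \<epsilon> D1 D2"
proof -
  obtain X ms1 Y ms2 where D: "D1 = (X, ms1)" "D2 = (Y, ms2)" by (cases D1; cases D2)
  obtain mx where mx: "mark r r X = (X, mx)" by (simp add: mark_def)
  obtain my where my: "mark r r Y = (Y, my)" by (simp add: mark_def)
  have B: "brauer_diagram r r X" "brauer_diagram r r Y" using assms by (auto simp: D marked_brauer_def)
  have m: "(X, mx) \<in> MB" "(Y, my) \<in> MB" using mark_marked[OF B(1)] mark_marked[OF B(2)] mx my by simp_all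
  let ?s = "\<lambda>ms. msign \<epsilon> key0 fw0 ms"
  have "qmul (dv D1) (dv D2) = scale (?s ms1 * ?s ms2) (scale (?s mx * ?s my) (cval \<delta> \<epsilon> (X, mx) (Y, my)))"
    by (simp add: qmul_def dvec_def D mark_sign_def mx my mult.assoc)
  also have "\<dots> = scale (?s ms1 * ?s ms2) (scale (?s ms1 * ?s ms2) (cval \<delta> \<epsilon> (X, ms1) (Y, ms2)))"
    using cval_change[OF m(1) _ m(2), of ms1 ms2] assms by (simp add: D)
  also have "\<dots> = cval \<delta> \<epsilon> D1 D2"
  proof -
    have "(?s ms1 * ?s ms2) * (?s ms1 * ?s ms2) = (?s ms1 * ?s ms1) * (?s ms2 * ?s ms2)"
      by (simp add: algebra_simps)
    then show ?thesis by (simp add: msign_square[OF eps] D)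
  qed
  finally show ?thesis .
qed

text \<open>One complete simplification determines the product, because all of them have the same
  coordinates.\<close>

lemma qmul_composes:
  assumes D: "D1 \<in> MB" "D2 \<in> MB" and c: "cp D1 D2 k mz"
  shows "qmul (dv D1) (dv D2) = scale k (dv (contract_edges (stk (fst D1) (fst D2)), mz))"
proof -
  have "single (contract_edges (stk (fst D1) (fst D2)), mz) k \<in> composites \<delta> \<epsilon> r r D1 D2"
    using c unfolding composites_composes by blast
  then have "nf \<epsilon> (single (contract_edges (stk (fst D1) (fst D2)), mz) k) = cval \<delta> \<epsilon> D1 D2"
    by (rule composites_nf[OF eps D])
  then show ?thesis unfolding qmul_dv[OF D] by simp
qed

lemma qmul_identity: "D \<in> MB \<Longrightarrow> qmul (dv (identity_diagram r)) (dv D) = dv D"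
  using qmul_composes[OF identity_marked, of D 1 "snd D"] composes_identity(1)[of "fst D" "snd D" r r \<delta> \<epsilon>]
    composes_identity(2)[of "fst D" "snd D" r r] by simp

lemma glue_marked:
  assumes "D \<in> MB" "{Top a, Bot c} \<in> fst D" "{Top b, Bot d} \<in> fst D" "a \<noteq> b"
  shows "glue a b c d D \<in> MB"
  using marked_exch[of "fst D" "snd D" r r a c b d "Arrow (Bot c) (Bot d)"] assms by (simp add: glue_def)

lemma perm_marked: "\<pi> permutes {1..r} \<Longrightarrow> perm_diagram r \<pi> \<in> MB"
  unfolding perm_diagram_def by (intro marked_tp identity_marked)

text \<open>A permutation of the top row acts away from the middle row, so it commutes with
  simplification. The second part is the instance of associativity needed for permutations.\<close>

lemma qmul_tp:
  assumes D: "D \<in> MB" "D' \<in> MB" and \<pi>: "\<pi> permutes {1..r}"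
  shows "qmul (dv (perm_diagram r \<pi>)) (dv D) = dv (dmap (tp \<pi>) D)"
    and "qmul (dv (dmap (tp \<pi>) D)) (dv D') = qmul (dv (perm_diagram r \<pi>)) (qmul (dv D) (dv D'))"
proof -
  have perm: "qmul (dv (perm_diagram r \<pi>)) (dv D) = dv (dmap (tp \<pi>) D)" if "D \<in> MB" for D
  proof -
    obtain X ms where X: "D = (X, ms)" by (cases D)
    have "cp (perm_diagram r \<pi>) (X, ms) 1 (map (relabel (tp \<pi>)) ms)"
      "contract_edges (stk (fst (perm_diagram r \<pi>)) X) = vmap (tp \<pi>) X" unfolding perm_diagram_def
      using composes_tp[OF identity_marked _ \<pi> composes_identity(1)[of X ms r r \<delta> \<epsilon>]] composes_identity(2)[of X ms r r] that X by auto
    then show ?thesis using qmul_composes[OF perm_marked[OF \<pi>] that] X by (simp add: dmap_def)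
  qed
  then show "qmul (dv (perm_diagram r \<pi>)) (dv D) = dv (dmap (tp \<pi>) D)" using D(1) .
  obtain k mz where c: "cp D D' k mz" using exists_composes[OF param D] by blast
  let ?Z = "contract_edges (stk (fst D) (fst D'))"
  have "qmul (dv (dmap (tp \<pi>) D)) (dv D') = scale k (dv (dmap (tp \<pi>) (?Z, mz)))"
    using qmul_composes[OF marked_tp[OF D(1) \<pi>] D(2) composes_tp(1)[OF D \<pi> c]] composes_tp(2)[OF D \<pi> c]
    by (simp add: dmap_def)
  then show "qmul (dv (dmap (tp \<pi>) D)) (dv D') = qmul (dv (perm_diagram r \<pi>)) (qmul (dv D) (dv D'))"
    using qmul_composes[OF D c] perm[OF composes_brauer[OF c]] by (simp add: qmul_scale_right)
qed

lemma qmul_bp: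
  assumes D: "D \<in> MB" "D' \<in> MB" and \<pi>: "\<pi> permutes {1..r}"
  shows "qmul (dv (dmap (bp \<pi>) D)) (dv D') = qmul (dv D) (qmul (dv (perm_diagram r (pinv \<pi>))) (dv D'))"
proof -
  have \<pi>': "pinv \<pi> permutes {1..r}" by (rule permutes_inv[OF \<pi>])
  have D'': "dmap (tp (pinv \<pi>)) D' \<in> MB" by (rule marked_tp[OF D(2) \<pi>'])
  obtain k mz where c: "cp D (dmap (tp (pinv \<pi>)) D') k mz" using exists_composes[OF param D(1) D''] by blast
  have "qmul (dv (dmap (bp \<pi>) D)) (dv D') = qmul (dv D) (dv (dmap (tp (pinv \<pi>)) D'))"
    using qmul_composes[OF marked_bp[OF D(1) \<pi>] D(2) composes_bp(1)[OF D \<pi> c]] composes_bp(2)[OF D \<pi> c]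
      qmul_composes[OF D(1) D'' c] by simp
  then show ?thesis using qmul_tp(1)[OF D(2) D(2) \<pi>'] by simp
qed

end

locale glued = marked_algebra \<delta> \<epsilon> r for \<delta> \<epsilon> :: "'k::field" and r +
  fixes D D' :: mdiagram and a b c d :: nat assumes D: "D \<in> marked_brauer r r" "D' \<in> marked_brauer r r"
    and edges: "{Top a, Bot c} \<in> fst D" "{Top b, Bot d} \<in> fst D" and ab: "a \<noteq> b"
begin

abbreviation "Z \<equiv> contract_edges (stk (fst D) (fst D'))"

lemma lf: "lift r r r (fst D) (fst D') a b c d (snd D) (snd D') (Arrow (Bot c) (Bot d))"
  using D edges ab by unfold_locales (auto simp: marked_brauer_def)

lemma lf': "lift r r r (fst D) (fst D') b a d c (snd D) (snd D') (Arrow (Bot c) (Bot d))"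
  using D edges ab by unfold_locales (auto simp: marked_brauer_def)

lemma cd: "c \<noteq> d" by (rule lift.cd[OF lf])

lemma glue_MB: "glue a b c d D \<in> MB" by (rule glue_marked[OF D(1) edges ab])

lemma glue_loop:
  assumes "cp D D' k mz" "mz = Bead {Top a, Top b} # vs"
  shows "qmul (dv (glue a b c d D)) (dv D') = scale k (scale \<delta> (dv (Z, mz)))"
proof -
  have c: "cp (fst D, snd D) (fst D', snd D') k mz" using assms(1) by simp
  have p: "\<epsilon> = 1 \<or> \<delta> = 0" using param by blast
  show ?thesis using qmul_composes[OF glue_MB D(2)] lift.lift_loop[OF lf p c assms(2)]
    by (simp add: glue_def mult.commute)
qed

lemma glue_cup_left:
  assumes "cp D D' k mz" "mz = Bead {Top a, Top p} # vs" "p \<noteq> b"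
  shows "qmul (dv (glue a b c d D)) (dv D') = scale k (scale \<epsilon> (dv (dmap (tp (trp p b)) (Z, mz))))"
proof -
  have c: "cp (fst D, snd D) (fst D', snd D') k mz" using assms(1) by simp
  show ?thesis using qmul_composes[OF glue_MB D(2)] lift.lift_cup[OF lf c assms(2,3)]
    by (simp add: glue_def dmap_def mult.commute)
qed

text \<open>Read with \<open>a\<close> and \<open>b\<close> exchanged, the new arrow points toward
  the bead on the strand from \<open>b\<close>, so the \<epsilon> of the left case is
  absent.\<close>

lemma glue_cup_right:
  assumes "cp D D' k mz" "mz = Bead {Top b, Top q} # vs" "q \<noteq> a"
  shows "qmul (dv (glue a b c d D)) (dv D') = scale k (dv (dmap (tp (trp q a)) (Z, mz)))"
proof -
  have c: "cp (fst D, snd D) (fst D', snd D') k mz" using assms(1) by simp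
  have eq: "glue a b c d D = (exch (Top b) (Bot d) (Top a) (Bot c) (fst D), Bead {Top b, Top a} # Arrow (Bot c) (Bot d) # snd D)"
    by (simp add: glue_def exch_sym[of "Top a"] insert_commute)
  have cd': "Arrow (Bot c) (Bot d) \<noteq> Arrow (Bot d) (Bot c)" using cd by simp
  show ?thesis using qmul_composes[OF glue_MB D(2)] lift.lift_cup[OF lf' c assms(2,3)] cd'
    by (simp add: eq dmap_def)
qed

lemma glue_bot:
  assumes "cp D D' k mz" "{Top a, Bot p} \<in> Z" "{Top b, Bot q} \<in> Z"
  shows "qmul (dv (glue a b c d D)) (dv D') = scale k (dv (glue a b p q (Z, mz)))"
proof -
  have c: "cp (fst D, snd D) (fst D', snd D') k mz" using assms(1) by simp
  show ?thesis using qmul_composes[OF glue_MB D(2)] lift.lift_bot[OF lf c assms(2,3) refl]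
    by (simp add: glue_def)
qed

end

context marked_algebra
begin

lemma identity_edge: "i \<in> {1..r} \<Longrightarrow> {Top i, Bot i} \<in> fst (identity_diagram r)"
  by (auto simp: identity_diagram_def)

lemma cupcap_marked: "a \<in> {1..r} \<Longrightarrow> b \<in> {1..r} \<Longrightarrow> a \<noteq> b \<Longrightarrow> cupcap r a b \<in> MB"
  unfolding cupcap_def by (intro glue_marked identity_marked identity_edge)

text \<open>A cup-cap is glued into the identity diagram, whose products simplify with scalar 1; the
  gluing formulas thus specialise to products with a cup-cap.\<close>

lemma glued_identity:
  assumes "a \<in> {1..r}" "b \<in> {1..r}" "a \<noteq> b" "(X, ms) \<in> MB"
  shows "glued \<delta> \<epsilon> r (identity_diagram r) (X, ms) a b a b"
    "contract_edges (stk (fst (identity_diagram r)) X) = X" "cp (identity_diagram r) (X, ms) 1 ms"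
  using assms identity_marked identity_edge marked_algebra_axioms composes_identity[OF assms(4)]
  by (auto simp: glued_def glued_axioms_def)

lemma cupcap_loop:
  assumes "a \<in> {1..r}" "b \<in> {1..r}" "a \<noteq> b" "(X, Bead {Top a, Top b} # vs) \<in> MB"
  shows "qmul (dv (cupcap r a b)) (dv (X, Bead {Top a, Top b} # vs)) = scale \<delta> (dv (X, Bead {Top a, Top b} # vs))"
  using glued.glue_loop[OF glued_identity(1)[OF assms] glued_identity(3)[OF assms] refl] glued_identity(2)[OF assms]
  by (simp add: cupcap_def)

lemma cupcap_cup_left:
  assumes "a \<in> {1..r}" "b \<in> {1..r}" "a \<noteq> b" "(X, Bead {Top a, Top p} # vs) \<in> MB" "p \<noteq> b"
  shows "qmul (dv (cupcap r a b)) (dv (X, Bead {Top a, Top p} # vs)) =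
    scale \<epsilon> (dv (dmap (tp (trp p b)) (X, Bead {Top a, Top p} # vs)))"
  using glued.glue_cup_left[OF glued_identity(1)[OF assms(1-4)] glued_identity(3)[OF assms(1-4)] refl assms(5)] glued_identity(2)[OF assms(1-4)]
  by (simp add: cupcap_def)

lemma cupcap_cup_right:
  assumes "a \<in> {1..r}" "b \<in> {1..r}" "a \<noteq> b" "(X, Bead {Top b, Top q} # vs) \<in> MB" "q \<noteq> a"
  shows "qmul (dv (cupcap r a b)) (dv (X, Bead {Top b, Top q} # vs)) =
    dv (dmap (tp (trp q a)) (X, Bead {Top b, Top q} # vs))"
  using glued.glue_cup_right[OF glued_identity(1)[OF assms(1-4)] glued_identity(3)[OF assms(1-4)] refl assms(5)] glued_identity(2)[OF assms(1-4)]
  by (simp add: cupcap_def)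

lemma cupcap_bot:
  assumes "a \<in> {1..r}" "b \<in> {1..r}" "a \<noteq> b" "D \<in> MB" "{Top a, Bot p} \<in> fst D" "{Top b, Bot q} \<in> fst D"
  shows "qmul (dv (cupcap r a b)) (dv D) = dv (glue a b p q D)"
proof -
  obtain X ms where X: "D = (X, ms)" by (cases D)
  have m: "(X, ms) \<in> MB" using assms X by simp
  show ?thesis
    using glued.glue_bot[OF glued_identity(1)[OF assms(1-3) m] glued_identity(3)[OF assms(1-3) m], of p q] glued_identity(2)[OF assms(1-3) m]
      assms(5,6) by (simp add: cupcap_def X)
qed

text \<open>The instance of associativity on which the construction rests. Both sides obey the same
  four formulas, according to where the strands from \<open>a\<close> and \<open>b\<close> end in
  the product of \<open>D\<close> and \<open>D'\<close>.\<close>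

lemma qmul_glue:
  assumes D: "D \<in> MB" "D' \<in> MB" and edges: "{Top a, Bot c} \<in> fst D" "{Top b, Bot d} \<in> fst D" and ab: "a \<noteq> b"
  shows "qmul (dv (glue a b c d D)) (dv D') = qmul (dv (cupcap r a b)) (qmul (dv D) (dv D'))"
proof -
  interpret g: glued \<delta> \<epsilon> r D D' a b c d using D edges ab by unfold_locales auto
  let ?Z = "contract_edges (stk (fst D) (fst D'))"
  have B: "brauer_diagram r r (fst D)" using D(1) by (cases D) (simp add: marked_brauer_def)
  have abr: "a \<in> {1..r}" "b \<in> {1..r}"
    using brauer_vertex(1)[OF B edges(1)] brauer_vertex(1)[OF B edges(2)] by auto
  obtain k mz where c: "cp D D' k mz" using exists_composes[OF param D] by blast
  have Z: "brauer_diagram r r ?Z" using composes_brauer[OF c] by (simp add: marked_brauer_def)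
  from Z abr ab show ?thesis
  proof (cases rule: top_partner_cases)
    case loop
    then obtain k' vs where c': "cp D D' k' (Bead {Top a, Top b} # vs)" using composes_cup_front[OF c] by blast
    show ?thesis
      using g.glue_loop[OF c' refl] qmul_composes[OF D c'] cupcap_loop[OF abr ab composes_brauer[OF c']]
      by (simp add: qmul_scale_right)
  next
    case (left p)
    then obtain k' vs where c': "cp D D' k' (Bead {Top a, Top p} # vs)" using composes_cup_front[OF c] by blast
    show ?thesis
      using g.glue_cup_left[OF c' refl left(2)] qmul_composes[OF D c'] cupcap_cup_left[OF abr ab composes_brauer[OF c'] left(2)]
      by (simp add: qmul_scale_right)
  next
    case (right q)
    then obtain k' vs where c': "cp D D' k' (Bead {Top b, Top q} # vs)" using composes_cup_front[OF c] by blast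
    show ?thesis
      using g.glue_cup_right[OF c' refl right(2)] qmul_composes[OF D c'] cupcap_cup_right[OF abr ab composes_brauer[OF c'] right(2)]
      by (simp add: qmul_scale_right)
  next
    case (bot p q)
    then show ?thesis
      using g.glue_bot[OF c bot] qmul_composes[OF D c] cupcap_bot[OF abr ab composes_brauer[OF c], of p q]
      by (simp add: qmul_scale_right)
  qed
qed

lemma dv_front:
  assumes "(X, us @ m # vs) \<in> MB"
  shows "\<exists>e. dv (X, us @ m # vs) = scale e (dv (X, m # us @ vs)) \<and> (X, m # us @ vs) \<in> MB"
proof -
  have m': "(X, m # us @ vs) \<in> MB" using assms by (rule marked_mset_kindI) simp
  let ?s = "msign \<epsilon> key0 fw0"
  have "dv (X, us @ m # vs) = scale (?s (us @ m # vs) * ?s (m # us @ vs)) (dv (X, m # us @ vs))"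
    unfolding dvec_def fst_conv snd_conv scale_single mult.assoc msign_square[OF eps] by simp
  then show ?thesis using m' by blast
qed

text \<open>A product with a cup-cap on the left has the cup \<open>{Top a, Top b}\<close>, and its
  bead can be brought to the front. Relations with two such factors need to be checked on diagrams
  of this shape only.\<close>

lemma cupcap_cup:
  assumes ab: "a \<in> {1..r}" "b \<in> {1..r}" "a \<noteq> b" and D: "D \<in> MB"
  shows "\<exists>e X vs. qmul (dv (cupcap r a b)) (dv D) = scale e (dv (X, Bead {Top a, Top b} # vs)) \<and>
    (X, Bead {Top a, Top b} # vs) \<in> MB"
proof -
  obtain X ms where X: "D = (X, ms)" "(X, ms) \<in> MB" using D by (cases D) auto
  have B: "brauer_diagram r r X" using X by (simp add: marked_brauer_def)
  have front: "\<exists>c vs. dv D = scale c (dv (X, Bead e # vs)) \<and> (X, Bead e # vs) \<in> MB" if "e \<in> cups X" for e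
  proof -
    have "Bead e \<in> set ms" using marked_bead_iff[OF X(2)] that by blast
    then obtain us vs where "ms = us @ Bead e # vs" by (auto dest: split_list)
    then show ?thesis using dv_front X by blast
  qed
  from B ab show ?thesis
  proof (cases rule: top_partner_cases)
    case loop
    then obtain c vs where c: "dv D = scale c (dv (X, Bead {Top a, Top b} # vs))" "(X, Bead {Top a, Top b} # vs) \<in> MB"
      using front by blast
    then have "qmul (dv (cupcap r a b)) (dv D) = scale (c * \<delta>) (dv (X, Bead {Top a, Top b} # vs))"
      using cupcap_loop[OF ab c(2)] by (simp add: qmul_scale_right)
    then show ?thesis using c(2) by blast
  next
    case (left p)
    then obtain c vs where c: "dv D = scale c (dv (X, Bead {Top a, Top p} # vs))" "(X, Bead {Top a, Top p} # vs) \<in> MB"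
      using front by blast
    let ?\<tau> = "trp p b"
    have "{Top p, Top a} \<in> X" using left by (simp add: cups_def insert_commute)
    then have "p \<in> {1..r}" "p \<noteq> a" using brauer_vertex(1)[OF B] brauer_neq[OF B] by blast+
    then have "dmap (tp ?\<tau>) (X, Bead {Top a, Top p} # vs) \<in> MB"
      using marked_tp[OF c(2)] ab(2) by (simp add: permutes_swap_id)
    moreover have "dmap (tp ?\<tau>) (X, Bead {Top a, Top p} # vs) = (vmap (tp ?\<tau>) X, Bead {Top a, Top b} # map (relabel (tp ?\<tau>)) vs)"
      using \<open>p \<noteq> a\<close> ab(3) by (simp add: dmap_def)
    moreover have "qmul (dv (cupcap r a b)) (dv D) = scale (c * \<epsilon>) (dv (dmap (tp ?\<tau>) (X, Bead {Top a, Top p} # vs)))"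
      using cupcap_cup_left[OF ab c(2) left(2)] c(1) by (simp add: qmul_scale_right)
    ultimately show ?thesis by metis
  next
    case (right q)
    then obtain c vs where c: "dv D = scale c (dv (X, Bead {Top b, Top q} # vs))" "(X, Bead {Top b, Top q} # vs) \<in> MB"
      using front by blast
    let ?\<tau> = "trp q a"
    have "{Top q, Top b} \<in> X" using right by (simp add: cups_def insert_commute)
    then have "q \<in> {1..r}" "q \<noteq> b" using brauer_vertex(1)[OF B] brauer_neq[OF B] by blast+
    then have "dmap (tp ?\<tau>) (X, Bead {Top b, Top q} # vs) \<in> MB"
      using marked_tp[OF c(2)] ab(1) by (simp add: permutes_swap_id)
    moreover have "dmap (tp ?\<tau>) (X, Bead {Top b, Top q} # vs) = (vmap (tp ?\<tau>) X, Bead {Top a, Top b} # map (relabel (tp ?\<tau>)) vs)"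
      using \<open>q \<noteq> b\<close> ab(3) by (simp add: dmap_def insert_commute)
    moreover have "qmul (dv (cupcap r a b)) (dv D) = scale c (dv (dmap (tp ?\<tau>) (X, Bead {Top b, Top q} # vs)))"
      using cupcap_cup_right[OF ab c(2) right(2)] c(1) by (simp add: qmul_scale_right)
    ultimately show ?thesis by metis
  next
    case (bot p q)
    then have "qmul (dv (cupcap r a b)) (dv D) = scale 1 (dv (glue a b p q D))" "glue a b p q D \<in> MB"
      using cupcap_bot[OF ab D, of p q] glue_marked[OF D, of a p b q] ab X by simp_all
    then show ?thesis unfolding glue_def by metis
  qed
qed

end

section \<open>Words up to the signless relations\<close>

text \<open>
  The congruence generated by the defining relations without signs, except for \<open>e\<^sub>i\<^sup>2 = \<delta> e\<^sub>i\<close>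
  and the redundant \<open>e\<^sub>i e\<^sub>i\<^sub>+\<^sub>1 e\<^sub>i = \<epsilon> e\<^sub>i\<close> and \<open>e\<^sub>i\<^sub>+\<^sub>1 e\<^sub>i e\<^sub>i\<^sub>+\<^sub>1 = \<epsilon> e\<^sub>i\<^sub>+\<^sub>1\<close>.
  Congruent words agree in the presented algebra up to an invertible scalar.
\<close>

inductive bcong :: "nat \<Rightarrow> letter list \<Rightarrow> letter list \<Rightarrow> bool" for r where
  refl: "bcong r u u"
| sym: "bcong r u v \<Longrightarrow> bcong r v u"
| trans: "bcong r u v \<Longrightarrow> bcong r v w \<Longrightarrow> bcong r u w"
| app: "bcong r u u' \<Longrightarrow> bcong r v v' \<Longrightarrow> bcong r (u @ v) (u' @ v')"
| SS: "i \<in> {1..<r} \<Longrightarrow> bcong r [S i, S i] []"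
| ES: "i \<in> {1..<r} \<Longrightarrow> bcong r [E i, S i] [E i]"
| SE: "i \<in> {1..<r} \<Longrightarrow> bcong r [S i, E i] [E i]"
| far_SS: "i \<in> {1..<r} \<Longrightarrow> j \<in> {1..<r} \<Longrightarrow> i + 1 < j \<or> j + 1 < i \<Longrightarrow> bcong r [S i, S j] [S j, S i]"
| far_EE: "i \<in> {1..<r} \<Longrightarrow> j \<in> {1..<r} \<Longrightarrow> i + 1 < j \<or> j + 1 < i \<Longrightarrow> bcong r [E i, E j] [E j, E i]"
| far_SE: "i \<in> {1..<r} \<Longrightarrow> j \<in> {1..<r} \<Longrightarrow> i + 1 < j \<or> j + 1 < i \<Longrightarrow> bcong r [S i, E j] [E j, S i]"
| braid: "i \<in> {1..<r} \<Longrightarrow> i + 1 \<in> {1..<r} \<Longrightarrow> bcong r [S i, S (i + 1), S i] [S (i + 1), S i, S (i + 1)]"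
| SEE: "i \<in> {1..<r} \<Longrightarrow> i + 1 \<in> {1..<r} \<Longrightarrow> bcong r [S i, E (i + 1), E i] [S (i + 1), E i]"
| EES: "i \<in> {1..<r} \<Longrightarrow> i + 1 \<in> {1..<r} \<Longrightarrow> bcong r [E (i + 1), E i, S (i + 1)] [E (i + 1), S i]"

fun wperm :: "nat list \<Rightarrow> nat \<Rightarrow> nat" where
  "wperm [] = id"
| "wperm (i # w) = trp i (Suc i) \<circ> wperm w"

lemma wperm_append: "wperm (u @ v) = wperm u \<circ> wperm v" by (induction u) (auto simp: comp_assoc)

lemma wperm_rev: "wperm (rev w) \<circ> wperm w = id" "wperm w \<circ> wperm (rev w) = id"
proof -
  have *: "wperm (rev w) \<circ> wperm w = id" for w
  proof (induction w)
    case (Cons i w)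
    have "wperm (rev (i # w)) \<circ> wperm (i # w) =
        wperm (rev w) \<circ> (trp i (Suc i) \<circ> trp i (Suc i)) \<circ> wperm w"
      by (simp only: rev.simps wperm_append wperm.simps comp_assoc id_comp comp_id)
    then show ?case by (simp only: transpose_comp_involutory comp_id Cons)
  qed simp
  then show "wperm (rev w) \<circ> wperm w = id" "wperm w \<circ> wperm (rev w) = id" using *[of "rev w"] by simp_all
qed

lemma wperm_permutes: "set w \<subseteq> {m..<n} \<Longrightarrow> wperm w permutes {m..n}"
proof (induction w)
  case Nil
  show ?case unfolding wperm.simps by (rule permutes_id)
next
  case (Cons i w)
  then have "trp i (Suc i) permutes {m..n}" "wperm w permutes {m..n}" by (auto intro!: permutes_swap_id)
  then show ?case unfolding wperm.simps by (intro permutes_compose)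
qed

text \<open>The descending word from \<open>n - 1\<close> to \<open>j\<close> carries
  \<open>j\<close> up to \<open>n\<close>. These runs serve as coset representatives when one point
  is added.\<close>

lemma wperm_run: "j \<le> n \<Longrightarrow> wperm (rev [j..<n]) j = n"
proof (induction n)
  case (Suc n)
  show ?case
  proof (cases "j = Suc n")
    case False
    then show ?thesis using Suc by simp
  qed simp
qed simp

text \<open>A run brings the preimage of the last point to the end; what remains fixes that
  point.\<close>

lemma permutation_word: "\<pi> permutes {m..n} \<Longrightarrow> \<exists>w. set w \<subseteq> {m..<n} \<and> wperm w = \<pi>"
proof (induction n arbitrary: \<pi>)
  case 0
  then have "\<pi> = id" by (cases m) auto
  then show ?case by (intro exI[of _ "[]"]) simp
next
  case (Suc n)
  show ?case
  proof (cases "m \<le> Suc n")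
    case False
    then have "\<pi> = id" using Suc.prems by simp
    then show ?thesis by (intro exI[of _ "[]"]) simp
  next
    case True
    define j where "j = inv_into UNIV \<pi> (Suc n)"
    have j: "j \<in> {m..Suc n}" "\<pi> j = Suc n"
      using permutes_in_image[OF permutes_inv[OF Suc.prems], of "Suc n"] permutes_inverses(1)[OF Suc.prems, of "Suc n"] True
      by (auto simp: j_def)
    define v where "v = rev [j..<Suc n]"
    have v: "set v \<subseteq> {m..<Suc n}" "wperm v j = Suc n"
      using j(1) wperm_run[of j "Suc n"] by (auto simp: v_def simp del: upt_Suc)
    have rv: "wperm (rev v) permutes {m..Suc n}" using v(1) by (intro wperm_permutes) simp
    have "wperm (rev v) (Suc n) = j" using v(2) wperm_rev(1)[of v] by (metis comp_apply id_apply)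
    then have fixes_last: "(\<pi> \<circ> wperm (rev v)) (Suc n) = Suc n" using j(2) by simp
    have "(\<pi> \<circ> wperm (rev v)) permutes {m..n}"
    proof (rule permutes_superset)
      show "(\<pi> \<circ> wperm (rev v)) permutes {m..Suc n}" by (rule permutes_compose[OF rv Suc.prems])
      show "(\<pi> \<circ> wperm (rev v)) x = x" if "x \<in> {m..Suc n} - {m..n}" for x
        using that fixes_last by (cases "x = Suc n") auto
    qed
    then obtain w where w: "set w \<subseteq> {m..<n}" "wperm w = \<pi> \<circ> wperm (rev v)" using Suc.IH by blast
    have "wperm (w @ v) = \<pi>" unfolding wperm_append w(2) comp_assoc wperm_rev(1) by simp
    moreover have "set (w @ v) \<subseteq> {m..<Suc n}" using w(1) v(1) by auto
    ultimately show ?thesis by blast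
  qed
qed

text \<open>Points are prescribed one at a time: a transposition corrects the image of the new point
  and misses the images already fixed.\<close>

lemma permutation_extension:
  assumes "distinct xs" "distinct ys" "length xs = length ys" "set xs \<subseteq> A" "set ys \<subseteq> A"
  shows "\<exists>\<rho>. \<rho> permutes A \<and> map \<rho> xs = ys" using assms
proof (induction xs arbitrary: ys)
  case Nil
  then show ?case by (intro exI[of _ id] conjI permutes_id) simp
next
  case (Cons x xs)
  then obtain y ys' where ys: "ys = y # ys'" by (cases ys) auto
  then obtain \<rho> where \<rho>: "\<rho> permutes A" "map \<rho> xs = ys'"
    using Cons by (metis distinct.simps(2) insert_subset length_Cons list.simps(15) nat.inject)
  have "\<rho> x \<notin> set ys'"
  proof
    assume "\<rho> x \<in> set ys'"
    then obtain x' where "x' \<in> set xs" "\<rho> x' = \<rho> x" using \<rho>(2) by auto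
    then show False using permutes_inj[OF \<rho>(1)] Cons.prems(1) by (auto simp: inj_eq)
  qed
  moreover have "y \<notin> set ys'" using Cons.prems ys by simp
  ultimately have "map (trp (\<rho> x) y \<circ> \<rho>) xs = ys'"
    unfolding map_map[symmetric] \<rho>(2) by (intro map_idI) (metis transpose_apply_other)
  moreover have "(trp (\<rho> x) y \<circ> \<rho>) permutes A"
  proof (rule permutes_compose[OF \<rho>(1)], rule permutes_swap_id)
    show "\<rho> x \<in> A" "y \<in> A" using Cons.prems ys permutes_in_image[OF \<rho>(1)] by auto
  qed
  moreover have "(trp (\<rho> x) y \<circ> \<rho>) x = y" by simp
  ultimately have "(trp (\<rho> x) y \<circ> \<rho>) permutes A \<and>
      map (trp (\<rho> x) y \<circ> \<rho>) (x # xs) = y # ys'" unfolding list.map by (intro conjI arg_cong2[of _ _ _ _ Cons])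
  then show ?case unfolding ys by (rule exI[of "\<lambda>\<sigma>. \<sigma> permutes A \<and> map \<sigma> (x # xs) = y # ys'"])
qed

locale brauer_words =
  fixes r :: nat
begin

text \<open>A fixed representative of each class, so that congruence becomes equality and can be
  used for rewriting.\<close>

definition nrm :: "letter list \<Rightarrow> letter list" where
  "nrm w = (SOME v. bcong r v w)"

lemma bcong_nrm: "bcong r (nrm w) w" unfolding nrm_def by (rule someI, rule bcong.refl)

lemma nrm_eq: "nrm u = nrm v \<longleftrightarrow> bcong r u v"
proof
  assume "nrm u = nrm v"
  then show "bcong r u v" using bcong_nrm[of u] bcong_nrm[of v] by (metis bcong.sym bcong.trans)
next
  assume "bcong r u v"
  then have "bcong r x u \<longleftrightarrow> bcong r x v" for x by (metis bcong.sym bcong.trans)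
  then show "nrm u = nrm v" by (simp add: nrm_def)
qed

definition mul :: "letter list \<Rightarrow> letter list \<Rightarrow> letter list" (infixl "\<bullet>" 70) where
  "u \<bullet> v = nrm (u @ v)"

definition "un = nrm []"
definition "s i = nrm [S i]"
definition "e i = nrm [E i]"

lemma nrm_append: "nrm (u @ v) = nrm u \<bullet> nrm v"
  unfolding mul_def nrm_eq by (intro bcong.app bcong.sym[OF bcong_nrm])

lemma assoc: "(u \<bullet> v) \<bullet> w = u \<bullet> (v \<bullet> w)"
proof -
  have "bcong r (nrm (u @ v) @ w) ((u @ v) @ w)" "bcong r (u @ v @ w) (u @ nrm (v @ w))"
    by (intro bcong.app bcong.refl bcong_nrm bcong.sym[OF bcong_nrm])+
  then show ?thesis unfolding mul_def nrm_eq by (metis append.assoc bcong.trans)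
qed

lemma one_left: "un \<bullet> nrm w = nrm w" and one_right: "nrm w \<bullet> un = nrm w"
  unfolding un_def nrm_append[symmetric] by simp_all

lemma word2: "nrm [x, y] = nrm [x] \<bullet> nrm [y]" and word3: "nrm [x, y, z] = nrm [x] \<bullet> nrm [y] \<bullet> nrm [z]"
  using nrm_append[of "[x]" "[y]"] nrm_append[of "[x]" "[y, z]"] nrm_append[of "[y]" "[z]"] by (simp_all add: assoc)

lemma
  assumes "i \<in> {1..<r}"
  shows SS: "s i \<bullet> s i = un" and ES: "e i \<bullet> s i = e i" and SE: "s i \<bullet> e i = e i"
  using bcong.SS[OF assms] bcong.ES[OF assms] bcong.SE[OF assms]
  unfolding s_def e_def un_def word2[symmetric] nrm_eq by blast+

lemma
  assumes "i \<in> {1..<r}" "j \<in> {1..<r}" "i + 1 < j \<or> j + 1 < i"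
  shows far_SS: "s i \<bullet> s j = s j \<bullet> s i" and far_EE: "e i \<bullet> e j = e j \<bullet> e i" and far_SE: "s i \<bullet> e j = e j \<bullet> s i"
  using bcong.far_SS[OF assms] bcong.far_EE[OF assms] bcong.far_SE[OF assms]
  unfolding s_def e_def word2[symmetric] nrm_eq by blast+

lemma
  assumes "i \<in> {1..<r}" "i + 1 \<in> {1..<r}"
  shows braid: "s i \<bullet> s (i + 1) \<bullet> s i = s (i + 1) \<bullet> s i \<bullet> s (i + 1)"
    and SEE: "s i \<bullet> e (i + 1) \<bullet> e i = s (i + 1) \<bullet> e i" and EES: "e (i + 1) \<bullet> e i \<bullet> s (i + 1) = e (i + 1) \<bullet> s i"
  using bcong.braid[OF assms] bcong.SEE[OF assms] bcong.EES[OF assms]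
  unfolding s_def e_def word3[symmetric] unfolding word2[symmetric] nrm_eq by blast+

subsection \<open>The Coxeter presentation of the symmetric group\<close>

definition sw :: "nat list \<Rightarrow> letter list" where
  "sw w = nrm (map S w)"

lemma sw_append: "sw (u @ v) = sw u \<bullet> sw v" by (simp add: sw_def nrm_append)

lemma sw_single: "sw [i] = s i" by (simp add: sw_def s_def)

lemma sw_Nil: "sw [] = un" by (simp add: sw_def un_def)

lemma sw_Cons: "sw (i # w) = s i \<bullet> sw w" using sw_append[of "[i]" w] sw_single by simp

lemma sw_one: "un \<bullet> sw w = sw w" "sw w \<bullet> un = sw w" by (simp_all add: sw_def one_left one_right)

lemma one_s: "un \<bullet> s i = s i" "s i \<bullet> un = s i" "un \<bullet> e i = e i" "e i \<bullet> un = e i" "un \<bullet> un = un"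
  using one_left[of "[S i]"] one_right[of "[S i]"] one_left[of "[E i]"] one_right[of "[E i]"] one_left[of "[]"]
  by (simp_all add: s_def e_def un_def)

text \<open>Carries the permutation along with the class, so that a rewritten word is known to
  evaluate to the same permutation.\<close>

definition weq :: "nat list \<Rightarrow> nat list \<Rightarrow> bool" where
  "weq u v \<longleftrightarrow> sw u = sw v \<and> wperm u = wperm v"

lemma weq_refl: "weq u u" by (simp add: weq_def)

lemma weq_trans: "weq u v \<Longrightarrow> weq v w \<Longrightarrow> weq u w" by (simp add: weq_def)

lemma weq_append: "weq u u' \<Longrightarrow> weq v v' \<Longrightarrow> weq (u @ v) (u' @ v')" by (simp add: weq_def sw_append wperm_append)

lemma weq_context: "weq v v' \<Longrightarrow> weq (u @ v @ w) (u @ v' @ w)" by (intro weq_append weq_refl)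

lemma weq_square: "i \<in> {1..<r} \<Longrightarrow> weq [i, i] []" using SS by (simp add: weq_def sw_Cons sw_Nil one_s)

lemma weq_far: "i \<in> {1..<r} \<Longrightarrow> j \<in> {1..<r} \<Longrightarrow> i + 1 < j \<or> j + 1 < i \<Longrightarrow> weq [i, j] [j, i]"
  using far_SS[of i j] by (auto simp: weq_def sw_Cons sw_Nil one_s fun_eq_iff transpose_def)

lemma weq_braid: "i \<in> {1..<r} \<Longrightarrow> i + 1 \<in> {1..<r} \<Longrightarrow> weq [i, i + 1, i] [i + 1, i, i + 1]"
  using braid[of i] by (auto simp: weq_def sw_Cons sw_Nil one_s assoc fun_eq_iff transpose_def)

lemma weq_commute:
  "i \<in> {1..<r} \<Longrightarrow> set v \<subseteq> {1..<r} \<Longrightarrow> (\<And>k. k \<in> set v \<Longrightarrow> i + 1 < k \<or> k + 1 < i) \<Longrightarrow> weq (v @ [i]) (i # v)"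
proof (induction v)
  case (Cons k v)
  then have "weq ([k] @ v @ [i]) ([k] @ i # v)" by (intro weq_append weq_refl Cons.IH) auto
  moreover have "weq ([] @ [k, i] @ v) ([] @ [i, k] @ v)" using Cons.prems by (intro weq_context weq_far) auto
  ultimately show ?case by (simp add: weq_def)
qed (simp add: weq_refl)

lemma run_last: "j \<le> i \<Longrightarrow> i \<le> n \<Longrightarrow> rev [j..<Suc n] = rev [Suc i..<Suc n] @ [i] @ rev [j..<i]"
proof -
  assume "j \<le> i" "i \<le> n"
  then have "[j..<Suc n] = [j..<i] @ [i..<Suc n]" by (metis le_Suc_eq le_Suc_ex le_trans upt_add_eq_append)
  moreover have "[i..<Suc n] = i # [Suc i..<Suc n]" using \<open>i \<le> n\<close> by (simp add: upt_conv_Cons del: upt_Suc)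
  ultimately show ?thesis by (simp del: upt_Suc)
qed

text \<open>The runs \<open>rev [j..<Suc n]\<close> represent the cosets of the symmetric group on
  \<open>n\<close> points in that on \<open>n + 1\<close> points. A generator multiplied from the
  right either lengthens or shortens the run, or passes through it and comes out on the left as a
  letter below \<open>n\<close>.\<close>

lemma coxeter_step:
  assumes n: "n < r" and j: "1 \<le> j" "j \<le> Suc n" and i: "1 \<le> i" "i \<le> n"
  shows "\<exists>u' j'. set u' \<subseteq> {1..<n} \<and> 1 \<le> j' \<and> j' \<le> Suc n \<and> weq (rev [j..<Suc n] @ [i]) (u' @ rev [j'..<Suc n])"
proof -
  consider "i + 1 < j" | "i + 1 = j" | "i = j" | "j < i" by linarith
  then show ?thesis
  proof cases
    case 1
    have "weq (rev [j..<Suc n] @ [i]) (i # rev [j..<Suc n])" using 1 n i j by (intro weq_commute) auto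
    then show ?thesis using 1 i j by (intro exI[of _ "[i]"] exI[of _ j]) auto
  next
    case 2
    have "rev [i..<Suc n] = rev [j..<Suc n] @ [i]" using run_last[of i i n] i 2 by (simp del: upt_Suc)
    then show ?thesis using 2 i by (intro exI[of _ "[]"] exI[of _ i]) (auto simp: weq_refl)
  next
    case 3
    have "rev [j..<Suc n] = rev [Suc j..<Suc n] @ [i]" using run_last[of j j n] i 3 by (simp del: upt_Suc)
    moreover have "weq (rev [Suc j..<Suc n] @ [i, i] @ []) (rev [Suc j..<Suc n] @ [] @ [])"
      using i n by (intro weq_context weq_square) auto
    ultimately show ?thesis using 3 j i by (intro exI[of _ "[]"] exI[of _ "Suc j"]) (auto simp del: upt_Suc)
  next
    case 4
    define A where "A = rev [Suc i..<Suc n]"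
    define B where "B = rev [j..<i - 1]"
    obtain h where h: "i = Suc h" "j \<le> h" using 4 by (cases i) auto
    have "rev [j..<Suc n] = A @ [i] @ rev [j..<Suc h]"
      using run_last[of j i n] 4 i h by (simp add: A_def del: upt_Suc)
    also have "rev [j..<Suc h] = [h] @ B" using h by (simp add: B_def)
    finally have run: "rev [j..<Suc n] = A @ [i, h] @ B" by simp
    \<comment> \<open>\<open>i\<close> commutes with \<open>B\<close>, the braid relation turns
      \<open>i, h, i\<close> into \<open>h, i, h\<close>, and the front \<open>h\<close> commutes
      with \<open>A\<close>.\<close>
    have "weq ((A @ [i, h]) @ B @ [i]) ((A @ [i, h]) @ i # B)"
      using h n i j by (intro weq_append weq_refl weq_commute) (auto simp: B_def)
    moreover have "weq (A @ [i, h, i] @ B) (A @ [h, i, h] @ B)"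
    proof -
      have "weq [h, i, h] [i, h, i]" using weq_braid[of h] h i j n by simp
      then show ?thesis by (intro weq_context) (simp add: weq_def)
    qed
    moreover have "weq ((A @ [h]) @ [i, h] @ B) ((h # A) @ [i, h] @ B)"
      using h n i j by (intro weq_append weq_refl weq_commute) (auto simp: A_def)
    ultimately have "weq (rev [j..<Suc n] @ [i]) ([h] @ rev [j..<Suc n])"
      unfolding run by (auto intro: weq_trans simp: weq_def)
    then show ?thesis using h i j by (intro exI[of _ "[h]"] exI[of _ j]) auto
  qed
qed

lemma coxeter_factor:
  assumes n: "n < r" and w: "set w \<subseteq> {1..<Suc n}"
  shows "\<exists>u j. set u \<subseteq> {1..<n} \<and> 1 \<le> j \<and> j \<le> Suc n \<and> weq w (u @ rev [j..<Suc n])" using w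
proof (induction w rule: rev_induct)
  case Nil
  show ?case by (intro exI[of _ "[]"] exI[of _ "Suc n"]) (simp add: weq_refl)
next
  case (snoc i w)
  then obtain u j where uj: "set u \<subseteq> {1..<n}" "1 \<le> j" "j \<le> Suc n" "weq w (u @ rev [j..<Suc n])" by auto
  have "1 \<le> i" "i \<le> n" using snoc.prems by auto
  from coxeter_step[OF n uj(2,3) this] obtain u' j' where
    u': "set u' \<subseteq> {1..<n}" "1 \<le> j'" "j' \<le> Suc n" "weq (rev [j..<Suc n] @ [i]) (u' @ rev [j'..<Suc n])" by blast
  have "weq (w @ [i]) ((u @ rev [j..<Suc n]) @ [i])" by (intro weq_append uj(4) weq_refl)
  moreover have "weq (u @ rev [j..<Suc n] @ [i]) (u @ u' @ rev [j'..<Suc n])"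
    by (intro weq_append u'(4) weq_refl)
  ultimately have "weq (w @ [i]) ((u @ u') @ rev [j'..<Suc n])" by (simp add: weq_def del: upt_Suc)
  then show ?case using uj(1) u'(1-3) by (intro exI[of _ "u @ u'"] exI[of _ j']) auto
qed

text \<open>A nonempty run moves some \<open>j\<close> to \<open>Suc n\<close>, which the letters
  below \<open>n\<close> cannot undo. A trivial permutation therefore leaves a word in fewer
  generators.\<close>

lemma coxeter_trivial: "n \<le> r \<Longrightarrow> set w \<subseteq> {1..<n} \<Longrightarrow> wperm w = id \<Longrightarrow> sw w = un"
proof (induction n arbitrary: w)
  case 0
  then show ?case by (simp add: sw_Nil)
next
  case (Suc n)
  then obtain u j where uj: "set u \<subseteq> {1..<n}" "1 \<le> j" "j \<le> Suc n" "weq w (u @ rev [j..<Suc n])"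
    using coxeter_factor[of n w] by auto
  have "wperm u permutes {1..n}" by (rule wperm_permutes[OF uj(1)])
  then have "wperm u (Suc n) = Suc n" by (rule permutes_not_in) simp
  then have "wperm (u @ rev [j..<Suc n]) j = Suc n"
    using wperm_run[OF uj(3)] by (simp add: wperm_append del: upt_Suc)
  then have "wperm w j = Suc n" using uj(4) by (simp add: weq_def del: upt_Suc)
  then have "j = Suc n" by (simp add: Suc.prems(3))
  then have "weq w u" using uj(4) by simp
  then show ?case using Suc.IH[OF _ uj(1)] Suc.prems by (simp add: weq_def)
qed

lemma sw_rev_cancel: "set w \<subseteq> {1..<r} \<Longrightarrow> sw (rev w @ w) = un"
proof (induction w)
  case (Cons i w)
  then have "weq (rev w @ [i, i] @ w) (rev w @ [] @ w)" by (intro weq_context weq_square) auto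
  then show ?case using Cons by (simp add: weq_def)
qed (simp add: sw_Nil)

lemma coxeter_unique:
  assumes "set u \<subseteq> {1..<r}" "set v \<subseteq> {1..<r}" "wperm u = wperm v" shows "sw u = sw v"
proof -
  have "wperm (u @ rev v) = id" by (simp add: wperm_append assms(3) wperm_rev)
  then have "sw (u @ rev v) = un" using assms by (intro coxeter_trivial[of r]) auto
  then have "sw ((u @ rev v) @ v) = sw v" unfolding sw_append[of "u @ rev v"] by (simp add: sw_one)
  moreover have "sw (u @ (rev v @ v)) = sw u"
    unfolding sw_append[of u] sw_rev_cancel[OF assms(2)] by (rule sw_one)
  ultimately show ?thesis by simp
qed

definition pword :: "(nat \<Rightarrow> nat) \<Rightarrow> nat list" where
  "pword \<pi> = (SOME w. set w \<subseteq> {1..<r} \<and> wperm w = \<pi>)"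

definition t :: "(nat \<Rightarrow> nat) \<Rightarrow> letter list" where
  "t \<pi> = sw (pword \<pi>)"

abbreviation perm :: "(nat \<Rightarrow> nat) \<Rightarrow> bool" where
  "perm \<pi> \<equiv> \<pi> permutes {1..r}"

lemma pword: "perm \<pi> \<Longrightarrow> set (pword \<pi>) \<subseteq> {1..<r} \<and> wperm (pword \<pi>) = \<pi>"
  unfolding pword_def by (rule someI_ex, rule permutation_word)

lemma sw_t: "set w \<subseteq> {1..<r} \<Longrightarrow> sw w = t (wperm w)"
  unfolding t_def using pword[OF wperm_permutes[of w 1 r]] by (intro coxeter_unique) auto

lemma t_mult: "perm \<pi> \<Longrightarrow> perm \<rho> \<Longrightarrow> t \<pi> \<bullet> t \<rho> = t (\<pi> \<circ> \<rho>)"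
  using sw_t[of "pword \<pi> @ pword \<rho>"] pword[of \<pi>] pword[of \<rho>] by (simp add: sw_append wperm_append t_def)

lemma t_id: "t id = un" using sw_t[of "[]"] by (simp add: sw_Nil)

lemma t_s: "i \<in> {1..<r} \<Longrightarrow> t (trp i (Suc i)) = s i" using sw_t[of "[i]"] by (simp add: sw_single)

lemma one_t: "un \<bullet> t \<pi> = t \<pi>" "t \<pi> \<bullet> un = t \<pi>" by (simp_all add: t_def sw_one)

lemma t_inv: "perm \<pi> \<Longrightarrow> t \<pi> \<bullet> t (inv_into UNIV \<pi>) = un" "perm \<pi> \<Longrightarrow> t (inv_into UNIV \<pi>) \<bullet> t \<pi> = un"
  by (simp_all add: t_mult permutes_inv permutes_inv_o t_id)

end

lemma transpose_conj:
  assumes "\<rho> permutes A" shows "\<rho> \<circ> trp x y = trp (\<rho> x) (\<rho> y) \<circ> \<rho>"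
  using permutes_inj[OF assms] by (auto simp: fun_eq_iff transpose_def inj_eq)

lemma fixing_permutation_12:
  assumes "\<sigma> permutes {1..r::nat}" "\<sigma> 1 = 1" "\<sigma> 2 = 2" shows "\<sigma> permutes {3..r}"
proof (rule permutes_superset[OF assms(1)])
  fix x assume "x \<in> {1..r} - {3..r}"
  then have "x = 1 \<or> x = 2" by auto
  then show "\<sigma> x = x" using assms by auto
qed

lemma distinct_le_card:
  assumes "distinct xs" "set xs \<subseteq> {1..r::nat}" shows "length xs \<le> r"
  using card_mono[of "{1..r}" "set xs"] assms by (simp add: distinct_card)

subsection \<open>The conjugates of \<open>e\<^sub>1\<close>\<close>

definition pts :: "(nat \<times> nat) list \<Rightarrow> nat list" where
  "pts ps = concat (map (\<lambda>(a, b). [a, b]) ps)"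

definition pair_sets :: "(nat \<times> nat) list \<Rightarrow> nat set set" where
  "pair_sets ps = (\<lambda>(a, b). {a, b}) ` set ps"

lemma pts_simps [simp]: "pts [] = []" "pts ((a, b) # ps) = a # b # pts ps" "pts (xs @ ys) = pts xs @ pts ys"
  by (simp_all add: pts_def)

lemma pair_sets_simps [simp]: "pair_sets [] = {}" "pair_sets ((a, b) # ps) = insert {a, b} (pair_sets ps)"
  "pair_sets (xs @ ys) = pair_sets xs \<union> pair_sets ys" by (auto simp: pair_sets_def)

lemma Union_pair_sets: "\<Union>(pair_sets ps) = set (pts ps)" by (auto simp: pair_sets_def pts_def)

lemma pts_map: "pts (map (map_prod f f) ps) = map f (pts ps)" by (induction ps) auto

definition valid :: "nat \<Rightarrow> (nat \<times> nat) list \<Rightarrow> bool" where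
  "valid r ps \<longleftrightarrow> distinct (pts ps) \<and> set (pts ps) \<subseteq> {1..r}"

lemma valid_map: "\<pi> permutes {1..r} \<Longrightarrow> valid r ps \<Longrightarrow> valid r (map (map_prod \<pi> \<pi>) ps)"
  using permutes_in_image[of \<pi> "{1..r}"] permutes_inj_on[of \<pi> "{1..r}" "set (pts ps)"]
  by (auto simp: valid_def pts_map distinct_map subset_iff)

lemma split_pair:
  assumes "{a, b} \<in> pair_sets ps"
  obtains xs p ys where "ps = xs @ p # ys" "p = (a, b) \<or> p = (b, a)"
proof -
  obtain c d where "(c, d) \<in> set ps" "{a, b} = {c, d}" using assms by (auto simp: pair_sets_def)
  moreover from this(1) obtain xs ys where "ps = xs @ (c, d) # ys" by (auto dest: split_list)
  ultimately show ?thesis using that by (auto simp: doubleton_eq_iff)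
qed

context brauer_words
begin

lemma un_mul: "un \<bullet> (x \<bullet> y) = x \<bullet> y" "(x \<bullet> y) \<bullet> un = x \<bullet> y"
  using one_left[of "x @ y"] one_right[of "x @ y"] by (simp_all add: mul_def[of x y])

lemma perm_transpose: "a \<in> {1..r} \<Longrightarrow> b \<in> {1..r} \<Longrightarrow> perm (trp a b)" by (rule permutes_swap_id)

lemma t_mult_left: "perm \<pi> \<Longrightarrow> perm \<rho> \<Longrightarrow> t \<pi> \<bullet> (t \<rho> \<bullet> x) = t (\<pi> \<circ> \<rho>) \<bullet> x" by (simp add: assoc[symmetric] t_mult)

lemma t_inv_left: "perm \<pi> \<Longrightarrow> t \<pi> \<bullet> (t (inv_into UNIV \<pi>) \<bullet> (x \<bullet> y)) = x \<bullet> y"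
  "perm \<pi> \<Longrightarrow> t (inv_into UNIV \<pi>) \<bullet> (t \<pi> \<bullet> (x \<bullet> y)) = x \<bullet> y"
  by (simp_all add: assoc[symmetric] t_inv) (simp_all add: assoc un_mul)

lemma t_transpose_twice: "a \<in> {1..r} \<Longrightarrow> b \<in> {1..r} \<Longrightarrow> t (trp a b) \<bullet> (t (trp a b) \<bullet> (x \<bullet> y)) = x \<bullet> y"
  using t_inv_left(1)[OF perm_transpose, of a b x y] by simp

definition cj :: "(nat \<Rightarrow> nat) \<Rightarrow> letter list \<Rightarrow> letter list" where
  "cj \<rho> x = t \<rho> \<bullet> x \<bullet> t (inv_into UNIV \<rho>)"

lemma cj_mult: "perm \<rho> \<Longrightarrow> cj \<rho> (x \<bullet> y) = cj \<rho> x \<bullet> cj \<rho> y" by (simp add: cj_def assoc t_inv_left)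

lemma cj_t_transpose:
  assumes "perm \<rho>" "x \<in> {1..r}" "y \<in> {1..r}"
  shows "cj \<rho> (t (trp x y)) = t (trp (\<rho> x) (\<rho> y))"
proof -
  have "cj \<rho> (t (trp x y)) = t (\<rho> \<circ> trp x y \<circ> inv_into UNIV \<rho>)"
    using assms(1) perm_transpose[OF assms(2,3)] unfolding cj_def by (simp add: t_mult permutes_compose permutes_inv)
  also have "\<rho> \<circ> trp x y \<circ> inv_into UNIV \<rho> = trp (\<rho> x) (\<rho> y)"
    unfolding transpose_conj[OF assms(1)] comp_assoc permutes_inv_o(1)[OF assms(1)] by simp
  finally show ?thesis .
qed

lemma cj_cj: "perm \<pi> \<Longrightarrow> perm \<rho> \<Longrightarrow> cj \<pi> (cj \<rho> x) = cj (\<pi> \<circ> \<rho>) x"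
proof -
  assume p: "perm \<pi>" "perm \<rho>"
  have "inv_into UNIV (\<pi> \<circ> \<rho>) = inv_into UNIV \<rho> \<circ> inv_into UNIV \<pi>" using p by (intro o_inv_distrib permutes_bij)
  then show ?thesis using p by (simp add: cj_def assoc t_mult_left t_mult permutes_inv)
qed

lemma t_cj: "perm \<rho> \<Longrightarrow> t \<rho> \<bullet> (x \<bullet> y) = cj \<rho> (x \<bullet> y) \<bullet> t \<rho>"
  using t_inv(2)[of \<rho>] by (simp add: cj_def assoc) (simp add: assoc[symmetric] un_mul)

text \<open>Permutations that fix 1 and 2 are words in \<open>s i\<close> with
  \<open>i \<ge> 3\<close>, all far from \<open>e 1\<close>.\<close>

lemma t_stab:
  assumes "perm \<sigma>" "\<sigma> 1 = 1" "\<sigma> 2 = 2" "2 \<le> r" shows "t \<sigma> \<bullet> e 1 = e 1 \<bullet> t \<sigma>"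
proof -
  have "\<sigma> permutes {3..r}" using assms by (intro fixing_permutation_12)
  then obtain w where w: "set w \<subseteq> {3..<r}" "wperm w = \<sigma>" using permutation_word by blast
  have "sw w \<bullet> e 1 = e 1 \<bullet> sw w" using w(1)
  proof (induction w)
    case Nil
    then show ?case by (simp add: sw_Nil one_s)
  next
    case (Cons i w)
    then have "s i \<bullet> (e 1 \<bullet> sw w) = e 1 \<bullet> (s i \<bullet> sw w)" unfolding assoc[symmetric] by (subst far_SE) auto
    then show ?case using Cons by (simp add: sw_Cons assoc)
  qed
  moreover have "set w \<subseteq> {1..<r}" using w(1) by auto
  ultimately show ?thesis using sw_t[of w] w(2) by simp
qed

definition rep :: "nat \<Rightarrow> nat \<Rightarrow> nat \<Rightarrow> nat" where
  "rep a b = (SOME \<rho>. perm \<rho> \<and> \<rho> 1 = a \<and> \<rho> 2 = b)"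

definition el :: "nat \<Rightarrow> nat \<Rightarrow> letter list" where
  "el a b = cj (rep a b) (e 1)"

lemma rep:
  assumes "a \<in> {1..r}" "b \<in> {1..r}" "a \<noteq> b"
  shows "perm (rep a b)" "rep a b 1 = a" "rep a b 2 = b" "2 \<le> r"
proof -
  show "2 \<le> r" using distinct_le_card[of "[a, b]" r] assms by simp
  then have "\<exists>\<rho>. \<rho> permutes {1..r} \<and> map \<rho> [1, 2] = [a, b]" using assms by (intro permutation_extension) auto
  then have "\<exists>\<rho>. perm \<rho> \<and> \<rho> 1 = a \<and> \<rho> 2 = b" by simp
  then have "perm (rep a b) \<and> rep a b 1 = a \<and> rep a b 2 = b" unfolding rep_def by (rule someI_ex)
  then show "perm (rep a b)" "rep a b 1 = a" "rep a b 2 = b" by auto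
qed

text \<open>Two permutations with the same values at 1 and 2 differ by one that commutes with
  \<open>e 1\<close>, so the choice made in \<open>rep\<close> does not matter.\<close>

lemma cj_e1:
  assumes "perm \<rho>" "2 \<le> r" shows "cj \<rho> (e 1) = el (\<rho> 1) (\<rho> 2)"
proof -
  have ab: "\<rho> 1 \<in> {1..r}" "\<rho> 2 \<in> {1..r}" "\<rho> 1 \<noteq> \<rho> 2"
    using assms permutes_in_image[OF assms(1)] permutes_inj[OF assms(1)] by (auto simp: inj_eq)
  note q = rep[OF ab]
  define \<sigma> where "\<sigma> = inv_into UNIV (rep (\<rho> 1) (\<rho> 2)) \<circ> \<rho>"
  have \<sigma>: "perm \<sigma>" unfolding \<sigma>_def by (intro permutes_compose assms permutes_inv q)
  have fixes1: "\<sigma> 1 = 1" using permutes_inverses(2)[OF q(1), of 1] q(2) by (simp add: \<sigma>_def)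
  have fixes2: "\<sigma> 2 = 2" using permutes_inverses(2)[OF q(1), of 2] q(3) by (simp add: \<sigma>_def)
  have "rep (\<rho> 1) (\<rho> 2) \<circ> \<sigma> = \<rho>" unfolding \<sigma>_def comp_assoc[symmetric] permutes_inv_o(1)[OF q(1)] by simp
  moreover have "cj \<sigma> (e 1) = e 1"
    using t_stab[OF \<sigma> fixes1 fixes2 q(4)] t_inv(1)[OF \<sigma>] by (simp add: cj_def assoc one_s)
  ultimately show ?thesis using cj_cj[OF q(1) \<sigma>, of "e 1"] by (simp add: el_def del: One_nat_def)
qed

lemma cj_el:
  assumes "perm \<pi>" "a \<in> {1..r}" "b \<in> {1..r}" "a \<noteq> b" shows "cj \<pi> (el a b) = el (\<pi> a) (\<pi> b)"
  using rep[OF assms(2-4)] cj_cj[OF assms(1)] cj_e1[of "\<pi> \<circ> rep a b"] permutes_compose[OF _ assms(1)]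
  by (simp add: el_def)

lemma un_el: "un \<bullet> el a b = el a b" "el a b \<bullet> un = el a b" by (simp_all add: el_def cj_def un_mul)

lemma t_el:
  assumes "perm \<pi>" "a \<in> {1..r}" "b \<in> {1..r}" "a \<noteq> b" shows "t \<pi> \<bullet> el a b = el (\<pi> a) (\<pi> b) \<bullet> t \<pi>"
  using t_cj[OF assms(1), of "el a b" un] cj_el[OF assms] by (simp add: un_el)

lemma el_12: "2 \<le> r \<Longrightarrow> el 1 2 = e 1" using cj_e1[of id] permutes_id[of "{1..r}"] by (simp add: cj_def t_id one_s)

lemma el_transpose:
  assumes "a \<in> {1..r}" "b \<in> {1..r}" "a \<noteq> b" shows "t (trp a b) \<bullet> el a b = el a b"
proof -
  note q = rep[OF assms]
  have "t (trp 1 2) = s 1" using t_s[of 1] q(4) by (simp add: numeral_2_eq_2)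
  then have "cj (rep a b) (t (trp 1 2) \<bullet> el 1 2) = cj (rep a b) (el 1 2)"
    using SE[of 1] q(4) by (simp add: el_12 del: One_nat_def)
  then show ?thesis using q by (simp add: cj_mult cj_t_transpose cj_el)
qed

lemma el_transpose':
  assumes "a \<in> {1..r}" "b \<in> {1..r}" "a \<noteq> b" shows "el a b \<bullet> t (trp a b) = el a b"
proof -
  note q = rep[OF assms]
  have "t (trp 1 2) = s 1" using t_s[of 1] q(4) by (simp add: numeral_2_eq_2)
  then have "cj (rep a b) (el 1 2 \<bullet> t (trp 1 2)) = cj (rep a b) (el 1 2)"
    using ES[of 1] q(4) by (simp add: el_12 del: One_nat_def)
  then show ?thesis using q by (simp add: cj_mult cj_t_transpose cj_el)
qed

text \<open>Moving the transposition past \<open>el a b\<close> turns it into \<open>el b a\<close>,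
  and both absorb that transposition. It is an equality only because signs are dropped.\<close>

lemma el_sym:
  assumes "a \<in> {1..r}" "b \<in> {1..r}" "a \<noteq> b" shows "el a b = el b a"
  using t_el[OF perm_transpose[OF assms(1,2)] assms] el_transpose[OF assms] el_transpose'[of b a] assms
  by (simp add: transpose_commute[of a])

text \<open>The two mixed relations turn \<open>s (i + 1) \<bullet> e i \<bullet> s (i + 1)\<close>
  into \<open>s i \<bullet> e (i + 1) \<bullet> s i\<close>. Hence all the \<open>e i\<close> are
  conjugates of \<open>e 1\<close>.\<close>

lemma e_Suc: "i \<in> {1..<r} \<Longrightarrow> i + 1 \<in> {1..<r} \<Longrightarrow> e (i + 1) = s i \<bullet> (s (i + 1) \<bullet> (e i \<bullet> (s (i + 1) \<bullet> s i)))"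
proof -
  assume i: "i \<in> {1..<r}" "i + 1 \<in> {1..<r}"
  have "s (i + 1) \<bullet> (e i \<bullet> s (i + 1)) = (s i \<bullet> e (i + 1) \<bullet> e i) \<bullet> s (i + 1)"
    unfolding SEE[OF i] by (simp add: assoc)
  also have "\<dots> = s i \<bullet> (e (i + 1) \<bullet> e i \<bullet> s (i + 1))" by (simp add: assoc)
  also have "\<dots> = s i \<bullet> (e (i + 1) \<bullet> s i)" by (simp only: EES[OF i])
  finally have "s i \<bullet> ((s (i + 1) \<bullet> (e i \<bullet> s (i + 1))) \<bullet> s i) = s i \<bullet> s i \<bullet> (e (i + 1) \<bullet> (s i \<bullet> s i))"
    by (simp add: assoc)
  then show ?thesis using SS[OF i(1)] by (simp add: assoc one_s)
qed

lemma e_el: "i \<in> {1..<r} \<Longrightarrow> e i = el i (i + 1)"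
proof (induction i)
  case (Suc i)
  show ?case
  proof (cases "i = 0")
    case True
    then show ?thesis using Suc.prems el_12 by (simp add: numeral_2_eq_2)
  next
    case False
    then have i: "i \<in> {1..<r}" "i + 1 \<in> {1..<r}" using Suc.prems by auto
    let ?\<tau> = "trp i (Suc i)" and ?\<tau>' = "trp (Suc i) (Suc (Suc i))"
    have p: "perm ?\<tau>" "perm ?\<tau>'" using i by (auto intro!: permutes_swap_id)
    have "cj ?\<tau> (cj ?\<tau>' (el i (Suc i))) = el (Suc i) (Suc (Suc i))" using i p by (simp add: cj_el)
    moreover have "cj ?\<tau> (cj ?\<tau>' (el i (Suc i))) = e (i + 1)"
      using i Suc.IH e_Suc[OF i] by (simp add: cj_def t_s assoc)
    ultimately show ?thesis by simp
  qed
qed simp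

text \<open>By conjugation it suffices to treat the points 3, 2, 1, where it follows from the
  relation for \<open>s 1 \<bullet> e 2 \<bullet> e 1\<close> because \<open>e 1\<close> absorbs
  \<open>s 1\<close>.\<close>

lemma el_el:
  assumes "a \<in> {1..r}" "b \<in> {1..r}" "c \<in> {1..r}" "distinct [a, b, c]"
  shows "el a b \<bullet> el b c = t (trp a c) \<bullet> el b c"
proof -
  have r: "3 \<le> r" using distinct_le_card[of "[a, b, c]" r] assms by simp
  then have "\<exists>\<rho>. \<rho> permutes {1..r} \<and> map \<rho> [3, 2, 1] = [a, b, c]"
    using assms by (intro permutation_extension) auto
  then obtain \<rho> where \<rho>: "perm \<rho>" "\<rho> 3 = a" "\<rho> 2 = b" "\<rho> 1 = c" by auto
  have i: "1 \<in> {1..<r}" "1 + 1 \<in> {1..<r}" using r by auto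
  have e: "e 1 = el 2 1" "e 2 = el 3 2" "el 1 2 = el 2 1"
    using e_el[of 1] e_el[of 2] el_sym[of 1 2] el_sym[of 3 2] r by (simp_all add: numeral_2_eq_2 numeral_3_eq_3)
  have ts: "s 1 = t (trp 1 2)" "s 2 = t (trp 2 3)"
    using t_s[of 1] t_s[of 2] r by (simp_all add: numeral_2_eq_2 numeral_3_eq_3)
  have p: "perm (trp 1 2)" "perm (trp 2 3)" using r by (auto intro!: permutes_swap_id)
  have "el 3 2 \<bullet> el 2 1 = s 1 \<bullet> s 1 \<bullet> (e 2 \<bullet> e 1)" using SS[OF i(1)] by (simp add: e un_mul del: One_nat_def)
  also have "\<dots> = s 1 \<bullet> (s 1 \<bullet> e (1 + 1) \<bullet> e 1)" by (simp add: assoc nat_1_add_1 del: One_nat_def)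
  also have "\<dots> = s 1 \<bullet> (s 2 \<bullet> (s 1 \<bullet> e 1))"
    unfolding SEE[OF i] SE[OF i(1)] by (simp add: nat_1_add_1 del: One_nat_def)
  also have "\<dots> = t (trp 1 2 \<circ> trp 2 3 \<circ> trp 1 2) \<bullet> el 2 1"
    unfolding e(1) ts by (simp only: t_mult_left[OF p(2,1)] t_mult_left[OF p(1) permutes_compose[OF p(1,2)]] comp_assoc)
  also have "trp 1 2 \<circ> trp 2 3 \<circ> trp 1 2 = trp 3 (1::nat)" by (auto simp: fun_eq_iff transpose_def)
  finally have "cj \<rho> (el 3 2 \<bullet> el 2 1) = cj \<rho> (t (trp 3 1) \<bullet> el 2 1)" by simp
  then show ?thesis using \<rho> r by (simp add: cj_mult cj_t_transpose cj_el)
qed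

lemma el_commute:
  assumes "a \<in> {1..r}" "b \<in> {1..r}" "c \<in> {1..r}" "d \<in> {1..r}" "distinct [a, b, c, d]"
  shows "el a b \<bullet> el c d = el c d \<bullet> el a b"
proof -
  have r: "4 \<le> r" using distinct_le_card[of "[a, b, c, d]" r] assms by simp
  then have "\<exists>\<rho>. \<rho> permutes {1..r} \<and> map \<rho> [1, 2, 3, 4] = [a, b, c, d]"
    using assms by (intro permutation_extension) auto
  then obtain \<rho> where \<rho>: "perm \<rho>" "\<rho> 1 = a" "\<rho> 2 = b" "\<rho> 3 = c" "\<rho> 4 = d" by auto
  have "e 1 = el 1 2" "e 3 = el 3 4" using e_el[of 1] e_el[of 3] r by (simp_all add: numeral_2_eq_2)
  moreover have "e 1 \<bullet> e 3 = e 3 \<bullet> e 1" using r by (intro far_EE) auto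
  ultimately have "cj \<rho> (el 1 2 \<bullet> el 3 4) = cj \<rho> (el 3 4 \<bullet> el 1 2)" by simp
  then show ?thesis using \<rho> r by (simp add: cj_mult cj_t_transpose cj_el)
qed

text \<open>Each of the two transpositions alone has the same effect on the product: by
  \<open>el_el\<close> both results are \<open>el b c \<bullet> el c d \<bullet> el a b\<close>.
  Since a transposition is an involution, the two together have no effect.\<close>

lemma el_exchange:
  assumes "a \<in> {1..r}" "b \<in> {1..r}" "c \<in> {1..r}" "d \<in> {1..r}" "distinct [a, b, c, d]"
  shows "t (trp a c \<circ> trp b d) \<bullet> (el a b \<bullet> el c d) = el a b \<bullet> el c d"
proof -
  have "t (trp b d) \<bullet> (el a b \<bullet> el c d) = (t (trp b d) \<bullet> el c d) \<bullet> el a b"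
    using el_commute[OF assms] by (simp add: assoc)
  also have "t (trp b d) \<bullet> el c d = el b c \<bullet> el c d" using el_el[of b c d] assms by simp
  also have "(el b c \<bullet> el c d) \<bullet> el a b = (el c b \<bullet> el b a) \<bullet> el c d"
    using el_commute[OF assms] el_sym[of b c] el_sym[of a b] assms by (simp add: assoc)
  also have "el c b \<bullet> el b a = t (trp a c) \<bullet> el a b"
    using el_el[of c b a] el_sym[of b a] assms by (simp add: transpose_commute[of c])
  finally have "t (trp a c) \<bullet> (t (trp b d) \<bullet> (el a b \<bullet> el c d)) = el a b \<bullet> el c d"
    using assms by (simp add: assoc t_transpose_twice)
  then show ?thesis using t_mult_left[OF perm_transpose[OF assms(1,3)] perm_transpose[OF assms(2,4)]] by simp
qed

subsection \<open>Normal forms\<close>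

fun pe :: "(nat \<times> nat) list \<Rightarrow> letter list" where
  "pe [] = un"
| "pe ((a, b) # ps) = el a b \<bullet> pe ps"

lemma un_pe: "un \<bullet> pe ps = pe ps" "pe ps \<bullet> un = pe ps" by (cases ps rule: pe.cases, simp_all add: one_s un_mul)+

lemma pe_append: "pe (xs @ ys) = pe xs \<bullet> pe ys" by (induction xs rule: pe.induct) (simp_all add: un_pe assoc)

lemma t_pe: "perm \<pi> \<Longrightarrow> valid r ps \<Longrightarrow> t \<pi> \<bullet> pe ps = pe (map (map_prod \<pi> \<pi>) ps) \<bullet> t \<pi>"
proof (induction ps rule: pe.induct)
  case 1
  then show ?case by (simp add: one_t)
next
  case (2 a b ps)
  then have "t \<pi> \<bullet> el a b = el (\<pi> a) (\<pi> b) \<bullet> t \<pi>" "t \<pi> \<bullet> pe ps = pe (map (map_prod \<pi> \<pi>) ps) \<bullet> t \<pi>"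
    by (auto intro!: t_el simp: valid_def)
  then show ?case by (simp add: assoc[symmetric]) (simp add: assoc)
qed

lemma pe_t_transpose:
  assumes "a \<in> {1..r}" "b \<in> {1..r}" "valid r ps" shows "pe ps \<bullet> t (trp a b) =
    t (trp a b) \<bullet> pe (map (map_prod (trp a b) (trp a b)) ps)"
proof -
  let ?\<tau> = "trp a b"
  have p: "perm ?\<tau>" by (rule perm_transpose[OF assms(1,2)])
  have "map (map_prod ?\<tau> ?\<tau>) (map (map_prod ?\<tau> ?\<tau>) ps) = ps" by (simp add: map_prod.comp map_prod.id)
  then show ?thesis using t_pe[OF p valid_map[OF p assms(3)]] by simp
qed

lemma pe_move: "valid r (xs @ (a, b) # ys) \<Longrightarrow> pe (xs @ (a, b) # ys) = el a b \<bullet> pe (xs @ ys)"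
proof (induction xs rule: pe.induct)
  case (2 c d xs)
  then have "el c d \<bullet> el a b = el a b \<bullet> el c d" by (intro el_commute) (auto simp: valid_def)
  moreover have "pe (xs @ (a, b) # ys) = el a b \<bullet> pe (xs @ ys)" using 2 by (auto simp: valid_def)
  ultimately show ?case by (simp add: assoc[symmetric])
qed simp

lemma pe_take:
  assumes "valid r ps" "{a, b} \<in> pair_sets ps"
  obtains qs where "pe ps = el a b \<bullet> pe qs" "valid r ((a, b) # qs)" "pair_sets ps = insert {a, b} (pair_sets qs)"
    "length ps = Suc (length qs)"
proof -
  obtain xs p ys where ps: "ps = xs @ p # ys" "p = (a, b) \<or> p = (b, a)" using split_pair[OF assms(2)] .
  have v: "valid r ((a, b) # xs @ ys)" using assms(1) ps by (auto simp: valid_def)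
  have "pe ps = el a b \<bullet> pe (xs @ ys)" using ps(2)
  proof
    assume "p = (b, a)"
    then show ?thesis using pe_move[of xs b a ys] ps assms(1) el_sym[of a b] v by (simp add: valid_def)
  qed (use pe_move[of xs a b ys] ps assms(1) in simp)
  moreover have "pair_sets ps = insert {a, b} (pair_sets (xs @ ys))" using ps by (auto simp: insert_commute)
  ultimately show ?thesis using that[of "xs @ ys"] v ps(1) by simp
qed

lemma pair_sets_Cons:
  assumes "valid r ((a, b) # qs)" shows "pair_sets qs = pair_sets ((a, b) # qs) - {{a, b}}"
proof -
  have "{a, b} \<notin> pair_sets qs" using assms Union_pair_sets[of qs] by (auto simp: valid_def)
  then show ?thesis by simp
qed

lemma pe_reorder: "valid r ps \<Longrightarrow> valid r ps' \<Longrightarrow> pair_sets ps = pair_sets ps' \<Longrightarrow> pe ps = pe ps'"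
proof (induction ps arbitrary: ps' rule: pe.induct)
  case 1
  then show ?case by (simp add: pair_sets_def)
next
  case (2 a b ps)
  then have "{a, b} \<in> pair_sets ps'" by auto
  from pe_take[OF 2(3) this] obtain qs where
    qs: "pe ps' = el a b \<bullet> pe qs" "valid r ((a, b) # qs)" "pair_sets ps' = insert {a, b} (pair_sets qs)" .
  have "pair_sets ps = pair_sets qs"
    unfolding pair_sets_Cons[OF 2(2)] pair_sets_Cons[OF qs(2)] using 2(4) qs(3) by simp
  moreover have "valid r ps" "valid r qs" using 2(2) qs(2) by (auto simp: valid_def)
  ultimately have "pe ps = pe qs" by (intro 2(1))
  then show ?case using qs(1) by simp
qed

lemma pe_transpose:
  assumes "valid r ps" "{a, b} \<in> pair_sets ps" shows "t (trp a b) \<bullet> pe ps = pe ps"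
proof -
  obtain qs where "pe ps = el a b \<bullet> pe qs" "valid r ((a, b) # qs)" using pe_take[OF assms] by metis
  then show ?thesis using el_transpose[of a b] by (simp add: valid_def assoc[symmetric])
qed

lemma pe_exchange:
  assumes "valid r ps" "{a, b} \<in> pair_sets ps" "{c, d} \<in> pair_sets ps" "{a, b} \<noteq> {c, d}"
  shows "t (trp a c \<circ> trp b d) \<bullet> pe ps = pe ps" and "distinct [a, b, c, d]"
proof -
  obtain qs where qs: "pe ps = el a b \<bullet> pe qs" "valid r ((a, b) # qs)" "pair_sets ps = insert {a, b} (pair_sets qs)"
    using pe_take[OF assms(1,2)] by metis
  have v: "valid r qs" using qs(2) by (simp add: valid_def)
  have "{c, d} \<in> pair_sets qs" using qs(3) assms(3,4) by auto
  from pe_take[OF v this] obtain us where us: "pe qs = el c d \<bullet> pe us" "valid r ((c, d) # us)"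
    "pair_sets qs = insert {c, d} (pair_sets us)" by metis
  have "{c, d} \<subseteq> set (pts qs)" unfolding Union_pair_sets[symmetric] us(3) by blast
  then show d: "distinct [a, b, c, d]" using us(2) qs(2) by (auto simp: valid_def)
  have "{a, b, c, d} \<subseteq> {1..r}" using us(2) qs(2) by (auto simp: valid_def)
  then show "t (trp a c \<circ> trp b d) \<bullet> pe ps = pe ps"
    using el_exchange[OF _ _ _ _ d] unfolding qs(1) us(1) by (simp add: assoc[symmetric])
qed

text \<open>These permutations flip single pairs and permute the pairs among themselves. Flips are
  absorbed by \<open>pe_transpose\<close>, exchanges of two pairs by \<open>pe_exchange\<close>; one
  such move brings the first pair back to its place, and the rest follows by induction.\<close>

lemma pe_stabilizer:
  assumes "valid r ps" "perm \<sigma>" "\<And>x. x \<notin> set (pts ps) \<Longrightarrow> \<sigma> x = x" "(\<lambda>e. \<sigma> ` e) ` pair_sets ps = pair_sets ps"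
  shows "t \<sigma> \<bullet> pe ps = pe ps" using assms
proof (induction ps arbitrary: \<sigma> rule: pe.induct)
  case 1
  then have "\<sigma> = id" by auto
  then show ?case by (simp only: t_id pe.simps one_s)
next
  case (2 a b qs)
  have ab: "a \<in> {1..r}" "b \<in> {1..r}" "a \<noteq> b" and v: "valid r qs" and nab: "a \<notin> set (pts qs)" "b \<notin> set (pts qs)"
    using 2(2) by (auto simp: valid_def)
  let ?P = "pair_sets ((a, b) # qs)"
  have fixing: "t \<rho> \<bullet> pe ((a, b) # qs) = pe ((a, b) # qs)"
    if \<rho>: "perm \<rho>" "\<rho> a = a" "\<rho> b = b" "\<And>x. x \<notin> set (pts ((a, b) # qs)) \<Longrightarrow> \<rho> x = x" "(\<lambda>e. \<rho> ` e) ` ?P = ?P" for \<rho>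
  proof -
    have "inj (\<lambda>e. \<rho> ` e)" using permutes_inj[OF \<rho>(1)] by (simp add: inj_image_eq_iff inj_def)
    then have "(\<lambda>e. \<rho> ` e) ` (?P - {{a, b}}) = ?P - {{a, b}}"
      using \<rho> by (simp add: image_set_diff del: pair_sets_simps)
    then have "(\<lambda>e. \<rho> ` e) ` pair_sets qs = pair_sets qs" unfolding pair_sets_Cons[OF 2(2)] .
    moreover have "\<rho> x = x" if "x \<notin> set (pts qs)" for x using \<rho> that by (cases "x = a \<or> x = b") auto
    ultimately have "t \<rho> \<bullet> pe qs = pe qs" using 2(1) v \<rho>(1) by blast
    moreover have "t \<rho> \<bullet> el a b = el a b \<bullet> t \<rho>" using t_el[OF \<rho>(1) ab] \<rho> by simp
    ultimately show ?thesis by (simp add: assoc[symmetric]) (simp add: assoc)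
  qed
  \<comment> \<open>\<open>\<tau>\<close> is an involution that returns \<open>\<sigma> a\<close>
    and \<open>\<sigma> b\<close> to \<open>a\<close> and \<open>b\<close>, so that
    \<open>\<tau> \<circ> \<sigma>\<close> falls under \<open>fixing\<close>.\<close>
  have pre: "t \<sigma> \<bullet> pe ((a, b) # qs) = pe ((a, b) # qs)"
    if \<tau>: "perm \<tau>" "\<tau> \<circ> \<tau> = id" "t \<tau> \<bullet> pe ((a, b) # qs) = pe ((a, b) # qs)" "\<tau> (\<sigma> a) = a" "\<tau> (\<sigma> b) = b"
      "\<And>x. x \<notin> set (pts ((a, b) # qs)) \<Longrightarrow> \<tau> x = x" "(\<lambda>e. \<tau> ` e) ` ?P = ?P" for \<tau>
  proof -
    have "(\<lambda>e. (\<tau> \<circ> \<sigma>) ` e) ` ?P = (\<lambda>e. \<tau> ` e) ` (\<lambda>e. \<sigma> ` e) ` ?P" by (simp add: image_comp)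
    then have "t (\<tau> \<circ> \<sigma>) \<bullet> pe ((a, b) # qs) = pe ((a, b) # qs)"
      using \<tau> 2(3-5) by (intro fixing permutes_compose) (auto simp del: pair_sets_simps)
    then have "t \<tau> \<bullet> (t (\<tau> \<circ> \<sigma>) \<bullet> pe ((a, b) # qs)) = pe ((a, b) # qs)" using \<tau>(3) by simp
    moreover have "\<tau> \<circ> (\<tau> \<circ> \<sigma>) = \<sigma>" using \<tau>(2) by (simp add: comp_assoc[symmetric])
    ultimately show ?thesis using t_mult_left[OF \<tau>(1) permutes_compose[OF 2(3) \<tau>(1)]] by simp
  qed
  have "\<sigma> ` {a, b} \<in> (\<lambda>e. \<sigma> ` e) ` ?P" by auto
  then have im: "{\<sigma> a, \<sigma> b} \<in> ?P" unfolding 2(5) by simp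
  have sab: "\<sigma> a \<noteq> \<sigma> b" using ab(3) permutes_inj[OF 2(3)] by (simp add: inj_eq)
  show ?case
  proof (cases "{\<sigma> a, \<sigma> b} = {a, b}")
    case True
    show ?thesis
    proof (cases "\<sigma> a = a")
      case True
      then have "\<sigma> b = b" using \<open>{\<sigma> a, \<sigma> b} = {a, b}\<close> by (auto simp: doubleton_eq_iff)
      then show ?thesis using fixing[OF 2(3) True] 2(4,5) by blast
    next
      case False
      then have ba: "\<sigma> a = b" "\<sigma> b = a" using \<open>{\<sigma> a, \<sigma> b} = {a, b}\<close> by (auto simp: doubleton_eq_iff)
      have "(\<lambda>e. trp a b ` e) ` pair_sets qs = pair_sets qs"
      proof -
        have "trp a b ` e = e" if "e \<in> pair_sets qs" for e
        proof -
          have "a \<notin> e" "b \<notin> e" using that nab Union_pair_sets[of qs] by auto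
          then show ?thesis by (auto simp: transpose_def image_def)
        qed
        then show ?thesis by simp
      qed
      then have P: "(\<lambda>e. trp a b ` e) ` ?P = ?P" by (simp add: insert_commute)
      have T: "t (trp a b) \<bullet> pe ((a, b) # qs) = pe ((a, b) # qs)" by (rule pe_transpose[OF 2(2)]) simp
      show ?thesis by (rule pre[OF perm_transpose[OF ab(1,2)] _ T _ _ _ P]) (auto simp: ba)
    qed
  next
    case False
    let ?\<tau> = "trp a (\<sigma> a) \<circ> trp b (\<sigma> b)"
    have abP: "{a, b} \<in> ?P" by simp
    note T = pe_exchange(1)[OF 2(2) abP im False[symmetric]]
    note d = pe_exchange(2)[OF 2(2) abP im False[symmetric]]
    have out: "\<sigma> a \<in> set (pts ((a, b) # qs))" "\<sigma> b \<in> set (pts ((a, b) # qs))"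
      using im Union_pair_sets[of "(a, b) # qs"] by blast+
    have p: "perm ?\<tau>" using ab permutes_in_image[OF 2(3)] by (intro permutes_compose perm_transpose) auto
    have tau: "?\<tau> a = \<sigma> a" "?\<tau> b = \<sigma> b" "?\<tau> (\<sigma> a) = a" "?\<tau> (\<sigma> b) = b" using d by (auto simp: transpose_def)
    have sub: "?\<tau> ` e \<in> ?P" if e: "e \<in> ?P" for e
    proof -
      consider "e = {a, b}" | "e = {\<sigma> a, \<sigma> b}" | "e \<noteq> {a, b}" "e \<noteq> {\<sigma> a, \<sigma> b}" by blast
      then show ?thesis
      proof cases
        case 1
        then have "?\<tau> ` e = {\<sigma> a, \<sigma> b}" using tau by (simp del: comp_apply)
        then show ?thesis using im by simp
      next
        case 2
        then have "?\<tau> ` e = {a, b}" using tau by (simp del: comp_apply)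
        then show ?thesis by simp
      next
        case 3
        obtain c d' where cd: "e = {c, d'}" using e by (auto simp: pair_sets_def)
        have "distinct [a, b, c, d']" using pe_exchange(2)[OF 2(2), of a b c d'] e 3 cd by simp
        moreover have "distinct [\<sigma> a, \<sigma> b, c, d']" using pe_exchange(2)[OF 2(2) im, of c d'] e 3 cd by simp
        ultimately have "?\<tau> ` e = e" unfolding cd by (auto simp: transpose_def)
        then show ?thesis using e by simp
      qed
    qed
    have sq: "?\<tau> \<circ> ?\<tau> = id" using d by (auto simp: fun_eq_iff transpose_def)
    have "(\<lambda>e. ?\<tau> ` e) ` ?P = ?P"
    proof
      show "?P \<subseteq> (\<lambda>e. ?\<tau> ` e) ` ?P"
      proof
        fix e assume "e \<in> ?P"
        moreover have "?\<tau> ` ?\<tau> ` e = e" unfolding image_comp sq by simp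
        ultimately show "e \<in> (\<lambda>e. ?\<tau> ` e) ` ?P" using sub by (metis imageI)
      qed
    qed (use sub in blast)
    moreover have "?\<tau> x = x" if "x \<notin> set (pts ((a, b) # qs))" for x using that out by (auto simp: transpose_def)
    ultimately show ?thesis using pre[OF p sq T tau(3,4)] by blast
  qed
qed

text \<open>The two permutations differ by one that preserves the set of pairs and fixes all other
  points, and \<open>pe\<close> absorbs it.\<close>

lemma normal_form_unique:
  assumes v: "valid r ps" "valid r ps'" "pair_sets ps = pair_sets ps'" and p: "perm \<pi>" "perm \<pi>'"
    and eq: "\<And>x. x \<notin> set (pts ps) \<Longrightarrow> \<pi> x = \<pi>' x" "(\<lambda>e. \<pi> ` e) ` pair_sets ps = (\<lambda>e. \<pi>' ` e) ` pair_sets ps"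
  shows "t \<pi> \<bullet> pe ps = t \<pi>' \<bullet> pe ps'"
proof -
  let ?\<sigma> = "inv_into UNIV \<pi>' \<circ> \<pi>"
  have \<sigma>: "perm ?\<sigma>" by (intro permutes_compose p permutes_inv)
  have "(\<lambda>e. ?\<sigma> ` e) ` pair_sets ps = (\<lambda>e. inv_into UNIV \<pi>' ` e) ` (\<lambda>e. \<pi> ` e) ` pair_sets ps"
    by (simp add: image_comp)
  also have "\<dots> = pair_sets ps" unfolding eq(2) image_comp comp_def by (simp add: permutes_inverses(2)[OF p(2)])
  finally have "t ?\<sigma> \<bullet> pe ps = pe ps"
    using eq(1) by (intro pe_stabilizer v \<sigma>) (simp_all add: permutes_inverses(2)[OF p(2)])
  then have "t \<pi>' \<bullet> pe ps = t (\<pi>' \<circ> ?\<sigma>) \<bullet> pe ps" by (simp only: t_mult_left[OF p(2) \<sigma>, symmetric])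
  also have "\<pi>' \<circ> ?\<sigma> = \<pi>" unfolding comp_assoc[symmetric] permutes_inv_o(1)[OF p(2)] by simp
  finally show ?thesis using pe_reorder[OF v] by simp
qed

text \<open>Explicit words for the normal forms: operators are evaluated on words, and a
  representative chosen by \<open>nrm\<close> has no known shape.\<close>

definition perm_word :: "(nat \<Rightarrow> nat) \<Rightarrow> letter list" where
  "perm_word \<pi> = map S (pword \<pi>)"

definition pair_word :: "nat \<Rightarrow> nat \<Rightarrow> letter list" where
  "pair_word a b = perm_word (rep a b) @ [E 1] @ perm_word (inv_into UNIV (rep a b))"

definition nf_word :: "(nat \<Rightarrow> nat) \<Rightarrow> (nat \<times> nat) list \<Rightarrow> letter list" where
  "nf_word \<pi> ps = perm_word \<pi> @ concat (map (\<lambda>(a, b). pair_word a b) ps)"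

lemma nrm_perm_word: "nrm (perm_word \<pi>) = t \<pi>" by (simp add: perm_word_def t_def sw_def)

lemma nrm_pair_word: "nrm (pair_word a b) = el a b"
  unfolding pair_word_def el_def cj_def nrm_append nrm_perm_word e_def by (simp add: assoc)

lemma nrm_nf_word: "nrm (nf_word \<pi> ps) = t \<pi> \<bullet> pe ps"
proof -
  have "nrm (concat (map (\<lambda>(a, b). pair_word a b) ps)) = pe ps"
    by (induction ps rule: pe.induct) (simp_all add: nrm_append nrm_pair_word un_def)
  then show ?thesis by (simp add: nf_word_def nrm_append nrm_perm_word)
qed

lemma perm_word_letters: "perm \<pi> \<Longrightarrow> set (perm_word \<pi>) \<subseteq> brauer_letters r"
  using pword[of \<pi>] by (auto simp: perm_word_def brauer_letters_def)

lemma pair_word_letters: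
  assumes "a \<in> {1..r}" "b \<in> {1..r}" "a \<noteq> b"
  shows "set (pair_word a b) \<subseteq> brauer_letters r"
  using rep[OF assms] perm_word_letters permutes_inv[of "rep a b"] by (auto simp: pair_word_def brauer_letters_def)

lemma nf_word_letters: "perm \<pi> \<Longrightarrow> valid r ps \<Longrightarrow> set (nf_word \<pi> ps) \<subseteq> brauer_letters r"
proof -
  assume p: "perm \<pi>" and "valid r ps"
  from this(2) have "set (concat (map (\<lambda>(a, b). pair_word a b) ps)) \<subseteq> brauer_letters r"
  proof (induction ps rule: pe.induct)
    case (2 a b ps)
    then have "set (pair_word a b) \<subseteq> brauer_letters r" by (intro pair_word_letters) (auto simp: valid_def)
    then show ?case using 2 by (auto simp: valid_def)
  qed simp
  then show ?thesis using perm_word_letters[OF p] by (simp add: nf_word_def)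
qed

text \<open>The pair containing \<open>a\<close> is moved to the end, where \<open>el_el\<close>
  trades it for a transposition; the transposition is pulled out to the left and renames the
  remaining pairs.\<close>

lemma pe_el_merge:
  assumes v: "valid r ps" and "{c, a} \<in> pair_sets ps" and b: "b \<in> {1..r}" "b \<noteq> a" "c \<noteq> b"
  shows "\<exists>ps'. valid r ps' \<and> c \<in> {1..r} \<and> pe ps \<bullet> el a b = t (trp c b) \<bullet> pe ps'"
proof -
  obtain xs p ys where ps: "ps = xs @ p # ys" "p = (c, a) \<or> p = (a, c)" using split_pair[OF assms(2)] .
  define qs where "qs = xs @ ys"
  have vq: "valid r (qs @ [(c, a)])" using v ps by (auto simp: valid_def qs_def)
  have "pair_sets ps = pair_sets (qs @ [(c, a)])" using ps by (auto simp: qs_def)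
  then have "pe ps = pe qs \<bullet> el c a" using pe_reorder[OF v vq] by (simp add: pe_append un_el)
  then have "pe ps \<bullet> el a b = pe qs \<bullet> (el c a \<bullet> el a b)" by (simp add: assoc)
  also have "el c a \<bullet> el a b = t (trp c b) \<bullet> el a b" using vq b by (intro el_el) (auto simp: valid_def)
  also have "pe qs \<bullet> (t (trp c b) \<bullet> el a b) =
      t (trp c b) \<bullet> pe (map (map_prod (trp c b) (trp c b)) qs @ [(a, b)])"
    (is "_ = _ \<bullet> pe ?ps'")
    using pe_t_transpose[of c b qs] vq b by (simp add: assoc[symmetric] pe_append un_el valid_def)
  finally have "pe ps \<bullet> el a b = t (trp c b) \<bullet> pe ?ps'" .
  moreover have "valid r ?ps'"
  proof -
    have "perm (trp c b)" using vq b by (intro perm_transpose) (auto simp: valid_def)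
    then have "valid r (map (map_prod (trp c b) (trp c b)) qs)"
      using vq by (intro valid_map) (auto simp: valid_def)
    moreover have "trp c b x \<noteq> a" "trp c b x \<noteq> b" if "x \<in> set (pts qs)" for x
      using that vq b by (auto simp: valid_def transpose_def)
    ultimately show ?thesis using vq b by (force simp: valid_def pts_map)
  qed
  ultimately show ?thesis using vq by (intro exI[of _ ?ps']) (auto simp: valid_def)
qed

text \<open>In the second alternative the new letter repeats a pair and produces a square of
  \<open>E 1\<close>. Its factor \<delta> may be 0, so the square is kept out of the congruence and
  reported separately.\<close>

lemma nf_word_snoc:
  assumes p: "perm \<pi>" and v: "valid r ps" and g: "g \<in> brauer_letters r"
  shows "(\<exists>\<pi>' ps'. perm \<pi>' \<and> valid r ps' \<and> bcong r (nf_word \<pi> ps @ [g]) (nf_word \<pi>' ps')) \<or>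
    (\<exists>u w. set (u @ w) \<subseteq> brauer_letters r \<and> 1 < r \<and> bcong r (nf_word \<pi> ps @ [g]) (u @ [E 1, E 1] @ w) \<and>
       bcong r (nf_word \<pi> ps) (u @ [E 1] @ w))"
proof -
  have res: ?thesis if "perm \<tau>" "valid r ps'" "pe ps \<bullet> nrm [g] = t \<tau> \<bullet> pe ps'" for \<tau> ps'
  proof -
    have "nrm (nf_word \<pi> ps @ [g]) = nrm (nf_word (\<pi> \<circ> \<tau>) ps')"
      unfolding nrm_append nrm_nf_word assoc that(3) using p that(1) by (simp add: t_mult_left)
    then show ?thesis using p that permutes_compose unfolding nrm_eq by blast
  qed
  from g consider i where "g = S i" "i \<in> {1..<r}" | i where "g = E i" "i \<in> {1..<r}"
    by (auto simp: brauer_letters_def)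
  then show ?thesis
  proof cases
    case (1 i)
    let ?\<tau> = "trp i (Suc i)"
    have i: "i \<in> {1..r}" "Suc i \<in> {1..r}" using 1 by auto
    have "pe ps \<bullet> nrm [g] = t ?\<tau> \<bullet> pe (map (map_prod ?\<tau> ?\<tau>) ps)"
      using pe_t_transpose[OF i v] 1 t_s by (simp add: s_def)
    then show ?thesis using perm_transpose[OF i] valid_map[OF perm_transpose[OF i] v] res by blast
  next
    case (2 i)
    define a b where "a = i" and "b = i + 1"
    have ab: "a \<in> {1..r}" "b \<in> {1..r}" "a \<noteq> b" using 2 by (auto simp: a_def b_def)
    have g: "nrm [g] = el a b" using e_el 2 by (simp add: e_def a_def b_def)
    consider "{a, b} \<in> pair_sets ps" | c where "{c, a} \<in> pair_sets ps" "c \<noteq> b" | c where "{c, b} \<in> pair_sets ps" "c \<noteq> a"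
      | "a \<notin> set (pts ps)" "b \<notin> set (pts ps)"
    proof -
      have "\<exists>c. {c, x} \<in> pair_sets ps" if "x \<in> set (pts ps)" for x
        using that unfolding pair_sets_def pts_def by (auto simp: image_def insert_commute) blast+
      then show ?thesis using that by (metis insert_commute)
    qed
    then show ?thesis
    proof cases
      case 1
      obtain qs where qs: "pe ps = el a b \<bullet> pe qs" "valid r ((a, b) # qs)" "pair_sets ps = insert {a, b} (pair_sets qs)"
        using pe_take[OF v 1] by metis
      have vq: "valid r (qs @ [(a, b)])" "valid r qs" using qs(2) by (auto simp: valid_def)
      have pe: "pe ps = pe qs \<bullet> el a b" using pe_reorder[OF v vq(1)] qs(3) by (simp add: pe_append un_el)
      define u where "u = nf_word \<pi> qs @ perm_word (rep a b)"
      define w where "w = perm_word (inv_into UNIV (rep a b))"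
      have "nrm (nf_word \<pi> ps @ [g]) = nrm (u @ [E 1, E 1] @ w)"
      proof -
        have "cj (rep a b) (e 1 \<bullet> e 1) = el a b \<bullet> el a b" using rep(1)[OF ab] by (simp add: cj_mult el_def)
        then have "nrm (u @ [E 1, E 1] @ w) = t \<pi> \<bullet> (pe qs \<bullet> (el a b \<bullet> el a b))"
          unfolding u_def w_def nrm_append nrm_nf_word nrm_perm_word word2 e_def[symmetric] cj_def by (simp add: assoc)
        then show ?thesis unfolding nrm_append nrm_nf_word g pe by (simp add: assoc)
      qed
      moreover have "nrm (nf_word \<pi> ps) = nrm (u @ [E 1] @ w)"
        unfolding nrm_nf_word u_def w_def nrm_append nrm_perm_word e_def[symmetric] pe el_def cj_def by (simp add: assoc)
      moreover have "set (u @ w) \<subseteq> brauer_letters r"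
        using nf_word_letters[OF p vq(2)] perm_word_letters[OF rep(1)[OF ab]]
          perm_word_letters[OF permutes_inv[OF rep(1)[OF ab]]] by (simp add: u_def w_def)
      ultimately show ?thesis using 2 unfolding nrm_eq by (intro disjI2 exI[of _ u] exI[of _ w]) auto
    next
      case (2 c)
      then obtain ps' where "valid r ps'" "c \<in> {1..r}" "pe ps \<bullet> el a b = t (trp c b) \<bullet> pe ps'"
        using pe_el_merge[OF v 2(1) ab(2)] ab(3) by auto
      then show ?thesis using res perm_transpose[OF _ ab(2)] g by metis
    next
      case (3 c)
      then obtain ps' where "valid r ps'" "c \<in> {1..r}" "pe ps \<bullet> el b a = t (trp c a) \<bullet> pe ps'"
        using pe_el_merge[OF v 3(1) ab(1)] ab(3) by auto
      then show ?thesis using res perm_transpose[OF _ ab(1)] g el_sym[OF ab] by metis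
    next
      case 4
      have "pe ps \<bullet> nrm [g] = t id \<bullet> pe (ps @ [(a, b)])" by (simp add: g pe_append un_el t_id un_mul)
      moreover have "valid r (ps @ [(a, b)])" using v ab 4 by (auto simp: valid_def)
      ultimately show ?thesis using res permutes_id by blast
    qed
  qed
qed

end

section \<open>The regular representation\<close>

lemma exch_commute:
  assumes "{{u1, u2}, {w1, w2}} \<inter> {{x1, y1}, {x2, y2}} = {}" "{{x1, x2}, {y1, y2}} \<inter> {{u1, w1}, {u2, w2}} = {}"
  shows "exch u1 w1 u2 w2 (exch x1 y1 x2 y2 X) = exch x1 y1 x2 y2 (exch u1 w1 u2 w2 X)"
proof -
  have "X - A \<union> B - C \<union> D = X - C \<union> D - A \<union> B" if "D \<inter> A = {}" "B \<inter> C = {}" for A B C D using that by blast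
  then show ?thesis unfolding exch_def using assms .
qed

lemma vmap_Un: "vmap f (X \<union> Y) = vmap f X \<union> vmap f Y" by (simp add: vmap_def image_Un)

context marked_algebra
begin

text \<open>The type of coordinates allows arbitrary sets of edges as keys; this subspace is the
  underlying space of the algebra.\<close>

definition Qs :: "'k coords set" where
  "Qs = {q. keys q \<subseteq> Collect (brauer_diagram r r)}"

lemma dv_Qs: "D \<in> MB \<Longrightarrow> dv D \<in> Qs" by (cases D) (auto simp: Qs_def dvec_def marked_brauer_def)

lemma scale_Qs: "q \<in> Qs \<Longrightarrow> scale c q \<in> Qs" using keys_scale[of c q] by (auto simp: Qs_def)

lemma lin_Qs: "(\<And>k. k \<in> keys x \<Longrightarrow> g k \<in> Qs) \<Longrightarrow> lin g x \<in> Qs" unfolding Qs_def by (simp add: keys_lin)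

lemma single_dv: "brauer_diagram r r X \<Longrightarrow> single X 1 = scale (mark_sign X) (dv (mark r r X))"
  by (simp add: dvec_def mark_sign_def msign_square[OF eps])

lemma Qs_eqI:
  assumes "q \<in> Qs" and "\<And>x y. f (x + y) = f x + f y" "\<And>c x. f (scale c x) = scale c (f x)"
    and "\<And>x y. g (x + y) = g x + g y" "\<And>c x. g (scale c x) = scale c (g x)"
    and "\<And>D. D \<in> MB \<Longrightarrow> f (dv D) = (g (dv D) :: 'b \<Rightarrow>\<^sub>0 'k)" shows "f q = g q"
proof (rule linear_eq_on_keys[OF assms(2-5)])
  fix X assume "X \<in> keys q"
  then have "brauer_diagram r r X" using assms(1) by (auto simp: Qs_def)
  then show "f (single X 1) = g (single X 1)" by (simp add: single_dv assms mark_marked del: scale_single)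
qed

lemma qmul_Qs:
  assumes "p \<in> Qs" "q \<in> Qs" shows "qmul p q \<in> Qs" unfolding qmul_def
proof (intro lin_Qs scale_Qs)
  fix X Y assume "X \<in> keys p" "Y \<in> keys q"
  then have "mark r r X \<in> MB" "mark r r Y \<in> MB" using assms by (auto simp: Qs_def intro!: mark_marked)
  moreover from this obtain k mz where "cp (mark r r X) (mark r r Y) k mz"
    using exists_composes[OF param] by blast
  ultimately show "cval \<delta> \<epsilon> (mark r r X) (mark r r Y) \<in> Qs"
    unfolding qmul_dv[symmetric, OF \<open>mark r r X \<in> MB\<close> \<open>mark r r Y \<in> MB\<close>]
    by (subst qmul_composes) (auto intro!: scale_Qs dv_Qs dest: composes_brauer)
qed

section \<open>The operators of permutations and cup-caps, and the relations between them\<close>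

definition pact :: "(nat \<Rightarrow> nat) \<Rightarrow> 'k coords \<Rightarrow> 'k coords" where
  "pact \<pi> = qmul (dv (perm_diagram r \<pi>))"

definition cact :: "nat \<Rightarrow> nat \<Rightarrow> 'k coords \<Rightarrow> 'k coords" where
  "cact a b = qmul (dv (cupcap r a b))"

lemma act_linear: "pact \<pi> (p + q) = pact \<pi> p + pact \<pi> q" "pact \<pi> (scale c q) = scale c (pact \<pi> q)"
  "cact a b (p + q) = cact a b p + cact a b q" "cact a b (scale c q) = scale c (cact a b q)"
  by (simp_all add: pact_def cact_def qmul_add_right qmul_scale_right)

lemma pact_Qs: "\<pi> permutes {1..r} \<Longrightarrow> q \<in> Qs \<Longrightarrow> pact \<pi> q \<in> Qs"
  unfolding pact_def by (intro qmul_Qs dv_Qs perm_marked)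

lemma cact_Qs: "a \<in> {1..r} \<Longrightarrow> b \<in> {1..r} \<Longrightarrow> a \<noteq> b \<Longrightarrow> q \<in> Qs \<Longrightarrow> cact a b q \<in> Qs"
  unfolding cact_def by (intro qmul_Qs dv_Qs cupcap_marked)

lemma pact_dv: "D \<in> MB \<Longrightarrow> \<pi> permutes {1..r} \<Longrightarrow> pact \<pi> (dv D) = dv (dmap (tp \<pi>) D)"
  unfolding pact_def by (rule qmul_tp(1))

lemma pact_pact:
  assumes "\<pi> permutes {1..r}" "\<rho> permutes {1..r}" "q \<in> Qs"
  shows "pact \<pi> (pact \<rho> q) = pact (\<pi> \<circ> \<rho>) q"
proof (rule Qs_eqI[OF assms(3)])
  show "pact \<pi> (pact \<rho> (dv D)) = pact (\<pi> \<circ> \<rho>) (dv D)" if D: "D \<in> MB" for D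
    unfolding pact_dv[OF D assms(2)] pact_dv[OF D permutes_compose[OF assms(2,1)]]
      pact_dv[OF marked_tp[OF D assms(2)] assms(1)] dmap_dmap perm_comp ..
qed (simp_all add: act_linear)

lemma pact_id: "q \<in> Qs \<Longrightarrow> pact id q = q"
  by (rule Qs_eqI) (simp_all only: act_linear pact_dv permutes_id perm_id dmap_id)

lemma pact_twice: "\<tau> permutes {1..r} \<Longrightarrow> \<tau> \<circ> \<tau> = id \<Longrightarrow> q \<in> Qs \<Longrightarrow> pact \<tau> (pact \<tau> q) = q"
  by (simp only: pact_pact pact_id)

lemma fst_cupcap:
  "fst (cupcap r a b) = {{Top a, Top b}, {Bot a, Bot b}} \<union> (\<lambda>l. {Top l, Bot l}) ` ({1..r} - {a, b})"
proof -
  let ?f = "\<lambda>l. {Top l, Bot l}"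
  have "inj ?f" by (auto simp: inj_def doubleton_eq_iff)
  then have "?f ` ({1..r} - {a, b}) = ?f ` {1..r} - ?f ` {a, b}" by (rule image_set_diff)
  then show ?thesis by (simp add: cupcap_def glue_def exch_def identity_diagram_def)
qed

lemma snd_cupcap: "snd (cupcap r a b) = [Bead {Top a, Top b}, Arrow (Bot a) (Bot b)]"
  by (simp add: cupcap_def glue_def identity_diagram_def)

text \<open>Permuting the top of one cup-cap equals permuting the bottom of another. With
  \<open>qmul_tp\<close> and \<open>qmul_bp\<close> this becomes the conjugation rule
  \<open>pact_cact\<close>.\<close>

lemma cupcap_conj:
  assumes \<pi>: "\<pi> permutes {1..r}"
  shows "dmap (tp \<pi>) (cupcap r a b) = dmap (bp (pinv \<pi>)) (cupcap r (\<pi> a) (\<pi> b))"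
proof (rule prod_eqI)
  have inv: "pinv \<pi> (\<pi> x) = x" for x by (rule permutes_inverses(2)[OF \<pi>])
  have first: "vmap (bp (pinv \<pi>)) {{Top (\<pi> a), Top (\<pi> b)}, {Bot (\<pi> a), Bot (\<pi> b)}} = vmap (tp \<pi>) {{Top a, Top b}, {Bot a, Bot b}}"
    by (simp add: vmap_def inv)
  have "vmap (bp (pinv \<pi>)) ((\<lambda>l. {Top l, Bot l}) ` ({1..r} - {\<pi> a, \<pi> b})) = (\<lambda>l. {Top l, Bot (pinv \<pi> l)}) ` ({1..r} - {\<pi> a, \<pi> b})"
    by (simp add: vmap_def image_image)
  also have img: "{1..r} - {\<pi> a, \<pi> b} = \<pi> ` ({1..r} - {a, b})"
    using permutes_image[OF \<pi>] permutes_inj[OF \<pi>] by (simp add: image_set_diff)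
  also have "(\<lambda>l. {Top l, Bot (pinv \<pi> l)}) ` \<pi> ` ({1..r} - {a, b}) = vmap (tp \<pi>) ((\<lambda>l. {Top l, Bot l}) ` ({1..r} - {a, b}))"
    by (simp add: vmap_def image_image inv)
  finally have rest: "vmap (bp (pinv \<pi>)) ((\<lambda>l. {Top l, Bot l}) ` ({1..r} - {\<pi> a, \<pi> b})) =
      vmap (tp \<pi>) ((\<lambda>l. {Top l, Bot l}) ` ({1..r} - {a, b}))" unfolding img .
  show "fst (dmap (tp \<pi>) (cupcap r a b)) = fst (dmap (bp (pinv \<pi>)) (cupcap r (\<pi> a) (\<pi> b)))"
    unfolding fst_dmap fst_cupcap vmap_Un rest first ..
  show "snd (dmap (tp \<pi>) (cupcap r a b)) = snd (dmap (bp (pinv \<pi>)) (cupcap r (\<pi> a) (\<pi> b)))"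
    by (simp add: snd_cupcap inv)
qed

lemma pact_cact:
  assumes \<pi>: "\<pi> permutes {1..r}" and ab: "a \<in> {1..r}" "b \<in> {1..r}" "a \<noteq> b" and q: "q \<in> Qs"
  shows "pact \<pi> (cact a b q) = cact (\<pi> a) (\<pi> b) (pact \<pi> q)"
proof (rule Qs_eqI[OF q])
  fix D assume D: "D \<in> MB"
  have im: "\<pi> a \<in> {1..r}" "\<pi> b \<in> {1..r}" "\<pi> a \<noteq> \<pi> b"
    using ab permutes_in_image[OF \<pi>] permutes_inj[OF \<pi>] by (auto simp: inj_eq)
  have "pact \<pi> (cact a b (dv D)) = qmul (dv (dmap (tp \<pi>) (cupcap r a b))) (dv D)"
    unfolding pact_def cact_def by (rule qmul_tp(2)[OF cupcap_marked[OF ab] D \<pi>, symmetric])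
  also have "\<dots> = qmul (dv (cupcap r (\<pi> a) (\<pi> b))) (qmul (dv (perm_diagram r (pinv (pinv \<pi>)))) (dv D))"
    unfolding cupcap_conj[OF \<pi>] by (rule qmul_bp[OF cupcap_marked[OF im] D permutes_inv[OF \<pi>]])
  also have "pinv (pinv \<pi>) = \<pi>" by (rule permutes_inv_inv[OF \<pi>])
  finally show "pact \<pi> (cact a b (dv D)) = cact (\<pi> a) (\<pi> b) (pact \<pi> (dv D))" by (simp add: pact_def cact_def)
qed (simp_all add: act_linear)

lemma cact_cact:
  assumes ab: "a \<in> {1..r}" "b \<in> {1..r}" "a \<noteq> b" and q: "q \<in> Qs"
  shows "cact a b (cact a b q) = scale \<delta> (cact a b q)"
proof (rule Qs_eqI[OF q])
  fix D assume "D \<in> MB"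
  then obtain e X vs where X: "cact a b (dv D) = scale e (dv (X, Bead {Top a, Top b} # vs))" "(X, Bead {Top a, Top b} # vs) \<in> MB"
    using cupcap_cup[OF ab] unfolding cact_def by blast
  then show "cact a b (cact a b (dv D)) = scale \<delta> (cact a b (dv D))"
    using cupcap_loop[OF ab X(2)] by (simp only: act_linear) (simp add: cact_def scale.scale_left_commute)
qed (simp_all add: act_linear scale.scale_right_distrib scale.scale_left_commute)

lemma dmap_transpose_cup:
  assumes D: "(X, ms) \<in> MB" and e: "{Top a, Top b} \<in> X"
  shows "dmap (tp (trp a b)) (X, ms) = (X, ms)"
proof -
  let ?f = "tp (trp a b)"
  have B: "brauer_diagram r r X" using D by (simp add: marked_brauer_def)
  have fixes_edge: "?f ` e' = e'" if e': "e' \<in> X" for e'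
  proof (cases "e' = {Top a, Top b}")
    case True
    then show ?thesis by (auto simp: image_def)
  next
    case False
    then have "Top a \<notin> e'" "Top b \<notin> e'" using brauer_disjoint[OF B e' e] by auto
    then have "?f v = v" if "v \<in> e'" for v using that by (cases v) (auto simp: transpose_def)
    then show ?thesis by simp
  qed
  have "relabel ?f m = m" if m: "m \<in> set ms" for m
  proof (cases m)
    case (Bead e')
    then show ?thesis using fixes_edge marked_edge(1)[OF D m] by simp
  next
    case (Arrow u v)
    then have "u \<in> range Bot" "v \<in> range Bot" using marked_arrow[OF D] m by auto
    then show ?thesis using Arrow by auto
  qed
  then show ?thesis using fixes_edge by (simp add: dmap_def vmap_def map_idI)
qed

lemma bead_cup: "(X, Bead e # vs) \<in> MB \<Longrightarrow> e \<in> X" using marked_edge(1)[of X "Bead e # vs" r r "Bead e"] by simp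

lemma pact_cact_same:
  assumes ab: "a \<in> {1..r}" "b \<in> {1..r}" "a \<noteq> b" and q: "q \<in> Qs"
  shows "pact (trp a b) (cact a b q) = cact a b q"
proof (rule Qs_eqI[OF q])
  fix D assume "D \<in> MB"
  then obtain e X vs where X: "cact a b (dv D) = scale e (dv (X, Bead {Top a, Top b} # vs))" "(X, Bead {Top a, Top b} # vs) \<in> MB"
    using cupcap_cup[OF ab] unfolding cact_def by blast
  have "pact (trp a b) (dv (X, Bead {Top a, Top b} # vs)) = dv (X, Bead {Top a, Top b} # vs)"
    using pact_dv[OF X(2) permutes_swap_id[OF ab(1,2)]] dmap_transpose_cup[OF X(2) bead_cup[OF X(2)]] by simp
  then show "pact (trp a b) (cact a b (dv D)) = cact a b (dv D)" by (simp add: X(1) act_linear)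
qed (simp_all add: act_linear)

text \<open>Reversal of the single arrow; in the relations verified below every \<epsilon>
  originates here.\<close>

lemma cact_swap:
  assumes ab: "a \<in> {1..r}" "b \<in> {1..r}" "a \<noteq> b" shows "cact b a q = scale \<epsilon> (cact a b q)"
proof -
  have "mstep ([Bead {Top a, Top b}] @ Arrow (Bot a) (Bot b) # []) ([Bead {Top a, Top b}] @ Arrow (Bot b) (Bot a) # [])"
    by (rule mstep.reverse)
  moreover have "cupcap r a b = (fst (cupcap r a b), [Bead {Top a, Top b}, Arrow (Bot a) (Bot b)])"
    by (simp flip: snd_cupcap)
  moreover have "cupcap r b a = (fst (cupcap r a b), [Bead {Top a, Top b}, Arrow (Bot b) (Bot a)])"
    using fst_cupcap[of a b] fst_cupcap[of b a] snd_cupcap[of b a] ab(3)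
    by (intro prod_eqI) (simp_all add: insert_commute)
  ultimately have "dv (cupcap r b a) = scale \<epsilon> (dv (cupcap r a b))"
    using dvec_mstep[OF eps, of "fst (cupcap r a b)" "[Bead {Top a, Top b}, Arrow (Bot a) (Bot b)]" r r] cupcap_marked[OF ab]
    by (metis append_Cons append_Nil)
  then show ?thesis by (simp add: cact_def qmul_scale_left)
qed

lemma cact_merge:
  assumes abc: "a \<in> {1..r}" "b \<in> {1..r}" "c \<in> {1..r}" "distinct [a, b, c]" and q: "q \<in> Qs"
  shows "cact a b (cact b c q) = pact (trp c a) (cact b c q)"
proof (rule Qs_eqI[OF q])
  fix D assume "D \<in> MB"
  then obtain e X vs where X: "cact b c (dv D) = scale e (dv (X, Bead {Top b, Top c} # vs))" "(X, Bead {Top b, Top c} # vs) \<in> MB"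
    using cupcap_cup[OF abc(2,3)] abc(4) unfolding cact_def by fastforce
  have "cact a b (dv (X, Bead {Top b, Top c} # vs)) = pact (trp c a) (dv (X, Bead {Top b, Top c} # vs))"
    using cupcap_cup_right[OF abc(1,2) _ X(2)] pact_dv[OF X(2) permutes_swap_id[OF abc(3,1)]] abc(4) by (simp add: cact_def)
  then show "cact a b (cact b c (dv D)) = pact (trp c a) (cact b c (dv D))" by (simp add: X(1) act_linear)
qed (simp_all add: act_linear)

lemma qmul_glue_diag:
  assumes "D \<in> MB" "D' \<in> MB" "{Top a, Bot a} \<in> fst D" "{Top b, Bot b} \<in> fst D" "a \<noteq> b"
  shows "qmul (dv (glue a b a b D)) (dv D') = cact a b (qmul (dv D) (dv D'))"
  unfolding cact_def by (rule qmul_glue[OF assms])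

text \<open>Both orders of gluing give the same edges, and the lists differ by exchanging two blocks
  of two markings, that is by four interchanges, whose signs cancel.\<close>

lemma cact_commute:
  assumes abcd: "a \<in> {1..r}" "b \<in> {1..r}" "c \<in> {1..r}" "d \<in> {1..r}" "distinct [a, b, c, d]" and q: "q \<in> Qs"
  shows "cact a b (cact c d q) = cact c d (cact a b q)"
proof (rule Qs_eqI[OF q])
  fix D assume D: "D \<in> MB"
  have ab: "cupcap r a b \<in> MB" and cd: "cupcap r c d \<in> MB" using abcd by (auto intro!: cupcap_marked)
  have e: "{Top a, Bot a} \<in> fst (cupcap r c d)" "{Top b, Bot b} \<in> fst (cupcap r c d)"
    "{Top c, Bot c} \<in> fst (cupcap r a b)" "{Top d, Bot d} \<in> fst (cupcap r a b)"
    using abcd fst_cupcap[of a b] fst_cupcap[of c d] by auto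
  define X where "X = exch (Top a) (Bot a) (Top b) (Bot b) (fst (cupcap r c d))"
  have X': "exch (Top c) (Bot c) (Top d) (Bot d) (fst (cupcap r a b)) = X"
    unfolding X_def cupcap_def glue_def fst_conv using abcd by (intro exch_commute) (auto simp: doubleton_eq_iff)
  let ?A = "[Bead {Top a, Top b}, Arrow (Bot a) (Bot b)]" and ?C = "[Bead {Top c, Top d}, Arrow (Bot c) (Bot d)]"
  have g: "glue a b a b (cupcap r c d) = (X, ?A @ ?C)" "glue c d c d (cupcap r a b) = (X, ?C @ ?A)"
    by (simp_all add: glue_def X_def X'[unfolded X_def] snd_cupcap)
  have m: "(X, ?A @ ?C) \<in> MB" "(X, ?C @ ?A) \<in> MB"
    using glue_marked[OF cd e(1,2)] glue_marked[OF ab e(3,4)] abcd unfolding g by auto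
  have sw: "dv (X, xs @ y # x # ys) = scale \<epsilon> (dv (X, xs @ x # y # ys)) \<and> (X, xs @ y # x # ys) \<in> MB"
    if "(X, xs @ x # y # ys) \<in> MB" for xs x y ys
    using dvec_mstep[OF eps that mstep.swap] marked_mset_kindI[OF that, of "xs @ y # x # ys"] by simp
  obtain w x y z where wxyz: "?A = [w, x]" "?C = [y, z]" by blast
  have 1: "dv (X, [w, y, x, z]) = scale \<epsilon> (dv (X, [w, x, y, z])) \<and> (X, [w, y, x, z]) \<in> MB"
    using sw[of "[w]" x y "[z]"] m(1) unfolding wxyz by simp
  have 2: "dv (X, [w, y, z, x]) = scale \<epsilon> (dv (X, [w, y, x, z])) \<and> (X, [w, y, z, x]) \<in> MB"
    using sw[of "[w, y]" x z "[]"] 1 by simp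
  have 3: "dv (X, [y, w, z, x]) = scale \<epsilon> (dv (X, [w, y, z, x])) \<and> (X, [y, w, z, x]) \<in> MB"
    using sw[of "[]" w y "[z, x]"] 2 by simp
  have 4: "dv (X, [y, z, w, x]) = scale \<epsilon> (dv (X, [y, w, z, x]))" using sw[of "[y]" w z "[x]"] 3 by simp
  have "dv (X, ?A @ ?C) = dv (X, ?C @ ?A)" unfolding wxyz using 1 2 3 4 by (simp add: eps)
  then have "qmul (dv (glue a b a b (cupcap r c d))) (dv D) = qmul (dv (glue c d c d (cupcap r a b))) (dv D)"
    unfolding g by simp
  then show "cact a b (cact c d (dv D)) = cact c d (cact a b (dv D))"
    using qmul_glue_diag[OF cd D e(1,2)] qmul_glue_diag[OF ab D e(3,4)] abcd(5) by (simp add: cact_def)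
qed (simp_all add: act_linear)

text \<open>Moved through the cup-cap, the transposition exchanges its two positions, hence reverses
  the arrow; on the other side it is absorbed.\<close>

lemma cact_pact_same:
  assumes ab: "a \<in> {1..r}" "b \<in> {1..r}" "a \<noteq> b" and q: "q \<in> Qs"
  shows "cact a b (pact (trp a b) q) = scale \<epsilon> (cact a b q)"
proof -
  have "cact a b (pact (trp a b) q) = pact (trp a b) (cact b a q)"
    using pact_cact[OF permutes_swap_id[OF ab(1,2)] ab(2,1) _ q] ab(3) by simp
  also have "\<dots> = cact b a q" using pact_cact_same[OF ab(2,1) _ q] ab(3) by (simp add: transpose_commute)
  finally show ?thesis using cact_swap[OF ab] by simp
qed

context
  fixes a b c :: nat and q
  assumes abc: "a \<in> {1..r}" "b \<in> {1..r}" "c \<in> {1..r}" "distinct [a, b, c]" and q: "q \<in> Qs"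
begin

text \<open>\<open>cact_merge\<close> fits after both cup-caps have been read with swapped
  positions; these two signs cancel, and undoing the inner swap leaves one.\<close>

lemma cact_chain: "cact b c (cact a b q) = scale \<epsilon> (pact (trp a c) (cact a b q))"
proof -
  have "cact b c (cact a b q) = scale (\<epsilon> * \<epsilon>) (cact c b (cact b a q))"
    using cact_swap[of c b] cact_swap[of b a] abc by (simp add: act_linear)
  also have "\<dots> = pact (trp a c) (cact b a q)" using cact_merge[of c b a q] abc q by (auto simp: eps)
  finally show ?thesis using cact_swap[of a b] abc by (simp add: act_linear)
qed

lemma transpose_ac: "trp a c permutes {1..r}" using abc by (intro permutes_swap_id)

lemma cact_braid: "cact a b (cact b c (cact a b q)) = scale \<epsilon> (cact a b q)"
proof -
  have z: "cact a b q \<in> Qs" using abc q by (intro cact_Qs) auto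
  have "cact a b (cact b c (cact a b q)) = scale \<epsilon> (pact (trp a c) (cact c b (cact a b q)))"
    using pact_cact[OF transpose_ac, of c b "cact a b q"] abc z by (simp add: cact_chain act_linear)
  also have "cact c b (cact a b q) = pact (trp a c) (cact a b q)"
    using cact_swap[of b c] abc by (simp add: cact_chain eps)
  finally show ?thesis using z transpose_ac by (simp add: pact_twice)
qed

lemma cact_braid': "cact b c (cact a b (cact b c q)) = scale \<epsilon> (cact b c q)"
proof -
  have z: "cact b c q \<in> Qs" "cact a b (cact b c q) \<in> Qs" using abc q by (auto intro!: cact_Qs)
  have "cact b c (cact a b (cact b c q)) = pact (trp a c) (cact b a (cact b c q))"
    using pact_cact[OF transpose_ac, of b a "cact b c q"] cact_merge[of a b c q] abc z q
    by (simp add: transpose_commute[of c])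
  also have "\<dots> = scale \<epsilon> (pact (trp a c) (pact (trp a c) (cact b c q)))"
    using cact_swap[of a b] cact_merge[of a b c q] abc q by (simp add: act_linear transpose_commute[of c])
  finally show ?thesis using z transpose_ac by (simp add: pact_twice)
qed

lemma pact_cact_cact: "pact (trp a b) (cact b c (cact a b q)) = scale \<epsilon> (pact (trp b c) (cact a b q))"
proof -
  have z: "cact a b q \<in> Qs" using abc q by (auto intro!: cact_Qs)
  have p: "trp a b permutes {1..r}" "trp b c permutes {1..r}" using abc by (auto intro!: permutes_swap_id)
  have eq: "trp a b \<circ> trp a c = trp b c \<circ> trp a b" using abc by (auto simp: fun_eq_iff transpose_def)
  have "pact (trp a b) (cact b c (cact a b q)) =
      scale \<epsilon> (pact (trp b c \<circ> trp a b) (cact a b q))"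
    using p transpose_ac z by (simp only: cact_chain act_linear pact_pact eq)
  also have "pact (trp b c \<circ> trp a b) (cact a b q) =
      pact (trp b c) (pact (trp a b) (cact a b q))" using p z by (simp only: pact_pact)
  finally show ?thesis using pact_cact_same[of a b q] abc q by simp
qed

lemma cact_cact_pact: "cact b c (cact a b (pact (trp b c) q)) = scale \<epsilon> (cact b c (pact (trp a b) q))"
proof -
  have p: "trp a b permutes {1..r}" "trp b c permutes {1..r}" using abc by (auto intro!: permutes_swap_id)
  have "cact b c (cact a b (pact (trp b c) q)) = pact (trp b c) (cact c b (cact a c q))"
    using pact_cact[OF p(2), of a c q] pact_cact[OF p(2), of c b "cact a c q"] cact_Qs[of a c q] abc q by auto
  also have "cact c b (cact a c q) = cact b c (cact c a q)"
    using cact_swap[of c b] cact_swap[of a c] abc by (simp add: act_linear eps)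
  also have "cact b c (cact c a q) = pact (trp a b) (cact c a q)" using cact_merge[of b c a q] abc q by auto
  also have "\<dots> = scale \<epsilon> (cact b c (pact (trp a b) q))"
    using pact_cact[OF p(1), of a c q] cact_swap[of a c] abc q by (auto simp: act_linear)
  also have "pact (trp b c) \<dots> = \<dots>"
    using pact_cact_same[of b c "pact (trp a b) q"] pact_Qs[OF p(1) q] abc by (auto simp: act_linear)
  finally show ?thesis .
qed

end

end

section \<open>The Brauer diagrams of normal forms and the action of words\<close>

lemma vmap_exch:
  assumes "inj f"
  shows "vmap f (exch u1 w1 u2 w2 X) = exch (f u1) (f w1) (f u2) (f w2) (vmap f X)"
proof -
  have "inj (\<lambda>e. f ` e)" using assms by (simp add: inj_def inj_image_eq_iff)
  then show ?thesis by (simp add: vmap_def exch_def image_Un image_set_diff)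
qed

definition nf_edges :: "nat \<Rightarrow> (nat \<Rightarrow> nat) \<Rightarrow> (nat \<times> nat) list \<Rightarrow> vertex set set" where
  "nf_edges r \<pi> ps = (\<lambda>e. Top ` \<pi> ` e) ` pair_sets ps \<union> (\<lambda>e. Bot ` e) ` pair_sets ps \<union>
     (\<lambda>l. {Top (\<pi> l), Bot l}) ` ({1..r} - set (pts ps))"

fun glues :: "nat \<Rightarrow> (nat \<times> nat) list \<Rightarrow> mdiagram" where
  "glues r [] = identity_diagram r"
| "glues r ((a, b) # ps) = glue a b a b (glues r ps)"

definition nf_diagram :: "nat \<Rightarrow> (nat \<Rightarrow> nat) \<Rightarrow> (nat \<times> nat) list \<Rightarrow> mdiagram" where
  "nf_diagram r \<pi> ps = dmap (tp \<pi>) (glues r ps)"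

lemma valid_Cons: "valid r ((a, b) # ps) \<longleftrightarrow> valid r ps \<and> a \<in> {1..r} \<and> b \<in> {1..r} \<and> a \<noteq> b \<and> a \<notin> set (pts ps) \<and> b \<notin> set (pts ps)"
  by (auto simp: valid_def)

lemma fst_glues: "fst (glues r ps) = nf_edges r id ps"
proof (induction ps rule: glues.induct)
  case (1 r)
  then show ?case by (simp add: identity_diagram_def nf_edges_def)
next
  case (2 r a b ps)
  define f where "f = (\<lambda>l. {Top l, Bot l})"
  define U where "U = (\<lambda>e. Top ` e) ` pair_sets ps \<union> (\<lambda>e. Bot ` e) ` pair_sets ps"
  define N where "N = {1..r} - set (pts ps)"
  have inj: "inj f" by (auto simp: f_def inj_def doubleton_eq_iff)
  have dj: "f l \<notin> U" for l by (auto simp: f_def U_def set_eq_iff image_iff)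
  have U: "U - {f a, f b} = U" using dj[of a] dj[of b] by blast
  have IH: "fst (glues r ps) = U \<union> f ` N" using 2 by (simp add: nf_edges_def U_def f_def N_def)
  have "{1..r} - set (pts ((a, b) # ps)) = N - {a, b}" by (auto simp: N_def)
  then have "nf_edges r id ((a, b) # ps) = {{Top a, Top b}, {Bot a, Bot b}} \<union> (U \<union> f ` (N - {a, b}))"
    unfolding nf_edges_def pair_sets_simps by (auto simp: U_def f_def)
  also have "f ` (N - {a, b}) = f ` N - {f a, f b}" using image_set_diff[OF inj, of N "{a, b}"] by simp
  also have "U \<union> (f ` N - {f a, f b}) = U \<union> f ` N - {f a, f b}" using U by blast
  finally show ?case by (simp add: glue_def exch_def IH) (simp add: f_def)
qed

lemma fst_nf_diagram: "fst (nf_diagram r \<pi> ps) = nf_edges r \<pi> ps"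
  unfolding nf_diagram_def fst_dmap fst_glues nf_edges_def vmap_Un by (simp add: vmap_def image_image)

lemma glues_edge: "a \<in> {1..r} \<Longrightarrow> a \<notin> set (pts ps) \<Longrightarrow> {Top a, Bot a} \<in> fst (glues r ps)"
  by (simp add: fst_glues nf_edges_def)

lemma nf_edges_vertical: "{Top a, Bot c} \<in> nf_edges r \<pi> ps \<longleftrightarrow> c \<in> {1..r} \<and> c \<notin> set (pts ps) \<and> \<pi> c = a"
proof
  assume "{Top a, Bot c} \<in> nf_edges r \<pi> ps"
  moreover have "{Top a, Bot c} \<noteq> Top ` e" "{Top a, Bot c} \<noteq> Bot ` e" for e by blast+
  ultimately have "{Top a, Bot c} \<in> (\<lambda>l. {Top (\<pi> l), Bot l}) ` ({1..r} - set (pts ps))"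
    unfolding nf_edges_def by blast
  then obtain l where "l \<in> {1..r} - set (pts ps)" "{Top a, Bot c} = {Top (\<pi> l), Bot l}" by blast
  then show "c \<in> {1..r} \<and> c \<notin> set (pts ps) \<and> \<pi> c = a" by (simp add: doubleton_eq_iff)
next
  assume "c \<in> {1..r} \<and> c \<notin> set (pts ps) \<and> \<pi> c = a"
  then have "{Top a, Bot c} \<in> (\<lambda>l. {Top (\<pi> l), Bot l}) ` ({1..r} - set (pts ps))" by blast
  then show "{Top a, Bot c} \<in> nf_edges r \<pi> ps" by (simp add: nf_edges_def)
qed

text \<open>Caps show the pairs and cups their images under \<open>\<pi>\<close>, so the diagram
  determines the data compared in \<open>normal_form_unique\<close>.\<close>

lemma nf_edges_pair_sets: "pair_sets ps = {e. e \<noteq> {} \<and> Bot ` e \<in> nf_edges r \<pi> ps}"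
  "(\<lambda>e. \<pi> ` e) ` pair_sets ps = {e. e \<noteq> {} \<and> Top ` e \<in> nf_edges r \<pi> ps}"
proof -
  have ne: "e \<noteq> {}" if "e \<in> pair_sets ps" for e using that by (auto simp: pair_sets_def)
  have B: "e \<in> pair_sets ps" if e: "e \<noteq> {}" "Bot ` e \<in> nf_edges r \<pi> ps" for e
  proof -
    have "Bot ` e \<noteq> Top ` f" "Bot ` e \<noteq> {Top x, y}" for f x y using e(1) by blast+
    then have "Bot ` e \<in> (\<lambda>e. Bot ` e) ` pair_sets ps" using e(2) unfolding nf_edges_def by blast
    then show ?thesis by (auto simp: inj_image_eq_iff inj_def)
  qed
  have T: "e \<in> (\<lambda>e. \<pi> ` e) ` pair_sets ps" if e: "e \<noteq> {}" "Top ` e \<in> nf_edges r \<pi> ps" for e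
  proof -
    have "Top ` e \<noteq> Bot ` f" "Top ` e \<noteq> {x, Bot y}" for f x y using e(1) by blast+
    then have "Top ` e \<in> (\<lambda>e. Top ` \<pi> ` e) ` pair_sets ps" using e(2) unfolding nf_edges_def by blast
    then show ?thesis by (auto simp: inj_image_eq_iff inj_def)
  qed
  show "pair_sets ps = {e. e \<noteq> {} \<and> Bot ` e \<in> nf_edges r \<pi> ps}" using ne B by (auto simp: nf_edges_def)
  show "(\<lambda>e. \<pi> ` e) ` pair_sets ps = {e. e \<noteq> {} \<and> Top ` e \<in> nf_edges r \<pi> ps}"
  proof -
    have "e \<noteq> {} \<and> Top ` e \<in> nf_edges r \<pi> ps" if "e \<in> (\<lambda>e. \<pi> ` e) ` pair_sets ps" for e
      using that ne unfolding nf_edges_def by blast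
    then show ?thesis using T by blast
  qed
qed

text \<open>Undoing one cup and cap leaves a diagram in which both restored through strings have the
  form \<open>{Top (\<pi> l), Bot l}\<close>. Adding their bottom ends as a pair recovers the
  diagram with the same \<open>\<pi>\<close>.\<close>

lemma nf_edges_exists: "brauer_diagram r r X \<Longrightarrow> \<exists>\<pi> ps. \<pi> permutes {1..r} \<and> valid r ps \<and> X = nf_edges r \<pi> ps"
proof (induction "card (caps X)" arbitrary: X)
  case 0
  have "finite (caps X)" using brauer_finite[OF 0(2)] by (simp add: caps_def)
  then have "caps X = {}" using 0(1) by simp
  moreover obtain ms where "mark r r X = (X, ms)" by (metis fst_mark prod.collapse)
  ultimately obtain \<pi> where \<pi>: "\<pi> permutes {1..r}" "(X, ms) = dmap (tp \<pi>) (identity_diagram r)"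
    using no_caps_permutation mark_marked[OF 0(2)] by metis
  then have "X = nf_edges r \<pi> []"
    using fst_nf_diagram[of r \<pi> "[]"] by (metis fst_conv glues.simps(1) nf_diagram_def)
  then show ?case using \<pi>(1) by (intro exI[of _ \<pi>] exI[of _ "[]"]) (simp add: valid_def)
next
  case (Suc n)
  have "caps X \<noteq> {}" using Suc.hyps(2) by auto
  moreover have "(X, snd (mark r r X)) \<in> marked_brauer r r"
    using mark_marked[OF Suc.prems] by (metis fst_mark prod.collapse)
  ultimately obtain a b c d X0 ms0 where m0: "(X0, ms0) \<in> marked_brauer r r"
    and e0: "{Top a, Bot c} \<in> X0" "{Top b, Bot d} \<in> X0" and cd: "c \<noteq> d"
    and X_eq: "exch (Top a) (Bot c) (Top b) (Bot d) X0 = X" and card: "card (caps X) = Suc (card (caps X0))"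
    using cap_decomposition by metis
  have "brauer_diagram r r X0" "n = card (caps X0)"
    using m0 card Suc.hyps(2) by (simp_all add: marked_brauer_def)
  then obtain \<pi> ps where ps: "\<pi> permutes {1..r}" "valid r ps" "X0 = nf_edges r \<pi> ps" using Suc.hyps(1) by blast
  have c: "c \<in> {1..r}" "c \<notin> set (pts ps)" "\<pi> c = a" and d: "d \<in> {1..r}" "d \<notin> set (pts ps)" "\<pi> d = b"
    using e0 unfolding ps(3) nf_edges_vertical by auto
  have "inj (tp \<pi>)" using bij_tp[OF permutes_bij[OF ps(1)]] by (rule bij_is_inj)
  then have "nf_edges r \<pi> ((c, d) # ps) = exch (Top a) (Bot c) (Top b) (Bot d) (nf_edges r \<pi> ps)"
    unfolding fst_nf_diagram[symmetric] nf_diagram_def by (simp add: glue_def vmap_exch c d)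
  then have "X = nf_edges r \<pi> ((c, d) # ps)" using X_eq ps(3) by simp
  moreover have "valid r ((c, d) # ps)" using ps(2) c d cd by (simp add: valid_Cons)
  ultimately show ?case using ps(1) by blast
qed

lemma nf_edges_unique:
  assumes "valid r ps" "valid r ps'" "\<pi> permutes {1..r}" "\<pi>' permutes {1..r}" "nf_edges r \<pi> ps = nf_edges r \<pi>' ps'"
  shows "bcong r (brauer_words.nf_word r \<pi> ps) (brauer_words.nf_word r \<pi>' ps')"
proof -
  interpret brauer_words r .
  have sets: "pair_sets ps = pair_sets ps'" "(\<lambda>e. \<pi> ` e) ` pair_sets ps = (\<lambda>e. \<pi>' ` e) ` pair_sets ps'"
    using nf_edges_pair_sets[where r = r and ps = ps and \<pi> = \<pi>] nf_edges_pair_sets[where r = r and ps = ps' and \<pi> = \<pi>'] assms(5) by simp_all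
  have "\<pi> x = \<pi>' x" if "x \<notin> set (pts ps)" for x
  proof (cases "x \<in> {1..r}")
    case True
    then have "{Top (\<pi> x), Bot x} \<in> nf_edges r \<pi>' ps'"
      using that nf_edges_vertical[of "\<pi> x" x r \<pi> ps] assms(5) by simp
    then show ?thesis unfolding nf_edges_vertical by simp
  next
    case False
    then show ?thesis using assms(3,4) by (simp add: permutes_not_in)
  qed
  then have "t \<pi> \<bullet> pe ps = t \<pi>' \<bullet> pe ps'" using assms sets by (intro normal_form_unique) auto
  then show ?thesis unfolding nrm_nf_word[symmetric] nrm_eq .
qed

context marked_algebra
begin

sublocale bw: brauer_words r .

definition gen_diagram :: "letter \<Rightarrow> mdiagram" where
  "gen_diagram g = (case g of S i \<Rightarrow> perm_diagram r (trp i (Suc i)) | E i \<Rightarrow> cupcap r i (Suc i))"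

text \<open>Letters act one after the other, so concatenated words act as composite operators
  without any appeal to associativity.\<close>

fun wact :: "letter list \<Rightarrow> 'k coords \<Rightarrow> 'k coords" where
  "wact [] q = q"
| "wact (g # w) q = qmul (dv (gen_diagram g)) (wact w q)"

lemma wact_append: "wact (u @ v) q = wact u (wact v q)" by (induction u) auto

lemma wact_S: "wact [S i] q = pact (trp i (Suc i)) q" and wact_E: "wact [E i] q = cact i (Suc i) q"
  by (simp_all add: gen_diagram_def pact_def cact_def)

lemma wact_linear: "wact w (p + q) = wact w p + wact w q" "wact w (scale c q) = scale c (wact w q)"
  by (induction w) (simp_all add: qmul_add_right qmul_scale_right)

lemma gen_diagram_marked: "g \<in> brauer_letters r \<Longrightarrow> gen_diagram g \<in> MB"
  by (auto simp: brauer_letters_def gen_diagram_def intro!: perm_marked cupcap_marked permutes_swap_id)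

lemma wact_Qs: "set w \<subseteq> brauer_letters r \<Longrightarrow> q \<in> Qs \<Longrightarrow> wact w q \<in> Qs"
  by (induction w) (auto intro!: qmul_Qs dv_Qs gen_diagram_marked)

lemma wact_map_S: "set w \<subseteq> {1..<r} \<Longrightarrow> q \<in> Qs \<Longrightarrow> wact (map S w) q = pact (wperm w) q"
proof (induction w)
  case Nil
  then show ?case unfolding wperm.simps by (simp only: pact_id list.map wact.simps)
next
  case (Cons i w)
  have "wact (map S (i # w)) q = pact (trp i (Suc i)) (wact (map S w) q)"
    using wact_S[of i "wact (map S w) q"] by simp
  also have "\<dots> = pact (trp i (Suc i)) (pact (wperm w) q)" using Cons by simp
  also have "\<dots> = pact (trp i (Suc i) \<circ> wperm w) q"
  proof (rule pact_pact)
    show "trp i (Suc i) permutes {1..r}" using Cons.prems by (intro permutes_swap_id) auto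
    show "wperm w permutes {1..r}" using Cons.prems by (intro wperm_permutes) auto
  qed (rule Cons.prems)
  finally show ?case by (simp only: wperm.simps)
qed

lemma wact_perm_word: "\<pi> permutes {1..r} \<Longrightarrow> q \<in> Qs \<Longrightarrow> wact (bw.perm_word \<pi>) q = pact \<pi> q"
  using wact_map_S[of "bw.pword \<pi>" q] bw.pword[of \<pi>] by (simp add: bw.perm_word_def)

lemma wact_pair_word:
  assumes ab: "a \<in> {1..r}" "b \<in> {1..r}" "a \<noteq> b" and q: "q \<in> Qs"
  shows "wact (bw.pair_word a b) q = cact a b q"
proof -
  note p = bw.rep[OF ab]
  let ?\<rho> = "bw.rep a b"
  have i: "pinv ?\<rho> permutes {1..r}" by (rule permutes_inv[OF p(1)])
  have q': "pact (pinv ?\<rho>) q \<in> Qs" by (rule pact_Qs[OF i q])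
  have 12: "1 \<in> {1..r}" "2 \<in> {1..r}" using p(4) by auto
  have "wact (bw.pair_word a b) q = pact ?\<rho> (cact 1 2 (pact (pinv ?\<rho>) q))"
    unfolding bw.pair_word_def wact_append wact_E wact_perm_word[OF i q]
    using wact_perm_word[OF p(1)] cact_Qs[OF 12 _ q'] by (simp add: numeral_2_eq_2)
  also have "\<dots> = cact a b (pact ?\<rho> (pact (pinv ?\<rho>) q))" using pact_cact[OF p(1) 12 _ q'] p by simp
  also have "pact ?\<rho> (pact (pinv ?\<rho>) q) = q"
    unfolding pact_pact[OF p(1) i q] permutes_inv_o(1)[OF p(1)] by (rule pact_id[OF q])
  finally show ?thesis .
qed

fun pairs_act :: "(nat \<times> nat) list \<Rightarrow> 'k coords \<Rightarrow> 'k coords" where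
  "pairs_act [] q = q"
| "pairs_act ((a, b) # ps) q = cact a b (pairs_act ps q)"

lemma pairs_act_Qs: "valid r ps \<Longrightarrow> q \<in> Qs \<Longrightarrow> pairs_act ps q \<in> Qs"
  by (induction ps q rule: pairs_act.induct) (auto simp: valid_Cons intro!: cact_Qs)

lemma wact_nf_word:
  assumes "\<pi> permutes {1..r}" "valid r ps" "q \<in> Qs"
  shows "wact (bw.nf_word \<pi> ps) q = pact \<pi> (pairs_act ps q)"
proof -
  have "wact (concat (map (\<lambda>(a, b). bw.pair_word a b) ps)) q = pairs_act ps q" using assms(2,3)
  proof (induction ps q rule: pairs_act.induct)
    case (2 a b ps q)
    then show ?case by (simp add: wact_append valid_Cons wact_pair_word pairs_act_Qs)
  qed simp
  then show ?thesis using assms by (simp add: bw.nf_word_def wact_append wact_perm_word pairs_act_Qs)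
qed

lemma glues_marked: "valid r ps \<Longrightarrow> glues r ps \<in> MB"
proof (induction r ps rule: glues.induct)
  case (2 r a b ps)
  interpret m: marked_algebra \<delta> \<epsilon> r by (rule marked_algebra.intro[OF param])
  from 2 show ?case by (auto simp: valid_Cons intro!: m.glue_marked glues_edge)
qed (simp add: identity_marked)

lemma nf_diagram_marked: "\<pi> permutes {1..r} \<Longrightarrow> valid r ps \<Longrightarrow> nf_diagram r \<pi> ps \<in> MB"
  unfolding nf_diagram_def by (intro marked_tp glues_marked)

lemma qmul_glues:
  assumes "valid r ps" "D \<in> MB" shows "qmul (dv (glues r ps)) (dv D) = pairs_act ps (dv D)"
  using assms(1)
proof (induction ps)
  case Nil
  then show ?case by (simp add: qmul_identity assms(2))
next
  case (Cons p ps)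
  obtain a b where p: "p = (a, b)" by (cases p)
  have v: "valid r ps" "a \<in> {1..r}" "b \<in> {1..r}" "a \<noteq> b" "a \<notin> set (pts ps)" "b \<notin> set (pts ps)"
    using Cons.prems by (auto simp: p valid_Cons)
  then have "qmul (dv (glues r (p # ps))) (dv D) = cact a b (qmul (dv (glues r ps)) (dv D))"
    unfolding p glues.simps by (intro qmul_glue_diag glues_marked glues_edge assms(2))
  then show ?case using Cons.IH[OF v(1)] by (simp add: p)
qed

lemma pairs_act_identity:
  assumes "valid r ps" shows "pairs_act ps (dv (identity_diagram r)) = dv (glues r ps)"
  using assms
proof (induction ps)
  case (Cons p ps)
  obtain a b where p: "p = (a, b)" by (cases p)
  have v: "valid r ps" "a \<in> {1..r}" "b \<in> {1..r}" "a \<noteq> b" "a \<notin> set (pts ps)" "b \<notin> set (pts ps)"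
    using Cons.prems by (auto simp: p valid_Cons)
  then have "cact a b (dv (glues r ps)) = dv (glue a b a b (glues r ps))"
    unfolding cact_def by (intro cupcap_bot glues_marked glues_edge)
  then show ?case using Cons.IH[OF v(1)] by (simp add: p)
qed simp

lemma wact_nf_word_identity:
  assumes "\<pi> permutes {1..r}" "valid r ps"
  shows "wact (bw.nf_word \<pi> ps) (dv (identity_diagram r)) = dv (nf_diagram r \<pi> ps)"
  using wact_nf_word[OF assms dv_Qs[OF identity_marked]] pairs_act_identity[OF assms(2)]
    pact_dv[OF glues_marked[OF assms(2)] assms(1)] by (simp add: nf_diagram_def)

text \<open>The substitute for associativity. The diagram is built from the identity by gluings and
  a permutation of the top row, and products with each of these are known to factor.\<close>

lemma qmul_nf_diagram:
  assumes \<pi>: "\<pi> permutes {1..r}" and v: "valid r ps" and q: "q \<in> Qs"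
  shows "qmul (dv (nf_diagram r \<pi> ps)) q = wact (bw.nf_word \<pi> ps) q"
proof (rule Qs_eqI[OF q])
  fix D assume D: "D \<in> MB"
  show "qmul (dv (nf_diagram r \<pi> ps)) (dv D) = wact (bw.nf_word \<pi> ps) (dv D)"
    unfolding nf_diagram_def qmul_tp(2)[OF glues_marked[OF v] D \<pi>] qmul_glues[OF v D] wact_nf_word[OF \<pi> v dv_Qs[OF D]]
    by (simp add: pact_def)
qed (simp_all add: qmul_add_right qmul_scale_right wact_linear)

end

section \<open>Free algebras\<close>

lemma lin_out:
  assumes "\<And>x y. f (x + y) = f x + f y" "\<And>c x. f (scale c x) = scale c (f x)"
  shows "f (lin g x) = lin (\<lambda>k. f (g k)) (x :: 'a \<Rightarrow>\<^sub>0 'k::field)"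
  by (rule linear_eq_on_keys) (simp_all add: lin_add lin_scale assms)

lemma mult_lin: "x * y = lin (\<lambda>k. lin (\<lambda>l. single (k + l) 1) y) (x :: 'a::monoid_add \<Rightarrow>\<^sub>0 'k::field)"
proof -
  have "x * y = (\<Sum>k\<in>keys x. single k (lookup x k)) *
      (\<Sum>l\<in>keys y. single l (lookup y l))" by (simp flip: poly_mapping_expansion)
  also have "\<dots> = (\<Sum>k\<in>keys x. \<Sum>l\<in>keys y.
      single (k + l) (lookup x k * lookup y l))" by (simp add: sum_product mult_single)
  finally show ?thesis by (simp add: lin_def scale.scale_sum_right)
qed

lemma scale_times: "scale c (x * y) = scale c x * y" "scale c (x * y) = x * scale c y"
  for x y :: "'a::monoid_add \<Rightarrow>\<^sub>0 'k::field" unfolding mult_lin by (simp_all add: lin_scale lin_fun_scale)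

lemma scale_uminus_one: "scale (- 1) x = - x" using scale.scale_minus_left[of 1 x] by simp

lemma free_algebra_simps: "carrier (free_algebra X) = {x. \<forall>w\<in>keys x. set (letters w) \<subseteq> X}"
  "x \<otimes>\<^bsub>free_algebra X\<^esub> y = x * y" "\<one>\<^bsub>free_algebra X\<^esub> = 1"
  "\<zero>\<^bsub>free_algebra X\<^esub> = 0" "x \<oplus>\<^bsub>free_algebra X\<^esub> y = x + y" by (simp_all add: free_algebra_def)

lemma free_carrier_scale: "x \<in> carrier (free_algebra X) \<Longrightarrow> scale c x \<in> carrier (free_algebra X)"
  using keys_scale[of c x] unfolding free_algebra_simps by blast

lemma free_carrier_closed:
  assumes "x \<in> carrier (free_algebra X)" "y \<in> carrier (free_algebra X)"
  shows "x + y \<in> carrier (free_algebra X)" "x * y \<in> carrier (free_algebra X)" "x - y \<in> carrier (free_algebra X)"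
proof -
  show "x + y \<in> carrier (free_algebra X)"
    using assms Poly_Mapping.keys_add[of x y] unfolding free_algebra_simps by blast
  have "keys (x * y) \<subseteq> {w. set (letters w) \<subseteq> X}" unfolding mult_lin using assms
    by (intro keys_lin) (auto simp: free_algebra_simps plus_word_def)
  then show "x * y \<in> carrier (free_algebra X)" unfolding free_algebra_simps by blast
  show "x - y \<in> carrier (free_algebra X)"
    using assms(1) free_carrier_scale[OF assms(2), of "- 1"] Poly_Mapping.keys_add[of x "scale (- 1) y"]
    unfolding free_algebra_simps scale_uminus_one by auto
qed

lemma free_algebra_ring: "ring (free_algebra X :: ('k::field, 'a word \<Rightarrow>\<^sub>0 'k) module)"
proof (rule ringI)
  let ?F = "free_algebra X :: ('k, 'a word \<Rightarrow>\<^sub>0 'k) module"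
  have zero: "0 \<in> carrier ?F" by (simp add: free_algebra_simps)
  have one: "1 \<in> carrier ?F" by (simp add: free_algebra_simps zero_word_def flip: single_one)
  show "abelian_group ?F"
  proof (rule abelian_groupI)
    fix x assume x: "x \<in> carrier ?F"
    show "\<exists>y\<in>carrier ?F. y \<oplus>\<^bsub>?F\<^esub> x = \<zero>\<^bsub>?F\<^esub>"
      using free_carrier_closed(3)[OF zero x] by (intro bexI[of _ "0 - x"]) (simp_all add: free_algebra_simps(4,5))
  qed (use zero free_carrier_closed in \<open>auto simp: free_algebra_simps(4,5) add.assoc add.commute\<close>)
  show "Group.monoid ?F"
    using one free_carrier_closed by (intro monoidI) (auto simp: free_algebra_simps(2,3) mult.assoc)
qed (simp_all add: free_algebra_simps distrib_left distrib_right)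

definition wmono :: "'a list \<Rightarrow> ('a word \<Rightarrow>\<^sub>0 'k::field)" where
  "wmono w = single (Word w) 1"

lemma wmono_append: "wmono (u @ v) = wmono u * wmono v"
  by (simp add: wmono_def mult_single plus_word_def)

lemma wmono_Nil: "wmono [] = 1" unfolding wmono_def zero_word_def[symmetric] by (rule single_one)

lemma free_gen_mono: "free_gen a = wmono [a]" by (simp add: free_gen_def wmono_def)

lemma wmono_mult: "wmono u * wmono v = wmono (u @ v)" by (simp add: wmono_append)

lemma wmono_carrier: "wmono w \<in> carrier (free_algebra X :: ('k::field, 'a word \<Rightarrow>\<^sub>0 'k) module) \<longleftrightarrow> set w \<subseteq> X"
  by (simp add: wmono_def free_algebra_simps)

locale free_ideal =
  fixes X :: "'a set" and R :: "('a word \<Rightarrow>\<^sub>0 'k::field) set" assumes R: "R \<subseteq> carrier (free_algebra X)"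
begin

abbreviation F :: "('k, 'a word \<Rightarrow>\<^sub>0 'k) module" where "F \<equiv> free_algebra X"
abbreviation I :: "('a word \<Rightarrow>\<^sub>0 'k) set" where "I \<equiv> relation_ideal X R"

lemma ideal_I: "ideal I F" unfolding relation_ideal_def by (rule ring.genideal_ideal[OF free_algebra_ring R])

lemma R_I: "x \<in> R \<Longrightarrow> x \<in> I" using ring.genideal_self[OF free_algebra_ring R] by (auto simp: relation_ideal_def)

lemma I_minimal: "ideal J F \<Longrightarrow> R \<subseteq> J \<Longrightarrow> I \<subseteq> J"
  unfolding relation_ideal_def by (rule ring.genideal_minimal[OF free_algebra_ring])

lemma I_zero: "0 \<in> I"
  using additive_subgroup.zero_closed[OF ideal.axioms(1)[OF ideal_I]] by (simp add: free_algebra_simps)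

lemma I_add: "x \<in> I \<Longrightarrow> y \<in> I \<Longrightarrow> x + y \<in> I"
  using additive_subgroup.a_closed[OF ideal.axioms(1)[OF ideal_I], of x y] by (simp add: free_algebra_simps)

lemma I_mult: "x \<in> I \<Longrightarrow> a \<in> carrier F \<Longrightarrow> a * x \<in> I" "x \<in> I \<Longrightarrow> a \<in> carrier F \<Longrightarrow> x * a \<in> I"
  using ideal.I_l_closed[OF ideal_I, of x a] ideal.I_r_closed[OF ideal_I, of x a] by (simp_all add: free_algebra_simps(2))

lemma I_scale: "x \<in> I \<Longrightarrow> scale c x \<in> I"
proof -
  assume "x \<in> I"
  moreover have "scale c 1 \<in> carrier F"
    using free_carrier_scale[of "wmono []" X c] by (simp add: wmono_carrier flip: wmono_Nil)
  ultimately have "scale c 1 * x \<in> I" by (intro I_mult)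
  then show ?thesis by (simp flip: scale_times)
qed

lemma I_uminus: "x \<in> I \<Longrightarrow> - x \<in> I" using I_scale[of x "- 1"] by (simp add: scale_uminus_one)

lemma I_diff: "x \<in> I \<Longrightarrow> y \<in> I \<Longrightarrow> x - y \<in> I" using I_add[of x "- y"] I_uminus[of y] by simp

lemma I_sum: "(\<And>a. a \<in> A \<Longrightarrow> f a \<in> I) \<Longrightarrow> sum f A \<in> I"
  by (induction A rule: infinite_finite_induct) (auto intro: I_zero I_add)

lemma I_lin: "(\<And>k. k \<in> keys x \<Longrightarrow> f k \<in> I) \<Longrightarrow> lin f x \<in> I" unfolding lin_def by (intro I_sum I_scale)

lemma coset_iff: "y \<in> I +>\<^bsub>F\<^esub> x \<longleftrightarrow> y - x \<in> I" unfolding a_r_coset_def' by (force simp: free_algebra_simps(5))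

lemma coset_eq_iff: "I +>\<^bsub>F\<^esub> x = I +>\<^bsub>F\<^esub> y \<longleftrightarrow> x - y \<in> I"
proof
  assume "I +>\<^bsub>F\<^esub> x = I +>\<^bsub>F\<^esub> y"
  then show "x - y \<in> I" using coset_iff[of x x] coset_iff[of x y] I_zero by simp
next
  assume xy: "x - y \<in> I"
  have "z - x \<in> I \<longleftrightarrow> z - y \<in> I" for z using I_add[of "z - x" "x - y"] I_diff[of "z - y" "x - y"] xy by auto
  then show "I +>\<^bsub>F\<^esub> x = I +>\<^bsub>F\<^esub> y" by (auto simp: coset_iff)
qed

end

section \<open>Validity of the relations\<close>

context marked_algebra
begin

abbreviation "gens \<equiv> brauer_letters r"
abbreviation "rels \<equiv> brauer_relations \<delta> \<epsilon> r"

lemma wact_Cons: "wact (S i # w) q = pact (trp i (Suc i)) (wact w q)"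
  "wact (E i # w) q = cact i (Suc i) (wact w q)"
  using wact_S[of i "wact w q"] wact_E[of i "wact w q"] by simp_all

definition valid_relations :: "(letter word \<Rightarrow>\<^sub>0 'k) set" where
  "valid_relations = {wmono u - scale c (wmono v) |u c v.
     set u \<subseteq> gens \<and> set v \<subseteq> gens \<and> (\<forall>q\<in>Qs. wact u q = scale c (wact v q))}"

lemma valid_relationI:
  assumes "set u \<subseteq> gens" "set v \<subseteq> gens" "\<And>q. q \<in> Qs \<Longrightarrow> wact u q = scale c (wact v q)"
  shows "wmono u - scale c (wmono v) \<in> valid_relations"
  using assms unfolding valid_relations_def by blast

lemma valid_relationI1:
  assumes "set u \<subseteq> gens" "set v \<subseteq> gens" "\<And>q. q \<in> Qs \<Longrightarrow> wact u q = wact v q"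
  shows "wmono u - wmono v \<in> valid_relations" using valid_relationI[of u v 1] assms by simp

lemma rels_valid: "rels \<subseteq> valid_relations"
proof -
  have L: "S i \<in> gens" "E i \<in> gens" if "i \<in> {1..<r}" for i using that by (auto simp: brauer_letters_def)
  have v: "i \<in> {1..r}" "Suc i \<in> {1..r}" "i \<noteq> Suc i" if "i \<in> {1..<r}" for i using that by auto
  have p: "trp i (Suc i) permutes {1..r}" if "i \<in> {1..<r}" for i by (rule permutes_swap_id[OF v(1,2)[OF that]])
  have SS: "wmono [S i, S i] - wmono [] \<in> valid_relations" if i: "i \<in> {1..<r}" for i
    by (rule valid_relationI1) (simp_all only: wact_Cons wact.simps(1) pact_twice[OF p[OF i] transpose_comp_involutory], simp_all add: L[OF i])
  have EE: "wmono [E i, E i] - scale \<delta> (wmono [E i]) \<in> valid_relations" if i: "i \<in> {1..<r}" for i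
    by (rule valid_relationI) (simp_all only: L[OF i] wact_Cons cact_cact[OF v[OF i]] wact.simps(1), simp_all add: L[OF i])
  have ES: "wmono [E i, S i] - scale \<epsilon> (wmono [E i]) \<in> valid_relations" if i: "i \<in> {1..<r}" for i
    by (rule valid_relationI) (simp_all only: L[OF i] wact_Cons cact_pact_same[OF v[OF i]] wact.simps(1), simp_all add: L[OF i])
  have SE: "wmono [S i, E i] - wmono [E i] \<in> valid_relations" if i: "i \<in> {1..<r}" for i
    by (rule valid_relationI1) (simp_all only: L[OF i] wact_Cons pact_cact_same[OF v[OF i]] wact.simps(1), simp_all add: L[OF i])
  have far_SS: "wmono [S i, S j] - wmono [S j, S i] \<in> valid_relations"
    if ij: "i \<in> {1..<r}" "j \<in> {1..<r}" "j \<noteq> i \<and> j \<noteq> i + 1 \<and> i \<noteq> j + 1" for i j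
  proof -
    have "trp i (Suc i) \<circ> trp j (Suc j) = trp j (Suc j) \<circ> trp i (Suc i)"
      using ij by (auto simp: fun_eq_iff transpose_def)
    then show ?thesis
      by (intro valid_relationI1) (simp_all only: wact_Cons wact.simps(1) pact_pact[OF p[OF ij(1)] p[OF ij(2)]] pact_pact[OF p[OF ij(2)] p[OF ij(1)]],
        simp_all add: L[OF ij(1)] L[OF ij(2)])
  qed
  have far_EE: "wmono [E i, E j] - wmono [E j, E i] \<in> valid_relations"
    if ij: "i \<in> {1..<r}" "j \<in> {1..<r}" "j \<noteq> i \<and> j \<noteq> i + 1 \<and> i \<noteq> j + 1" for i j
  proof -
    have d: "distinct [i, Suc i, j, Suc j]" using ij by auto
    show ?thesis
      by (intro valid_relationI1) (simp_all only: wact_Cons wact.simps(1) cact_commute[OF v(1,2)[OF ij(1)] v(1,2)[OF ij(2)] d],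
        simp_all add: L[OF ij(1)] L[OF ij(2)])
  qed
  have far_SE: "wmono [S i, E j] - wmono [E j, S i] \<in> valid_relations"
    if ij: "i \<in> {1..<r}" "j \<in> {1..<r}" "j \<noteq> i \<and> j \<noteq> i + 1 \<and> i \<noteq> j + 1" for i j
  proof -
    have "trp i (Suc i) j = j" "trp i (Suc i) (Suc j) = Suc j" using ij by (auto simp: transpose_def)
    then show ?thesis
      by (intro valid_relationI1) (simp_all only: wact_Cons wact.simps(1) pact_cact[OF p[OF ij(1)] v[OF ij(2)]],
        simp_all add: L[OF ij(1)] L[OF ij(2)])
  qed
  have abc: "i \<in> {1..r}" "Suc i \<in> {1..r}" "Suc (Suc i) \<in> {1..r}" "distinct [i, Suc i, Suc (Suc i)]"
    if "i \<in> {1..<r}" "i + 1 \<in> {1..<r}" for i using that by auto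
  have L': "S (i + 1) \<in> gens" "E (i + 1) \<in> gens" if "i + 1 \<in> {1..<r}" for i
    using that by (auto simp: brauer_letters_def)
  have braid: "wmono [S i, S (i + 1), S i] - wmono [S (i + 1), S i, S (i + 1)] \<in> valid_relations"
    if i: "i \<in> {1..<r}" "i + 1 \<in> {1..<r}" for i
  proof (rule valid_relationI1)
    fix q assume q: "q \<in> Qs"
    let ?\<tau> = "trp i (Suc i)" and ?\<tau>' = "trp (Suc i) (Suc (Suc i))"
    have p': "?\<tau>' permutes {1..r}" using p[OF i(2)] by simp
    have "?\<tau> \<circ> (?\<tau>' \<circ> ?\<tau>) = ?\<tau>' \<circ> (?\<tau> \<circ> ?\<tau>')" by (auto simp: fun_eq_iff transpose_def)
    then have "pact ?\<tau> (pact ?\<tau>' (pact ?\<tau> q)) = pact ?\<tau>' (pact ?\<tau> (pact ?\<tau>' q))"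
      by (simp only: pact_pact p[OF i(1)] p' q permutes_compose)
    then show "wact [S i, S (i + 1), S i] q = wact [S (i + 1), S i, S (i + 1)] q"
      by (simp only: wact_Cons wact.simps(1) Suc_eq_plus1)
  qed (use L[OF i(1)] L'[OF i(2)] in simp_all)
  have EEE: "wmono [E i, E (i + 1), E i] - scale \<epsilon> (wmono [E i]) \<in> valid_relations"
    if i: "i \<in> {1..<r}" "i + 1 \<in> {1..<r}" for i using cact_braid[OF abc[OF i]] L[OF i(1)] L'[OF i(2)]
    by (intro valid_relationI) (simp_all add: wact_Cons del: wact.simps(2))
  have EEE': "wmono [E (i + 1), E i, E (i + 1)] - scale \<epsilon> (wmono [E (i + 1)]) \<in> valid_relations"
    if i: "i \<in> {1..<r}" "i + 1 \<in> {1..<r}" for i using cact_braid'[OF abc[OF i]] L[OF i(1)] L'[OF i(2)]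
    by (intro valid_relationI) (simp_all add: wact_Cons del: wact.simps(2))
  have SEE: "wmono [S i, E (i + 1), E i] - scale \<epsilon> (wmono [S (i + 1), E i]) \<in> valid_relations"
    if i: "i \<in> {1..<r}" "i + 1 \<in> {1..<r}" for i using pact_cact_cact[OF abc[OF i]] L[OF i(1)] L'[OF i(2)]
    by (intro valid_relationI) (simp_all add: wact_Cons del: wact.simps(2))
  have EES: "wmono [E (i + 1), E i, S (i + 1)] - scale \<epsilon> (wmono [E (i + 1), S i]) \<in> valid_relations"
    if i: "i \<in> {1..<r}" "i + 1 \<in> {1..<r}" for i using cact_cact_pact[OF abc[OF i]] L[OF i(1)] L'[OF i(2)]
    by (intro valid_relationI) (simp_all add: wact_Cons del: wact.simps(2))
  show ?thesis
    unfolding brauer_relations_def Let_def free_gen_mono wmono_mult append.simps wmono_Nil[symmetric] mem_Collect_eq prod.case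
    by (intro Un_least; use SS EE ES SE far_SS far_EE far_SE braid EEE EEE' SEE EES in blast)
qed

lemma rels_single:
  assumes "i \<in> {1..<r}"
  shows "wmono [S i, S i] - wmono [] \<in> rels" "wmono [E i, E i] - scale \<delta> (wmono [E i]) \<in> rels"
    "wmono [E i, S i] - scale \<epsilon> (wmono [E i]) \<in> rels" "wmono [S i, E i] - wmono [E i] \<in> rels"
  unfolding brauer_relations_def Let_def free_gen_mono wmono_mult append.simps wmono_Nil[symmetric] Un_iff mem_Collect_eq prod.case
  using assms by blast+

lemma rels_far:
  assumes "i \<in> {1..<r}" "j \<in> {1..<r}" "j \<noteq> i \<and> j \<noteq> i + 1 \<and> i \<noteq> j + 1"
  shows "wmono [S i, S j] - wmono [S j, S i] \<in> rels" "wmono [E i, E j] - wmono [E j, E i] \<in> rels"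
    "wmono [S i, E j] - wmono [E j, S i] \<in> rels"
  unfolding brauer_relations_def Let_def free_gen_mono wmono_mult append.simps wmono_Nil[symmetric] Un_iff mem_Collect_eq prod.case
  using assms by blast+

lemma rels_near:
  assumes "i \<in> {1..<r}" "i + 1 \<in> {1..<r}"
  shows "wmono [S i, S (i + 1), S i] - wmono [S (i + 1), S i, S (i + 1)] \<in> rels"
    "wmono [S i, E (i + 1), E i] - scale \<epsilon> (wmono [S (i + 1), E i]) \<in> rels"
    "wmono [E (i + 1), E i, S (i + 1)] - scale \<epsilon> (wmono [E (i + 1), S i]) \<in> rels"
  unfolding brauer_relations_def Let_def free_gen_mono wmono_mult append.simps wmono_Nil[symmetric] Un_iff mem_Collect_eq prod.case
  using assms by blast+

lemma valid_relations_carrier: "valid_relations \<subseteq> carrier (free_algebra gens)"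
  unfolding valid_relations_def by (auto intro!: free_carrier_closed(3) free_carrier_scale simp: wmono_carrier)

sublocale free_ideal gens rels by unfold_locales (use rels_valid valid_relations_carrier in blast)

end

lemma lin_fun_diff: "lin (\<lambda>k. f k - g k) x = lin f x - lin g x"
  by (simp add: lin_def scale.scale_right_diff_distrib sum_subtractf)

section \<open>Reduction of words to normal form\<close>

context marked_algebra
begin

lemma eps_nonzero: "\<epsilon> \<noteq> 0" using eps by auto

lemma I_trans: "x - scale c y \<in> I \<Longrightarrow> y - scale d z \<in> I \<Longrightarrow> x - scale (c * d) z \<in> I"
  using I_add[of "x - scale c y" "scale c (y - scale d z)"] I_scale[of "y - scale d z" c]
  by (simp add: scale.scale_right_diff_distrib)

lemma I_context:
  assumes "wmono u - scale c (wmono v) \<in> I" "set xs \<subseteq> gens" "set ys \<subseteq> gens"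
  shows "wmono (xs @ u @ ys) - scale c (wmono (xs @ v @ ys)) \<in> I"
proof -
  have "wmono xs * ((wmono u - scale c (wmono v)) * wmono ys) \<in> I"
    using assms by (intro I_mult) (simp_all add: wmono_carrier)
  then show ?thesis by (simp add: left_diff_distrib right_diff_distrib wmono_append flip: scale_times)
qed

text \<open>Symmetry of the congruence needs a nonzero scalar, and transitivity needs the
  intermediate word to consist of generators; this is why the equivalence of the letter conditions
  is part of the induction.\<close>

lemma bcong_sound:
  assumes "bcong r u v" shows "(set u \<subseteq> gens \<longleftrightarrow> set v \<subseteq> gens) \<and>
    (set u \<subseteq> gens \<longrightarrow> (\<exists>c. c \<noteq> 0 \<and> wmono u - scale c (wmono v) \<in> I))"
proof -
  have L: "S i \<in> gens" "E i \<in> gens" if "i \<in> {1..<r}" for i using that by (auto simp: brauer_letters_def)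
  have plus: "\<exists>c. c \<noteq> 0 \<and> wmono u - scale c (wmono v) \<in> I" if "wmono u - wmono v \<in> rels" for u v
    using R_I[OF that] by (intro exI[of _ 1]) simp
  have times: "\<exists>c. c \<noteq> 0 \<and> wmono u - scale c (wmono v) \<in> I" if "wmono u - scale \<epsilon> (wmono v) \<in> rels" for u v
    using R_I[OF that] eps_nonzero by (intro exI[of _ \<epsilon>]) simp
  from assms show ?thesis
  proof (induction rule: bcong.induct)
    case (refl u)
    then show ?case using I_zero by (auto intro!: exI[of _ 1])
  next
    case (sym u v)
    moreover have "\<exists>d. d \<noteq> 0 \<and> wmono v - scale d (wmono u) \<in> I"
      if c: "c \<noteq> 0" "wmono u - scale c (wmono v) \<in> I" for c
    proof -
      have "scale (- (1 / c)) (wmono u - scale c (wmono v)) \<in> I" by (rule I_scale[OF c(2)])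
      then have "wmono v - scale (1 / c) (wmono u) \<in> I"
        using c(1) by (simp add: scale.scale_right_diff_distrib)
      then show ?thesis using c(1) by (intro exI[of _ "1 / c"]) simp
    qed
    ultimately show ?case by blast
  next
    case (trans u v w)
    moreover have "\<exists>e. e \<noteq> 0 \<and> wmono u - scale e (wmono w) \<in> I"
      if "c \<noteq> 0" "wmono u - scale c (wmono v) \<in> I" "d \<noteq> 0" "wmono v - scale d (wmono w) \<in> I" for c d
      using I_trans[OF that(2,4)] that(1,3) by (intro exI[of _ "c * d"]) simp
    ultimately show ?case by blast
  next
    case (app u u' v v')
    have "\<exists>e. e \<noteq> 0 \<and> wmono (u @ v) - scale e (wmono (u' @ v')) \<in> I" if uv: "set (u @ v) \<subseteq> gens"
    proof -
      obtain c d where cd: "c \<noteq> 0" "wmono u - scale c (wmono u') \<in> I" "d \<noteq> 0" "wmono v - scale d (wmono v') \<in> I"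
        using app.IH uv by auto
      have "set u' \<subseteq> gens" "set v \<subseteq> gens" using app.IH uv by auto
      then have "wmono (u @ v) - scale (c * d) (wmono (u' @ v')) \<in> I"
        using I_context[OF cd(2), of "[]" v] I_context[OF cd(4), of u' "[]"] by (intro I_trans[of _ c "wmono (u' @ v)"]) simp_all
      then show ?thesis using cd by (intro exI[of _ "c * d"]) simp
    qed
    then show ?case using app.IH by auto
  next
    case (SS i)
    then show ?case using plus[OF rels_single(1)] L by simp
  next
    case (ES i)
    then show ?case using times[OF rels_single(3)] L by simp
  next
    case (SE i)
    then show ?case using plus[OF rels_single(4)] L by simp
  next
    case (far_SS i j)
    then have "j \<noteq> i \<and> j \<noteq> i + 1 \<and> i \<noteq> j + 1" by auto
    then show ?case using plus[OF rels_far(1)[OF far_SS(1,2)]] L[OF far_SS(1)] L[OF far_SS(2)] by simp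
  next
    case (far_EE i j)
    then have "j \<noteq> i \<and> j \<noteq> i + 1 \<and> i \<noteq> j + 1" by auto
    then show ?case using plus[OF rels_far(2)[OF far_EE(1,2)]] L[OF far_EE(1)] L[OF far_EE(2)] by simp
  next
    case (far_SE i j)
    then have "j \<noteq> i \<and> j \<noteq> i + 1 \<and> i \<noteq> j + 1" by auto
    then show ?case using plus[OF rels_far(3)[OF far_SE(1,2)]] L[OF far_SE(1)] L[OF far_SE(2)] by simp
  next
    case (braid i)
    then show ?case using plus[OF rels_near(1)[OF braid]] L[OF braid(1)] L[OF braid(2)] by simp
  next
    case (SEE i)
    then show ?case using times[OF rels_near(2)[OF SEE]] L[OF SEE(1)] L[OF SEE(2)] by simp
  next
    case (EES i)
    then show ?case using times[OF rels_near(3)[OF EES]] L[OF EES(1)] L[OF EES(2)] by simp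
  qed
qed

lemma bcongE:
  assumes "bcong r u v" "set u \<subseteq> gens"
  obtains c where "c \<noteq> 0" "wmono u - scale c (wmono v) \<in> I"
  using bcong_sound[OF assms(1)] assms(2) by blast

text \<open>No claim is made that \<open>c\<close> is nonzero: a repeated pair contributes the
  factor \<delta>.\<close>

lemma word_reduces:
  "set w \<subseteq> gens \<Longrightarrow> \<exists>c \<pi> ps. \<pi> permutes {1..r} \<and> valid r ps \<and> wmono w - scale c (wmono (bw.nf_word \<pi> ps)) \<in> I"
proof (induction w rule: rev_induct)
  case Nil
  have "bw.nrm [] = bw.nrm (bw.nf_word id [])"
    unfolding bw.nrm_nf_word bw.t_id bw.pe.simps bw.one_s by (simp add: bw.un_def)
  then have "bcong r [] (bw.nf_word id [])" unfolding bw.nrm_eq .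
  then obtain c where "wmono [] - scale c (wmono (bw.nf_word id [])) \<in> I" by (rule bcongE) simp
  moreover have "valid r []" by (simp add: valid_def)
  ultimately show ?case using permutes_id by blast
next
  case (snoc g w)
  then obtain c \<pi> ps where w: "\<pi> permutes {1..r}" "valid r ps" "wmono w - scale c (wmono (bw.nf_word \<pi> ps)) \<in> I"
    by auto
  have g: "g \<in> gens" using snoc.prems by simp
  have step: "wmono (w @ [g]) - scale c (wmono (bw.nf_word \<pi> ps @ [g])) \<in> I"
    using I_context[OF w(3), of "[]" "[g]"] g by simp
  have letters: "set (bw.nf_word \<pi> ps @ [g]) \<subseteq> gens" using bw.nf_word_letters[OF w(1,2)] g by simp
  from bw.nf_word_snoc[OF w(1,2) g] show ?case
  proof
    assume "\<exists>\<pi>' ps'. \<pi>' permutes {1..r} \<and> valid r ps' \<and> bcong r (bw.nf_word \<pi> ps @ [g]) (bw.nf_word \<pi>' ps')"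
    then obtain \<pi>' ps' where n: "\<pi>' permutes {1..r}" "valid r ps'" "bcong r (bw.nf_word \<pi> ps @ [g]) (bw.nf_word \<pi>' ps')"
      by blast
    obtain d where "wmono (bw.nf_word \<pi> ps @ [g]) - scale d (wmono (bw.nf_word \<pi>' ps')) \<in> I"
      using bcongE[OF n(3) letters] by blast
    from I_trans[OF step this] show ?thesis using n(1,2) by blast
  next
    assume "\<exists>u w. set (u @ w) \<subseteq> gens \<and> 1 < r \<and> bcong r (bw.nf_word \<pi> ps @ [g]) (u @ [E 1, E 1] @ w) \<and>
      bcong r (bw.nf_word \<pi> ps) (u @ [E 1] @ w)"
    then obtain u v where n: "set (u @ v) \<subseteq> gens" "1 < r" "bcong r (bw.nf_word \<pi> ps @ [g]) (u @ [E 1, E 1] @ v)"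
      "bcong r (bw.nf_word \<pi> ps) (u @ [E 1] @ v)" by blast
    have E1: "E 1 \<in> gens" "1 \<in> {1..<r}" using n(2) by (auto simp: brauer_letters_def)
    obtain d where d: "wmono (bw.nf_word \<pi> ps @ [g]) - scale d (wmono (u @ [E 1, E 1] @ v)) \<in> I"
      using bcongE[OF n(3) letters] by blast
    have "set (u @ [E 1] @ v) \<subseteq> gens" using n(1) E1(1) by simp
    then obtain k where k: "wmono (u @ [E 1] @ v) - scale k (wmono (bw.nf_word \<pi> ps)) \<in> I"
      using bcongE[OF bcong.sym[OF n(4)]] by blast
    \<comment> \<open>Here the square relation enters the reduction: it leads back to the normal
      form before the last letter, times \<delta> and the scalars of the congruences.\<close>
    have "wmono (u @ [E 1, E 1] @ v) - scale \<delta> (wmono (u @ [E 1] @ v)) \<in> I"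
      using n(1) by (intro I_context R_I rels_single(2) E1(2)) simp_all
    from I_trans[OF step I_trans[OF d I_trans[OF this k]]] show ?thesis using w(1,2) by blast
  qed
qed

section \<open>The homomorphism on the free algebra\<close>

definition opr :: "(letter word \<Rightarrow>\<^sub>0 'k) \<Rightarrow> 'k coords \<Rightarrow> 'k coords" where
  "opr a q = lin (\<lambda>w. wact (letters w) q) a"

abbreviation "dvid \<equiv> dv (identity_diagram r)"

definition hom_map :: "(letter word \<Rightarrow>\<^sub>0 'k) \<Rightarrow> 'k coords" where
  "hom_map a = opr a dvid"

lemma dvid_Qs: "dvid \<in> Qs" by (rule dv_Qs[OF identity_marked])

lemma opr_linear: "opr (a + b) q = opr a q + opr b q" "opr (scale c a) q = scale c (opr a q)"
  "opr (a - b) q = opr a q - opr b q" "opr 0 q = 0" "opr (- a) q = - opr a q"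
  by (simp_all add: opr_def lin_add lin_scale lin_diff lin_uminus)

lemma opr_mono: "opr (wmono w) q = wact w q" by (simp add: opr_def wmono_def)

lemma wact_zero: "wact w 0 = 0" by (induction w) simp_all

lemma opr_zero: "opr a 0 = 0" by (simp add: opr_def wact_zero lin_def)

lemma opr_times: "opr (a * b) q = opr a (opr b q)"
proof -
  have "opr (a * b) q = lin (\<lambda>k. lin (\<lambda>l. wact (letters k) (wact (letters l) q)) b) a"
    by (simp add: opr_def mult_lin lin_lin plus_word_def wact_append)
  also have "(\<lambda>k. lin (\<lambda>l. wact (letters k) (wact (letters l) q)) b) = (\<lambda>k. wact (letters k) (opr b q))"
    unfolding opr_def by (subst lin_out[where f = "wact _"]) (simp_all add: wact_linear)
  finally show ?thesis by (simp add: opr_def)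
qed

lemma opr_Qs: "a \<in> carrier F \<Longrightarrow> q \<in> Qs \<Longrightarrow> opr a q \<in> Qs"
  unfolding opr_def by (intro lin_Qs wact_Qs) (auto simp: free_algebra_simps)

text \<open>An ideal that contains the relations, hence the whole relation ideal; this makes the
  action well defined on the quotient.\<close>

definition annihilator :: "(letter word \<Rightarrow>\<^sub>0 'k) set" where
  "annihilator = {a \<in> carrier F. \<forall>q\<in>Qs. opr a q = 0}"

lemma ideal_annihilator: "ideal annihilator F"
proof (rule idealI[OF free_algebra_ring])
  interpret R: ring F by (rule free_algebra_ring)
  show "subgroup annihilator (add_monoid F)"
  proof (rule subgroup.intro)
    fix x assume x: "x \<in> annihilator"
    have "- x \<in> carrier F"
      using x free_carrier_scale[of x gens "- 1"] by (simp add: annihilator_def scale_uminus_one)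
    moreover from this have "\<ominus>\<^bsub>F\<^esub> x = - x"
      using x by (intro R.minus_equality) (simp_all add: free_algebra_simps(4,5) annihilator_def)
    ultimately show "inv\<^bsub>add_monoid F\<^esub> x \<in> annihilator"
      using x by (simp add: annihilator_def opr_linear flip: a_inv_def)
  qed (auto simp: annihilator_def free_algebra_simps(4,5) opr_linear intro!: free_carrier_closed, simp add: free_algebra_simps)
  show "x \<otimes>\<^bsub>F\<^esub> a \<in> annihilator" "a \<otimes>\<^bsub>F\<^esub> x \<in> annihilator" if "a \<in> annihilator" "x \<in> carrier F" for a x
    using that by (auto simp: annihilator_def free_algebra_simps(2) opr_times opr_zero opr_Qs intro!: free_carrier_closed)
qed

lemma I_annihilator: "I \<subseteq> annihilator"
proof (rule I_minimal[OF ideal_annihilator])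
  have "valid_relations \<subseteq> annihilator"
    using valid_relations_carrier by (auto simp: annihilator_def valid_relations_def opr_linear opr_mono)
  then show "rels \<subseteq> annihilator" using rels_valid by blast
qed

lemma opr_I: "a \<in> I \<Longrightarrow> q \<in> Qs \<Longrightarrow> opr a q = 0" using I_annihilator by (auto simp: annihilator_def)

lemma opr_cong: "a - b \<in> I \<Longrightarrow> q \<in> Qs \<Longrightarrow> opr a q = opr b q" using opr_I[of "a - b" q] by (simp add: opr_linear)

text \<open>A word acts as a multiple of a normal form, and a normal form acts as multiplication by
  its diagram. This identity makes \<open>hom_map\<close> multiplicative.\<close>

lemma wact_qmul:
  assumes w: "set w \<subseteq> gens" and q: "q \<in> Qs" shows "wact w q = qmul (wact w dvid) q"
proof -
  obtain c \<pi> ps where n: "\<pi> permutes {1..r}" "valid r ps" "wmono w - scale c (wmono (bw.nf_word \<pi> ps)) \<in> I"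
    using word_reduces[OF w] by blast
  have red: "wact w p = scale c (wact (bw.nf_word \<pi> ps) p)" if "p \<in> Qs" for p
    using opr_cong[OF n(3) that] by (simp add: opr_linear opr_mono)
  show ?thesis
    unfolding red[OF q] red[OF dvid_Qs] wact_nf_word_identity[OF n(1,2)] qmul_scale_left qmul_nf_diagram[OF n(1,2) q] ..
qed

lemma opr_qmul:
  assumes "a \<in> carrier F" "q \<in> Qs" shows "opr a q = qmul (hom_map a) q"
proof -
  have "opr a q = lin (\<lambda>w. qmul (wact (letters w) dvid) q) a"
    unfolding opr_def using assms by (intro lin_cong wact_qmul) (auto simp: free_algebra_simps)
  also have "\<dots> = qmul (hom_map a) q"
    unfolding hom_map_def opr_def by (rule lin_out[symmetric]) (simp_all add: qmul_add_left qmul_scale_left)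
  finally show ?thesis .
qed

lemma hom_map_mult: "a \<in> carrier F \<Longrightarrow> b \<in> carrier F \<Longrightarrow> hom_map (a * b) = qmul (hom_map a) (hom_map b)"
  using opr_qmul[of a "hom_map b"] opr_Qs[OF _ dvid_Qs, of b] by (simp add: hom_map_def opr_times)

lemma hom_map_linear: "hom_map (a + b) = hom_map a + hom_map b" "hom_map (scale c a) = scale c (hom_map a)"
  "hom_map (a - b) = hom_map a - hom_map b" by (simp_all add: hom_map_def opr_linear)

lemma hom_map_Qs: "a \<in> carrier F \<Longrightarrow> hom_map a \<in> Qs" unfolding hom_map_def by (rule opr_Qs[OF _ dvid_Qs])

section \<open>A section of the homomorphism, and its kernel\<close>

definition sec_word :: "vertex set set \<Rightarrow> letter list" where
  "sec_word X = (SOME w. \<exists>\<pi> ps. \<pi> permutes {1..r} \<and> valid r ps \<and> X = nf_edges r \<pi> ps \<and> w = bw.nf_word \<pi> ps)"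

text \<open>The coefficient with which the chosen word hits the basis vector. Its square is 1, so it
  also serves as the correcting factor in \<open>section_map\<close>.\<close>

definition sec_sign :: "vertex set set \<Rightarrow> 'k" where
  "sec_sign X = lookup (wact (sec_word X) dvid) X"

definition section_map :: "'k coords \<Rightarrow> (letter word \<Rightarrow>\<^sub>0 'k)" where
  "section_map = lin (\<lambda>X. scale (sec_sign X) (wmono (sec_word X)))"

lemma wact_nf_word_single:
  assumes "\<pi> permutes {1..r}" "valid r ps"
  obtains c where "wact (bw.nf_word \<pi> ps) dvid = single (nf_edges r \<pi> ps) c" "c * c = 1"
  using wact_nf_word_identity[OF assms] that msign_square[OF eps] by (simp add: dvec_def fst_nf_diagram)

lemma sec_word:
  assumes "brauer_diagram r r X"
  obtains \<pi> ps where "\<pi> permutes {1..r}" "valid r ps" "X = nf_edges r \<pi> ps" "sec_word X = bw.nf_word \<pi> ps"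
proof -
  have "\<exists>w \<pi> ps. \<pi> permutes {1..r} \<and> valid r ps \<and> X = nf_edges r \<pi> ps \<and> w = bw.nf_word \<pi> ps"
    using nf_edges_exists[OF assms] by blast
  then have "\<exists>\<pi> ps. \<pi> permutes {1..r} \<and> valid r ps \<and> X = nf_edges r \<pi> ps \<and> sec_word X = bw.nf_word \<pi> ps"
    unfolding sec_word_def by (rule someI_ex)
  then show ?thesis using that by blast
qed

lemma sec_sign:
  assumes "brauer_diagram r r X"
  shows "wact (sec_word X) dvid = single X (sec_sign X)" "sec_sign X * sec_sign X = 1"
proof -
  obtain \<pi> ps where p: "\<pi> permutes {1..r}" "valid r ps" "X = nf_edges r \<pi> ps" "sec_word X = bw.nf_word \<pi> ps"
    using sec_word[OF assms] .
  obtain c where c: "wact (bw.nf_word \<pi> ps) dvid = single X c" "c * c = 1"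
    using wact_nf_word_single[OF p(1,2)] p(3) by metis
  then have "sec_sign X = c" by (simp add: sec_sign_def p(4))
  then show "wact (sec_word X) dvid = single X (sec_sign X)" "sec_sign X * sec_sign X = 1"
    using c p(4) by simp_all
qed

lemma sec_word_letters: "brauer_diagram r r X \<Longrightarrow> set (sec_word X) \<subseteq> gens" by (metis sec_word bw.nf_word_letters)

lemma section_map_carrier:
  assumes "q \<in> Qs" shows "section_map q \<in> carrier F"
proof -
  have "keys (section_map q) \<subseteq> {w. set (letters w) \<subseteq> gens}" unfolding section_map_def
  proof (rule keys_lin)
    fix X assume "X \<in> keys q"
    then have "set (sec_word X) \<subseteq> gens" using assms by (intro sec_word_letters) (auto simp: Qs_def)
    then show "keys (scale (sec_sign X) (wmono (sec_word X))) \<subseteq> {w. set (letters w) \<subseteq> gens}"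
      by (auto simp: wmono_def split: if_splits)
  qed
  then show ?thesis unfolding free_algebra_simps by blast
qed

lemma hom_map_section:
  assumes "q \<in> Qs" shows "hom_map (section_map q) = q"
proof -
  have "hom_map (section_map q) = lin (\<lambda>X. hom_map (scale (sec_sign X) (wmono (sec_word X)))) q"
    unfolding section_map_def by (rule lin_out) (simp_all add: hom_map_linear)
  also have "\<dots> = lin (\<lambda>X. single X 1) q"
    using assms by (intro lin_cong) (auto simp: hom_map_def opr_linear opr_mono sec_sign Qs_def)
  finally show ?thesis by simp
qed

text \<open>The scalars \<open>c\<close> and \<open>d\<close> of the two reductions are unknown, but
  comparing images shows that the coefficient \<open>e\<close> of the normal form is
  \<open>d\<close> times \<open>sec_sign X\<close>. As \<open>sec_sign X\<close> has square 1, the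
  section returns exactly the multiple \<open>c * d\<close> to which \<open>w\<close>
  reduces.\<close>

lemma section_word:
  assumes w: "set w \<subseteq> gens" shows "section_map (wact w dvid) - wmono w \<in> I"
proof -
  obtain c \<pi> ps where n: "\<pi> permutes {1..r}" "valid r ps" "wmono w - scale c (wmono (bw.nf_word \<pi> ps)) \<in> I"
    using word_reduces[OF w] by blast
  define X where "X = nf_edges r \<pi> ps"
  have X: "brauer_diagram r r X"
    using nf_diagram_marked[OF n(1,2)] by (cases "nf_diagram r \<pi> ps") (auto simp: X_def marked_brauer_def simp flip: fst_nf_diagram)
  obtain e where e: "wact (bw.nf_word \<pi> ps) dvid = single X e"
    using wact_nf_word_single[OF n(1,2)] unfolding X_def by metis
  have red: "wact w dvid = single X (c * e)"
    using opr_cong[OF n(3) dvid_Qs] e by (simp add: opr_linear opr_mono)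
  obtain \<pi>' ps' where p: "\<pi>' permutes {1..r}" "valid r ps'" "X = nf_edges r \<pi>' ps'" "sec_word X = bw.nf_word \<pi>' ps'"
    using sec_word[OF X] .
  have "bcong r (bw.nf_word \<pi> ps) (sec_word X)"
    unfolding p(4) using nf_edges_unique[OF n(2) p(2) n(1) p(1)] p(3) X_def by simp
  then obtain d where d: "wmono (bw.nf_word \<pi> ps) - scale d (wmono (sec_word X)) \<in> I"
    using bcongE bw.nf_word_letters[OF n(1,2)] by metis
  then have "single X e = single X (d * sec_sign X)"
    using opr_cong[OF d dvid_Qs] e sec_sign(1)[OF X] by (simp add: opr_linear opr_mono)
  then have "e = d * sec_sign X" by (metis lookup_single_eq)
  then have "section_map (wact w dvid) = scale (c * d) (wmono (sec_word X))"
    using sec_sign(2)[OF X] by (simp add: red section_map_def mult.assoc)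
  then show ?thesis using I_uminus[OF I_trans[OF n(3) d]] by simp
qed

lemma section_hom_map:
  assumes "a \<in> carrier F" shows "section_map (hom_map a) - a \<in> I"
proof -
  have "section_map (hom_map a) = lin (\<lambda>w. section_map (wact (letters w) dvid)) a"
    unfolding hom_map_def opr_def by (rule lin_out) (simp_all add: section_map_def lin_add lin_scale)
  moreover have "a = lin (\<lambda>w. wmono (letters w)) a" by (simp add: wmono_def)
  ultimately have "section_map (hom_map a) - a = lin (\<lambda>w. section_map (wact (letters w) dvid) - wmono (letters w)) a"
    by (simp add: lin_fun_diff)
  moreover have "lin (\<lambda>w. section_map (wact (letters w) dvid) - wmono (letters w)) a \<in> I"
    using assms by (intro I_lin section_word) (auto simp: free_algebra_simps)
  ultimately show ?thesis by simp
qed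

lemma hom_map_eq_iff:
  assumes "a \<in> carrier F" "b \<in> carrier F" shows "hom_map a = hom_map b \<longleftrightarrow> a - b \<in> I"
proof
  assume "hom_map a = hom_map b"
  then have "a - b = (section_map (hom_map b) - b) - (section_map (hom_map a) - a)" by simp
  then show "a - b \<in> I" using section_hom_map[OF assms(1)] section_hom_map[OF assms(2)] I_diff by metis
next
  assume "a - b \<in> I"
  then show "hom_map a = hom_map b" unfolding hom_map_def by (rule opr_cong[OF _ dvid_Qs])
qed

end

section \<open>The isomorphism\<close>

lemma bilinear_extension_lin: "bilinear_extension f x y = lin (\<lambda>D1. lin (\<lambda>D2. f D1 D2) y) x"
  by (simp add: bilinear_extension_def lin_def scale.scale_sum_right)

lemma diagram_space_closed: "x \<in> diagram_space r s \<Longrightarrow> y \<in> diagram_space r s \<Longrightarrow> x + y \<in> diagram_space r s"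
  "x \<in> diagram_space r s \<Longrightarrow> scale c x \<in> diagram_space r s"
  using Poly_Mapping.keys_add[of x y] keys_scale[of c x] unfolding diagram_space_def by blast+

lemma presented_algebra_simps:
  "carrier (presented_algebra X R) = a_rcosets\<^bsub>free_algebra X\<^esub> (relation_ideal X R)"
  "A \<otimes>\<^bsub>presented_algebra X R\<^esub> B = rcoset_mult (free_algebra X) (relation_ideal X R) A B"
  "A \<oplus>\<^bsub>presented_algebra X R\<^esub> B = A <+>\<^bsub>free_algebra X\<^esub> B"
  "\<one>\<^bsub>presented_algebra X R\<^esub> = relation_ideal X R +>\<^bsub>free_algebra X\<^esub> 1"
  "c \<odot>\<^bsub>presented_algebra X R\<^esub> A = (\<Union>x\<in>A. relation_ideal X R +>\<^bsub>free_algebra X\<^esub> scale c x)"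
  by (simp_all add: presented_algebra_def ring.defs module.defs FactRing_def free_algebra_simps(3))

lemma perm_diagram_s:
  assumes "i \<in> {1..<r}" shows "perm_diagram r (trp i (Suc i)) = s_diagram r i"
proof (rule prod_eqI)
  have "{1..r} = insert i (insert (Suc i) ({1..r} - {i, Suc i}))" using assms by auto
  then have "fst (perm_diagram r (trp i (Suc i))) =
      (\<lambda>l. {Top (trp i (Suc i) l), Bot l}) ` insert i (insert (Suc i) ({1..r} - {i, Suc i}))"
    by (simp add: perm_diagram_def identity_diagram_def vmap_def image_image)
  also have "\<dots> = {{Top (Suc i), Bot i}, {Top i, Bot (Suc i)}} \<union> (\<lambda>l. {Top l, Bot l}) ` ({1..r} - {i, Suc i})"
    by (auto simp: transpose_def image_iff)
  finally show "fst (perm_diagram r (trp i (Suc i))) = fst (s_diagram r i)"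
    by (simp add: s_diagram_def insert_commute)
qed (simp add: perm_diagram_def identity_diagram_def s_diagram_def)

context marked_algebra
begin

lemma cupcap_e: "cupcap r i (Suc i) = e_diagram r i"
  by (rule prod_eqI) (simp_all add: fst_cupcap snd_cupcap e_diagram_def)

section \<open>The marked Brauer algebra as the fibres of the coordinate map\<close>

definition cls :: "'k coords \<Rightarrow> (mdiagram \<Rightarrow>\<^sub>0 'k) set" where
  "cls q = {x \<in> diagram_space r r. nf \<epsilon> x = q}"

lemma nf_linear: "nf \<epsilon> (x + y) = nf \<epsilon> x + nf \<epsilon> y" "nf \<epsilon> (scale c x) = scale c (nf \<epsilon> x)"
  by (simp_all add: nf_def lin_add lin_scale)

lemma nf_Qs: "x \<in> diagram_space r r \<Longrightarrow> nf \<epsilon> x \<in> Qs"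
  unfolding nf_def by (intro lin_Qs dv_Qs) (auto simp: diagram_space_def)

lemma diagram_class_cls: "x \<in> diagram_space r r \<Longrightarrow> diagram_class \<epsilon> r r x = cls (nf \<epsilon> x)"
  unfolding cls_def by (rule diagram_class_eq[OF eps])

lemma cls_nonempty:
  assumes "q \<in> Qs" obtains x where "x \<in> cls q"
proof
  let ?x = "lin (\<lambda>X. single (mark r r X) (mark_sign X)) q"
  have "nf \<epsilon> ?x = lin (\<lambda>X. single X 1) q" unfolding nf_def lin_lin using assms
    by (intro lin_cong) (auto simp: Qs_def single_dv simp del: scale_single)
  moreover have "?x \<in> diagram_space r r"
    unfolding diagram_space_def mem_Collect_eq using assms mark_marked by (intro keys_lin) (auto simp: Qs_def)
  ultimately show "?x \<in> cls q" by (simp add: cls_def)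
qed

lemma cls_inject: "p \<in> Qs \<Longrightarrow> cls p = cls q \<Longrightarrow> p = q"
proof -
  assume "p \<in> Qs" and eq: "cls p = cls q"
  then obtain x where "x \<in> cls p" using cls_nonempty by blast
  moreover from this have "x \<in> cls q" unfolding eq .
  ultimately show ?thesis by (simp add: cls_def)
qed

lemma nf_bilinear_extension:
  assumes f: "\<forall>D1\<in>MB. \<forall>D2\<in>MB. f D1 D2 \<in> composites \<delta> \<epsilon> r r D1 D2"
    and x: "x \<in> diagram_space r r" and y: "y \<in> diagram_space r r"
  shows "nf \<epsilon> (bilinear_extension f x y) = qmul (nf \<epsilon> x) (nf \<epsilon> y)" "bilinear_extension f x y \<in> diagram_space r r"
proof -
  have inner: "lin (\<lambda>D2. nf \<epsilon> (f D1 D2)) y = qmul (dv D1) (nf \<epsilon> y)" if D1: "D1 \<in> MB" for D1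
  proof -
    have "lin (\<lambda>D2. nf \<epsilon> (f D1 D2)) y = lin (\<lambda>D2. qmul (dv D1) (dv D2)) y"
    proof (rule lin_cong)
      fix D2 assume "D2 \<in> keys y"
      then have D2: "D2 \<in> MB" using y by (auto simp: diagram_space_def)
      show "nf \<epsilon> (f D1 D2) = qmul (dv D1) (dv D2)"
        unfolding qmul_dv[OF D1 D2] using f D1 D2 by (intro composites_nf[OF eps D1 D2]) blast
    qed
    also have "\<dots> = qmul (dv D1) (nf \<epsilon> y)"
      unfolding nf_def by (rule lin_out[symmetric]) (simp_all add: qmul_add_right qmul_scale_right)
    finally show ?thesis .
  qed
  have "nf \<epsilon> (bilinear_extension f x y) = lin (\<lambda>D1. lin (\<lambda>D2. nf \<epsilon> (f D1 D2)) y) x"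
    by (simp add: bilinear_extension_lin nf_def lin_lin)
  also have "\<dots> = lin (\<lambda>D1. qmul (dv D1) (nf \<epsilon> y)) x"
    using x by (intro lin_cong inner) (auto simp: diagram_space_def)
  also have "\<dots> = qmul (nf \<epsilon> x) (nf \<epsilon> y)"
    unfolding nf_def[of \<epsilon>, THEN fun_cong, of x] by (rule lin_out[symmetric]) (simp_all add: qmul_add_left qmul_scale_left)
  finally show "nf \<epsilon> (bilinear_extension f x y) = qmul (nf \<epsilon> x) (nf \<epsilon> y)" .
  have "keys (f D1 D2) \<subseteq> MB" if D: "D1 \<in> keys x" "D2 \<in> keys y" for D1 D2
  proof -
    have "f D1 D2 \<in> composites \<delta> \<epsilon> r r D1 D2" using f D x y by (auto simp: diagram_space_def)
    then obtain c D where "f D1 D2 = single D c" "D \<in> MB" unfolding composites_def by blast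
    then show ?thesis by simp
  qed
  then show "bilinear_extension f x y \<in> diagram_space r r"
    unfolding bilinear_extension_lin diagram_space_def mem_Collect_eq by (intro keys_lin)
qed

lemma outcomes_exist: "\<exists>f. \<forall>D1\<in>MB. \<forall>D2\<in>MB. f D1 D2 \<in> composites \<delta> \<epsilon> r r D1 D2"
proof -
  have "(SOME z. z \<in> composites \<delta> \<epsilon> r r D1 D2) \<in> composites \<delta> \<epsilon> r r D1 D2" if D: "D1 \<in> MB" "D2 \<in> MB" for D1 D2
  proof (rule someI_ex)
    show "\<exists>z. z \<in> composites \<delta> \<epsilon> r r D1 D2"
      using exists_composes[OF param D] unfolding composites_composes by blast
  qed
  then show ?thesis by (intro exI[of _ "\<lambda>D1 D2. SOME z. z \<in> composites \<delta> \<epsilon> r r D1 D2"]) blast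
qed

text \<open>All choices of representatives and outcomes have the same coordinates, so the big union
  repeats one class; \<open>cls_nonempty\<close> and \<open>outcomes_exist\<close> guarantee that
  there is at least one choice.\<close>

lemma class_compose_cls:
  assumes "p \<in> Qs" "q \<in> Qs"
  shows "class_compose \<delta> \<epsilon> r r r (cls p) (cls q) = cls (qmul p q)"
proof -
  let ?C = "{f. \<forall>D1\<in>MB. \<forall>D2\<in>MB. f D1 D2 \<in> composites \<delta> \<epsilon> r r D1 D2}"
  have *: "diagram_class \<epsilon> r r (bilinear_extension f x y) = cls (qmul p q)"
    if "x \<in> cls p" "y \<in> cls q" "f \<in> ?C" for x y f
    using nf_bilinear_extension[of f x y] that by (simp add: cls_def diagram_class_cls[unfolded cls_def])
  obtain x where x: "x \<in> cls p" by (rule cls_nonempty[OF assms(1)])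
  obtain y where y: "y \<in> cls q" by (rule cls_nonempty[OF assms(2)])
  obtain f where f: "f \<in> ?C" using outcomes_exist by blast
  show ?thesis unfolding class_compose_def
  proof
    show "(\<Union>x\<in>cls p. \<Union>y\<in>cls q. \<Union>f\<in>?C. diagram_class \<epsilon> r r (bilinear_extension f x y)) \<subseteq> cls (qmul p q)"
      using * by blast
    show "cls (qmul p q) \<subseteq> (\<Union>x\<in>cls p. \<Union>y\<in>cls q. \<Union>f\<in>?C. diagram_class \<epsilon> r r (bilinear_extension f x y))"
      using *[OF x y f] x y f by blast
  qed
qed

abbreviation "B \<equiv> marked_brauer_algebra \<delta> \<epsilon> r"

lemma B_add: "p \<in> Qs \<Longrightarrow> q \<in> Qs \<Longrightarrow> cls p \<oplus>\<^bsub>B\<^esub> cls q = cls (p + q)"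
proof -
  assume pq: "p \<in> Qs" "q \<in> Qs"
  have *: "diagram_class \<epsilon> r r (x + y) = cls (p + q)" if "x \<in> cls p" "y \<in> cls q" for x y
    using that diagram_class_cls[OF diagram_space_closed(1)[of x r r y]] by (simp add: cls_def nf_linear)
  obtain x y where "x \<in> cls p" "y \<in> cls q" using cls_nonempty pq by metis
  then show ?thesis using * by (auto simp: marked_brauer_algebra_def)
qed

lemma B_smult: "q \<in> Qs \<Longrightarrow> c \<odot>\<^bsub>B\<^esub> cls q = cls (scale c q)"
proof -
  assume q: "q \<in> Qs"
  have *: "diagram_class \<epsilon> r r (scale c x) = cls (scale c q)" if "x \<in> cls q" for x
    using that diagram_class_cls[OF diagram_space_closed(2)[of x r r c]] by (simp add: cls_def nf_linear)
  obtain x where "x \<in> cls q" by (rule cls_nonempty[OF q])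
  then show ?thesis using * by (auto simp: marked_brauer_algebra_def)
qed

lemma B_mult: "p \<in> Qs \<Longrightarrow> q \<in> Qs \<Longrightarrow> cls p \<otimes>\<^bsub>B\<^esub> cls q = cls (qmul p q)"
  by (simp add: marked_brauer_algebra_def class_compose_cls)

lemma diagram_class_single: "D \<in> MB \<Longrightarrow> diagram_class \<epsilon> r r (single D 1) = cls (dv D)"
  by (subst diagram_class_cls) (simp_all add: diagram_space_def)

lemma B_one: "\<one>\<^bsub>B\<^esub> = cls dvid"
  using diagram_class_single[OF identity_marked] by (simp add: marked_brauer_algebra_def)

lemma B_carrier: "carrier B = cls ` Qs"
proof -
  have "carrier B = (\<lambda>x. cls (nf \<epsilon> x)) ` diagram_space r r"
    using diagram_class_cls by (simp add: marked_brauer_algebra_def)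
  also have "\<dots> = cls ` Qs"
  proof
    show "(\<lambda>x. cls (nf \<epsilon> x)) ` diagram_space r r \<subseteq> cls ` Qs" using nf_Qs by blast
    show "cls ` Qs \<subseteq> (\<lambda>x. cls (nf \<epsilon> x)) ` diagram_space r r"
    proof
      fix A assume "A \<in> cls ` Qs"
      then obtain q where q: "q \<in> Qs" "A = cls q" by blast
      obtain x where "x \<in> cls q" by (rule cls_nonempty[OF q(1)])
      then show "A \<in> (\<lambda>x. cls (nf \<epsilon> x)) ` diagram_space r r" using q(2) by (auto simp: cls_def)
    qed
  qed
  finally show ?thesis .
qed

section \<open>The map from the presented algebra to the marked Brauer algebra\<close>

abbreviation "coset a \<equiv> I +>\<^bsub>F\<^esub> a"
abbreviation "P \<equiv> presented_algebra gens rels"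

text \<open>Written with all elements of a coset at once, so that no representative is chosen; by
  \<open>opr_cong\<close> they have the same image.\<close>

definition iso_map :: "(letter word \<Rightarrow>\<^sub>0 'k) set \<Rightarrow> (mdiagram \<Rightarrow>\<^sub>0 'k) set" where
  "iso_map A = {x \<in> diagram_space r r. \<exists>a\<in>A. nf \<epsilon> x = hom_map a}"

lemma iso_map_coset: "iso_map (coset a) = cls (hom_map a)"
proof -
  have "hom_map b = hom_map a" if "b \<in> coset a" for b
    using that opr_cong[OF _ dvid_Qs, of b a] by (simp add: coset_iff hom_map_def)
  moreover have "a \<in> coset a" using I_zero by (simp add: coset_iff)
  ultimately have "(\<exists>b\<in>coset a. nf \<epsilon> x = hom_map b) \<longleftrightarrow> nf \<epsilon> x = hom_map a" for x by metis
  then show ?thesis by (simp only: iso_map_def cls_def)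
qed

lemma P_carrier: "carrier P = coset ` carrier F" by (auto simp: presented_algebra_simps A_RCOSETS_def')

lemma P_mult: "a \<in> carrier F \<Longrightarrow> b \<in> carrier F \<Longrightarrow> coset a \<otimes>\<^bsub>P\<^esub> coset b = coset (a * b)"
  using ideal.rcoset_mult_add[OF ideal_I, of a b] by (simp add: presented_algebra_simps free_algebra_simps(2))

lemma P_add: "a \<in> carrier F \<Longrightarrow> b \<in> carrier F \<Longrightarrow> coset a \<oplus>\<^bsub>P\<^esub> coset b = coset (a + b)"
  using ideal.a_rcos_sum[OF ideal_I, of a b] by (simp add: presented_algebra_simps free_algebra_simps(5))

lemma P_smult: "c \<odot>\<^bsub>P\<^esub> coset a = coset (scale c a)"
proof -
  have "coset (scale c x) = coset (scale c a)" if "x \<in> coset a" for x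
    using that I_scale[of "x - a" c] by (simp add: coset_iff coset_eq_iff scale.scale_right_diff_distrib)
  moreover have "a \<in> coset a" using I_zero by (simp add: coset_iff)
  ultimately show ?thesis unfolding presented_algebra_simps by (metis (no_types, lifting) UN_constant_eq)
qed

lemma hom_map_one: "hom_map 1 = dvid" using opr_mono[of "[]" dvid] by (simp add: hom_map_def wmono_Nil)

lemma iso_map_iso: "iso_map \<in> algebra_iso P B"
proof -
  have "iso_map \<in> ring_hom P B"
  proof (rule ring_hom_memI)
    show "iso_map A \<in> carrier B" if "A \<in> carrier P" for A
      using that hom_map_Qs by (auto simp: P_carrier B_carrier iso_map_coset)
    show "iso_map (A \<otimes>\<^bsub>P\<^esub> A') = iso_map A \<otimes>\<^bsub>B\<^esub> iso_map A'" if "A \<in> carrier P" "A' \<in> carrier P" for A A'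
      using that by (auto simp: P_carrier P_mult iso_map_coset hom_map_mult B_mult hom_map_Qs)
    show "iso_map (A \<oplus>\<^bsub>P\<^esub> A') = iso_map A \<oplus>\<^bsub>B\<^esub> iso_map A'" if "A \<in> carrier P" "A' \<in> carrier P" for A A'
      using that by (auto simp: P_carrier P_add iso_map_coset hom_map_linear B_add hom_map_Qs)
    show "iso_map \<one>\<^bsub>P\<^esub> = \<one>\<^bsub>B\<^esub>" by (simp add: presented_algebra_simps iso_map_coset hom_map_one B_one)
  qed
  moreover have "bij_betw iso_map (carrier P) (carrier B)"
  proof (rule bij_betw_imageI)
    show "inj_on iso_map (carrier P)"
    proof (rule inj_onI)
      fix A A' assume "A \<in> carrier P" "A' \<in> carrier P" and eq: "iso_map A = iso_map A'"
      then obtain a a' where a: "a \<in> carrier F" "A = coset a" "a' \<in> carrier F" "A' = coset a'"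
        by (auto simp: P_carrier)
      then have "hom_map a = hom_map a'" using eq hom_map_Qs by (intro cls_inject) (auto simp: iso_map_coset)
      then show "A = A'" using a hom_map_eq_iff by (simp add: coset_eq_iff)
    qed
    show "iso_map ` carrier P = carrier B"
    proof
      show "iso_map ` carrier P \<subseteq> carrier B" using hom_map_Qs by (auto simp: P_carrier B_carrier iso_map_coset)
      show "carrier B \<subseteq> iso_map ` carrier P"
      proof
        fix A assume "A \<in> carrier B"
        then obtain q where q: "q \<in> Qs" "A = cls q" by (auto simp: B_carrier)
        then have "A = iso_map (coset (section_map q))" by (simp add: iso_map_coset hom_map_section)
        then show "A \<in> iso_map ` carrier P" using section_map_carrier[OF q(1)] by (auto simp: P_carrier)
      qed
    qed
  qed
  moreover have "iso_map (c \<odot>\<^bsub>P\<^esub> A) = c \<odot>\<^bsub>B\<^esub> iso_map A" if "A \<in> carrier P" for c A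
    using that by (auto simp: P_carrier P_smult iso_map_coset hom_map_linear B_smult hom_map_Qs)
  ultimately show ?thesis by (simp add: algebra_iso_def ring_iso_def)
qed

lemma iso_map_gens:
  assumes i: "i \<in> {1..<r}"
  shows "iso_map (presented_gen gens rels (S i)) = diagram_class \<epsilon> r r (single (s_diagram r i) 1)"
    and "iso_map (presented_gen gens rels (E i)) = diagram_class \<epsilon> r r (single (e_diagram r i) 1)"
proof -
  have v: "i \<in> {1..r}" "Suc i \<in> {1..r}" "i \<noteq> Suc i" using i by auto
  have p: "trp i (Suc i) permutes {1..r}" by (rule permutes_swap_id[OF v(1,2)])
  have iso: "iso_map (presented_gen gens rels g) = cls (wact [g] dvid)" for g
    by (simp add: presented_gen_def iso_map_coset hom_map_def free_gen_mono opr_mono)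
  have "wact [S i] dvid = dv (s_diagram r i)"
    unfolding wact_S pact_dv[OF identity_marked p] by (simp add: perm_diagram_s[OF i] flip: perm_diagram_def)
  then show "iso_map (presented_gen gens rels (S i)) = diagram_class \<epsilon> r r (single (s_diagram r i) 1)"
    unfolding iso using diagram_class_single perm_marked[OF p] perm_diagram_s[OF i] by simp
  have "wact [E i] dvid = dv (e_diagram r i)"
    using pairs_act_identity[of "[(i, Suc i)]"] v by (simp add: wact_E valid_def cupcap_def del: wact.simps flip: cupcap_e)
  then show "iso_map (presented_gen gens rels (E i)) = diagram_class \<epsilon> r r (single (e_diagram r i) 1)"
    unfolding iso using diagram_class_single cupcap_marked[OF v] cupcap_e by simp
qed

lemma presentation: "\<exists>h\<in>algebra_iso P B. \<forall>i\<in>{1..<r}.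
     h (presented_gen gens rels (S i)) = diagram_class \<epsilon> r r (single (s_diagram r i) 1) \<and>
     h (presented_gen gens rels (E i)) = diagram_class \<epsilon> r r (single (e_diagram r i) 1)"
  using iso_map_iso iso_map_gens by blast

end

theorem theorem4p1p1:
  fixes \<delta> \<epsilon> :: "'k::field" and r :: nat assumes "CHAR('k) \<noteq> 2" and "\<epsilon> \<in> {1, -1}" and "\<epsilon> = -1 \<longrightarrow> \<delta> = 0"
  shows "\<exists>h \<in> algebra_iso
               (presented_algebra (brauer_letters r) (brauer_relations \<delta> \<epsilon> r))
               (marked_brauer_algebra \<delta> \<epsilon> r).
           \<forall>i\<in>{1..<r}.
             h (presented_gen (brauer_letters r) (brauer_relations \<delta> \<epsilon> r) (S i)) =
               diagram_class \<epsilon> r r (Poly_Mapping.single (s_diagram r i) 1) \<and>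
             h (presented_gen (brauer_letters r) (brauer_relations \<delta> \<epsilon> r) (E i)) =
               diagram_class \<epsilon> r r (Poly_Mapping.single (e_diagram r i) 1)"
proof -
  have "\<epsilon> = 1 \<or> \<epsilon> = - 1" using assms(2) by simp
  then have "\<epsilon> = 1 \<or> \<delta> = 0 \<and> \<epsilon> * \<epsilon> = 1" using assms(3) by auto
  then have "marked_algebra \<delta> \<epsilon>" by (rule marked_algebra.intro)
  then show ?thesis by (rule marked_algebra.presentation)
qed

end
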